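(* Let $i\ge 0$ and assume $\Sigma^p_{i+1}\not\subseteq\Delta^p_{i+1}/\mathsf{poly}$. Then for every increasing $\mathsf{PV}$ function symbol $\mathsf{b}$ with $\mathsf{b}(x)\le x$, \[\mathsf{T}^i_2+\mathsf{BB}(\mathsf{s}\Sigma^b_{i+1})\nvdash \mathsf{LIND}(\mathsf{s}\Sigma^b_{i+1},\mathsf{b}),\] equivalently $\mathsf{T}^i_2+\mathsf{LIND}(\mathsf{s}\Sigma^b_{i+1},\mathsf{b})\not\subseteq \mathsf{T}^i_2+\mathsf{BB}(\mathsf{s}\Sigma^b_{i+1})$.
   Context: All theories are in the language of $\mathsf{PV}$ (function symbols for all polynomial-time functions, as in Cook's theory $\mathsf{PV}$); $|x|$ is the binary length of $x$. $\mathsf{T}^i_2=\mathsf{BASIC}+\mathsf{IND}(\Sigma^b_i)$ is Buss's theory (with $\mathsf{T}^0_2$ in the $\mathsf{PV}$ language being equivalent to $\mathsf{PV}_1$). A quantifier $\exists x\le|t|$ or $\forall x\le |t|$ is sharply bounded, $\exists x\le t$, $\forall x\le t$ bounded. A strict $\Sigma^b_{i+1}$ formula ($\mathsf{s}\Sigma^b_{i+1}$) is one of the form $\exists^b\forall^b\exists^b\cdots\phi$ with $i+1$ alternating bounded quantifiers followed by a sharply bounded formula $\phi$. For a formula $\varphi$ (possibly with parameters): \[\mathsf{BB}(\varphi):=\forall x,t\Big[\big(\forall j\le |x|\,\exists y\le t\,\varphi(j,y)\big)\to\big(\exists w\,\forall j\le|x|\,\varphi(j,w_j)\big)\Big],\]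 where $w$ codes a sequence with $j$-th element $w_j$, and for a $\mathsf{PV}$ function symbol $\mathsf{b}$, \[\mathsf{LIND}(\varphi,\mathsf{b}):=\forall x\Big[\big(\varphi(0)\wedge\forall n<\mathsf{b}(|x|)\,(\varphi(n)\to\varphi(n+1))\big)\to\varphi(\mathsf{b}(|x|))\Big].\] $\mathsf{BB}(\mathsf{s}\Sigma^b_{i+1})$ and $\mathsf{LIND}(\mathsf{s}\Sigma^b_{i+1},\mathsf{b})$ are the schemes of these axioms for all $\varphi\in\mathsf{s}\Sigma^b_{i+1}$. *)

theory Defs
  imports "HOL-Computational_Algebra.Polynomial" "HOL-Library.Log_Nat"
begin

section \<open>The function symbols of PV\<close>

text \<open>
  Function symbols are generated from Buss's initial functions and the projections by composition
  and limited recursion on notation. \<open>Comp n f gs\<close> is the \<open>n\<close>-ary function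
  \<open>f (gs\<^sub>1 xs) \<dots> (gs\<^sub>m xs)\<close>. The function \<open>f = Rec g h\<^sub>0 h\<^sub>1 k\<close> satisfies \<open>f 0 ys = g ys\<close> and
  \<open>f (s\<^sub>i x) ys = h\<^sub>i x (f x ys) ys\<close>, where \<open>s\<^sub>0 x = 2 \<cdot> x\<close> (for \<open>x \<noteq> 0\<close>) and \<open>s\<^sub>1 x = 2 \<cdot> x + 1\<close>, as long
  as the length of the right-hand side is at most that of \<open>k (s\<^sub>i x) ys\<close>; otherwise the value is
  \<open>k (s\<^sub>i x) ys\<close>. Building the length bound into the recursion (as Cook and Urquhart do for their
  recursor) replaces the proviso of Cook's original PV that the bound be provable beforehand,
  so that being a function symbol does not depend on provability.
\<close>

datatype pv =
    Zero | Succ | Plus | Times | Smash | Len | Half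
  | Proj nat nat
  | Comp nat pv "pv list"
  | Rec pv pv pv pv

fun arity :: "pv \<Rightarrow> nat" where
  "arity Zero = 0"
| "arity Succ = 1"
| "arity Plus = 2"
| "arity Times = 2"
| "arity Smash = 2"
| "arity Len = 1"
| "arity Half = 1"
| "arity (Proj n i) = n"
| "arity (Comp n f gs) = n"
| "arity (Rec g h0 h1 k) = Suc (arity g)"

fun wf_pv :: "pv \<Rightarrow> bool" where
  "wf_pv (Proj n i) \<longleftrightarrow> i < n"
| "wf_pv (Comp n f gs) \<longleftrightarrow>
     wf_pv f \<and> length gs = arity f \<and> (\<forall>g\<in>set gs. wf_pv g \<and> arity g = n)"
| "wf_pv (Rec g h0 h1 k) \<longleftrightarrow> wf_pv g \<and> wf_pv h0 \<and> wf_pv h1 \<and> wf_pv k \<and>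
     arity h0 = arity g + 2 \<and> arity h1 = arity g + 2 \<and> arity k = arity g + 1"
| "wf_pv _ \<longleftrightarrow> True"

abbreviation blen :: "nat \<Rightarrow> nat" where
  "blen x \<equiv> floorlog 2 x"

function limited_rec ::
  "nat \<Rightarrow> (nat \<Rightarrow> nat \<Rightarrow> nat) \<Rightarrow> (nat \<Rightarrow> nat \<Rightarrow> nat) \<Rightarrow> (nat \<Rightarrow> nat) \<Rightarrow> nat \<Rightarrow> nat" where
  "limited_rec a h0 h1 k x =
     (if x = 0 then a
      else let v = (if even x then h0 else h1) (x div 2) (limited_rec a h0 h1 k (x div 2))
           in if blen v \<le> blen (k x) then v else k x)"
  by pat_completeness auto
termination
  by (relation "measure (\<lambda>(a, h0, h1, k, x). x)") auto

declare limited_rec.simps [simp del]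

text \<open>
  Interpretation of the function symbols in the standard model. It is meaningful only for
  well-formed symbols and argument lists of the right length.
\<close>

fun eval :: "pv \<Rightarrow> nat list \<Rightarrow> nat" where
  "eval Zero xs = 0"
| "eval Succ xs = Suc (xs ! 0)"
| "eval Plus xs = xs ! 0 + xs ! 1"
| "eval Times xs = xs ! 0 * xs ! 1"
| "eval Smash xs = 2 ^ (blen (xs ! 0) * blen (xs ! 1))"
| "eval Len xs = blen (xs ! 0)"
| "eval Half xs = xs ! 0 div 2"
| "eval (Proj n i) xs = xs ! i"
| "eval (Comp n f gs) xs = eval f (map (\<lambda>g. eval g xs) gs)"
| "eval (Rec g h0 h1 k) xs =
     limited_rec (eval g (tl xs))
       (\<lambda>x z. eval h0 (x # z # tl xs)) (\<lambda>x z. eval h1 (x # z # tl xs))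
       (\<lambda>x. eval k (x # tl xs)) (hd xs)"


section \<open>First-order logic over PV\<close>

text \<open>Variables are de Bruijn indices.\<close>

datatype tm = Var nat | Fn pv "tm list"

datatype fm =
    Eq tm tm (infix "\<^bold>=" 55)
  | Le tm tm (infix "\<^bold>\<le>" 55)
  | Fls
  | Imp fm fm (infixr "\<^bold>\<longrightarrow>" 40)
  | Conj fm fm (infixr "\<^bold>\<and>" 50)
  | Disj fm fm (infixr "\<^bold>\<or>" 45)
  | Forall fm
  | Exists fm

abbreviation Neg :: "fm \<Rightarrow> fm" ("\<^bold>\<not> _" [53] 53) where "\<^bold>\<not> p \<equiv> p \<^bold>\<longrightarrow> Fls"
abbreviation Iff :: "fm \<Rightarrow> fm \<Rightarrow> fm" (infix "\<^bold>\<longleftrightarrow>" 38) where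
  "p \<^bold>\<longleftrightarrow> q \<equiv> (p \<^bold>\<longrightarrow> q) \<^bold>\<and> (q \<^bold>\<longrightarrow> p)"
abbreviation Neq :: "tm \<Rightarrow> tm \<Rightarrow> fm" (infix "\<^bold>\<noteq>" 55) where "s \<^bold>\<noteq> t \<equiv> \<^bold>\<not> (s \<^bold>= t)"
abbreviation Less :: "tm \<Rightarrow> tm \<Rightarrow> fm" (infix "\<^bold><" 55) where
  "s \<^bold>< t \<equiv> (s \<^bold>\<le> t) \<^bold>\<and> (s \<^bold>\<noteq> t)"

abbreviation zero :: tm ("\<^bold>0") where "\<^bold>0 \<equiv> Fn Zero []"
abbreviation suc :: "tm \<Rightarrow> tm" ("\<^bold>S") where "\<^bold>S t \<equiv> Fn Succ [t]"
abbreviation plus_tm :: "tm \<Rightarrow> tm \<Rightarrow> tm" (infixl "\<^bold>+" 65) where "s \<^bold>+ t \<equiv> Fn Plus [s, t]"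
abbreviation times_tm :: "tm \<Rightarrow> tm \<Rightarrow> tm" (infixl "\<^bold>*" 70) where "s \<^bold>* t \<equiv> Fn Times [s, t]"
abbreviation smash_tm :: "tm \<Rightarrow> tm \<Rightarrow> tm" (infixl "\<^bold>#" 70) where "s \<^bold># t \<equiv> Fn Smash [s, t]"
abbreviation len_tm :: "tm \<Rightarrow> tm" ("\<^bold>L") where "\<^bold>L t \<equiv> Fn Len [t]"
abbreviation half_tm :: "tm \<Rightarrow> tm" ("\<^bold>H") where "\<^bold>H t \<equiv> Fn Half [t]"
abbreviation one_tm :: tm ("\<^bold>1") where "\<^bold>1 \<equiv> \<^bold>S \<^bold>0"
abbreviation two_tm :: tm ("\<^bold>2") where "\<^bold>2 \<equiv> \<^bold>S (\<^bold>S \<^bold>0)"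

fun wf_tm :: "tm \<Rightarrow> bool" where
  "wf_tm (Var n) \<longleftrightarrow> True"
| "wf_tm (Fn f ts) \<longleftrightarrow> wf_pv f \<and> length ts = arity f \<and> (\<forall>t\<in>set ts. wf_tm t)"

fun wf_fm :: "fm \<Rightarrow> bool" where
  "wf_fm (s \<^bold>= t) \<longleftrightarrow> wf_tm s \<and> wf_tm t"
| "wf_fm (s \<^bold>\<le> t) \<longleftrightarrow> wf_tm s \<and> wf_tm t"
| "wf_fm Fls \<longleftrightarrow> True"
| "wf_fm (p \<^bold>\<longrightarrow> q) \<longleftrightarrow> wf_fm p \<and> wf_fm q"
| "wf_fm (p \<^bold>\<and> q) \<longleftrightarrow> wf_fm p \<and> wf_fm q"
| "wf_fm (p \<^bold>\<or> q) \<longleftrightarrow> wf_fm p \<and> wf_fm q"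
| "wf_fm (Forall p) \<longleftrightarrow> wf_fm p"
| "wf_fm (Exists p) \<longleftrightarrow> wf_fm p"

fun subst_tm :: "(nat \<Rightarrow> tm) \<Rightarrow> tm \<Rightarrow> tm" where
  "subst_tm \<sigma> (Var n) = \<sigma> n"
| "subst_tm \<sigma> (Fn f ts) = Fn f (map (subst_tm \<sigma>) ts)"

abbreviation lift_tm :: "tm \<Rightarrow> tm" where
  "lift_tm \<equiv> subst_tm (\<lambda>n. Var (Suc n))"

definition up :: "(nat \<Rightarrow> tm) \<Rightarrow> nat \<Rightarrow> tm" where
  "up \<sigma> = case_nat (Var 0) (\<lambda>n. lift_tm (\<sigma> n))"

fun subst_fm :: "(nat \<Rightarrow> tm) \<Rightarrow> fm \<Rightarrow> fm" where
  "subst_fm \<sigma> (s \<^bold>= t) = (subst_tm \<sigma> s \<^bold>= subst_tm \<sigma> t)"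
| "subst_fm \<sigma> (s \<^bold>\<le> t) = (subst_tm \<sigma> s \<^bold>\<le> subst_tm \<sigma> t)"
| "subst_fm \<sigma> Fls = Fls"
| "subst_fm \<sigma> (p \<^bold>\<longrightarrow> q) = (subst_fm \<sigma> p \<^bold>\<longrightarrow> subst_fm \<sigma> q)"
| "subst_fm \<sigma> (p \<^bold>\<and> q) = (subst_fm \<sigma> p \<^bold>\<and> subst_fm \<sigma> q)"
| "subst_fm \<sigma> (p \<^bold>\<or> q) = (subst_fm \<sigma> p \<^bold>\<or> subst_fm \<sigma> q)"
| "subst_fm \<sigma> (Forall p) = Forall (subst_fm (up \<sigma>) p)"
| "subst_fm \<sigma> (Exists p) = Exists (subst_fm (up \<sigma>) p)"

abbreviation lift_fm :: "fm \<Rightarrow> fm" where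
  "lift_fm \<equiv> subst_fm (\<lambda>n. Var (Suc n))"

abbreviation inst :: "tm \<Rightarrow> fm \<Rightarrow> fm" where
  "inst t \<equiv> subst_fm (case_nat t Var)"

text \<open>All free variables of \<open>p\<close> have an index below \<open>bnd_fm p\<close>, which is the least such number.\<close>

fun bnd_tm :: "tm \<Rightarrow> nat" where
  "bnd_tm (Var n) = Suc n"
| "bnd_tm (Fn f ts) = foldr max (map bnd_tm ts) 0"

fun bnd_fm :: "fm \<Rightarrow> nat" where
  "bnd_fm (s \<^bold>= t) = max (bnd_tm s) (bnd_tm t)"
| "bnd_fm (s \<^bold>\<le> t) = max (bnd_tm s) (bnd_tm t)"
| "bnd_fm Fls = 0"
| "bnd_fm (p \<^bold>\<longrightarrow> q) = max (bnd_fm p) (bnd_fm q)"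
| "bnd_fm (p \<^bold>\<and> q) = max (bnd_fm p) (bnd_fm q)"
| "bnd_fm (p \<^bold>\<or> q) = max (bnd_fm p) (bnd_fm q)"
| "bnd_fm (Forall p) = bnd_fm p - 1"
| "bnd_fm (Exists p) = bnd_fm p - 1"

definition univ_closure :: "fm \<Rightarrow> fm" where
  "univ_closure p = (Forall ^^ bnd_fm p) p"

text \<open>Classical natural deduction with equality. The side conditions keep all formulas of a
  derivation within the language.\<close>

inductive proves :: "fm set \<Rightarrow> fm \<Rightarrow> bool" (infix "\<turnstile>" 30) where
  Assm: "p \<in> \<Gamma> \<Longrightarrow> \<Gamma> \<turnstile> p"
| ImpI: "wf_fm p \<Longrightarrow> insert p \<Gamma> \<turnstile> q \<Longrightarrow> \<Gamma> \<turnstile> p \<^bold>\<longrightarrow> q"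
| ImpE: "\<Gamma> \<turnstile> p \<^bold>\<longrightarrow> q \<Longrightarrow> \<Gamma> \<turnstile> p \<Longrightarrow> \<Gamma> \<turnstile> q"
| Raa: "wf_fm p \<Longrightarrow> insert (\<^bold>\<not> p) \<Gamma> \<turnstile> Fls \<Longrightarrow> \<Gamma> \<turnstile> p"
| ConjI: "\<Gamma> \<turnstile> p \<Longrightarrow> \<Gamma> \<turnstile> q \<Longrightarrow> \<Gamma> \<turnstile> p \<^bold>\<and> q"
| ConjE1: "\<Gamma> \<turnstile> p \<^bold>\<and> q \<Longrightarrow> \<Gamma> \<turnstile> p"
| ConjE2: "\<Gamma> \<turnstile> p \<^bold>\<and> q \<Longrightarrow> \<Gamma> \<turnstile> q"
| DisjI1: "wf_fm q \<Longrightarrow> \<Gamma> \<turnstile> p \<Longrightarrow> \<Gamma> \<turnstile> p \<^bold>\<or> q"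
| DisjI2: "wf_fm p \<Longrightarrow> \<Gamma> \<turnstile> q \<Longrightarrow> \<Gamma> \<turnstile> p \<^bold>\<or> q"
| DisjE: "\<Gamma> \<turnstile> p \<^bold>\<or> q \<Longrightarrow> insert p \<Gamma> \<turnstile> r \<Longrightarrow> insert q \<Gamma> \<turnstile> r \<Longrightarrow> \<Gamma> \<turnstile> r"
| ForallI: "lift_fm ` \<Gamma> \<turnstile> p \<Longrightarrow> \<Gamma> \<turnstile> Forall p"
| ForallE: "wf_tm t \<Longrightarrow> \<Gamma> \<turnstile> Forall p \<Longrightarrow> \<Gamma> \<turnstile> inst t p"
| ExistsI: "wf_tm t \<Longrightarrow> wf_fm p \<Longrightarrow> \<Gamma> \<turnstile> inst t p \<Longrightarrow> \<Gamma> \<turnstile> Exists p"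
| ExistsE: "\<Gamma> \<turnstile> Exists p \<Longrightarrow> insert p (lift_fm ` \<Gamma>) \<turnstile> lift_fm q \<Longrightarrow> \<Gamma> \<turnstile> q"
| EqRefl: "wf_tm t \<Longrightarrow> \<Gamma> \<turnstile> t \<^bold>= t"
| EqSubst: "\<Gamma> \<turnstile> s \<^bold>= t \<Longrightarrow> \<Gamma> \<turnstile> inst s p \<Longrightarrow> \<Gamma> \<turnstile> inst t p"

definition thms_of :: "fm set \<Rightarrow> fm set" where
  "thms_of T = {p. T \<turnstile> p}"


section \<open>Bounded formulas\<close>

definition BForall :: "tm \<Rightarrow> fm \<Rightarrow> fm" where
  "BForall t p = Forall ((Var 0 \<^bold>\<le> lift_tm t) \<^bold>\<longrightarrow> p)"

definition BExists :: "tm \<Rightarrow> fm \<Rightarrow> fm" where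
  "BExists t p = Exists ((Var 0 \<^bold>\<le> lift_tm t) \<^bold>\<and> p)"

inductive sharply_bounded :: "fm \<Rightarrow> bool" where
  "sharply_bounded (s \<^bold>= t)"
| "sharply_bounded (s \<^bold>\<le> t)"
| "sharply_bounded Fls"
| "sharply_bounded p \<Longrightarrow> sharply_bounded q \<Longrightarrow> sharply_bounded (p \<^bold>\<longrightarrow> q)"
| "sharply_bounded p \<Longrightarrow> sharply_bounded q \<Longrightarrow> sharply_bounded (p \<^bold>\<and> q)"
| "sharply_bounded p \<Longrightarrow> sharply_bounded q \<Longrightarrow> sharply_bounded (p \<^bold>\<or> q)"
| "sharply_bounded p \<Longrightarrow> sharply_bounded (BForall (\<^bold>L t) p)"
| "sharply_bounded p \<Longrightarrow> sharply_bounded (BExists (\<^bold>L t) p)"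

text \<open>Buss's classes. Negation is the case \<open>q = Fls\<close> of the rules for implication.\<close>

inductive SigmaB :: "nat \<Rightarrow> fm \<Rightarrow> bool" and PiB :: "nat \<Rightarrow> fm \<Rightarrow> bool" where
  "sharply_bounded p \<Longrightarrow> SigmaB i p"
| "PiB i p \<Longrightarrow> SigmaB (Suc i) p"
| "SigmaB i p \<Longrightarrow> SigmaB (Suc i) p"
| "SigmaB (Suc i) p \<Longrightarrow> SigmaB (Suc i) q \<Longrightarrow> SigmaB (Suc i) (p \<^bold>\<and> q)"
| "SigmaB (Suc i) p \<Longrightarrow> SigmaB (Suc i) q \<Longrightarrow> SigmaB (Suc i) (p \<^bold>\<or> q)"
| "PiB (Suc i) p \<Longrightarrow> SigmaB (Suc i) q \<Longrightarrow> SigmaB (Suc i) (p \<^bold>\<longrightarrow> q)"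
| "SigmaB (Suc i) p \<Longrightarrow> SigmaB (Suc i) (BForall (\<^bold>L t) p)"
| "SigmaB (Suc i) p \<Longrightarrow> SigmaB (Suc i) (BExists t p)"
| "sharply_bounded p \<Longrightarrow> PiB i p"
| "SigmaB i p \<Longrightarrow> PiB (Suc i) p"
| "PiB i p \<Longrightarrow> PiB (Suc i) p"
| "PiB (Suc i) p \<Longrightarrow> PiB (Suc i) q \<Longrightarrow> PiB (Suc i) (p \<^bold>\<and> q)"
| "PiB (Suc i) p \<Longrightarrow> PiB (Suc i) q \<Longrightarrow> PiB (Suc i) (p \<^bold>\<or> q)"
| "SigmaB (Suc i) p \<Longrightarrow> PiB (Suc i) q \<Longrightarrow> PiB (Suc i) (p \<^bold>\<longrightarrow> q)"
| "PiB (Suc i) p \<Longrightarrow> PiB (Suc i) (BExists (\<^bold>L t) p)"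
| "PiB (Suc i) p \<Longrightarrow> PiB (Suc i) (BForall t p)"

fun strict_SigmaB :: "nat \<Rightarrow> fm \<Rightarrow> bool" and strict_PiB :: "nat \<Rightarrow> fm \<Rightarrow> bool" where
  "strict_SigmaB 0 p \<longleftrightarrow> sharply_bounded p"
| "strict_SigmaB (Suc i) p \<longleftrightarrow> (\<exists>t q. p = BExists t q \<and> strict_PiB i q)"
| "strict_PiB 0 p \<longleftrightarrow> sharply_bounded p"
| "strict_PiB (Suc i) p \<longleftrightarrow> (\<exists>t q. p = BForall t q \<and> strict_SigmaB i q)"


section \<open>Sequence coding\<close>

text \<open>
  A code \<open>w = (2 \<cdot> u + 1) \<cdot> 2\<^sup>s\<close> stands for the sequence of the consecutive \<open>s\<close>-bit blocks of \<open>u\<close>,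
  starting from the least significant one. The symbol \<open>beta\<close> extracts the block with a given index;
  \<open>eval_beta\<close> and \<open>beta_codes\<close> below state its properties. With \<open>tz\<close> returning \<open>2\<^sup>s - 1\<close>, a number of
  length \<open>s\<close>, and \<open>pow2\<close> returning \<open>2\<^sup>j\<close> for \<open>j < \<bar>w\<bar>\<close>, the number \<open>H (H (pow2 j w) # tz w)\<close> has
  length \<open>j \<cdot> s\<close>.
\<close>

abbreviation comp1 :: "nat \<Rightarrow> pv \<Rightarrow> pv \<Rightarrow> pv" where "comp1 n f g \<equiv> Comp n f [g]"
abbreviation comp2 :: "nat \<Rightarrow> pv \<Rightarrow> pv \<Rightarrow> pv \<Rightarrow> pv" where "comp2 n f g h \<equiv> Comp n f [g, h]"
abbreviation zero_pv :: "nat \<Rightarrow> pv" where "zero_pv n \<equiv> Comp n Zero []"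
abbreviation one_pv :: "nat \<Rightarrow> pv" where "one_pv n \<equiv> comp1 n Succ (zero_pv n)"

definition shift :: pv where
  "shift = Rec (Proj 1 0) (comp1 3 Half (Proj 3 1)) (comp1 3 Half (Proj 3 1)) (Proj 2 1)"

definition parity :: pv where
  "parity = Rec Zero (zero_pv 2) (one_pv 2) (one_pv 1)"

definition tz :: pv where
  "tz = Rec Zero (comp1 2 Succ (comp2 2 Plus (Proj 2 1) (Proj 2 1))) (zero_pv 2) (Proj 1 0)"

definition low_step :: pv where
  "low_step = comp2 3 Plus (Proj 3 1)
     (comp2 3 Times (comp1 3 parity (comp2 3 shift (Proj 3 0) (Proj 3 2)))
       (comp2 3 Smash (one_pv 3) (Proj 3 0)))"

definition low :: pv where
  "low = Rec (zero_pv 1) low_step low_step (Proj 2 1)"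

definition pow2 :: pv where
  "pow2 = Rec (one_pv 1)
     (comp2 3 Times (Proj 3 1) (Proj 3 1))
     (comp2 3 Plus (comp2 3 Times (Proj 3 1) (Proj 3 1)) (comp2 3 Times (Proj 3 1) (Proj 3 1)))
     (Proj 2 1)"

definition beta :: pv where
  "beta = comp2 2 low (comp1 2 tz (Proj 2 0))
     (comp2 2 shift
       (comp1 2 Half (comp2 2 Smash (comp1 2 Half (comp2 2 pow2 (Proj 2 1) (Proj 2 0)))
                                    (comp1 2 tz (Proj 2 0))))
       (comp1 2 Half (comp2 2 shift (comp1 2 tz (Proj 2 0)) (Proj 2 0))))"

lemma blen_double: "y > 0 \<Longrightarrow> blen y = Suc (blen (y div 2))"
  by (subst compute_floorlog) auto

lemma blen_0: "blen 0 = 0" by (simp add: floorlog_def)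

lemma limited_rec_eqI:
  assumes "F 0 = a"
    and "\<And>y. y > 0 \<Longrightarrow> (if even y then h0 else h1) (y div 2) (F (y div 2)) = F y"
    and "\<And>y. y > 0 \<Longrightarrow> blen (F y) \<le> blen (k y)"
  shows "limited_rec a h0 h1 k y = F y"
proof (induction y rule: less_induct)
  case (less y)
  show ?case
    using less[of "y div 2"] assms
    by (subst limited_rec.simps) (auto simp: Let_def)
qed

lemma eval_shift: "eval shift [y, x] = x div 2 ^ blen y"
proof -
  have "limited_rec x (\<lambda>u z. z div 2) (\<lambda>u z. z div 2) (\<lambda>u. x) y = x div 2 ^ blen y"
    by (rule limited_rec_eqI)
      (auto simp: blen_0 blen_double div_mult2_eq[symmetric] mult.commute intro!: floorlog_mono)
  then show ?thesis by (simp add: shift_def)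
qed

lemma eval_parity: "eval parity [x] = x mod 2"
proof -
  have "limited_rec 0 (\<lambda>u z. 0) (\<lambda>u z. 1) (\<lambda>u. 1) x = x mod 2"
    by (rule limited_rec_eqI) (auto simp: odd_iff_mod_2_eq_one intro!: floorlog_mono)
  then show ?thesis by (simp add: parity_def)
qed

lemma eval_tz_code: "eval tz [(2 * u + 1) * 2 ^ s] = 2 ^ s - 1"
proof -
  define g where "g = limited_rec 0 (\<lambda>u z. Suc (z + z)) (\<lambda>u z. 0) (\<lambda>x. x)"
  have odd: "g x = 0" if "odd x" for x
    using that unfolding g_def by (subst limited_rec.simps) (auto simp: blen_0 elim: oddE)
  have "g ((2 * u + 1) * 2 ^ s) = 2 ^ s - 1"
  proof (induction s)
    case 0
    then show ?case by (simp add: odd)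
  next
    case (Suc s)
    define x where "x = (2 * u + 1) * 2 ^ s"
    have x: "(2 * u + 1) * 2 ^ Suc s = 2 * x" "x > 0" by (simp_all add: x_def)
    have IH: "g x = 2 ^ s - 1" using Suc by (simp add: x_def)
    have ge: "(1::nat) \<le> 2 ^ s" by simp
    have "(2::nat) ^ s \<le> x" by (simp add: x_def)
    then have len: "blen (Suc (g x + g x)) \<le> blen (2 * x)"
      using IH ge by (intro floorlog_mono) linarith
    have "g (2 * x) = Suc (g x + g x)"
      unfolding g_def
      using len x(2) by (subst limited_rec.simps) (simp add: Let_def g_def)
    then show ?case
      unfolding x(1) using IH ge by (simp only: power_Suc)
  qed
  then show ?thesis by (simp add: tz_def g_def)
qed

lemma eval_low: "eval low [y, x] = x mod 2 ^ blen y"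
proof -
  have blen1: "blen (Suc 0) = 1" by (simp add: floorlog_def)
  have "limited_rec 0 (\<lambda>u z. z + x div 2 ^ blen u mod 2 * 2 ^ blen u)
      (\<lambda>u z. z + x div 2 ^ blen u mod 2 * 2 ^ blen u) (\<lambda>u. x) y = x mod 2 ^ blen y"
  proof (rule limited_rec_eqI)
    show "blen (x mod 2 ^ blen y) \<le> blen x" for y
      by (intro floorlog_mono) simp
    fix y :: nat
    assume "y > 0"
    then show "(if even y then \<lambda>u z. z + x div 2 ^ blen u mod 2 * 2 ^ blen u
        else (\<lambda>u z. z + x div 2 ^ blen u mod 2 * 2 ^ blen u))
        (y div 2) (x mod 2 ^ blen (y div 2)) = x mod 2 ^ blen y"
      using mod_mult2_eq[of x "2 ^ blen (y div 2)" 2]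
      by (simp add: blen_double mult.commute)
  qed (simp add: blen_0)
  then show ?thesis by (simp add: low_def low_step_def eval_shift eval_parity blen1)
qed

lemma blen_power: "blen (2 ^ n) = Suc n"
  using floorlog_power[of 1 2 n] by (simp add: floorlog_def)

lemma blen_half_power: "blen (2 ^ n div 2) = n"
  by (cases n) (auto simp: blen_power blen_0)

lemma blen_ones: "blen (2 ^ n - 1) = n"
proof (induction n)
  case (Suc n)
  have "(2 ^ Suc n - 1) div 2 = (2 ^ n - 1 :: nat)"
    by (cases n) auto
  moreover have "(2 ^ Suc n - 1 :: nat) > 0"
    using one_le_power[of "2 :: nat" n] by (simp only: power_Suc) linarith
  ultimately show ?case
    using Suc blen_double[of "2 ^ Suc n - 1"] by simp
qed (simp add: blen_0)

lemma less_power_blen: "x < 2 ^ blen x"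
  using floorlog_bounds[of x 2] by (cases "x = 0") auto

lemma eval_pow2:
  assumes "w > 0"
  shows "eval pow2 [j, w] = (if j < blen w then 2 ^ j else w)"
proof -
  have "limited_rec 1 (\<lambda>u z. z * z) (\<lambda>u z. z * z + z * z) (\<lambda>u. w) j =
      (if j < blen w then 2 ^ j else w)"
  proof (induction j rule: less_induct)
    case (less j)
    show ?case
    proof (cases "j = 0")
      case True
      moreover have "blen w > 0" using assms by (simp add: blen_double)
      ultimately show ?thesis by (subst limited_rec.simps) simp
    next
      case False
      define z where "z = (if j div 2 < blen w then 2 ^ (j div 2) else w)"
      define v where "v = (if even j then z * z else z * z + z * z)"
      have rec: "limited_rec 1 (\<lambda>u z. z * z) (\<lambda>u z. z * z + z * z) (\<lambda>u. w) j =
          (if blen v \<le> blen w then v else w)"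
        using False less[of "j div 2"]
        by (subst limited_rec.simps) (auto simp: Let_def v_def z_def)
      show ?thesis
      proof (cases "j div 2 < blen w")
        case True
        have "v = 2 ^ j"
        proof (cases "even j")
          case e: True
          then obtain m where "j = 2 * m" by (elim evenE)
          then show ?thesis using True by (simp add: v_def z_def mult_2 power_add)
        next
          case o: False
          then obtain m where "j = 2 * m + 1" by (elim oddE)
          then show ?thesis using True by (simp add: v_def z_def mult_2 power_add)
        qed
        then show ?thesis unfolding rec by (simp add: blen_power Suc_le_eq)
      next
        case F: False
        then have "\<not> j < blen w" by auto
        moreover have "(if blen v \<le> blen w then v else w) = w"
        proof (cases "w = 1")
          case True
          then show ?thesis using F by (auto simp: v_def z_def floorlog_def)
        next
          case w: False
          then have "2 * w \<le> w * w" using assms by simp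
          then have "2 * w \<le> v" using F by (auto simp: v_def z_def intro: trans_le_add1)
          then have "blen (2 * w) \<le> blen v" by (rule floorlog_mono)
          then show ?thesis using assms by (simp add: blen_double)
        qed
        ultimately show ?thesis unfolding rec by simp
      qed
    qed
  qed
  then show ?thesis by (simp add: pow2_def)
qed

lemma eval_beta: "eval beta [(2 * u + 1) * 2 ^ s, j] = u div 2 ^ (j * s) mod 2 ^ s"
proof -
  define w where "w = (2 * u + 1) * 2 ^ s"
  define c where "c = min j (blen w - 1)"
  have w: "w > 0" by (simp add: w_def)
  have "2 * u + 1 \<le> w" using mult_le_mono2[of 1 "2 ^ s" "2 * u + 1"] by (simp only: w_def mult_1_right one_le_power one_le_numeral)
  then have "blen (2 * u + 1) \<le> blen w" by (rule floorlog_mono)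
  then have u: "blen u \<le> blen w - 1" by (simp add: blen_double)
  have "blen (w div 2) = blen w - 1" using w by (simp add: blen_double)
  then have half: "blen (eval pow2 [j, w] div 2) = c"
    using w by (auto simp: eval_pow2 blen_half_power c_def)
  have tz: "eval tz [w] = 2 ^ s - 1"
    unfolding w_def by (rule eval_tz_code)
  have body: "w div 2 ^ s div 2 = u"
    by (simp add: w_def)
  have "eval beta [w, j] = u div 2 ^ (c * s) mod 2 ^ s"
    by (simp add: beta_def eval_low eval_shift tz blen_ones[unfolded One_nat_def] blen_ones half
        blen_half_power body)
  also have "\<dots> = u div 2 ^ (j * s) mod 2 ^ s"
  proof (cases "c = j \<or> s = 0")
    case False
    then have "c = blen w - 1" "c \<le> j" "1 \<le> s" by (auto simp: c_def)
    have "blen u \<le> c * s" "blen u \<le> j * s"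
      using u \<open>c = blen w - 1\<close> \<open>c \<le> j\<close> mult_le_mono[of "blen u" c 1 s] mult_le_mono[of "blen u" j 1 s] \<open>1 \<le> s\<close>
      by auto
    then have "u < 2 ^ (c * s)" "u < 2 ^ (j * s)"
      using less_power_blen[of u] by (meson less_le_trans one_le_numeral power_increasing)+
    then show ?thesis by simp
  qed auto
  finally show ?thesis by (simp only: w_def)
qed

lemma beta_codes: "\<exists>w. \<forall>j < length xs. eval beta [w, j] = xs ! j"
proof -
  obtain s where s: "\<forall>x\<in>set xs. x < 2 ^ s"
  proof
    show "\<forall>x\<in>set xs. x < 2 ^ sum_list xs"
      using member_le_sum_list[of _ xs] less_exp le_less_trans by blast
  qed
  then have "\<exists>u. \<forall>j < length xs. u div 2 ^ (j * s) mod 2 ^ s = xs ! j"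
  proof (induction xs)
    case (Cons x xs)
    then obtain u where u: "\<forall>j < length xs. u div 2 ^ (j * s) mod 2 ^ s = xs ! j" by auto
    have "(x + 2 ^ s * u) div 2 ^ (j * s) mod 2 ^ s = (x # xs) ! j" if "j < length (x # xs)" for j
    proof (cases j)
      case 0
      then show ?thesis using Cons.prems by simp
    next
      case (Suc i)
      have "(x + 2 ^ s * u) div 2 ^ s = u" using Cons.prems by simp
      then show ?thesis
        using Suc that u by (simp add: power_add div_mult2_eq)
    qed
    then show ?case by blast
  qed simp
  then show ?thesis by (metis eval_beta)
qed


section \<open>The theories\<close>

text \<open>The 32 axioms of Buss's BASIC, in his order.\<close>

definition BASIC :: "fm set" where
  "BASIC = univ_closure `
     (let x = Var 0; y = Var 1; z = Var 2; u = Var 3 in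
     {y \<^bold>\<le> x \<^bold>\<longrightarrow> y \<^bold>\<le> \<^bold>S x,
      x \<^bold>\<noteq> \<^bold>S x,
      \<^bold>0 \<^bold>\<le> x,
      x \<^bold>\<le> y \<^bold>\<and> x \<^bold>\<noteq> y \<^bold>\<longleftrightarrow> \<^bold>S x \<^bold>\<le> y,
      x \<^bold>\<noteq> \<^bold>0 \<^bold>\<longrightarrow> \<^bold>2 \<^bold>* x \<^bold>\<noteq> \<^bold>0,
      y \<^bold>\<le> x \<^bold>\<or> x \<^bold>\<le> y,
      x \<^bold>\<le> y \<^bold>\<and> y \<^bold>\<le> x \<^bold>\<longrightarrow> x \<^bold>= y,
      x \<^bold>\<le> y \<^bold>\<and> y \<^bold>\<le> z \<^bold>\<longrightarrow> x \<^bold>\<le> z,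
      \<^bold>L \<^bold>0 \<^bold>= \<^bold>0,
      x \<^bold>\<noteq> \<^bold>0 \<^bold>\<longrightarrow> \<^bold>L (\<^bold>2 \<^bold>* x) \<^bold>= \<^bold>S (\<^bold>L x) \<^bold>\<and> \<^bold>L (\<^bold>S (\<^bold>2 \<^bold>* x)) \<^bold>= \<^bold>S (\<^bold>L x),
      \<^bold>L \<^bold>1 \<^bold>= \<^bold>1,
      x \<^bold>\<le> y \<^bold>\<longrightarrow> \<^bold>L x \<^bold>\<le> \<^bold>L y,
      \<^bold>L (x \<^bold># y) \<^bold>= \<^bold>S (\<^bold>L x \<^bold>* \<^bold>L y),
      \<^bold>0 \<^bold># y \<^bold>= \<^bold>1,
      x \<^bold>\<noteq> \<^bold>0 \<^bold>\<longrightarrow> \<^bold>1 \<^bold># (\<^bold>2 \<^bold>* x) \<^bold>= \<^bold>2 \<^bold>* (\<^bold>1 \<^bold># x) \<^bold>\<and> \<^bold>1 \<^bold># \<^bold>S (\<^bold>2 \<^bold>* x) \<^bold>= \<^bold>2 \<^bold>* (\<^bold>1 \<^bold># x),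
      x \<^bold># y \<^bold>= y \<^bold># x,
      \<^bold>L x \<^bold>= \<^bold>L y \<^bold>\<longrightarrow> x \<^bold># z \<^bold>= y \<^bold># z,
      \<^bold>L x \<^bold>= \<^bold>L u \<^bold>+ \<^bold>L z \<^bold>\<longrightarrow> x \<^bold># y \<^bold>= (u \<^bold># y) \<^bold>* (z \<^bold># y),
      x \<^bold>\<le> x \<^bold>+ y,
      x \<^bold>\<le> y \<^bold>\<and> x \<^bold>\<noteq> y \<^bold>\<longrightarrow> \<^bold>S (\<^bold>2 \<^bold>* x) \<^bold>\<le> \<^bold>2 \<^bold>* y \<^bold>\<and> \<^bold>S (\<^bold>2 \<^bold>* x) \<^bold>\<noteq> \<^bold>2 \<^bold>* y,
      x \<^bold>+ y \<^bold>= y \<^bold>+ x,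
      x \<^bold>+ \<^bold>0 \<^bold>= x,
      x \<^bold>+ \<^bold>S y \<^bold>= \<^bold>S (x \<^bold>+ y),
      (x \<^bold>+ y) \<^bold>+ z \<^bold>= x \<^bold>+ (y \<^bold>+ z),
      x \<^bold>+ y \<^bold>\<le> x \<^bold>+ z \<^bold>\<longleftrightarrow> y \<^bold>\<le> z,
      x \<^bold>* \<^bold>0 \<^bold>= \<^bold>0,
      x \<^bold>* \<^bold>S y \<^bold>= x \<^bold>* y \<^bold>+ x,
      x \<^bold>* y \<^bold>= y \<^bold>* x,
      x \<^bold>* (y \<^bold>+ z) \<^bold>= x \<^bold>* y \<^bold>+ x \<^bold>* z,
      \<^bold>1 \<^bold>\<le> x \<^bold>\<longrightarrow> (x \<^bold>* y \<^bold>\<le> x \<^bold>* z \<^bold>\<longleftrightarrow> y \<^bold>\<le> z),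
      x \<^bold>\<noteq> \<^bold>0 \<^bold>\<longrightarrow> \<^bold>L x \<^bold>= \<^bold>S (\<^bold>L (\<^bold>H x)),
      x \<^bold>= \<^bold>H y \<^bold>\<longleftrightarrow> \<^bold>2 \<^bold>* x \<^bold>= y \<^bold>\<or> \<^bold>S (\<^bold>2 \<^bold>* x) \<^bold>= y})"

text \<open>The defining equations of the remaining function symbols.\<close>

definition rec_axiom :: "pv \<Rightarrow> pv \<Rightarrow> pv \<Rightarrow> tm \<Rightarrow> tm \<Rightarrow> tm list \<Rightarrow> fm" where
  "rec_axiom f h k x sx ys =
     (let v = Fn h (x # Fn f (x # ys) # ys); b = Fn k (sx # ys) in
      (\<^bold>L v \<^bold>\<le> \<^bold>L b \<^bold>\<longrightarrow> Fn f (sx # ys) \<^bold>= v) \<^bold>\<and> (\<^bold>\<not> (\<^bold>L v \<^bold>\<le> \<^bold>L b) \<^bold>\<longrightarrow> Fn f (sx # ys) \<^bold>= b))"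

fun def_axioms :: "pv \<Rightarrow> fm set" where
  "def_axioms (Proj n i) = {Fn (Proj n i) (map Var [0..<n]) \<^bold>= Var i}"
| "def_axioms (Comp n f gs) =
     (let xs = map Var [0..<n]
      in {Fn (Comp n f gs) xs \<^bold>= Fn f (map (\<lambda>g. Fn g xs) gs)})"
| "def_axioms (Rec g h0 h1 k) =
     (let f = Rec g h0 h1 k; x = Var 0; ys = map Var [1..<Suc (arity g)]
      in {Fn f (\<^bold>0 # ys) \<^bold>= Fn g ys,
          x \<^bold>\<noteq> \<^bold>0 \<^bold>\<longrightarrow> rec_axiom f h0 k x (\<^bold>2 \<^bold>* x) ys,
          rec_axiom f h1 k x (\<^bold>S (\<^bold>2 \<^bold>* x)) ys})"
| "def_axioms _ = {}"

definition PV_axioms :: "fm set" where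
  "PV_axioms = univ_closure ` (\<Union>f\<in>{f. wf_pv f}. def_axioms f)"

definition scheme :: "(fm \<Rightarrow> fm) \<Rightarrow> (fm \<Rightarrow> bool) \<Rightarrow> fm set" where
  "scheme Ax \<Phi> = {univ_closure (Ax p) |p. wf_fm p \<and> \<Phi> p}"

text \<open>In \<open>IND\<close> and \<open>LIND\<close> the induction variable of \<open>p\<close> is \<open>Var 0\<close>; the other variables are
  parameters.\<close>

definition IND :: "fm \<Rightarrow> fm" where
  "IND p = (inst \<^bold>0 p \<^bold>\<and> Forall (p \<^bold>\<longrightarrow> subst_fm (case_nat (\<^bold>S (Var 0)) (\<lambda>n. Var (Suc n))) p)
            \<^bold>\<longrightarrow> Forall p)"

text \<open>Below the outer quantifier of \<open>LIND\<close>, \<open>x\<close> is \<open>Var 0\<close>; below the inner one, \<open>n\<close> is \<open>Var 0\<close> and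
  \<open>x\<close> is \<open>Var 1\<close>.\<close>

definition LIND :: "pv \<Rightarrow> fm \<Rightarrow> fm" where
  "LIND b p =
     Forall
       (subst_fm (case_nat \<^bold>0 (\<lambda>n. Var (n + 1))) p \<^bold>\<and>
        Forall (Var 0 \<^bold>< Fn b [\<^bold>L (Var 1)] \<^bold>\<longrightarrow>
          subst_fm (case_nat (Var 0) (\<lambda>n. Var (n + 2))) p \<^bold>\<longrightarrow>
          subst_fm (case_nat (\<^bold>S (Var 0)) (\<lambda>n. Var (n + 2))) p) \<^bold>\<longrightarrow>
        subst_fm (case_nat (Fn b [\<^bold>L (Var 0)]) (\<lambda>n. Var (n + 1))) p)"

text \<open>In \<open>BB\<close> the formula \<open>p(j, y)\<close> has \<open>y\<close> as \<open>Var 0\<close> and \<open>j\<close> as \<open>Var 1\<close>; the other variables are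
  parameters. Below the two outer quantifiers, \<open>t\<close> is \<open>Var 0\<close> and \<open>x\<close> is \<open>Var 1\<close>.\<close>

definition BB :: "fm \<Rightarrow> fm" where
  "BB p =
     Forall (Forall
       (BForall (\<^bold>L (Var 1)) (BExists (Var 1)
          (subst_fm (case_nat (Var 0) (case_nat (Var 1) (\<lambda>n. Var (n + 4)))) p)) \<^bold>\<longrightarrow>
        Exists (BForall (\<^bold>L (Var 2))
          (subst_fm (case_nat (Fn beta [Var 1, Var 0]) (case_nat (Var 0) (\<lambda>n. Var (n + 4)))) p))))"

definition T2 :: "nat \<Rightarrow> fm set" where
  "T2 i = BASIC \<union> PV_axioms \<union> scheme IND (SigmaB i)"


section \<open>Complexity classes\<close>

text \<open>
  Deterministic multitape oracle Turing machines over the alphabet \<open>{0, 1, blank}\<close> with two-way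
  infinite tapes, where \<open>None\<close> is the blank. The input is on tape 0; tape 1 is the oracle tape. The
  transition table yields the new state and, for each tape, the symbol to write and the head
  movement.
\<close>

type_synonym lang = "bool list set"

datatype otm = OTM
  (tapes: nat)
  (states: nat)
  (delta: "nat \<Rightarrow> bool option list \<Rightarrow> nat \<times> (bool option \<times> int) list")

abbreviation (input) q_start :: nat where "q_start \<equiv> 0"
abbreviation (input) q_accept :: nat where "q_accept \<equiv> 1"
abbreviation (input) q_reject :: nat where "q_reject \<equiv> 2"
abbreviation (input) q_query :: nat where "q_query \<equiv> 3"
abbreviation (input) q_yes :: nat where "q_yes \<equiv> 4"
abbreviation (input) q_no :: nat where "q_no \<equiv> 5"

definition wf_otm :: "otm \<Rightarrow> bool" where
  "wf_otm M \<longleftrightarrow> 2 \<le> tapes M \<and> 6 \<le> states M \<and>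
     (\<forall>q < states M. \<forall>as. length as = tapes M \<longrightarrow>
        (case delta M q as of (q', acts) \<Rightarrow>
           q' < states M \<and> length acts = tapes M \<and> (\<forall>(a, d)\<in>set acts. d \<in> {-1, 0, 1})))"

text \<open>A configuration consists of the state, the head positions and the tape contents.\<close>

type_synonym config = "nat \<times> (nat \<Rightarrow> int) \<times> (nat \<Rightarrow> int \<Rightarrow> bool option)"

definition init_config :: "bool list \<Rightarrow> config" where
  "init_config x =
     (q_start, \<lambda>i. 0,
      \<lambda>i z. if i = 0 \<and> 0 \<le> z \<and> z < int (length x) then Some (x ! nat z) else None)"

text \<open>The oracle is asked about the word that starts at cell 0 of the oracle tape and ends before
  the first blank.\<close>

definition query_word :: "(int \<Rightarrow> bool option) \<Rightarrow> bool list" where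
  "query_word tp = map (\<lambda>n. the (tp (int n))) [0..<(LEAST n. tp (int n) = None)]"

definition step :: "lang \<Rightarrow> otm \<Rightarrow> config \<Rightarrow> config" where
  "step A M = (\<lambda>(q, pos, tp).
     if q = q_accept \<or> q = q_reject then (q, pos, tp)
     else if q = q_query then (if query_word (tp 1) \<in> A then q_yes else q_no, pos, tp)
     else
       let (q', acts) = delta M q (map (\<lambda>i. tp i (pos i)) [0..<tapes M])
       in (q',
           \<lambda>i. if i < tapes M then pos i + snd (acts ! i) else pos i,
           \<lambda>i. if i < tapes M then (tp i)(pos i := fst (acts ! i)) else tp i))"

definition P_rel :: "lang \<Rightarrow> lang set" where
  "P_rel A = {L. \<exists>M (p :: nat poly). wf_otm M \<and>
     (\<forall>x. fst ((step A M ^^ poly p (length x)) (init_config x)) =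
            (if x \<in> L then q_accept else q_reject))}"

fun pair :: "bool list \<Rightarrow> bool list \<Rightarrow> bool list" where
  "pair [] y = False # y"
| "pair (a # x) y = True # a # pair x y"

fun Sigma_p :: "nat \<Rightarrow> lang set" where
  "Sigma_p 0 = P_rel {}"
| "Sigma_p (Suc i) = {L. \<exists>R (p :: nat poly). - R \<in> Sigma_p i \<and>
     (\<forall>x. x \<in> L \<longleftrightarrow> (\<exists>y. length y \<le> poly p (length x) \<and> pair x y \<in> R))}"

fun Delta_p :: "nat \<Rightarrow> lang set" where
  "Delta_p 0 = P_rel {}"
| "Delta_p (Suc i) = (\<Union>A\<in>Sigma_p i. P_rel A)"

definition with_poly_advice :: "lang set \<Rightarrow> lang set" ("_'/poly" [100] 100) where
  "C/poly = {L. \<exists>B\<in>C. \<exists>(adv :: nat \<Rightarrow> bool list) (p :: nat poly).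
     (\<forall>n. length (adv n) \<le> poly p n) \<and>
     (\<forall>x. x \<in> L \<longleftrightarrow> pair x (adv (length x)) \<in> B)}"

end

theory Submission
  imports Defs "HOL-Library.Countable_Set" "HOL-Library.FuncSet"
begin

text \<open>Let \<open>L\<close> be a language in \<open>Sigma_p (i + 1)\<close> outside \<open>(Delta_p (i + 1))/poly\<close>. Consider tuples
  \<open>x\<^sub>0, \<dots>, x\<^sub>K\<close> of elements of \<open>L\<close>, where \<open>x\<^sub>0\<close> is fixed, the other ones have a common length \<open>n\<close> and
  \<open>K = b(n)\<close>, together with witnesses \<open>y\<^sub>0, \<dots>, y\<^sub>K\<close> of their membership. Given finitely many lists of
  candidates, each computed in \<open>Delta_p (i + 1)\<close> from \<open>x\<^sub>0, \<dots>, x\<^sub>K\<close> and the witnesses with index below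
  some \<open>m\<close>, there is a tuple such that no candidate is a witness for an \<open>x\<^sub>l\<close> with \<open>l \<ge> m\<close>: otherwise,
  by averaging, polynomially many tuples would serve as advice for \<open>L\<close>, as in the theorem of
  Krajicek, Pudlak and Takeuti. Hence there is an ultrafilter on the tuples which
  contains, for each list of candidates, the set of tuples that it fails to solve.

  The elements of the model are the functions on tuples all of whose values lie in one of the lists
  of candidates, modulo the ultrafilter. Witnesses for \<open>\<Sigma>\<^sup>b\<^sub>i\<close> formulas are found by binary search with
  an oracle, so the model is \<open>\<Sigma>\<^sup>b\<^sub>i\<close>-elementary in the ultrapower of the standard model and satisfies
  \<open>T2 i\<close>. The values may be chosen from the lists without any uniformity, and so all functions with
  sharply bounded values belong to the model. If each \<open>j \<le> \<bar>x\<bar>\<close> has a solution in the model, this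
  applies to the \<open>j\<close> that is hardest to solve; thus a single list solves all \<open>j \<le> \<bar>x\<bar>\<close> and \<open>BB\<close> holds.
  But \<open>LIND\<close> fails for the formula stating that \<open>x\<^sub>k\<close> has a witness, for this holds in the model
  precisely if \<open>k\<close> is a standard number.\<close>

section \<open>Programs on stacks and their oracle machines\<close>

text \<open>Languages are defined by machines and the theories by function symbols, so the two are
  matched in both directions: machines without oracle are simulated by function symbols, which turns
  \<open>L\<close> into a strict formula, and functions with an oracle are programmed on machines,
  which puts the test of instances against advice into \<open>Delta_p (i + 1)\<close>.

  Working with lists rather than single values serves both halves. Trying all entries of a short
  list is still a \<open>Delta_p (i + 1)\<close> test, and the free choice of an entry at each tuple
  gives the model its sharply bounded functions. There are countably many lists, so they can be
  numbered, and the number at which an instance is first solved measures its hardness.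

  A tuple has \<open>b n\<close> open instances because \<open>LIND\<close> is applied to
  \<open>x\<^sub>1\<close>, whose length is \<open>n\<close>. As \<open>b\<close> is monotone and
  unbounded, \<open>b n\<close> outgrows each fixed number of visible witnesses; as
  \<open>b n \<le> n\<close>, tuples have size polynomial in \<open>n\<close>, and so has the number
  of greedy choices. The entry \<open>x\<^sub>0\<close> has a constant witness, which gives the base
  case of the induction.\<close>

datatype com = Skip | Push nat bool | Pop nat | Seq com com
  | Case nat com com com | While nat com | Ask com com

fun regs_below :: "nat \<Rightarrow> com \<Rightarrow> bool" where
  "regs_below n Skip \<longleftrightarrow> True"
| "regs_below n (Push r a) \<longleftrightarrow> r < n"
| "regs_below n (Pop r) \<longleftrightarrow> r < n"
| "regs_below n (Seq c d) \<longleftrightarrow> regs_below n c \<and> regs_below n d"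
| "regs_below n (Case r c d e) \<longleftrightarrow> r < n \<and> regs_below n c \<and> regs_below n d \<and> regs_below n e"
| "regs_below n (While r c) \<longleftrightarrow> r < n \<and> regs_below n c"
| "regs_below n (Ask c d) \<longleftrightarrow> regs_below n c \<and> regs_below n d"

lemma regs_below_mono: "regs_below n c \<Longrightarrow> n \<le> m \<Longrightarrow> regs_below m c"
  by (induction c) auto

lemma ex_regs_below: "\<exists>n. regs_below n c"
proof (induction c)
  case (Seq c d)
  then show ?case by (metis regs_below.simps(4) regs_below_mono max.cobounded1 max.cobounded2)
next
  case (Case r c d e)
  then obtain a b f where "regs_below a c" "regs_below b d" "regs_below f e" by blast
  then have "regs_below (Suc r + a + b + f) (Case r c d e)"
    by (auto elim: regs_below_mono)
  then show ?case by blast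
next
  case (While r c)
  then obtain a where "regs_below a c" by blast
  then have "regs_below (Suc r + a) (While r c)"
    by (auto elim: regs_below_mono)
  then show ?case by blast
next
  case (Ask c d)
  then show ?case by (metis regs_below.simps(7) regs_below_mono max.cobounded1 max.cobounded2)
qed (auto intro: lessI)

text \<open>Register 1 is the oracle tape; its stack has the top at the right end, so that the query is
  the reversed stack. The cost is the number of steps of the machine built below.\<close>

inductive exec :: "lang \<Rightarrow> com \<Rightarrow> (nat \<Rightarrow> bool list) \<Rightarrow> nat \<Rightarrow> (nat \<Rightarrow> bool list) \<Rightarrow> bool"
  for A where
  Skip: "exec A Skip s 1 s"
| Push: "exec A (Push r a) s 2 (s(r := a # s r))"
| Pop: "exec A (Pop r) s 1 (s(r := tl (s r)))"
| Seq: "exec A c s t s' \<Longrightarrow> exec A d s' t' s'' \<Longrightarrow> exec A (Seq c d) s (t + t') s''"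
| CaseNil: "s r = [] \<Longrightarrow> exec A c s t s' \<Longrightarrow> exec A (Case r c d e) s (Suc t) s'"
| CaseF: "s r = False # l \<Longrightarrow> exec A d s t s' \<Longrightarrow> exec A (Case r c d e) s (Suc t) s'"
| CaseT: "s r = True # l \<Longrightarrow> exec A e s t s' \<Longrightarrow> exec A (Case r c d e) s (Suc t) s'"
| WhileNil: "s r = [] \<Longrightarrow> exec A (While r c) s 1 s"
| WhileCons: "s r \<noteq> [] \<Longrightarrow> exec A c s t s' \<Longrightarrow> exec A (While r c) s' t' s'' \<Longrightarrow>
    exec A (While r c) s (Suc (t + t')) s''"
| AskYes: "rev (s 1) \<in> A \<Longrightarrow> exec A c s t s' \<Longrightarrow> exec A (Ask c d) s (t + 3) s'"
| AskNo: "rev (s 1) \<notin> A \<Longrightarrow> exec A d s t s' \<Longrightarrow> exec A (Ask c d) s (t + 3) s'"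

text \<open>The running time pays for every pushed symbol. Through this bound all functions computed
  in polynomial time have values of polynomial length.\<close>

lemma exec_length: "exec A c s t s' \<Longrightarrow> length (s' r) \<le> length (s r) + t"
  by (induction rule: exec.induct) auto

text \<open>Lets a function be recovered from its program and oracle, from which the countability of
  the function class follows.\<close>

lemma exec_deterministic: "exec A c s t s' \<Longrightarrow> exec A c s t' s'' \<Longrightarrow> s'' = s' \<and> t' = t"
proof (induction arbitrary: t' s'' rule: exec.induct)
  case (Seq c s t s' d t' s'')
  from Seq.prems show ?case by cases (use Seq in blast)
next
  case (WhileCons s r c t1 s1 t2 s2)
  from WhileCons.prems show ?case
  proof cases
    case (WhileCons t3 s3 t4)
    then show ?thesis using WhileCons.IH by blast
  qed (use WhileCons.hyps(1) in simp)
next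
  case (CaseNil s r c t s' d e)
  from CaseNil.prems show ?case by cases ((use CaseNil.hyps(1) in \<open>simp; fail\<close>) | (use CaseNil.hyps CaseNil.IH in metis))+
next
  case (CaseF s r l d t s' c e)
  from CaseF.prems show ?case by cases ((use CaseF.hyps(1) in \<open>simp; fail\<close>) | (use CaseF.hyps CaseF.IH in metis))+
next
  case (CaseT s r l e t s' c d)
  from CaseT.prems show ?case by cases ((use CaseT.hyps(1) in \<open>simp; fail\<close>) | (use CaseT.hyps CaseT.IH in metis))+
next
  case (AskYes s c t s' d)
  from AskYes.prems show ?case by cases ((use AskYes.hyps(1) in \<open>simp; fail\<close>) | (use AskYes.hyps AskYes.IH in metis))+
next
  case (AskNo s d t s' c)
  from AskNo.prems show ?case by cases ((use AskNo.hyps(1) in \<open>simp; fail\<close>) | (use AskNo.hyps AskNo.IH in metis))+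
next
  case (WhileNil s r c)
  from WhileNil.prems show ?case by cases ((use WhileNil.hyps(1) in \<open>simp; fail\<close>) | (use WhileNil.hyps in metis))+
next
  case (Skip s)
  then show ?case by cases auto
next
  case (Push r a s)
  then show ?case by cases auto
next
  case (Pop r s)
  then show ?case by cases auto
qed

section \<open>Compilation of programs into oracle machines\<close>

datatype instr = Tape nat "bool option \<Rightarrow> bool option \<times> int \<times> nat" | Query nat nat

text \<open>The stack of the input register grows to the left, the other ones to the right.\<close>

definition dir :: "nat \<Rightarrow> int" where "dir r = (if r = 0 then -1 else 1)"

fun csize :: "com \<Rightarrow> nat" where
  "csize Skip = 1"
| "csize (Push r a) = 2"
| "csize (Pop r) = 1"
| "csize (Seq c d) = csize c + csize d"
| "csize (Case r c d e) = 1 + csize c + csize d + csize e"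
| "csize (While r c) = 1 + csize c"
| "csize (Ask c d) = 1 + csize c + csize d"

text \<open>\<open>comp c q q'\<close> is the code of \<open>c\<close> for the states from \<open>q\<close> on, with exit state \<open>q'\<close>.\<close>

fun comp :: "com \<Rightarrow> nat \<Rightarrow> nat \<Rightarrow> instr list" where
  "comp Skip q q' = [Tape 0 (\<lambda>a. (a, 0, q'))]"
| "comp (Push r b) q q' = [Tape r (\<lambda>a. (a, dir r, q + 1)), Tape r (\<lambda>a. (Some b, 0, q'))]"
| "comp (Pop r) q q' = [Tape r (\<lambda>a. (None, if a = None then 0 else - dir r, q'))]"
| "comp (Seq c d) q q' = comp c q (q + csize c) @ comp d (q + csize c) q'"
| "comp (Case r c d e) q q' =
     Tape r (\<lambda>a. (a, 0, case a of None \<Rightarrow> q + 1 | Some False \<Rightarrow> q + 1 + csize c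
                          | Some True \<Rightarrow> q + 1 + csize c + csize d)) #
     comp c (q + 1) q' @ comp d (q + 1 + csize c) q' @ comp e (q + 1 + csize c + csize d) q'"
| "comp (While r c) q q' = Tape r (\<lambda>a. (a, 0, if a = None then q' else q + 1)) # comp c (q + 1) q"
| "comp (Ask c d) q q' =
     Query (q + 1) (q + 1 + csize c) # comp c (q + 1) q' @ comp d (q + 1 + csize c) q'"

lemma length_comp [simp]: "length (comp c q q') = csize c"
  by (induction c arbitrary: q q') auto

lemma csize_pos: "0 < csize c"
  by (induction c) auto

definition set_act :: "bool option list \<Rightarrow> nat \<Rightarrow> bool option \<times> int \<Rightarrow> (bool option \<times> int) list" where
  "set_act as r x = (map (\<lambda>a. (a, 0)) as)[r := x]"

text \<open>All queries share the states \<open>q_query\<close>, \<open>q_yes\<close> and \<open>q_no\<close>. The return address is kept by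
  a mark on a tape reserved for the querying instruction.\<close>

definition machine :: "nat \<Rightarrow> instr list \<Rightarrow> otm" where
  "machine n code = OTM (n + length code) (6 + length code)
     (\<lambda>q as.
        if q = 0 then (6, set_act as 1 (as ! 1, -1))
        else if 6 \<le> q \<and> q < 6 + length code then
          (case code ! (q - 6) of
             Tape r f \<Rightarrow> (case f (as ! r) of (a, d, q') \<Rightarrow> (q', set_act as r (a, d)))
           | Query y z \<Rightarrow> (3, set_act as (n + (q - 6)) (Some True, 0)))
        else if q = 4 \<or> q = 5 then
          (let k = (LEAST k. as ! (n + k) \<noteq> None) in
           if k < length code then
           (case code ! k of
              Tape r f \<Rightarrow> (2, set_act as 1 (as ! 1, 0))
            | Query y z \<Rightarrow> (if q = 4 then y else z, set_act as (n + k) (None, 0)))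
           else (2, set_act as 1 (as ! 1, 0)))
        else (2, set_act as 1 (as ! 1, 0)))"

fun wf_instr :: "nat \<Rightarrow> nat \<Rightarrow> instr \<Rightarrow> bool" where
  "wf_instr n N (Tape r f) \<longleftrightarrow> r < n \<and> (\<forall>a. case f a of (b, d, q) \<Rightarrow> d \<in> {-1, 0, 1} \<and> q < N)"
| "wf_instr n N (Query y z) \<longleftrightarrow> y < N \<and> z < N"

lemma wf_comp:
  "regs_below n c \<Longrightarrow> 0 < n \<Longrightarrow> q + csize c \<le> N \<Longrightarrow> q' < N \<Longrightarrow> \<forall>i\<in>set (comp c q q'). wf_instr n N i"
proof (induction c arbitrary: q q')
  case (Seq c d)
  then show ?case
    using Seq.IH(1)[of q "q + csize c"] Seq.IH(2)[of "q + csize c" q'] csize_pos[of d] by auto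
next
  case (Case r c d e)
  have "csize c > 0" "csize d > 0" "csize e > 0" by (simp_all add: csize_pos)
  then show ?case
    using Case.IH(1)[of "q + 1" q'] Case.IH(2)[of "q + 1 + csize c" q']
      Case.IH(3)[of "q + 1 + csize c + csize d" q'] Case.prems
    by (simp add: ball_Un split: option.split bool.split)
next
  case (While r c)
  have "csize c > 0" by (rule csize_pos)
  then show ?case using While.IH[of "q + 1" q] While.prems by simp
next
  case (Ask c d)
  have "csize c > 0" "csize d > 0" by (simp_all add: csize_pos)
  then show ?case
    using Ask.IH(1)[of "q + 1" q'] Ask.IH(2)[of "q + 1 + csize c" q'] Ask.prems by (simp add: ball_Un)
qed (auto simp: dir_def)

lemma set_act_bounds:
  "length as = N \<Longrightarrow> d \<in> {-1, 0, 1} \<Longrightarrow>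
   length (set_act as r (a, d)) = N \<and> (\<forall>(a, d)\<in>set (set_act as r (a, d)). d \<in> {-1, 0, 1})"
  unfolding set_act_def by (auto dest!: set_update_subset_insert[THEN subsetD])

text \<open>\<open>wf_otm\<close> constrains the transition table at every state and symbol list,
  also where no run leads; \<open>machine\<close> sends all such cases to state 2.\<close>

lemma wf_machine:
  assumes n: "2 \<le> n" and code: "code \<noteq> []" "\<forall>i\<in>set code. wf_instr n (6 + length code) i"
  shows "wf_otm (machine n code)"
proof -
  have *: "case delta (machine n code) q as of (q', acts) \<Rightarrow>
           q' < states (machine n code) \<and> length acts = tapes (machine n code) \<and>
           (\<forall>(a, d)\<in>set acts. d \<in> {-1, 0, 1})"
    if len: "length as = tapes (machine n code)" for q as
  proof -
    have len': "length as = n + length code" using len by (simp add: machine_def)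
    have wfi: "wf_instr n (6 + length code) (code ! j)" if "j < length code" for j
      using that code by simp
    note sa = set_act_bounds[OF len']
    let ?k = "LEAST k. as ! (n + k) \<noteq> None"
    have c0: "0 < length code" using code by simp
    consider "q = 0" | "6 \<le> q \<and> q < 6 + length code" | "q = 4 \<or> q = 5"
      | "q \<noteq> 0" "\<not> (6 \<le> q \<and> q < 6 + length code)" "\<not> (q = 4 \<or> q = 5)" by blast
    then show ?thesis
    proof cases
      case 2
      then have j: "q - 6 < length code" "q \<noteq> 0" by auto
      show ?thesis
      proof (cases "code ! (q - 6)")
        case (Tape r f)
        obtain a d q' where f: "f (as ! r) = (a, d, q')" by (metis prod_cases3)
        have d: "d \<in> {-1, 0, 1}" "q' < 6 + length code"
          using wfi[OF j(1)] f unfolding Tape by (auto dest!: spec[of _ "as ! r"])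
        show ?thesis using 2 j f sa[OF d(1)] d(2) by (simp add: machine_def Tape)
      next
        case (Query y z)
        then show ?thesis using 2 j sa[of 0] by (simp add: machine_def)
      qed
    next
      case 3
      then show ?thesis
      proof (cases "?k < length code")
        case True
        show ?thesis
        proof (cases "code ! ?k")
          case (Tape r f)
          then show ?thesis using 3 c0 sa[of 0] by (auto simp: machine_def Let_def)
        next
          case (Query y z)
          then show ?thesis using 3 wfi[OF True] c0 sa[of 0] by (auto simp: machine_def Let_def)
        qed
      qed (use 3 c0 sa[of 0] in \<open>auto simp: machine_def Let_def\<close>)
    qed (use c0 sa[of 0] sa[of "-1"] in \<open>auto simp: machine_def\<close>)
  qed
  then show ?thesis using n unfolding wf_otm_def by (auto simp: machine_def)
qed

text \<open>The cell below the bottom of the stack is \<open>base r\<close>; the input has length \<open>m\<close>.\<close>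

definition base :: "nat \<Rightarrow> nat \<Rightarrow> int" where
  "base m r = (if r = 0 then int m else if r = 1 then -1 else 0)"

definition stack_tape :: "nat \<Rightarrow> nat \<Rightarrow> bool list \<Rightarrow> int \<Rightarrow> bool option" where
  "stack_tape m r l z =
     (let k = dir r * (z - base m r) in
      if 1 \<le> k \<and> k \<le> int (length l) then Some (rev l ! nat (k - 1)) else None)"

text \<open>The head scans the top symbol, and the blank cell \<open>base m r\<close> if the stack
  is empty, so emptiness is seen without a move.\<close>

definition head_pos :: "nat \<Rightarrow> nat \<Rightarrow> bool list \<Rightarrow> int" where
  "head_pos m r l = base m r + dir r * int (length l)"

definition conf :: "nat \<Rightarrow> nat \<Rightarrow> nat \<Rightarrow> (nat \<Rightarrow> bool list) \<Rightarrow> config" where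
  "conf n m q s = (q, \<lambda>i. if i < n then head_pos m i (s i) else 0,
                      \<lambda>i. if i < n then stack_tape m i (s i) else (\<lambda>_. None))"

lemma dir_square [simp]: "dir r * (dir r * k) = k" "dir r * dir r = 1"
  by (auto simp: dir_def)

lemma dir_neq_0 [simp]: "dir r \<noteq> 0"
  by (simp add: dir_def)

lemma stack_tape_head [simp]:
  "stack_tape m r l (head_pos m r l) = (case l of [] \<Rightarrow> None | a # l' \<Rightarrow> Some a)"
  by (cases l) (auto simp: stack_tape_def head_pos_def Let_def nth_append algebra_simps)

lemma stack_tape_push:
  "(stack_tape m r l)(head_pos m r (a # l) := Some a) = stack_tape m r (a # l)"
proof
  fix z
  define k where "k = dir r * (z - base m r)"
  have z: "z = base m r + dir r * k" by (simp add: k_def)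
  have "z = head_pos m r (a # l) \<longleftrightarrow> k = int (Suc (length l))"
    unfolding z head_pos_def by simp
  then show "((stack_tape m r l)(head_pos m r (a # l) := Some a)) z = stack_tape m r (a # l) z"
    unfolding fun_upd_def stack_tape_def k_def[symmetric] Let_def
    by (auto simp: nth_append)
qed

lemma stack_tape_pop:
  "(stack_tape m r (a # l))(head_pos m r (a # l) := None) = stack_tape m r l"
proof -
  have "stack_tape m r l (head_pos m r (a # l)) = None"
    by (simp add: stack_tape_def head_pos_def Let_def algebra_simps)
  then show ?thesis by (metis stack_tape_push fun_upd_upd fun_upd_triv)
qed

lemma head_pos_Cons: "head_pos m r (a # l) = head_pos m r l + dir r"
  by (simp add: head_pos_def algebra_simps)

lemma query_word_stack: "query_word (stack_tape m 1 l) = rev l"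
proof -
  have "(LEAST n. stack_tape m 1 l (int n) = None) = length l"
    by (rule Least_equality) (auto simp: stack_tape_def base_def dir_def Let_def split: if_splits)
  then show ?thesis
    unfolding query_word_def
    by (auto intro!: nth_equalityI simp: stack_tape_def base_def dir_def Let_def)
qed

text \<open>State \<open>q\<close> executes instruction \<open>q - 6\<close>, since the first six
  states are fixed by the machine model.\<close>

definition code_at :: "instr list \<Rightarrow> nat \<Rightarrow> instr list \<Rightarrow> bool" where
  "code_at code q is \<longleftrightarrow> 6 \<le> q \<and> (\<exists>xs ys. code = xs @ is @ ys \<and> length xs = q - 6)"

lemma code_at_append:
  "code_at code q (is @ js) \<Longrightarrow> code_at code q is \<and> code_at code (q + length is) js"
proof -
  assume a: "code_at code q (is @ js)"
  then obtain xs ys where *: "code = xs @ (is @ js) @ ys" "length xs = q - 6" "6 \<le> q"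
    by (auto simp: code_at_def)
  have "code = xs @ is @ (js @ ys)" "code = (xs @ is) @ js @ ys" "length (xs @ is) = q + length is - 6"
    using * by auto
  then show ?thesis unfolding code_at_def using * by (metis trans_le_add1)
qed

lemma code_at_Cons:
  "code_at code q (i # is) \<Longrightarrow>
   6 \<le> q \<and> q < 6 + length code \<and> code ! (q - 6) = i \<and> code_at code (q + 1) is"
  using code_at_append[of code q "[i]" "is"]
  by (auto simp: code_at_def nth_append)

lemma step_set_act:
  assumes "q \<noteq> 1" "q \<noteq> 2" "q \<noteq> 3" "r < tapes M"
    and "delta M q (map (\<lambda>i. tp i (pos i)) [0..<tapes M]) =
          (q', set_act (map (\<lambda>i. tp i (pos i)) [0..<tapes M]) r (a, d))"
  shows "step A M (q, pos, tp) = (q', pos(r := pos r + d), tp(r := (tp r)(pos r := a)))"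
  using assms by (auto simp: step_def set_act_def nth_list_update fun_eq_iff)

lemma step_Tape:
  assumes "code_at code q (Tape r f # is)" "r < n" "f (tp r (pos r)) = (a, d, q')"
  shows "step A (machine n code) (q, pos, tp) =
           (q', pos(r := pos r + d), tp(r := (tp r)(pos r := a)))"
proof (rule step_set_act)
  note * = code_at_Cons[OF assms(1)]
  show "q \<noteq> 1" "q \<noteq> 2" "q \<noteq> 3" using * by auto
  show "r < tapes (machine n code)" using assms by (simp add: machine_def)
  show "delta (machine n code) q (map (\<lambda>i. tp i (pos i)) [0..<tapes (machine n code)]) =
    (q', set_act (map (\<lambda>i. tp i (pos i)) [0..<tapes (machine n code)]) r (a, d))"
    using * assms by (simp add: machine_def)
qed

lemma stack_tape_same:
  "(stack_tape m r l)(head_pos m r l := case l of [] \<Rightarrow> None | a # l' \<Rightarrow> Some a) = stack_tape m r l"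
  by (rule fun_upd_idem) simp

lemma conf_step:
  assumes "code_at code q (Tape r f # is)" "r < n"
    and "f (case s r of [] \<Rightarrow> None | a # l \<Rightarrow> Some a) = (a, d, q')"
    and "head_pos m r (s r) + d = head_pos m r l"
    and "(stack_tape m r (s r))(head_pos m r (s r) := a) = stack_tape m r l"
  shows "step A (machine n code) (conf n m q s) = conf n m q' (s(r := l))"
proof -
  have "step A (machine n code) (conf n m q s) = (q',
     (\<lambda>i. if i < n then head_pos m i (s i) else 0)(r := head_pos m r l),
     (\<lambda>i. if i < n then stack_tape m i (s i) else (\<lambda>_. None))(r := stack_tape m r l))"
    unfolding conf_def
    by (subst step_Tape[OF assms(1), where a = a and d = d and q' = q']) (use assms in auto)
  also have "\<dots> = conf n m q' (s(r := l))"
    using assms(2) by (auto simp: conf_def fun_eq_iff)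
  finally show ?thesis .
qed

lemma conf_step_test:
  assumes "code_at code q (Tape r f # is)" "r < n"
    and "f (case s r of [] \<Rightarrow> None | a # l \<Rightarrow> Some a) =
          (case s r of [] \<Rightarrow> None | a # l \<Rightarrow> Some a, 0, q')"
  shows "step A (machine n code) (conf n m q s) = conf n m q' s"
proof -
  have "step A (machine n code) (conf n m q s) = conf n m q' (s(r := s r))"
    by (rule conf_step[OF assms(1,2), where a = "case s r of [] \<Rightarrow> None | a # l \<Rightarrow> Some a" and d = 0])
      (use assms in \<open>simp_all add: stack_tape_same\<close>)
  then show ?thesis by simp
qed

lemma conf_push:
  assumes "code_at code q (comp (Push r b) q q')" "r < n"
  shows "(step A (machine n code) ^^ 2) (conf n m q s) = conf n m q' (s(r := b # s r))"
proof -
  let ?c = "case s r of [] \<Rightarrow> None | a # l \<Rightarrow> Some a"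
  have c1: "code_at code q (Tape r (\<lambda>a. (a, dir r, q + 1)) # [Tape r (\<lambda>a. (Some b, 0, q'))])"
    using assms by simp
  have c2: "code_at code (q + 1) [Tape r (\<lambda>a. (Some b, 0, q'))]"
    using code_at_Cons[OF c1] by simp
  have id: "(stack_tape m r (s r))(head_pos m r (s r) := ?c) = stack_tape m r (s r)"
    by (rule stack_tape_same)
  have "step A (machine n code) (conf n m q s) = (q + 1,
     (\<lambda>i. if i < n then head_pos m i (s i) else 0)(r := head_pos m r (b # s r)),
     (\<lambda>i. if i < n then stack_tape m i (s i) else (\<lambda>_. None)))"
    unfolding conf_def
    by (subst step_Tape[OF c1, where a = ?c and d = "dir r" and q' = "q + 1"])
      (use assms id in \<open>auto simp: head_pos_Cons fun_eq_iff\<close>)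
  moreover have "step A (machine n code) \<dots> = conf n m q' (s(r := b # s r))"
    by (subst step_Tape[OF c2, where a = "Some b" and d = 0 and q' = q'])
      (use assms in \<open>auto simp: stack_tape_push conf_def fun_eq_iff\<close>)
  ultimately show ?thesis by (simp add: numeral_2_eq_2)
qed

text \<open>The three steps mark the tape reserved for this instruction, ask, and then find and
  erase the mark. In a configuration \<open>conf\<close> all reserved tapes are blank, so the only
  marked one identifies the caller.\<close>

lemma conf_ask:
  assumes "code_at code q (Query y z # is)" "2 \<le> n"
  shows "(step A (machine n code) ^^ 3) (conf n m q s) =
           conf n m (if rev (s 1) \<in> A then y else z) s"
proof -
  note c = code_at_Cons[OF assms(1)]
  define k where "k = q - 6"
  have k: "k < length code" "code ! k = Query y z" "q = k + 6" using c by (auto simp: k_def)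
  let ?M = "machine n code"
  let ?pos = "\<lambda>i. if i < n then head_pos m i (s i) else 0"
  let ?tp = "\<lambda>i. if i < n then stack_tape m i (s i) else (\<lambda>_. None)"
  let ?tp' = "?tp(n + k := (?tp (n + k))(?pos (n + k) := Some True))"
  have tapes: "tapes ?M = n + length code" by (simp add: machine_def)
  have 1: "step A ?M (q, ?pos, ?tp) = (3, ?pos(n + k := ?pos (n + k) + 0), ?tp')"
    by (rule step_set_act) (use k in \<open>auto simp: machine_def\<close>)
  have 2: "step A ?M (3, ?pos, ?tp') = (if rev (s 1) \<in> A then 4 else 5, ?pos, ?tp')"
    using assms(2) by (simp add: step_def query_word_stack[unfolded One_nat_def])
  define as where "as = map (\<lambda>i. ?tp' i (?pos i)) [0..<n + length code]"
  have as_nth: "as ! (n + j) = (if j = k then Some True else None)" if "j < length code" for j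
    using that by (simp add: as_def)
  have least: "(LEAST j. as ! (n + j) \<noteq> None) = k"
  proof (rule Least_equality)
    show "as ! (n + k) \<noteq> None" using k as_nth by simp
    show "k \<le> j" if "as ! (n + j) \<noteq> None" for j
      using that as_nth[of j] k by (cases "j < length code") (auto split: if_splits)
  qed
  have 3: "step A ?M (q', ?pos, ?tp') =
      (if q' = 4 then y else z, ?pos(n + k := ?pos (n + k) + 0), ?tp'(n + k := (?tp' (n + k))(?pos (n + k) := None)))"
    if "q' = 4 \<or> q' = 5" for q'
  proof (rule step_set_act)
    show "delta ?M q' (map (\<lambda>i. ?tp' i (?pos i)) [0..<tapes ?M]) =
      (if q' = 4 then y else z, set_act (map (\<lambda>i. ?tp' i (?pos i)) [0..<tapes ?M]) (n + k) (None, 0))"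
      unfolding tapes as_def[symmetric] using that k
      by (auto simp add: machine_def Let_def least simp del: not_None_eq)
  qed (use that k in \<open>auto simp: tapes\<close>)
  have tp: "?tp'(n + k := (?tp' (n + k))(?pos (n + k) := None)) = ?tp" by (auto simp: fun_eq_iff)
  have pos: "?pos(n + k := ?pos (n + k) + 0) = ?pos" by (auto simp: fun_eq_iff)
  have "(step A ?M ^^ 3) (q, ?pos, ?tp) = (if rev (s 1) \<in> A then y else z, ?pos, ?tp)"
    unfolding numeral_3_eq_3 funpow.simps comp_apply 1 pos id_apply
    unfolding numeral_3_eq_3[symmetric] 2
    by (subst 3) (auto simp only: tp pos split: if_splits)
  then show ?thesis by (simp only: conf_def)
qed

text \<open>The cost in \<open>exec\<close> is the exact number of machine steps, so runs of
  subprograms are joined by \<open>funpow_add\<close> with no waiting in between.\<close>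

lemma comp_correct:
  assumes "exec A c s t s'" "regs_below n c" "2 \<le> n" "code_at code q (comp c q q')"
  shows "(step A (machine n code) ^^ t) (conf n m q s) = conf n m q' s'"
  using assms
proof (induction arbitrary: q q' rule: exec.induct)
  case (Skip s)
  then show ?case by (simp, intro conf_step_test) auto
next
  case (Push r a s)
  then show ?case by (intro conf_push) auto
next
  case (Pop r s)
  have "step A (machine n code) (conf n m q s) = conf n m q' (s(r := tl (s r)))"
  proof (cases "s r")
    case Nil
    have "step A (machine n code) (conf n m q s) = conf n m q' (s(r := []))"
      by (rule conf_step[OF Pop.prems(3)[unfolded comp.simps], where a = None and d = 0])
        (use Pop Nil stack_tape_same[of m r "[]"] in auto)
    then show ?thesis using Nil by simp
  next
    case (Cons a l)
    have "step A (machine n code) (conf n m q s) = conf n m q' (s(r := l))"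
      by (rule conf_step[OF Pop.prems(3)[unfolded comp.simps], where a = None and d = "- dir r"])
        (use Pop Cons stack_tape_pop[of m r a l] in \<open>auto simp: head_pos_Cons\<close>)
    then show ?thesis using Cons by simp
  qed
  then show ?case by (simp add: fun_upd_def)
next
  case (Seq c s t s' d t' s'')
  have "code_at code q (comp c q (q + csize c))"
    "code_at code (q + csize c) (comp d (q + csize c) q')"
    using code_at_append[of code q "comp c q (q + csize c)" "comp d (q + csize c) q'"] Seq.prems by auto
  then show ?case using Seq by (simp add: add.commute[of t] funpow_add)
next
  case (CaseNil s r c t s' d e)
  note ca = code_at_Cons[OF CaseNil.prems(3)[unfolded comp.simps]]
  have c: "code_at code (q + 1) (comp c (q + 1) q')" using ca code_at_append by blast
  have 1: "step A (machine n code) (conf n m q s) = conf n m (q + 1) s"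
    by (rule conf_step_test[OF CaseNil.prems(3)[unfolded comp.simps]]) (use CaseNil in auto)
  show ?case using CaseNil.IH[OF _ _ c] CaseNil.prems 1 by (simp add: funpow_Suc_right del: funpow.simps)
next
  case (CaseF s r l d t s' c e)
  note ca = code_at_Cons[OF CaseF.prems(3)[unfolded comp.simps]]
  have c: "code_at code (q + 1 + csize c) (comp d (q + 1 + csize c) q')"
    using ca code_at_append length_comp by metis
  have 1: "step A (machine n code) (conf n m q s) = conf n m (q + 1 + csize c) s"
    by (rule conf_step_test[OF CaseF.prems(3)[unfolded comp.simps]]) (use CaseF in auto)
  show ?case using CaseF.IH[OF _ _ c] CaseF.prems 1 by (simp add: funpow_Suc_right del: funpow.simps)
next
  case (CaseT s r l e t s' c d)
  note ca = code_at_Cons[OF CaseT.prems(3)[unfolded comp.simps]]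
  have c: "code_at code (q + 1 + csize c + csize d) (comp e (q + 1 + csize c + csize d) q')"
    using ca code_at_append length_comp by metis
  have 1: "step A (machine n code) (conf n m q s) = conf n m (q + 1 + csize c + csize d) s"
    by (rule conf_step_test[OF CaseT.prems(3)[unfolded comp.simps]]) (use CaseT in auto)
  show ?case using CaseT.IH[OF _ _ c] CaseT.prems 1 by (simp add: funpow_Suc_right del: funpow.simps)
next
  case (WhileNil s r c)
  have 1: "step A (machine n code) (conf n m q s) = conf n m q' s"
    by (rule conf_step_test[OF WhileNil.prems(3)[unfolded comp.simps]]) (use WhileNil in auto)
  then show ?case by simp
next
  case (WhileCons s r c t s' t' s'')
  note ca = code_at_Cons[OF WhileCons.prems(3)[unfolded comp.simps]]
  have c: "code_at code (q + 1) (comp c (q + 1) q)" using ca by blast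
  have 1: "step A (machine n code) (conf n m q s) = conf n m (q + 1) s"
    by (rule conf_step_test[OF WhileCons.prems(3)[unfolded comp.simps]])
      (use WhileCons in \<open>auto split: list.splits\<close>)
  have "(step A (machine n code) ^^ (t' + t)) (conf n m (q + 1) s) = conf n m q' s''"
    using WhileCons.IH(1)[OF _ _ c] WhileCons.IH(2)[of q q'] WhileCons.prems by (simp add: funpow_add)
  then show ?case using 1 by (simp add: funpow_Suc_right add.commute del: funpow.simps)
next
  case (AskYes s c t s' d)
  note ca = code_at_Cons[OF AskYes.prems(3)[unfolded comp.simps]]
  have c: "code_at code (q + 1) (comp c (q + 1) q')" using ca code_at_append by blast
  show ?case using AskYes.IH[OF _ _ c] AskYes.prems AskYes.hyps
      conf_ask[OF AskYes.prems(3)[unfolded comp.simps], of n A m s] by (simp add: funpow_add)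
next
  case (AskNo s d t s' c)
  note ca = code_at_Cons[OF AskNo.prems(3)[unfolded comp.simps]]
  have c: "code_at code (q + 1 + csize c) (comp d (q + 1 + csize c) q')"
    using ca code_at_append length_comp by metis
  show ?case using AskNo.IH[OF _ _ c] AskNo.prems AskNo.hyps
      conf_ask[OF AskNo.prems(3)[unfolded comp.simps], of n A m s] by (simp add: funpow_add)
qed

lemma funpow_fixpoint: "f x = x \<Longrightarrow> (f ^^ n) x = x"
  by (induction n) auto

text \<open>The halting states are fixed by \<open>step\<close>, so a machine that has reached its
  verdict may idle until the polynomial bound is exhausted, as \<open>P_rel\<close>
  requires.\<close>

lemma com_decides:
  fixes p :: "nat poly"
  assumes "\<And>x. \<exists>t s'. t \<le> poly p (length x) \<and> exec A c ((\<lambda>_. [])(0 := x)) t s' \<and> (s' r \<noteq> [] \<longleftrightarrow> x \<in> L)"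
  shows "L \<in> P_rel A"
proof -
  obtain n0 where "regs_below n0 c" using ex_regs_below by blast
  define n where "n = n0 + r + 2"
  have n: "regs_below n c" "2 \<le> n" "r < n"
    using \<open>regs_below n0 c\<close> by (auto simp: n_def elim: regs_below_mono)
  define qf where "qf = 6 + csize c"
  define test where "test = Tape r (\<lambda>a. (a, 0, if a = None then 2 else 1))"
  define code where "code = comp c 6 qf @ [test]"
  define M where "M = machine n code"
  have lc: "length code = csize c + 1" by (simp add: code_def)
  have "\<forall>i\<in>set (comp c 6 qf). wf_instr n (6 + length code) i"
    by (rule wf_comp) (use n in \<open>auto simp: qf_def lc\<close>)
  then have wf: "wf_otm M" unfolding M_def
    by (intro wf_machine) (use n in \<open>auto simp: code_def test_def\<close>)
  have c1: "code_at code 6 (comp c 6 qf)" "code_at code qf [test]"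
    by (auto simp: code_at_def code_def qf_def)
  \<comment> \<open>The input tape already is a stack: its first symbol, at cell 0, is the top and
    the bottom is at the far end. Only the head of the oracle tape has to be moved, from cell 0 to
    the cell -1 below the bottom.\<close>
  have init: "step A M (init_config x) = conf n (length x) 6 ((\<lambda>_. [])(0 := x))" for x
  proof -
    have "step A M (init_config x) = (6, (\<lambda>i. 0)(1 := 0 + -1),
        (\<lambda>i z. if i = 0 \<and> 0 \<le> z \<and> z < int (length x) then Some (x ! nat z) else None)(1 := (\<lambda>z. None)(0 := None)))"
      unfolding init_config_def
      by (subst step_set_act[where r = 1 and a = None and d = "-1" and q' = 6])
        (use n in \<open>auto simp: M_def machine_def\<close>)
    also have "\<dots> = conf n (length x) 6 ((\<lambda>_. [])(0 := x))"
    proof -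
      have "length x - Suc (nat (int (length x) - z - 1)) = nat z" if "0 \<le> z" "z < int (length x)" for z
        using that by linarith
      then show ?thesis
        using n by (auto simp: conf_def fun_eq_iff head_pos_def base_def dir_def stack_tape_def Let_def rev_nth)
    qed
    finally show ?thesis .
  qed
  have "wf_otm M \<and> (\<forall>x. fst ((step A M ^^ poly (p + 2) (length x)) (init_config x)) = (if x \<in> L then 1 else 2))"
  proof (intro conjI allI wf)
    fix x
    obtain t s' where t: "t \<le> poly p (length x)" "exec A c ((\<lambda>_. [])(0 := x)) t s'" "s' r \<noteq> [] \<longleftrightarrow> x \<in> L"
      using assms by blast
    define k where "k = poly p (length x) - t"
    \<comment> \<open>The two additional steps are the initial head move and the final test; the
      remaining \<open>k\<close> steps are idle.\<close>
    have k: "poly (p + 2) (length x) = k + (1 + (t + 1))" using t by (simp add: k_def)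
    have 2: "(step A M ^^ t) (conf n (length x) 6 ((\<lambda>_. [])(0 := x))) = conf n (length x) qf s'"
      unfolding M_def by (rule comp_correct) (use t n c1 in auto)
    have 3: "step A M (conf n (length x) qf s') = conf n (length x) (if x \<in> L then 1 else 2) s'"
      unfolding M_def
      by (rule conf_step_test[OF c1(2)[unfolded test_def]]) (use n t in \<open>auto split: list.splits\<close>)
    have 4: "step A M (conf n (length x) (if x \<in> L then 1 else 2) s') = conf n (length x) (if x \<in> L then 1 else 2) s'"
      by (auto simp: step_def conf_def)
    have "(step A M ^^ poly (p + 2) (length x)) (init_config x) = conf n (length x) (if x \<in> L then 1 else 2) s'"
      unfolding k funpow_add using init[of x] 2 3 funpow_fixpoint[of "step A M", OF 4] by simp
    then show "fst ((step A M ^^ poly (p + 2) (length x)) (init_config x)) = (if x \<in> L then 1 else 2)"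
      by (simp add: conf_def)
  qed
  then show ?thesis unfolding P_rel_def by blast
qed

section \<open>Functions computable in polynomial time relative to an oracle\<close>

text \<open>The summand 2 keeps the base of \<open>sz xs ^ e\<close> at least 2, so that a single
  power absorbs constants, sums and products.\<close>

definition sz :: "nat list \<Rightarrow> nat" where "sz xs = sum_list (map blen xs) + 2"

definition pbd :: "nat \<Rightarrow> (nat list \<Rightarrow> nat) \<Rightarrow> bool" where
  "pbd k T \<longleftrightarrow> (\<exists>e. \<forall>xs. length xs = k \<longrightarrow> T xs \<le> sz xs ^ e)"

lemma sz_ge: "2 \<le> sz xs" by (simp add: sz_def)

lemma pbd_mono: "pbd k T \<Longrightarrow> (\<And>xs. length xs = k \<Longrightarrow> U xs \<le> T xs) \<Longrightarrow> pbd k U"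
  unfolding pbd_def by (meson order_trans)

lemma pbd_const [intro!, simp]: "pbd k (\<lambda>xs. c)"
proof -
  have "c \<le> sz xs ^ c" for xs
    using less_exp[of c] power_mono[OF sz_ge[of xs], of c] by linarith
  then show ?thesis unfolding pbd_def by blast
qed

lemma pbd_sz [intro!, simp]: "pbd k sz"
  unfolding pbd_def by (intro exI[of _ 1]) simp

lemma pbd_mult [intro!]:
  assumes "pbd k T" "pbd k U" shows "pbd k (\<lambda>xs. T xs * U xs)"
proof -
  obtain a b where "\<forall>xs. length xs = k \<longrightarrow> T xs \<le> sz xs ^ a" "\<forall>xs. length xs = k \<longrightarrow> U xs \<le> sz xs ^ b"
    using assms unfolding pbd_def by blast
  then have "\<forall>xs. length xs = k \<longrightarrow> T xs * U xs \<le> sz xs ^ (a + b)"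
    by (simp add: power_add mult_le_mono)
  then show ?thesis unfolding pbd_def by blast
qed

lemma pbd_Suc [intro!]:
  assumes "pbd k T" shows "pbd k (\<lambda>xs. Suc (T xs))"
proof -
  obtain a where a: "\<forall>xs. length xs = k \<longrightarrow> T xs \<le> sz xs ^ a" using assms unfolding pbd_def by blast
  have "Suc (T xs) \<le> sz xs ^ Suc a" if "length xs = k" for xs
  proof -
    have "T xs \<le> sz xs ^ a" using a that by blast
    moreover have "sz xs ^ a * 2 \<le> sz xs ^ a * sz xs" using sz_ge by (intro mult_le_mono2)
    moreover have "1 \<le> sz xs ^ a" using sz_ge[of xs] by simp
    ultimately show ?thesis unfolding power_Suc2 by linarith
  qed
  then show ?thesis unfolding pbd_def by blast
qed

lemma pbd_add [intro!]:
  assumes "pbd k T" "pbd k U" shows "pbd k (\<lambda>xs. T xs + U xs)"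
  by (rule pbd_mono[OF pbd_mult[OF pbd_Suc[OF assms(1)] pbd_Suc[OF assms(2)]]]) simp

lemma pbd_power [intro!]: "pbd k T \<Longrightarrow> pbd k (\<lambda>xs. T xs ^ e)"
  by (induction e) (auto simp: pbd_const)

lemma pbd_sum_list: "(\<And>g. g \<in> set gs \<Longrightarrow> pbd k (G g)) \<Longrightarrow> pbd k (\<lambda>xs. sum_list (map (\<lambda>g. G g xs) gs))"
  by (induction gs) auto

lemma pbd_blen_nth: "i < k \<Longrightarrow> pbd k (\<lambda>xs. blen (xs ! i))"
proof (rule pbd_mono[OF pbd_sz])
  fix xs :: "nat list" assume "i < k" "length xs = k"
  then have "blen (xs ! i) \<in> set (map blen xs)" by simp
  then show "blen (xs ! i) \<le> sz xs" using member_le_sum_list[of "blen (xs ! i)" "map blen xs"] by (simp add: sz_def)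
qed

lemma pbd_comp:
  assumes "pbd l T" "length gs = l" "\<And>g. g \<in> set gs \<Longrightarrow> pbd k (\<lambda>xs. blen (g xs))"
  shows "pbd k (\<lambda>xs. T (map (\<lambda>g. g xs) gs))"
proof -
  obtain a where a: "\<forall>xs. length xs = l \<longrightarrow> T xs \<le> sz xs ^ a" using assms unfolding pbd_def by blast
  have "pbd k (\<lambda>xs. (sum_list (map (\<lambda>g. blen (g xs)) gs) + 2) ^ a)"
    using assms(3) by (intro pbd_power pbd_add pbd_sum_list) auto
  then show ?thesis
  proof (rule pbd_mono)
    fix xs :: "nat list"
    have "sum_list (map blen (map (\<lambda>g. g xs) gs)) = sum_list (map (\<lambda>g. blen (g xs)) gs)"
      by (simp add: comp_def)
    then show "T (map (\<lambda>g. g xs) gs) \<le> (sum_list (map (\<lambda>g. blen (g xs)) gs) + 2) ^ a"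
      using a[rule_format, of "map (\<lambda>g. g xs) gs"] assms(2) by (simp add: sz_def)
  qed
qed

lemma pbd_tl: "pbd k T \<Longrightarrow> pbd (Suc k) (\<lambda>xs. T (tl xs))"
proof -
  assume "pbd k T"
  then obtain a where a: "\<forall>xs. length xs = k \<longrightarrow> T xs \<le> sz xs ^ a" unfolding pbd_def by blast
  have "T (tl xs) \<le> sz xs ^ a" if "length xs = Suc k" for xs
  proof -
    have "sz (tl xs) \<le> sz xs" by (cases xs) (auto simp: sz_def)
    then have "sz (tl xs) ^ a \<le> sz xs ^ a" by (rule power_mono) simp
    moreover have "T (tl xs) \<le> sz (tl xs) ^ a" using a that by simp
    ultimately show ?thesis by (rule order_trans[rotated])
  qed
  then show ?thesis unfolding pbd_def by blast
qed

section \<open>Numbers and words\<close>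

fun bits :: "nat \<Rightarrow> bool list" where
  "bits n = (if n = 0 then [] else odd n # bits (n div 2))"

declare bits.simps [simp del]

fun val :: "bool list \<Rightarrow> nat" where
  "val [] = 0"
| "val (a # x) = 2 * val x + of_bool a"

text \<open>The digits of \<open>num x\<close>, least significant first, are \<open>x\<close>
  followed by a sentinel 1; thus words that differ only in final zeros have different
  numbers.\<close>

fun num :: "bool list \<Rightarrow> nat" where
  "num [] = 1"
| "num (a # x) = 2 * num x + of_bool a"

lemma bits_0 [simp]: "bits 0 = []" by (simp add: bits.simps)

lemma bits_double: "0 < 2 * n + of_bool b \<Longrightarrow> bits (2 * n + of_bool b) = b # bits n"
  by (subst bits.simps) auto

lemma val_bits [simp]: "val (bits n) = n"
  by (induction n rule: bits.induct) (subst bits.simps, auto simp: odd_two_times_div_two_succ)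

lemma length_bits [simp]: "length (bits n) = blen n"
  by (induction n rule: bits.induct) (subst bits.simps, auto simp: blen_0 blen_double)

lemma bits_Nil_iff [simp]: "bits n = [] \<longleftrightarrow> n = 0"
  by (subst bits.simps) simp

lemma num_pos [simp]: "0 < num x"
  by (induction x) auto

lemma bits_num: "bits (num x) = x @ [True]"
proof (induction x)
  case Nil
  then show ?case by (simp add: bits.simps)
next
  case (Cons a x)
  have "0 < 2 * num x + of_bool a" using num_pos[of x] by linarith
  then show ?case using Cons by (simp add: bits_double)
qed

text \<open>A nonempty suffix keeps the leading digit 1 and so is again a canonical expansion.
  Recursion on notation passes through exactly these suffixes.\<close>

lemma bits_suffix: "bits n = l1 @ l2 \<Longrightarrow> bits (val l2) = l2"
proof (induction l1 arbitrary: n)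
  case Nil
  then show ?case by (metis append_Nil val_bits)
next
  case (Cons a l1)
  then show ?case using bits.simps[of n] by (auto split: if_splits)
qed

lemma blen_val_le: "blen (val l) \<le> length l"
proof (induction l)
  case (Cons a l)
  have "(2 * val l + of_bool a) div 2 = val l" by simp
  then show ?case using Cons by (cases "2 * val l + of_bool a = 0") (auto simp: blen_0 blen_double)
qed (simp add: blen_0)

section \<open>Running times of small programs\<close>

definition runs :: "lang \<Rightarrow> com \<Rightarrow> (nat \<Rightarrow> bool list) \<Rightarrow> nat \<Rightarrow> (nat \<Rightarrow> bool list) \<Rightarrow> bool" where
  "runs A c s T s' \<longleftrightarrow> (\<exists>t\<le>T. exec A c s t s')"

lemma runs_mono: "runs A c s T s' \<Longrightarrow> T \<le> T' \<Longrightarrow> runs A c s T' s'"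
  unfolding runs_def by (meson order_trans)

lemma runs_Seq: "runs A c s T s' \<Longrightarrow> runs A d s' T' s'' \<Longrightarrow> runs A (Seq c d) s (T + T') s''"
  unfolding runs_def by (meson add_mono exec.Seq)

lemma runs_Skip: "1 \<le> T \<Longrightarrow> runs A Skip s T s"
  unfolding runs_def by (blast intro: exec.Skip)

lemma runs_Push: "runs A (Push r a) s 2 (s(r := a # s r))"
  unfolding runs_def by (blast intro: exec.Push)

lemma runs_Pop: "runs A (Pop r) s 1 (s(r := tl (s r)))"
  unfolding runs_def by (blast intro: exec.Pop)

lemma runs_Case:
  "runs A (case s r of [] \<Rightarrow> c | a # l \<Rightarrow> if a then e else d) s T s' \<Longrightarrow>
   runs A (Case r c d e) s (Suc T) s'"
proof (cases "s r")
  case Nil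
  then show "runs A (case s r of [] \<Rightarrow> c | a # l \<Rightarrow> if a then e else d) s T s' \<Longrightarrow> ?thesis"
    unfolding runs_def by (auto intro: exec.CaseNil)
next
  case (Cons a l)
  then show "runs A (case s r of [] \<Rightarrow> c | a # l \<Rightarrow> if a then e else d) s T s' \<Longrightarrow> ?thesis"
    unfolding runs_def by (cases a) (auto intro: exec.CaseF exec.CaseT)
qed

lemma runs_WhileNil: "s r = [] \<Longrightarrow> 1 \<le> T \<Longrightarrow> runs A (While r c) s T s"
  unfolding runs_def by (blast intro: exec.WhileNil)

lemma runs_WhileCons:
  "s r \<noteq> [] \<Longrightarrow> runs A c s T s' \<Longrightarrow> runs A (While r c) s' T' s'' \<Longrightarrow> runs A (While r c) s (Suc (T + T')) s''"
  unfolding runs_def by (meson add_mono exec.WhileCons Suc_le_mono)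

lemma runs_Ask:
  "runs A (if rev (s 1) \<in> A then c else d) s T s' \<Longrightarrow> runs A (Ask c d) s (T + 3) s'"
  unfolding runs_def by (metis add_le_mono1 exec.AskYes exec.AskNo)

definition clear :: "nat \<Rightarrow> com" where "clear r = While r (Pop r)"

lemma runs_clear: "runs A (clear r) s (2 * length (s r) + 1) (s(r := []))"
proof -
  have "runs A (While r (Pop r)) s (2 * length l + 1) (s(r := []))" if "s r = l" for l
    using that
  proof (induction l arbitrary: s)
    case Nil
    then show ?case using runs_WhileNil[of s r 1 A "Pop r"] by (simp add: fun_upd_idem)
  next
    case (Cons a l)
    have "(s(r := tl (s r)))(r := []) = s(r := [])" by simp
    then have "runs A (While r (Pop r)) (s(r := tl (s r))) (2 * length l + 1) (s(r := []))"
      using Cons.IH[of "s(r := tl (s r))"] Cons.prems by (metis fun_upd_same list.sel(3))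
    from runs_WhileCons[OF _ runs_Pop this] show ?case using Cons.prems by (simp add: fun_upd_def)
  qed
  then show ?thesis unfolding clear_def by blast
qed

definition move :: "nat \<Rightarrow> nat \<Rightarrow> com" where
  "move r d = While r (Case r Skip (Seq (Pop r) (Push d False)) (Seq (Pop r) (Push d True)))"

lemma runs_move:
  assumes "r \<noteq> d"
  shows "runs A (move r d) s (5 * length (s r) + 1) (s(r := [], d := rev (s r) @ s d))"
proof -
  have "runs A (move r d) s (5 * length l + 1) (s(r := [], d := rev l @ s d))" if "s r = l" for l
    using that
  proof (induction l arbitrary: s)
    case Nil
    then show ?case unfolding move_def
      by (auto intro!: runs_WhileNil[where s = s] simp: fun_upd_idem)
  next
    case (Cons a l)
    let ?s = "s(r := l, d := a # s d)"
    have "runs A (Seq (Pop r) (Push d a)) s (1 + 2) ?s"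
      using runs_Seq[OF runs_Pop[of A r s] runs_Push[of A d a]] Cons.prems assms by simp
    then have 1: "runs A (Case r Skip (Seq (Pop r) (Push d False)) (Seq (Pop r) (Push d True))) s 4 ?s"
      using runs_Case[where A = A and s = s and r = r and c = Skip and e = "Seq (Pop r) (Push d True)" and d = "Seq (Pop r) (Push d False)" and T = 3 and s' = ?s] Cons.prems
      by (cases a) (auto simp: eval_nat_numeral)
    have eq: "?s(r := [], d := rev l @ ?s d) = s(r := [], d := rev (a # l) @ s d)"
      using assms by (auto simp: fun_eq_iff)
    have "?s r = l" using assms by simp
    note IH = Cons.IH[of ?s, OF this, unfolded eq]
    then have 2: "runs A (move r d) ?s (5 * length l + 1) (s(r := [], d := rev (a # l) @ s d))" .
    show ?case
      using runs_WhileCons[OF _ 1 2[unfolded move_def]] Cons.prems unfolding move_def by (simp add: fun_upd_def)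
  qed
  then show ?thesis by blast
qed

definition move2 :: "nat \<Rightarrow> nat \<Rightarrow> nat \<Rightarrow> com" where
  "move2 r d e = While r (Case r Skip (Seq (Pop r) (Seq (Push d False) (Push e False)))
                                     (Seq (Pop r) (Seq (Push d True) (Push e True))))"

lemma runs_move2:
  assumes "r \<noteq> d" "r \<noteq> e" "d \<noteq> e"
  shows "runs A (move2 r d e) s (7 * length (s r) + 1) (s(r := [], d := rev (s r) @ s d, e := rev (s r) @ s e))"
proof -
  have "runs A (move2 r d e) s (7 * length l + 1) (s(r := [], d := rev l @ s d, e := rev l @ s e))" if "s r = l" for l
    using that
  proof (induction l arbitrary: s)
    case Nil
    then show ?case unfolding move2_def
      by (auto intro!: runs_WhileNil[where s = s] simp: fun_upd_idem)
  next
    case (Cons a l)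
    let ?s = "s(r := l, d := a # s d, e := a # s e)"
    have "runs A (Seq (Pop r) (Seq (Push d a) (Push e a))) s (1 + (2 + 2)) ?s"
      using runs_Seq[OF runs_Pop[of A r s] runs_Seq[OF runs_Push[of A d a] runs_Push[of A e a]]] Cons.prems assms by simp
    then have 1: "runs A (Case r Skip (Seq (Pop r) (Seq (Push d False) (Push e False)))
                                     (Seq (Pop r) (Seq (Push d True) (Push e True)))) s 6 ?s"
      using runs_Case[where A = A and s = s and r = r and c = Skip and e = "Seq (Pop r) (Seq (Push d True) (Push e True))"
          and d = "Seq (Pop r) (Seq (Push d False) (Push e False))" and T = 5 and s' = ?s] Cons.prems
      by (cases a) (auto simp: eval_nat_numeral)
    have eq: "?s(r := [], d := rev l @ ?s d, e := rev l @ ?s e) = s(r := [], d := rev (a # l) @ s d, e := rev (a # l) @ s e)"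
      using assms by (auto simp: fun_eq_iff)
    have "?s r = l" using assms by simp
    note IH = Cons.IH[of ?s, OF this, unfolded eq]
    then have 2: "runs A (move2 r d e) ?s (7 * length l + 1) (s(r := [], d := rev (a # l) @ s d, e := rev (a # l) @ s e))" .
    show ?case
      using runs_WhileCons[OF _ 1 2[unfolded move2_def]] Cons.prems unfolding move2_def by (simp add: fun_upd_def)
  qed
  then show ?thesis by blast
qed

definition copy :: "nat \<Rightarrow> nat \<Rightarrow> nat \<Rightarrow> com" where
  "copy r d e = Seq (move r e) (move2 e r d)"

lemma runs_copy:
  assumes "r \<noteq> d" "r \<noteq> e" "d \<noteq> e" "s e = []" "s d = []"
  shows "runs A (copy r d e) s (12 * length (s r) + 2) (s(d := s r))"
proof -
  let ?s = "s(r := [], e := rev (s r) @ s e)"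
  have "?s(e := [], r := rev (?s e) @ ?s r, d := rev (?s e) @ ?s d) = s(d := s r)"
    using assms by (auto simp: fun_eq_iff)
  then have "runs A (move2 e r d) ?s (7 * length (s r) + 1) (s(d := s r))"
    using runs_move2[of e r d A ?s] assms by simp
  from runs_mono[OF runs_Seq[OF runs_move[OF assms(2), of A s] this]] show ?thesis
    unfolding copy_def by simp
qed

section \<open>Functions computed by programs\<close>

definition computes ::
  "lang \<Rightarrow> com \<Rightarrow> nat \<Rightarrow> nat list \<Rightarrow> nat \<Rightarrow> nat \<Rightarrow> (nat list \<Rightarrow> nat) \<Rightarrow> (nat list \<Rightarrow> nat) \<Rightarrow> bool" where
  "computes A c k args d m T f \<longleftrightarrow> (\<forall>xs s. length xs = k \<longrightarrow> (\<forall>i<k. s (args ! i) = bits (xs ! i)) \<longrightarrow>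
      s d = [] \<longrightarrow> s 1 = [] \<longrightarrow> (\<forall>j\<ge>m. s j = []) \<longrightarrow> runs A c s (T xs) (s(d := bits (f xs))))"

text \<open>Quantifying over the argument and result registers makes relocation of programs
  unnecessary. Registers 0 and 1 are excluded as input and oracle tape. Scratch registers from
  \<open>m\<close> on are handed back empty, which allows programs to be put in sequence.\<close>

definition pt :: "lang \<Rightarrow> nat \<Rightarrow> (nat list \<Rightarrow> nat) \<Rightarrow> bool" where
  "pt A k f \<longleftrightarrow> (\<forall>args d m. length args = k \<longrightarrow> set args \<subseteq> {2..<m} \<longrightarrow> d \<in> {2..<m} \<longrightarrow> d \<notin> set args \<longrightarrow>
     (\<exists>c T. pbd k T \<and> computes A c k args d m T f))"

lemma ptD:
  assumes "pt A k f" "length args = k" "set args \<subseteq> {2..<m}" "d \<in> {2..<m}" "d \<notin> set args"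
  obtains c T where "pbd k T" "computes A c k args d m T f"
  using assms unfolding pt_def by blast

lemma computesD:
  assumes "computes A c k args d m T f" "length xs = k" "\<And>i. i < k \<Longrightarrow> s (args ! i) = bits (xs ! i)"
    "s d = []" "s 1 = []" "\<And>j. j \<ge> m \<Longrightarrow> s j = []"
  shows "runs A c s (T xs) (s(d := bits (f xs)))"
  using assms unfolding computes_def by blast

lemma pt_ext: "pt A k f \<Longrightarrow> (\<And>xs. length xs = k \<Longrightarrow> f xs = g xs) \<Longrightarrow> pt A k g"
  unfolding pt_def computes_def by simp

lemma pt_zero: "pt A k (\<lambda>_. 0)"
  unfolding pt_def computes_def
  by (auto intro!: exI[of _ Skip] exI[of _ "\<lambda>_. 1"] simp: fun_upd_idem runs_Skip)

lemma pt_proj: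
  assumes "i < k" shows "pt A k (\<lambda>xs. xs ! i)"
  unfolding pt_def
proof (intro allI impI exI conjI)
  fix args :: "nat list" and d m :: nat assume a: "length args = k" "set args \<subseteq> {2..<m}" "d \<in> {2..<m}" "d \<notin> set args"
  have ai: "args ! i \<in> {2..<m}" "args ! i \<noteq> d" using a assms nth_mem[of i args] by blast+
  show "pbd k (\<lambda>xs. 12 * blen (xs ! i) + 2)" using assms by (intro pbd_add pbd_mult pbd_const pbd_blen_nth)
  show "computes A (copy (args ! i) d m) k args d m (\<lambda>xs. 12 * blen (xs ! i) + 2) (\<lambda>xs. xs ! i)"
    unfolding computes_def
  proof (intro allI impI)
    fix xs and s :: "nat \<Rightarrow> bool list"
    assume "length xs = k" "\<forall>i<k. s (args ! i) = bits (xs ! i)" "s d = []" "\<forall>j\<ge>m. s j = []"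
    then show "runs A (copy (args ! i) d m) s (12 * blen (xs ! i) + 2) (s(d := bits (xs ! i)))"
      using runs_copy[of "args ! i" d m s A] ai a assms by auto
  qed
qed

lemma pt_push:
  "pt A 1 (\<lambda>xs. 2 * xs ! 0 + of_bool b)"
  unfolding pt_def
proof (intro allI impI exI conjI)
  fix args :: "nat list" and d m :: nat assume a: "length args = 1" "set args \<subseteq> {2..<m}" "d \<in> {2..<m}" "d \<notin> set args"
  let ?r = "args ! 0"
  have r: "?r \<in> {2..<m}" "?r \<noteq> d" using a nth_mem[of 0 args] by fastforce+
  \<comment> \<open>A digit 0 pushed on the empty stack would give a noncanonical expansion of 0,
    hence the test.\<close>
  let ?c = "Seq (copy ?r d m) (if b then Push d True else Case d Skip (Push d False) (Push d False))"
  show "pbd 1 (\<lambda>xs. 12 * blen (xs ! 0) + 5)" by (intro pbd_add pbd_mult pbd_const pbd_blen_nth) simp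
  show "computes A ?c 1 args d m (\<lambda>xs. 12 * blen (xs ! 0) + 5) (\<lambda>xs. 2 * xs ! 0 + of_bool b)"
    unfolding computes_def
  proof (intro allI impI)
    fix xs s
    assume l: "length xs = 1" and *: "\<forall>i<1. s (args ! i) = bits (xs ! i)" "s d = []" "\<forall>j\<ge>m. s j = []"
    let ?s = "s(d := bits (xs ! 0))"
    have 1: "runs A (copy ?r d m) s (12 * blen (xs ! 0) + 2) ?s"
      using runs_copy[of ?r d m s A] * a r by auto
    have "runs A (if b then Push d True else Case d Skip (Push d False) (Push d False)) ?s 3 (s(d := bits (2 * xs ! 0 + of_bool b)))"
    proof (cases "2 * xs ! 0 + of_bool b = 0")
      case True
      then have "runs A (Case d Skip (Push d False) (Push d False)) ?s (Suc 1) ?s"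
        by (intro runs_Case) (simp add: runs_Skip)
      then show ?thesis
        using True runs_mono[of A "Case d Skip (Push d False) (Push d False)" ?s "Suc 1" ?s 3] by (cases b) auto
    next
      case False
      then have eq: "s(d := bits (2 * xs ! 0 + of_bool b)) = ?s(d := b # ?s d)" by (simp add: bits_double)
      show ?thesis
      proof (cases b)
        case True
        then show ?thesis unfolding eq using runs_mono[OF runs_Push[of A d True ?s], of 3] by simp
      next
        case F: False
        then have "bits (xs ! 0) \<noteq> []" using False by simp
        then have "runs A (case ?s d of [] \<Rightarrow> Skip | a # l \<Rightarrow> if a then Push d False else Push d False) ?s 2 (?s(d := False # ?s d))"
          using runs_Push[of A d False ?s] by (auto split: list.split)
        then show ?thesis unfolding eq using runs_mono[OF runs_Case[where s = ?s and r = d]] F by simp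
      qed
    qed
    from runs_mono[OF runs_Seq[OF 1 this]]
    show "runs A ?c s (12 * blen (xs ! 0) + 5) (s(d := bits (2 * xs ! 0 + of_bool b)))" by simp
  qed
qed

lemma pt_oracle: "pt A 1 (\<lambda>xs. of_bool (rev (bits (xs ! 0)) \<in> A))"
  unfolding pt_def
proof (intro allI impI exI conjI)
  fix args :: "nat list" and d m :: nat assume a: "length args = 1" "set args \<subseteq> {2..<m}" "d \<in> {2..<m}" "d \<notin> set args"
  let ?r = "args ! 0"
  have r: "?r \<in> {2..<m}" "?r \<noteq> d" using a nth_mem[of 0 args] by fastforce+
  let ?c = "Seq (copy ?r 1 m) (Seq (Ask (Push d True) Skip) (clear 1))"
  show "pbd 1 (\<lambda>xs. 14 * blen (xs ! 0) + 8)" by (intro pbd_add pbd_mult pbd_const pbd_blen_nth) simp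
  show "computes A ?c 1 args d m (\<lambda>xs. 14 * blen (xs ! 0) + 8) (\<lambda>xs. of_bool (rev (bits (xs ! 0)) \<in> A))"
    unfolding computes_def
  proof (intro allI impI)
    fix xs s
    assume l: "length xs = 1" and *: "\<forall>i<1. s (args ! i) = bits (xs ! i)" "s d = []" "s 1 = []" "\<forall>j\<ge>m. s j = []"
    let ?s = "s(1 := bits (xs ! 0))"
    let ?b = "rev (bits (xs ! 0)) \<in> A"
    have 1: "runs A (copy ?r 1 m) s (12 * blen (xs ! 0) + 2) ?s"
      using runs_copy[of ?r 1 m s A] * a r by auto
    have b1: "bits 1 = [True]" by (simp add: bits.simps)
    have 2: "runs A (Ask (Push d True) Skip) ?s (2 + 3) (?s(d := bits (of_bool ?b)))"
    proof (rule runs_Ask, cases ?b)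
      case True
      then show "runs A (if rev (?s 1) \<in> A then Push d True else Skip) ?s 2 (?s(d := bits (of_bool ?b)))"
        using runs_Push[of A d True ?s] a * b1 by simp
    next
      case False
      then show "runs A (if rev (?s 1) \<in> A then Push d True else Skip) ?s 2 (?s(d := bits (of_bool ?b)))"
        using runs_Skip[of 2 A ?s] a * by (simp add: fun_upd_idem)
    qed
    let ?s' = "?s(d := bits (of_bool ?b))"
    have "?s'(1 := []) = s(d := bits (of_bool ?b))" using a * by (auto simp: fun_eq_iff)
    moreover have "?s' 1 = bits (xs ! 0)" using a by auto
    ultimately have 3: "runs A (clear 1) ?s' (2 * blen (xs ! 0) + 1) (s(d := bits (of_bool ?b)))"
      using runs_clear[of A 1 ?s'] by simp
    from runs_mono[OF runs_Seq[OF 1 runs_Seq[OF 2 3]]]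
    show "runs A ?c s (14 * blen (xs ! 0) + 8) (s(d := bits (of_bool ?b)))" by simp
  qed
qed

lemma pt_bound:
  assumes "pt A k f" shows "pbd k (\<lambda>xs. blen (f xs))"
proof -
  obtain c T where c: "pbd k T" "computes A c k [2..<2 + k] (2 + k) (3 + k) T f"
    by (rule ptD[OF assms, of "[2..<2 + k]" "3 + k" "2 + k"]) (auto simp del: upt_Suc)
  have "blen (f xs) \<le> T xs" if l: "length xs = k" for xs
  proof -
    define s where "s = (\<lambda>r. if 2 \<le> r \<and> r < 2 + k then bits (xs ! (r - 2)) else [])"
    have "runs A c s (T xs) (s(2 + k := bits (f xs)))"
    proof (rule computesD[OF c(2) l])
      fix i assume "i < k"
      moreover from this have "[2..<2 + k] ! i = 2 + i" by (intro nth_upt) simp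
      ultimately show "s ([2..<2 + k] ! i) = bits (xs ! i)" by (simp only: s_def) simp
    qed (auto simp: s_def)
    then obtain t where t: "t \<le> T xs" "exec A c s t (s(2 + k := bits (f xs)))" unfolding runs_def by blast
    have "length ((s(2 + k := bits (f xs))) (2 + k)) \<le> length (s (2 + k)) + t"
      by (rule exec_length[OF t(2)])
    then show ?thesis using t(1) by (simp add: s_def)
  qed
  then show ?thesis by (rule pbd_mono[OF c(1)])
qed

text \<open>Each value is stored in the first free register, which then counts as memory in use for
  the next function; this is why the induction appends at the end of \<open>gs\<close>.\<close>

lemma pt_comp_args:
  assumes "\<forall>g\<in>set gs. pt A k g" "length args = k" "set args \<subseteq> {2..<m}" "2 \<le> m"
  shows "\<exists>c T. pbd k T \<and> (\<forall>xs s. length xs = k \<longrightarrow> (\<forall>i<k. s (args ! i) = bits (xs ! i)) \<longrightarrow>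
      s 1 = [] \<longrightarrow> (\<forall>j\<ge>m. s j = []) \<longrightarrow>
      runs A c s (T xs) (\<lambda>r. if m \<le> r \<and> r < m + length gs then bits ((gs ! (r - m)) xs) else s r))"
  using assms
proof (induction gs rule: rev_induct)
  case Nil
  have "runs A Skip s 1 (\<lambda>r. if m \<le> r \<and> r < m + length [] then bits (([] ! (r - m)) xs) else s r)" for xs s
    using runs_Skip[of 1 A s] by (simp add: not_le[symmetric] cong: conj_cong)
  then show ?case by (intro exI[of _ Skip] exI[of _ "\<lambda>_. 1"]) auto
next
  case (snoc g gs)
  define upd where "upd gs xs s = (\<lambda>r. if m \<le> r \<and> r < m + length gs then bits ((gs ! (r - m)) xs) else s r)"
    for gs :: "(nat list \<Rightarrow> nat) list" and xs s
  have "\<forall>g\<in>set gs. pt A k g" using snoc.prems by simp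
  from snoc.IH[OF this snoc.prems(2-4)] obtain c T where c: "pbd k T"
    "\<forall>xs s. length xs = k \<longrightarrow> (\<forall>i<k. s (args ! i) = bits (xs ! i)) \<longrightarrow>
      s 1 = [] \<longrightarrow> (\<forall>j\<ge>m. s j = []) \<longrightarrow> runs A c s (T xs) (upd gs xs s)"
    unfolding upd_def by blast
  let ?d = "m + length gs"
  have "pt A k g" "set args \<subseteq> {2..<?d + 1}" "?d \<notin> set args" using snoc.prems by fastforce+
  then obtain c' T' where c': "pbd k T'" "computes A c' k args ?d (?d + 1) T' g"
    using ptD[of A k g args "?d + 1" ?d] snoc.prems(2,4)
    by (metis Suc_eq_plus1 atLeastLessThan_iff lessI trans_le_add1)
  have "runs A (Seq c c') s (T xs + T' xs) (upd (gs @ [g]) xs s)"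
    if "length xs = k" "\<forall>i<k. s (args ! i) = bits (xs ! i)" "s 1 = []" "\<forall>j\<ge>m. s j = []" for xs s
  proof (rule runs_Seq)
    show "runs A c s (T xs) (upd gs xs s)" using c that by blast
    have "upd (gs @ [g]) xs s = (upd gs xs s)(?d := bits (g xs))"
      by (auto simp: upd_def fun_eq_iff nth_append)
    moreover have "runs A c' (upd gs xs s) (T' xs) ((upd gs xs s)(?d := bits (g xs)))"
    proof (rule computesD[OF c'(2) that(1)])
      fix i assume i: "i < k"
      then have "args ! i < m" using snoc.prems(2,3) nth_mem[of i args] by fastforce
      then show "upd gs xs s (args ! i) = bits (xs ! i)" using that i by (simp add: upd_def)
    qed (use that snoc.prems in \<open>auto simp: upd_def\<close>)
    ultimately show "runs A c' (upd gs xs s) (T' xs) (upd (gs @ [g]) xs s)" by simp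
  qed
  then show ?case unfolding upd_def[symmetric] using c(1) c'(1)
    by (intro exI[of _ "Seq c c'"] exI[of _ "\<lambda>xs. T xs + T' xs"]) auto
qed

lemma runs_clear_range:
  "\<exists>c. \<forall>s. runs A c s (1 + (\<Sum>r\<leftarrow>[m..<m + l]. 2 * length (s r) + 1)) (\<lambda>r. if m \<le> r \<and> r < m + l then [] else s r)"
proof (induction l)
  case 0
  have "runs A Skip s 1 (\<lambda>r. if m \<le> r \<and> r < m + 0 then [] else s r)" for s
    using runs_Skip[of 1 A s] by (simp add: not_le[symmetric] cong: conj_cong)
  then show ?case by auto
next
  case (Suc l)
  then obtain c where c: "\<And>s. runs A c s (1 + (\<Sum>r\<leftarrow>[m..<m + l]. 2 * length (s r) + 1))
      (\<lambda>r. if m \<le> r \<and> r < m + l then [] else s r)" by blast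
  have "runs A (Seq c (clear (m + l))) s (1 + (\<Sum>r\<leftarrow>[m..<m + Suc l]. 2 * length (s r) + 1))
     (\<lambda>r. if m \<le> r \<and> r < m + Suc l then [] else s r)" for s
  proof -
    let ?s = "\<lambda>r. if m \<le> r \<and> r < m + l then [] else s r"
    have "?s(m + l := []) = (\<lambda>r. if m \<le> r \<and> r < m + Suc l then [] else s r)"
      by (auto simp: fun_eq_iff less_Suc_eq)
    then show ?thesis
      using runs_Seq[OF c[of s] runs_clear[of A "m + l" ?s]] by (simp add: add.assoc)
  qed
  then show ?case by blast
qed

lemma pt_comp:
  assumes "pt A l h" "length gs = l" "\<forall>g\<in>set gs. pt A k g"
  shows "pt A k (\<lambda>xs. h (map (\<lambda>g. g xs) gs))"
  unfolding pt_def
proof (intro allI impI)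
  fix args :: "nat list" and d m :: nat assume a: "length args = k" "set args \<subseteq> {2..<m}" "d \<in> {2..<m}" "d \<notin> set args"
  define upd where "upd xs s = (\<lambda>r. if m \<le> r \<and> r < m + length gs then bits ((gs ! (r - m)) xs) else s r)"
    for xs and s :: "nat \<Rightarrow> bool list"
  have "2 \<le> m" using a(3) by simp
  from pt_comp_args[OF assms(3) a(1,2) this] obtain c T where c: "pbd k T"
    "\<forall>xs s. length xs = k \<longrightarrow> (\<forall>i<k. s (args ! i) = bits (xs ! i)) \<longrightarrow>
      s 1 = [] \<longrightarrow> (\<forall>j\<ge>m. s j = []) \<longrightarrow> runs A c s (T xs) (upd xs s)"
    unfolding upd_def by blast
  have "set [m..<m + l] \<subseteq> {2..<m + l}" "d \<in> {2..<m + l}" "d \<notin> set [m..<m + l]" using a by auto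
  then obtain c' T' where c': "pbd l T'" "computes A c' l [m..<m + l] d (m + l) T' h"
    by (rule ptD[OF assms(1), rotated]) auto
  obtain e where e: "\<And>s. runs A e s (1 + (\<Sum>r\<leftarrow>[m..<m + l]. 2 * length (s r) + 1))
      (\<lambda>r. if m \<le> r \<and> r < m + l then [] else s r)" using runs_clear_range by blast
  define Te where "Te xs = 1 + (\<Sum>g\<leftarrow>gs. 2 * blen (g xs) + 1)" for xs
  have bnd: "pbd k (\<lambda>xs. blen (g xs))" if "g \<in> set gs" for g using that assms(3) pt_bound by blast
  have "runs A (Seq c (Seq c' e)) s (T xs + (T' (map (\<lambda>g. g xs) gs) + Te xs)) (s(d := bits (h (map (\<lambda>g. g xs) gs))))"
    if p: "length xs = k" "\<forall>i<k. s (args ! i) = bits (xs ! i)" "s d = []" "s 1 = []" "\<forall>j\<ge>m. s j = []" for xs s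
  proof (intro runs_Seq)
    let ?r = "bits (h (map (\<lambda>g. g xs) gs))"
    show "runs A c s (T xs) (upd xs s)" using c p by blast
    show "runs A c' (upd xs s) (T' (map (\<lambda>g. g xs) gs)) ((upd xs s)(d := ?r))"
      by (rule computesD[OF c'(2)]) (use p a assms(2) in \<open>auto simp: upd_def\<close>)
    have 1: "(\<lambda>r. if m \<le> r \<and> r < m + l then [] else ((upd xs s)(d := ?r)) r) = s(d := ?r)"
      using p a assms(2) by (auto simp: upd_def fun_eq_iff)
    have "[m..<m + l] = map (\<lambda>i. m + i) [0..<l]" by (simp add: map_add_upt add.commute)
    then have "(\<Sum>r\<leftarrow>[m..<m + l]. 2 * length (((upd xs s)(d := ?r)) r) + 1) = (\<Sum>i\<leftarrow>[0..<l]. 2 * blen ((gs ! i) xs) + 1)"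
      using a assms(2) by (auto simp: comp_def upd_def intro!: arg_cong[of _ _ sum_list])
    also have "\<dots> = (\<Sum>g\<leftarrow>gs. 2 * blen (g xs) + 1)"
      using assms(2) by (auto simp: sum_list_sum_nth)
    finally show "runs A e ((upd xs s)(d := ?r)) (Te xs) (s(d := ?r))"
      using e[of "(upd xs s)(d := ?r)"] unfolding 1 Te_def by simp
  qed
  moreover have "pbd k (\<lambda>xs. T xs + (T' (map (\<lambda>g. g xs) gs) + Te xs))"
    unfolding Te_def
    by (intro pbd_add c(1) pbd_comp[OF c'(1) assms(2)] pbd_const pbd_sum_list pbd_mult bnd)
  ultimately show "\<exists>c T. pbd k T \<and> computes A c k args d m T (\<lambda>xs. h (map (\<lambda>g. g xs) gs))"
    unfolding computes_def by blast
qed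

text \<open>The recursion is run as a loop over the digits of the first argument, the most
  significant one first: \<open>R\<close> holds the digits still to be read, \<open>Cu\<close> the
  number read so far, \<open>Ac\<close> the value of \<open>f\<close> there. The bound on the length
  of \<open>f\<close> keeps the time of every round polynomial.\<close>

lemma pt_rec:
  assumes g: "pt A k g" and h: "\<And>b. pt A (k + 2) (h b)"
    and f0: "\<And>ys. length ys = k \<Longrightarrow> f (0 # ys) = g ys"
    and fS: "\<And>b x ys. length ys = k \<Longrightarrow> 0 < 2 * x + of_bool b \<Longrightarrow>
               f ((2 * x + of_bool b) # ys) = h b (x # f (x # ys) # ys)"
    and bd: "pbd (Suc k) (\<lambda>xs. blen (f xs))"
  shows "pt A (Suc k) f"
  unfolding pt_def
proof (intro allI impI)
  fix args :: "nat list" and d m :: nat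
  assume a: "length args = Suc k" "set args \<subseteq> {2..<m}" "d \<in> {2..<m}" "d \<notin> set args"
  define a0 as where "a0 = args ! 0" and "as = tl args"
  have args: "args = a0 # as" "length as = k" using a(1) by (cases args; simp add: a0_def as_def)+
  have a0: "2 \<le> a0" "a0 < m" "a0 \<noteq> d" and as: "set as \<subseteq> {2..<m}" "d \<notin> set as" and d: "2 \<le> d" "d < m"
    using a unfolding args by auto
  have as_nth: "2 \<le> as ! i" "as ! i < m" if "i < k" for i
  proof -
    have "as ! i \<in> set as" using that args(2) by simp
    then show "2 \<le> as ! i" "as ! i < m" using as(1) by auto
  qed
  define R Cu Ac Tm F where regs: "R = m" "Cu = m + 1" "Ac = m + 2" "Tm = m + 3" "F = m + 4"
  obtain cg Tg where cg: "pbd k Tg" "computes A cg k as Ac F Tg g"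
    by (rule ptD[OF g args(2), of F Ac]) (use as in \<open>auto simp: regs\<close>)
  have "\<exists>c T. pbd (k + 2) T \<and> computes A c (k + 2) (Cu # Ac # as) Tm F T (h b)" for b
    by (rule ptD[OF h[of b], of "Cu # Ac # as" F Tm]) (use as d args in \<open>auto simp: regs\<close>)
  then obtain ch Th where ch: "\<And>b. pbd (k + 2) (Th b)" "\<And>b. computes A (ch b) (k + 2) (Cu # Ac # as) Tm F (Th b) (h b)"
    by metis
  obtain ef where ef: "\<And>xs. length xs = Suc k \<Longrightarrow> blen (f xs) \<le> sz xs ^ ef" using bd unfolding pbd_def by blast
  have "\<exists>e. \<forall>xs. length xs = k + 2 \<longrightarrow> Th b xs \<le> sz xs ^ e" for b using ch(1) unfolding pbd_def by blast
  then obtain eh where eh: "\<And>b xs. length xs = k + 2 \<Longrightarrow> Th b xs \<le> sz xs ^ eh b" by metis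
  define B where "B xs = sz xs ^ ef" for xs
  define K where "K xs = (sz xs + B xs) ^ eh False + (sz xs + B xs) ^ eh True" for xs
  have bound: "blen (f (v # ys)) \<le> B (x # ys)" "Th b (v # f (v # ys) # ys) \<le> K (x # ys)"
    if "blen v \<le> blen x" "length ys = k" for v x ys b
  proof -
    have le: "sz (v # ys) \<le> sz (x # ys)" using that by (simp add: sz_def)
    then have "sz (v # ys) ^ ef \<le> sz (x # ys) ^ ef" by (rule power_mono) simp
    then show 1: "blen (f (v # ys)) \<le> B (x # ys)" using ef[of "v # ys"] that by (simp add: B_def)
    have "sz (v # f (v # ys) # ys) \<le> sz (x # ys) + B (x # ys)" using 1 that(1) by (simp add: sz_def)
    then have "sz (v # f (v # ys) # ys) ^ eh b \<le> (sz (x # ys) + B (x # ys)) ^ eh b" by (rule power_mono) simp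
    then have "Th b (v # f (v # ys) # ys) \<le> (sz (x # ys) + B (x # ys)) ^ eh b"
      using eh[of "v # f (v # ys) # ys" b] that(2) by simp
    then show "Th b (v # f (v # ys) # ys) \<le> K (x # ys)" by (cases b) (auto simp: K_def)
  qed
  define body where "body b = Seq (Pop R) (Seq (ch b) (Seq (clear Ac) (Seq (copy Tm Ac F) (Seq (clear Tm) (Push Cu b)))))" for b
  define loop where "loop = While R (Case R Skip (body False) (body True))"
  define c where "c = Seq (copy a0 Tm F) (Seq (move Tm R) (Seq cg (Seq loop (Seq (copy Ac d F) (Seq (clear Ac) (clear Cu))))))"
  \<comment> \<open>A round consists of one call of \<open>h\<close>, of copying and clearing values
    of length at most \<open>B xs\<close>, and of the tests of \<open>Case\<close> and
    \<open>While\<close>.\<close>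
  define E where "E xs = K xs + 16 * B xs + 10" for xs
  define T where "T xs = (12 * blen (xs ! 0) + 2) + ((5 * blen (xs ! 0) + 1) + (Tg (tl xs) + ((blen (xs ! 0) * E xs + 1) +
      ((12 * B xs + 2) + ((2 * B xs + 1) + (2 * blen (xs ! 0) + 1))))))" for xs
  have pB: "pbd (Suc k) B" unfolding B_def by (intro pbd_power pbd_sz)
  then have "pbd (Suc k) E" unfolding E_def K_def by (intro pbd_add pbd_mult pbd_power pbd_sz pbd_const)
  with pB have "pbd (Suc k) T" unfolding T_def
    by (intro pbd_add pbd_mult pbd_const pbd_blen_nth pbd_tl cg(1)) simp_all
  moreover have "computes A c (Suc k) args d m T f"
    unfolding computes_def
  proof (intro allI impI)
    fix xs and s :: "nat \<Rightarrow> bool list"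
    assume l: "length xs = Suc k" and sa: "\<forall>i<Suc k. s (args ! i) = bits (xs ! i)"
      and s0: "s d = []" "s 1 = []" "\<forall>j\<ge>m. s j = []"
    obtain x ys where xs: "xs = x # ys" "length ys = k" using l by (cases xs) auto
    have sa0: "s a0 = bits x" using sa unfolding args xs by auto
    have sas: "s (as ! i) = bits (ys ! i)" if "i < k" for i
      using sa that unfolding args xs by (metis Suc_less_eq nth_Cons_Suc)
    have sj: "s R = []" "s Cu = []" "s Ac = []" "s Tm = []" "\<And>j. F \<le> j \<Longrightarrow> s j = []" "s F = []"
      using s0 by (auto simp: regs)
    \<comment> \<open>Loop invariant for \<open>bits x = l1 @ l2\<close>: the digits in
      \<open>l2\<close> have been read, and the top of \<open>R\<close> is the next digit, the last
      one of \<open>l1\<close>.\<close>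
    define st where "st l1 l2 = s(R := rev l1, Cu := l2, Ac := bits (f (val l2 # ys)))" for l1 l2
    have iter: "runs A (Case R Skip (body False) (body True)) (st (l1 @ [b]) l2) (E xs - 1) (st l1 (b # l2))"
      if bx: "bits x = l1 @ b # l2" for l1 b l2
    proof -
      define v where "v = val l2"
      have l2: "l2 = bits v" using bits_suffix[of x "l1 @ [b]" l2] bx by (simp add: v_def)
      have "bits (val (b # l2)) = b # l2" using bits_suffix[OF bx] .
      then have pos: "0 < 2 * v + of_bool b" by (metis bits_Nil_iff list.distinct(1) v_def val.simps(2) neq0_conv)
      have bv: "blen v \<le> blen x"
        using arg_cong[OF bx, of length] arg_cong[OF l2, of length] by simp
      define r where "r = f (v # ys)"
      define r' where "r' = f ((2 * v + of_bool b) # ys)"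
      have r': "r' = h b (v # r # ys)" using fS[OF xs(2) pos] by (simp add: r_def r'_def)
      have br: "blen r \<le> B xs" using bound(1)[OF bv xs(2)] by (simp add: r_def xs)
      have "blen (2 * v + of_bool b) \<le> blen x"
        using arg_cong[OF bx, of length] arg_cong[OF bits_double[OF pos], of length] l2 by simp
      then have br': "blen r' \<le> B xs" using bound(1)[OF _ xs(2)] by (simp add: r'_def xs)
      let ?s0 = "st (l1 @ [b]) l2"
      let ?s1 = "?s0(R := rev l1)"
      let ?s2 = "?s1(Tm := bits r')"
      let ?s3 = "?s2(Ac := [])"
      let ?s4 = "?s3(Ac := bits r')"
      let ?s5 = "?s4(Tm := [])"
      let ?s6 = "?s5(Cu := b # l2)"
      have 1: "runs A (Pop R) ?s0 1 ?s1"
        using runs_Pop[of A R ?s0] by (simp add: st_def regs)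
      have 2: "runs A (ch b) ?s1 (K xs) ?s2"
      proof (rule runs_mono)
        show "runs A (ch b) ?s1 (Th b (v # r # ys)) ?s2"
          unfolding r'
        proof (rule computesD[OF ch(2)])
          fix i assume i: "i < k + 2"
          show "?s1 ((Cu # Ac # as) ! i) = bits ((v # r # ys) ! i)"
          proof (cases i)
            case 0
            then show ?thesis using l2 by (simp add: st_def regs)
          next
            case (Suc j)
            show ?thesis
            proof (cases j)
              case 0
              then show ?thesis using Suc by (simp add: st_def regs r_def v_def)
            next
              case (Suc j')
              then have "j' < k" using i \<open>i = Suc j\<close> by simp
              then show ?thesis using Suc \<open>i = Suc j\<close> as_nth[of j'] sas[of j'] by (simp add: st_def regs)
            qed
          qed
        qed (use xs sj s0 d in \<open>auto simp: st_def regs\<close>)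
        show "Th b (v # r # ys) \<le> K xs" using bound(2)[OF bv xs(2)] by (simp add: r_def xs)
      qed
      have 3: "runs A (clear Ac) ?s2 (2 * B xs + 1) ?s3"
        by (rule runs_mono[OF runs_clear]) (use br in \<open>simp add: st_def regs v_def r_def\<close>)
      have 4: "runs A (copy Tm Ac F) ?s3 (12 * B xs + 2) ?s4"
        using runs_copy[of Tm Ac F ?s3 A] br' sj
        by (auto simp: regs st_def intro: runs_mono)
      have 5: "runs A (clear Tm) ?s4 (2 * B xs + 1) ?s5"
        by (rule runs_mono[OF runs_clear]) (use br' in \<open>simp add: st_def regs\<close>)
      have 6: "runs A (Push Cu b) ?s5 2 ?s6"
        using runs_Push[of A Cu b ?s5] by (simp add: st_def regs)
      have "?s6 = st l1 (b # l2)"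
        using sj by (auto simp: fun_eq_iff st_def regs r'_def v_def)
      with runs_Seq[OF 1 runs_Seq[OF 2 runs_Seq[OF 3 runs_Seq[OF 4 runs_Seq[OF 5 6]]]]]
      have "runs A (body b) ?s0 (1 + (K xs + (2 * B xs + 1 + (12 * B xs + 2 + (2 * B xs + 1 + 2))))) (st l1 (b # l2))"
        unfolding body_def by simp
      then have "runs A (body b) ?s0 (E xs - 2) (st l1 (b # l2))"
        by (rule runs_mono) (simp add: E_def)
      moreover have "?s0 R = b # rev l1" by (simp add: st_def regs)
      ultimately have "runs A (Case R Skip (body False) (body True)) ?s0 (Suc (E xs - 2)) (st l1 (b # l2))"
        by (intro runs_Case) (cases b; simp)
      then show ?thesis by (rule runs_mono) (simp add: E_def)
    qed
    have loop: "runs A loop (st l1 l2) (length l1 * E xs + 1) (st [] (l1 @ l2))" if "bits x = l1 @ l2" for l1 l2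
      using that
    proof (induction l1 arbitrary: l2 rule: rev_induct)
      case Nil
      then show ?case unfolding loop_def append_Nil
        by (intro runs_WhileNil) (simp_all add: st_def regs)
    next
      case (snoc b l1)
      have "bits x = l1 @ b # l2" using snoc.prems by simp
      have "st (l1 @ [b]) l2 R \<noteq> []" by (simp add: st_def regs)
      from runs_WhileCons[OF this iter[OF \<open>bits x = l1 @ b # l2\<close>]
          snoc.IH[OF \<open>bits x = l1 @ b # l2\<close>, unfolded loop_def]]
      have "runs A loop (st (l1 @ [b]) l2) (Suc (E xs - 1 + (length l1 * E xs + 1))) (st [] (l1 @ b # l2))"
        unfolding loop_def .
      moreover have "Suc (E xs - 1 + (length l1 * E xs + 1)) = length (l1 @ [b]) * E xs + 1"
        by (simp add: E_def)
      ultimately show ?case by simp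
    qed
    let ?s1 = "s(Tm := bits x)"
    let ?s2 = "s(R := rev (bits x))"
    let ?s3 = "?s2(Ac := bits (g ys))"
    let ?s4 = "st [] (bits x)"
    let ?s5 = "?s4(d := bits (f xs))"
    let ?s6 = "?s5(Ac := [])"
    have 1: "runs A (copy a0 Tm F) s (12 * blen x + 2) ?s1"
      using runs_copy[of a0 Tm F s A] sa0 sj a0 by (simp add: regs)
    have 2: "runs A (move Tm R) ?s1 (5 * blen x + 1) ?s2"
    proof -
      have "?s1(Tm := [], R := rev (?s1 Tm) @ ?s1 R) = ?s2" using sj by (auto simp: fun_eq_iff regs)
      then show ?thesis using runs_move[of Tm R A ?s1] by (simp add: regs)
    qed
    have 3: "runs A cg ?s2 (Tg ys) ?s3"
      by (rule computesD[OF cg(2) xs(2)]) (use sj sas as_nth s0 d in \<open>auto simp: regs\<close>)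
    have "?s3 = st (bits x) []" using sj f0[OF xs(2)] by (auto simp: st_def fun_eq_iff regs)
    then have 4: "runs A loop ?s3 (blen x * E xs + 1) ?s4"
      using loop[of "bits x" "[]"] by simp
    have b1: "blen (f xs) \<le> B xs" using bound(1)[of x x ys] xs by simp
    have fx: "?s4 Ac = bits (f xs)" by (simp add: st_def regs xs)
    have 5: "runs A (copy Ac d F) ?s4 (12 * B xs + 2) ?s5"
    proof -
      have "runs A (copy Ac d F) ?s4 (12 * length (?s4 Ac) + 2) (?s4(d := ?s4 Ac))"
        by (rule runs_copy) (use sj s0 d in \<open>auto simp: regs st_def\<close>)
      then show ?thesis unfolding fx length_bits by (rule runs_mono) (use b1 in simp)
    qed
    have 6: "runs A (clear Ac) ?s5 (2 * B xs + 1) ?s6"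
      by (rule runs_mono[OF runs_clear]) (use b1 fx d in \<open>simp add: regs\<close>)
    have 7: "runs A (clear Cu) ?s6 (2 * blen x + 1) (?s6(Cu := []))"
      by (rule runs_mono[OF runs_clear]) (use d in \<open>simp add: regs st_def\<close>)
    have "?s6(Cu := []) = s(d := bits (f xs))"
      using sj d by (auto simp: fun_eq_iff st_def regs)
    with runs_Seq[OF 1 runs_Seq[OF 2 runs_Seq[OF 3 runs_Seq[OF 4 runs_Seq[OF 5 runs_Seq[OF 6 7]]]]]]
    show "runs A c s (T xs) (s(d := bits (f xs)))"
      unfolding c_def T_def by (simp add: xs)
  qed
  ultimately show "\<exists>c T. pbd (Suc k) T \<and> computes A c (Suc k) args d m T f" by blast
qed

section \<open>Change of the oracle\<close>

fun tr :: "bool \<Rightarrow> com \<Rightarrow> com" where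
  "tr b (Seq c d) = Seq (tr b c) (tr b d)"
| "tr b (Case r c d e) = Case r (tr b c) (tr b d) (tr b e)"
| "tr b (While r c) = While r (tr b c)"
| "tr b (Ask c d) = Seq (Push 1 b) (Ask (Seq (Pop 1) (tr b c)) (Seq (Pop 1) (tr b d)))"
| "tr b c = c"

text \<open>A symbol pushed on the oracle stack becomes the last letter of the query, by which a
  join of two oracles is addressed. Pushing and popping it costs three steps, as much as a query, so
  the time at most doubles.\<close>

lemma exec_tr:
  assumes "exec A c s t s'" "\<And>w. w @ [b] \<in> A' \<longleftrightarrow> w \<in> A"
  shows "runs A' (tr b c) s (2 * t) s'"
  using assms(1)
proof (induction rule: exec.induct)
  case (Seq c s t s' d t' s'')
  then show ?case using runs_Seq[OF Seq.IH] by (simp add: algebra_simps)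
next
  case (CaseNil s r c t s' d e)
  then show ?case using runs_mono[OF runs_Case[where s = s and r = r and c = "tr b c" and A = A']] by auto
next
  case (CaseF s r l d t s' c e)
  then show ?case using runs_mono[OF runs_Case[where s = s and r = r and d = "tr b d" and A = A']] by auto
next
  case (CaseT s r l e t s' c d)
  then show ?case using runs_mono[OF runs_Case[where s = s and r = r and e = "tr b e" and A = A']] by auto
next
  case (WhileNil s r c)
  then show ?case using runs_WhileNil[of s r 2 A'] by simp
next
  case (WhileCons s r c t s' t' s'')
  then show ?case using runs_mono[OF runs_WhileCons[OF WhileCons.hyps(1) WhileCons.IH[simplified]]] by simp
next
  case (AskYes s c t s' d)
  let ?s = "s(1 := b # s 1)"
  have "?s(1 := tl (?s 1)) = s" by (simp add: fun_upd_idem)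
  with runs_Seq[OF runs_Pop[of A' 1 ?s], of "tr b c" "2 * t" s'] AskYes.IH
  have "runs A' (Seq (Pop 1) (tr b c)) ?s (1 + 2 * t) s'" by simp
  then have "runs A' (Ask (Seq (Pop 1) (tr b c)) (Seq (Pop 1) (tr b d))) ?s (1 + 2 * t + 3) s'"
    by (intro runs_Ask) (use AskYes assms(2) in simp)
  from runs_mono[OF runs_Seq[OF runs_Push this]] show ?case by simp
next
  case (AskNo s d t s' c)
  let ?s = "s(1 := b # s 1)"
  have "?s(1 := tl (?s 1)) = s" by (simp add: fun_upd_idem)
  with runs_Seq[OF runs_Pop[of A' 1 ?s], of "tr b d" "2 * t" s'] AskNo.IH
  have "runs A' (Seq (Pop 1) (tr b d)) ?s (1 + 2 * t) s'" by simp
  then have "runs A' (Ask (Seq (Pop 1) (tr b c)) (Seq (Pop 1) (tr b d))) ?s (1 + 2 * t + 3) s'"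
    by (intro runs_Ask) (use AskNo assms(2) in simp)
  from runs_mono[OF runs_Seq[OF runs_Push this]] show ?case by simp
next
  case (Skip s)
  then show ?case by (simp add: runs_Skip)
next
  case (Push r a s)
  then show ?case unfolding tr.simps by (rule runs_mono[OF runs_Push]) simp
next
  case (Pop r s)
  then show ?case unfolding tr.simps by (rule runs_mono[OF runs_Pop]) simp
qed

lemma pt_change_oracle:
  assumes "pt A k f" "\<And>w. w @ [b] \<in> A' \<longleftrightarrow> w \<in> A"
  shows "pt A' k f"
  unfolding pt_def
proof (intro allI impI)
  fix args :: "nat list" and d m :: nat
  assume "length args = k" "set args \<subseteq> {2..<m}" "d \<in> {2..<m}" "d \<notin> set args"
  then obtain c T where c: "pbd k T" "computes A c k args d m T f" by (rule ptD[OF assms(1)])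
  have "computes A' (tr b c) k args d m (\<lambda>xs. 2 * T xs) f"
    unfolding computes_def
  proof (intro allI impI)
    fix xs and s :: "nat \<Rightarrow> bool list"
    assume "length xs = k" "\<forall>i<k. s (args ! i) = bits (xs ! i)" "s d = []" "s 1 = []" "\<forall>j\<ge>m. s j = []"
    then have "runs A c s (T xs) (s(d := bits (f xs)))" using c(2) by (intro computesD) auto
    then obtain t where "t \<le> T xs" "exec A c s t (s(d := bits (f xs)))" by (auto simp: runs_def)
    then show "runs A' (tr b c) s (2 * T xs) (s(d := bits (f xs)))"
      by (intro runs_mono[OF exec_tr[OF _ assms(2)]]) auto
  qed
  moreover have "pbd k (\<lambda>xs. 2 * T xs)" using c(1) by (intro pbd_mult pbd_const)
  ultimately show "\<exists>c T. pbd k T \<and> computes A' c k args d m T f" by blast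
qed

lemma pt_decides:
  assumes "pt A 1 f" shows "{x. f [num x] \<noteq> 0} \<in> P_rel A"
proof -
  obtain c T where c: "pbd 1 T" "computes A c 1 [3] 4 5 T f"
    by (rule ptD[OF assms, of "[3]" 5 4]) auto
  obtain e where e: "\<And>xs. length xs = 1 \<Longrightarrow> T xs \<le> sz xs ^ e" using c(1) unfolding pbd_def by blast
  \<comment> \<open>The detour through register 2 reverses the input twice, and the sentinel is put
    below it in between, so that register 3 ends with \<open>x @ [True]\<close>, which is
    \<open>bits (num x)\<close>.\<close>
  define C where "C = Seq (move 0 2) (Seq (Push 3 True) (Seq (move 2 3) c))"
  define p :: "nat poly" where "p = [:3, 1:] ^ e + [:4, 10:]"
  show ?thesis
  proof (rule com_decides[where c = C and r = 4 and p = p])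
    fix x
    let ?s0 = "(\<lambda>_::nat. [] :: bool list)(0 := x)"
    let ?s1 = "(\<lambda>_::nat. [] :: bool list)(2 := rev x)"
    let ?s2 = "(\<lambda>_::nat. [] :: bool list)(2 := rev x, 3 := [True])"
    let ?s3 = "(\<lambda>_::nat. [] :: bool list)(3 := bits (num x))"
    have "?s0(0 := [], 2 := rev (?s0 0) @ ?s0 2) = ?s1" by (auto simp: fun_eq_iff)
    then have 1: "runs A (move 0 2) ?s0 (5 * length x + 1) ?s1" using runs_move[of 0 2 A ?s0] by simp
    have 2: "runs A (Push 3 True) ?s1 2 ?s2" using runs_Push[of A 3 True ?s1] by simp
    have "?s2(2 := [], 3 := rev (?s2 2) @ ?s2 3) = ?s3" by (auto simp: fun_eq_iff bits_num)
    then have 3: "runs A (move 2 3) ?s2 (5 * length x + 1) ?s3" using runs_move[of 2 3 A ?s2] by simp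
    have 4: "runs A c ?s3 (T [num x]) (?s3(4 := bits (f [num x])))"
      by (rule computesD[OF c(2)]) auto
    have "sz [num x] = length x + 3"
      using arg_cong[OF bits_num[of x], of length] by (simp add: sz_def)
    then have "T [num x] \<le> (length x + 3) ^ e" using e[of "[num x]"] by simp
    then have "5 * length x + 1 + (2 + (5 * length x + 1 + T [num x])) \<le> poly p (length x)"
      by (simp add: p_def poly_power add.commute algebra_simps)
    with runs_Seq[OF 1 runs_Seq[OF 2 runs_Seq[OF 3 4]]]
    have "runs A C ?s0 (poly p (length x)) (?s3(4 := bits (f [num x])))"
      unfolding C_def by (rule runs_mono)
    then show "\<exists>t s'. t \<le> poly p (length x) \<and> exec A C ?s0 t s' \<and> (s' 4 \<noteq> [] \<longleftrightarrow> x \<in> {x. f [num x] \<noteq> 0})"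
      unfolding runs_def by fastforce
  qed
qed

section \<open>Classes of functions closed under polynomially bounded recursion on notation\<close>

lemma blen_Suc_le: "blen (Suc x) \<le> Suc (blen x)"
proof -
  have "Suc x \<le> 2 ^ blen x" using less_power_blen[of x] by simp
  then have "blen (Suc x) \<le> blen (2 ^ blen x)" by (rule floorlog_mono)
  then show ?thesis by (simp add: blen_power)
qed

lemma blen_step: "0 < 2 * x + of_bool b \<Longrightarrow> blen (2 * x + of_bool b) = Suc (blen x)"
  by (simp add: blen_double)

lemma blen_le_pow: "blen y \<le> n \<longleftrightarrow> y < 2 ^ n"
proof
  assume "blen y \<le> n"
  then have "(2::nat) ^ blen y \<le> 2 ^ n" by simp
  then show "y < 2 ^ n" using less_power_blen[of y] by linarith
next
  assume "y < 2 ^ n"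
  then have "y \<le> 2 ^ n - 1" by simp
  then have "blen y \<le> blen (2 ^ n - 1)" by (rule floorlog_mono)
  then show "blen y \<le> n" unfolding blen_ones .
qed

lemma blen_le_iff: "blen y \<le> n \<longleftrightarrow> y div 2 ^ n = 0"
  by (simp add: blen_le_pow div_eq_0_iff)

lemma div_pow_step:
  fixes x :: nat
  assumes "n < L" shows "x div 2 ^ (L - Suc n) = 2 * (x div 2 ^ (L - n)) + of_bool (odd (x div 2 ^ (L - Suc n)))"
proof -
  have "L - n = Suc (L - Suc n)" using assms by simp
  then have "x div 2 ^ (L - n) = x div 2 ^ (L - Suc n) div 2"
    by (simp add: div_mult2_eq[symmetric] mult.commute)
  moreover have "(z::nat) = 2 * (z div 2) + of_bool (odd z)" for z
    by (simp add: odd_iff_mod_2_eq_one of_bool_def) presburger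
  ultimately show ?thesis by metis
qed

text \<open>Expresses the difference of two lengths by shifts, which are available before
  subtraction is.\<close>

lemma blen_half_shift: "blen (p div 2 ^ n div 2) = blen p - Suc n"
proof (induction n arbitrary: p)
  case 0
  then show ?case by (cases "p = 0") (simp_all add: blen_0 blen_double)
next
  case (Suc n)
  have "p div 2 ^ Suc n div 2 = p div 2 div 2 ^ n div 2" by (simp add: div_mult2_eq)
  then show ?case using Suc[of "p div 2"] by (cases "p = 0") (simp_all add: blen_0 blen_double)
qed

lemma limited_rec_step:
  "0 < 2 * x + of_bool b \<Longrightarrow> limited_rec a h0 h1 l (2 * x + of_bool b) =
     (let v = (if b then h1 else h0) x (limited_rec a h0 h1 l x) in
      if blen v \<le> blen (l (2 * x + of_bool b)) then v else l (2 * x + of_bool b))"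
  by (subst limited_rec.simps) (cases b; auto simp: Let_def)

text \<open>Instances will be the functions of programs with a fixed oracle, the functions given by
  symbols of PV, and those with an oracle from a level of the hierarchy. In \<open>C_rec\<close> the
  semantic bound \<open>pbd\<close> takes the place of a limiting function.\<close>

locale fclass =
  fixes C :: "nat \<Rightarrow> (nat list \<Rightarrow> nat) \<Rightarrow> bool"
  assumes C_ext: "C k f \<Longrightarrow> (\<And>xs. length xs = k \<Longrightarrow> f xs = g xs) \<Longrightarrow> C k g"
    and C_zero: "C k (\<lambda>_. 0)"
    and C_proj: "i < k \<Longrightarrow> C k (\<lambda>xs. xs ! i)"
    and C_push: "C 1 (\<lambda>xs. 2 * xs ! 0 + of_bool b)"
    and C_comp: "C l h \<Longrightarrow> length gs = l \<Longrightarrow> \<forall>g\<in>set gs. C k g \<Longrightarrow> C k (\<lambda>xs. h (map (\<lambda>g. g xs) gs))"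
    and C_rec: "C k g \<Longrightarrow> (\<And>b. C (k + 2) (hb b)) \<Longrightarrow>
      (\<And>ys. length ys = k \<Longrightarrow> f (0 # ys) = g ys) \<Longrightarrow>
      (\<And>b x ys. length ys = k \<Longrightarrow> 0 < 2 * x + of_bool b \<Longrightarrow>
         f ((2 * x + of_bool b) # ys) = hb b (x # f (x # ys) # ys)) \<Longrightarrow>
      pbd (Suc k) (\<lambda>xs. blen (f xs)) \<Longrightarrow> C (Suc k) f"
    and C_bound: "C k f \<Longrightarrow> pbd k (\<lambda>xs. blen (f xs))"
begin

lemma C_comp1: "C 1 h \<Longrightarrow> C k a \<Longrightarrow> C k (\<lambda>xs. h [a xs])"
  using C_comp[of 1 h "[a]" k] by simp

lemma C_comp2: "C 2 h \<Longrightarrow> C k a \<Longrightarrow> C k b \<Longrightarrow> C k (\<lambda>xs. h [a xs, b xs])"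
  using C_comp[of 2 h "[a, b]" k] by simp

lemma C_subst_list:
  assumes "C (l + k) h" "length gs = l" "\<forall>g\<in>set gs. C k g"
  shows "C k (\<lambda>xs. h (map (\<lambda>g. g xs) gs @ xs))"
proof -
  have *: "map (\<lambda>g. g xs) (gs @ map (\<lambda>i xs. xs ! i) [0..<k]) = map (\<lambda>g. g xs) gs @ xs" if "length xs = k" for xs :: "nat list"
  proof -
    have "map ((!) xs) [0..<k] = xs" using that map_nth by blast
    then show ?thesis by (simp add: comp_def)
  qed
  have "C k (\<lambda>xs. h (map (\<lambda>g. g xs) (gs @ map (\<lambda>i xs. xs ! i) [0..<k])))"
    by (rule C_comp[OF assms(1)]) (use assms in \<open>auto intro: C_proj\<close>)
  then show ?thesis by (rule C_ext) (use * in simp)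
qed

lemma C_subst: "C (Suc k) (\<lambda>zs. E (hd zs) (tl zs)) \<Longrightarrow> C k a \<Longrightarrow> C k (\<lambda>xs. E (a xs) xs)"
  using C_subst_list[of 1 k "\<lambda>zs. E (hd zs) (tl zs)" "[a]"] by simp

lemma C_tl: "C k f \<Longrightarrow> C (Suc k) (\<lambda>xs. f (tl xs))"
proof -
  assume "C k f"
  then have "C (Suc k) (\<lambda>xs. f (map (\<lambda>g. g xs) (map (\<lambda>i xs. xs ! Suc i) [0..<k])))"
    by (rule C_comp) (auto intro: C_proj)
  then show ?thesis
  proof (rule C_ext)
    fix xs :: "nat list" assume "length xs = Suc k"
    then have "map (\<lambda>g. g xs) (map (\<lambda>i xs. xs ! Suc i) [0..<k]) = tl xs"
      by (intro nth_equalityI) (auto simp: nth_tl)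
    then show "f (map (\<lambda>g. g xs) (map (\<lambda>i xs. xs ! Suc i) [0..<k])) = f (tl xs)" by simp
  qed
qed

lemma C_tl2: "C k f \<Longrightarrow> C (k + 2) (\<lambda>xs. f (tl (tl xs)))"
  using C_tl[OF C_tl] by simp

lemma C_tl2': "C k f \<Longrightarrow> C (Suc (Suc k)) (\<lambda>xs. f (tl (tl xs)))"
  using C_tl[OF C_tl] by simp

lemma C_hd: "C (Suc k) hd"
  by (rule C_ext[OF C_proj[of 0]]) (auto simp: length_Suc_conv)

lemma C_nth_tl: "i < k \<Longrightarrow> C (Suc k) (\<lambda>xs. tl xs ! i)"
  by (rule C_tl[OF C_proj])

lemma C_hd_tl: "C (Suc (Suc k)) (\<lambda>xs. hd (tl xs))"
  by (rule C_tl[OF C_hd])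

lemma C_dbl: "C k a \<Longrightarrow> C k (\<lambda>xs. 2 * a xs)"
  using C_comp1[OF C_push[of False]] by simp

lemma C_dbl1: "C k a \<Longrightarrow> C k (\<lambda>xs. Suc (2 * a xs))"
  using C_comp1[OF C_push[of True]] by simp

lemma C_rec_ctxt:
  assumes "C k g" "\<And>b. C (k + 2) (\<lambda>zs. H b (zs ! 0) (zs ! 1) (tl (tl zs)))"
    and "\<And>ys. length ys = k \<Longrightarrow> F 0 ys = g ys"
    and "\<And>b x ys. length ys = k \<Longrightarrow> 0 < 2 * x + of_bool b \<Longrightarrow> F (2 * x + of_bool b) ys = H b x (F x ys) ys"
    and "pbd (Suc k) (\<lambda>xs. blen (F (hd xs) (tl xs)))" "C k a"
  shows "C k (\<lambda>xs. F (a xs) xs)"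
proof (rule C_subst[OF _ assms(6)])
  show "C (Suc k) (\<lambda>zs. F (hd zs) (tl zs))"
    by (rule C_rec[where g = g and hb = "\<lambda>b zs. H b (zs ! 0) (zs ! 1) (tl (tl zs))"]) (use assms in auto)
qed

lemma pbd_hd: "pbd (Suc k) (\<lambda>xs. blen (hd xs))"
  using C_bound[OF C_hd] .

lemma C_half: "C k a \<Longrightarrow> C k (\<lambda>xs. a xs div 2)"
  by (rule C_rec_ctxt[where F = "\<lambda>x ys. x div 2" and H = "\<lambda>b x r ys. x" and g = "\<lambda>_. 0"])
    (auto intro: C_zero C_proj intro!: pbd_mono[OF pbd_hd] floorlog_mono)

lemma C_if0: "C k a \<Longrightarrow> C k u \<Longrightarrow> C k v \<Longrightarrow> C k (\<lambda>xs. if a xs = 0 then u xs else v xs)"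
proof (rule C_rec_ctxt[where F = "\<lambda>x ys. if x = 0 then u ys else v ys" and H = "\<lambda>b x r ys. v ys" and g = u])
  assume "C k u" "C k v"
  then have "pbd (Suc k) (\<lambda>xs. blen (u (tl xs)) + blen (v (tl xs)))"
    by (intro pbd_add C_bound C_tl)
  then show "pbd (Suc k) (\<lambda>xs. blen (if hd xs = 0 then u (tl xs) else v (tl xs)))"
    by (rule pbd_mono) auto
qed (auto intro: C_tl2')

definition CP :: "nat \<Rightarrow> (nat list \<Rightarrow> bool) \<Rightarrow> bool" where
  "CP k P \<longleftrightarrow> C k (\<lambda>xs. of_bool (P xs))"

lemma C_one: "C k (\<lambda>_. Suc 0)" using C_dbl1[OF C_zero] by simp

lemma CP_ext: "CP k P \<Longrightarrow> (\<And>xs. length xs = k \<Longrightarrow> P xs = Q xs) \<Longrightarrow> CP k Q"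
  unfolding CP_def by (erule C_ext) simp

lemma CP_const: "CP k (\<lambda>_. c)" unfolding CP_def by (cases c) (auto intro: C_zero C_one)

lemma CP_neq0: "C k a \<Longrightarrow> CP k (\<lambda>xs. a xs \<noteq> 0)"
  unfolding CP_def by (rule C_ext[OF C_if0[of k a "\<lambda>_. 0" "\<lambda>_. Suc 0"]]) (auto intro: C_zero C_one)

lemma C_if: "CP k P \<Longrightarrow> C k u \<Longrightarrow> C k v \<Longrightarrow> C k (\<lambda>xs. if P xs then u xs else v xs)"
  by (rule C_ext[OF C_if0[of k "\<lambda>xs. of_bool (P xs)" v u]]) (auto simp: CP_def)

lemma CP_if: "CP k P \<Longrightarrow> CP k Q \<Longrightarrow> CP k R \<Longrightarrow> CP k (\<lambda>xs. if P xs then Q xs else R xs)"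
  unfolding CP_def by (rule C_ext[OF C_if[of k P "\<lambda>xs. of_bool (Q xs)" "\<lambda>xs. of_bool (R xs)"]]) (auto simp: CP_def)

lemma CP_not: "CP k P \<Longrightarrow> CP k (\<lambda>xs. \<not> P xs)"
  by (rule CP_ext[OF CP_if[of k P "\<lambda>_. False" "\<lambda>_. True"]]) (auto intro: CP_const)

lemma CP_conj: "CP k P \<Longrightarrow> CP k Q \<Longrightarrow> CP k (\<lambda>xs. P xs \<and> Q xs)"
  by (rule CP_ext[OF CP_if[of k P Q "\<lambda>_. False"]]) (auto intro: CP_const)

lemma CP_disj: "CP k P \<Longrightarrow> CP k Q \<Longrightarrow> CP k (\<lambda>xs. P xs \<or> Q xs)"
  by (rule CP_ext[OF CP_if[of k P "\<lambda>_. True" Q]]) (auto intro: CP_const)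

lemma CP_imp: "CP k P \<Longrightarrow> CP k Q \<Longrightarrow> CP k (\<lambda>xs. P xs \<longrightarrow> Q xs)"
  by (rule CP_ext[OF CP_if[of k P Q "\<lambda>_. True"]]) (auto intro: CP_const)

lemma CP_odd: "C k a \<Longrightarrow> CP k (\<lambda>xs. odd (a xs))"
  unfolding CP_def
  by (rule C_rec_ctxt[where F = "\<lambda>x ys. of_bool (odd x)" and H = "\<lambda>b x r ys. of_bool b" and g = "\<lambda>_. 0"])
    (auto intro: C_zero C_one pbd_mono[OF pbd_hd] floorlog_mono
      intro!: pbd_mono[OF pbd_hd] floorlog_mono simp: odd_pos Suc_leI)

text \<open>The carry is the recursive call: the successor of an odd number is twice the successor
  of its half.\<close>

lemma C_Suc: "C k a \<Longrightarrow> C k (\<lambda>xs. Suc (a xs))"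
proof (rule C_rec_ctxt[where F = "\<lambda>x ys. Suc x" and H = "\<lambda>b x r ys. if b then 2 * r else Suc (2 * x)" and g = "\<lambda>_. Suc 0"])
  have "pbd (Suc k) (\<lambda>xs. Suc (blen (hd xs)))" by (intro pbd_Suc pbd_hd)
  then show "pbd (Suc k) (\<lambda>xs. blen (Suc (hd xs)))" by (rule pbd_mono) (rule blen_Suc_le)
  show "C (k + 2) (\<lambda>zs. if b then 2 * zs ! 1 else Suc (2 * zs ! 0))" for b
    by (cases b) (auto intro!: C_dbl C_dbl1 C_proj)
qed (auto intro: C_one)

lemma C_const: "C k (\<lambda>_. c)"
  by (induction c) (auto intro: C_zero C_Suc)

lemma C_shift: "C k u \<Longrightarrow> C k a \<Longrightarrow> C k (\<lambda>xs. a xs div 2 ^ blen (u xs))"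
proof (rule C_rec_ctxt[where F = "\<lambda>x ys. a ys div 2 ^ blen x" and H = "\<lambda>b x r ys. r div 2" and g = a])
  assume a: "C k a"
  show "pbd (Suc k) (\<lambda>xs. blen (a (tl xs) div 2 ^ blen (hd xs)))"
    by (rule pbd_mono[OF C_bound[OF C_tl[OF a]]]) (intro floorlog_mono, simp)
  show "a ys div 2 ^ blen (2 * x + of_bool b) = a ys div 2 ^ blen x div 2" if "0 < 2 * x + of_bool b" for ys x b
    using that by (simp only: blen_step) (simp add: div_mult2_eq[symmetric] mult.commute)
qed (auto intro: C_half C_proj simp: blen_0)

lemma CP_blen_le: "C k a \<Longrightarrow> C k b \<Longrightarrow> CP k (\<lambda>xs. blen (a xs) \<le> blen (b xs))"
  by (rule CP_ext[OF CP_not[OF CP_neq0[OF C_shift[of k b a]]]]) (auto simp: blen_le_iff)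

text \<open>\<open>S\<close> is the transition function of a machine that reads the bits of two numbers in parallel,
  starting from the most significant ones.\<close>

lemma C_topdown:
  assumes a: "C k a" and b: "C k b"
    and S: "\<And>i j. C 1 (\<lambda>zs. S i j (hd zs))"
    and G0: "G 0 0 = 0"
    and GS: "\<And>x y i j. G (2 * x + of_bool i) (2 * y + of_bool j) = S i j (G x y)"
    and bd: "\<And>x y. blen (G x y) \<le> Suc (blen x + blen y)"
  shows "C k (\<lambda>xs. G (a xs) (b xs))"
proof -
  \<comment> \<open>The longer argument is the clock: after \<open>blen u\<close> rounds the state
    is the value of \<open>G\<close> at the leading parts of both numbers, cut at the same
    place.\<close>
  define p where "p ys = (if blen (b ys) \<le> blen (a ys) then a ys else b ys)" for ys
  have p: "C k p" unfolding p_def by (intro C_if CP_blen_le a b)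
  have pl: "blen (a ys) \<le> blen (p ys)" "blen (b ys) \<le> blen (p ys)" for ys by (auto simp: p_def)
  define F where "F u ys = G (a ys div 2 ^ (blen (p ys) - blen u)) (b ys div 2 ^ (blen (p ys) - blen u))" for u ys
  define bit where "bit c u ys \<longleftrightarrow> odd (c ys div 2 ^ blen (p ys div 2 ^ blen u div 2))" for c :: "nat list \<Rightarrow> nat" and u ys
  define H where "H u r ys = (if p ys div 2 ^ blen u \<noteq> 0 then S (bit a u ys) (bit b u ys) r else r)" for u r ys
  have "C k (\<lambda>xs. F (p xs) xs)"
  proof (rule C_rec_ctxt[where F = F and H = "\<lambda>_. H" and g = "\<lambda>_. 0"])
    fix ys :: "nat list"
    show "F 0 ys = 0" using pl[of ys] by (simp add: F_def blen_0 blen_le_iff[THEN iffD1] G0)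
    fix c and x :: nat assume "0 < 2 * x + of_bool c"
    then have u: "blen (2 * x + of_bool c) = Suc (blen x)" by (rule blen_step)
    show "F (2 * x + of_bool c) ys = H x (F x ys) ys"
    proof (cases "blen x < blen (p ys)")
      case True
      then have "p ys div 2 ^ blen x \<noteq> 0" by (metis blen_le_iff not_le)
      moreover have "bit e x ys \<longleftrightarrow> odd (e ys div 2 ^ (blen (p ys) - Suc (blen x)))" for e
        by (simp add: bit_def blen_half_shift)
      ultimately show ?thesis unfolding F_def H_def u
        by (subst div_pow_step[OF True, of "a ys"], subst div_pow_step[OF True, of "b ys"]) (simp add: GS)
    next
      case False
      then have "blen (p ys) - Suc (blen x) = 0" "blen (p ys) - blen x = 0" "p ys div 2 ^ blen x = 0"
        by (auto simp: blen_le_iff[symmetric])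
      then show ?thesis unfolding F_def H_def u by simp
    qed
  next
    have cb: "CP (k + 2) (\<lambda>zs. bit e (zs ! 0) (tl (tl zs)))" if "C k e" for e
      unfolding bit_def by (intro CP_odd C_shift C_half C_tl2 C_proj p that) simp
    have S': "C (k + 2) (\<lambda>zs. S i j (zs ! 1))" for i j
      using C_comp1[OF S[of i j], of "k + 2" "\<lambda>zs. zs ! 1"] C_proj[of 1 "k + 2"] by simp
    have "C (k + 2) (\<lambda>zs. if p (tl (tl zs)) div 2 ^ blen (zs ! 0) \<noteq> 0 then
        if bit a (zs ! 0) (tl (tl zs)) then
          if bit b (zs ! 0) (tl (tl zs)) then S True True (zs ! 1) else S True False (zs ! 1)
        else if bit b (zs ! 0) (tl (tl zs)) then S False True (zs ! 1) else S False False (zs ! 1)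
        else zs ! 1)"
      by (intro C_if CP_neq0 C_shift C_tl2 p C_proj cb a b S') auto
    then show "C (k + 2) (\<lambda>zs. H (zs ! 0) (zs ! 1) (tl (tl zs)))"
      by (rule C_ext) (auto simp: H_def)
    have "pbd (Suc k) (\<lambda>xs. Suc (blen (a (tl xs)) + blen (b (tl xs))))"
      by (intro pbd_Suc pbd_add C_bound C_tl a b)
    then show "pbd (Suc k) (\<lambda>xs. blen (F (hd xs) (tl xs)))"
    proof (rule pbd_mono)
      fix xs :: "nat list"
      have "blen (e div 2 ^ n) \<le> blen e" for e n by (intro floorlog_mono) simp
      then show "blen (F (hd xs) (tl xs)) \<le> Suc (blen (a (tl xs)) + blen (b (tl xs)))"
        unfolding F_def by (meson bd order_trans Suc_le_mono add_mono)
    qed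
  qed (use p C_zero in auto)
  then show ?thesis by (rule C_ext) (simp add: F_def)
qed

text \<open>Read from the top, the sum of the leading parts is itself the state, and no carry has to
  be anticipated: a step doubles it and adds at most 2.\<close>

lemma C_add: assumes "C k a" "C k b" shows "C k (\<lambda>xs. a xs + b xs)"
proof (rule C_topdown[OF assms, where S = "\<lambda>i j r. 2 * r + of_bool i + of_bool j"])
  show "C 1 (\<lambda>zs. 2 * hd zs + of_bool i + of_bool j)" for i j
    by (cases i; cases j) (auto intro!: C_dbl C_dbl1 C_Suc C_hd simp: One_nat_def simp del: mult_Suc_right)
  fix x y :: nat
  have "x + y < 2 ^ blen x + 2 ^ blen y" using less_power_blen[of x] less_power_blen[of y] by linarith
  also have "\<dots> \<le> 2 ^ (blen x + blen y) + 2 ^ (blen x + blen y)" by (intro add_mono power_increasing) auto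
  finally show "blen (x + y) \<le> Suc (blen x + blen y)" by (simp add: blen_le_pow)
qed auto

text \<open>Among the three results only the one for \<open><\<close> is odd, which
  \<open>CP_less\<close> uses.\<close>

lemma C_cmp: assumes "C k a" "C k b" shows "C k (\<lambda>xs. if a xs = b xs then 0 else if a xs < b xs then 1 else 2)"
proof (rule C_topdown[OF assms, where G = "\<lambda>x y. if x = y then 0 else if x < y then 1 else 2"
    and S = "\<lambda>i j r. if r = 0 then (if i = j then 0 else if j then 1 else 2) else r"])
  show "C 1 (\<lambda>zs. if hd zs = 0 then (if i = j then 0 else if j then 1 else 2) else hd zs)" for i j
    by (auto intro!: C_if0 C_const C_hd simp: One_nat_def)
  fix x y :: nat
  have *: "0 < blen z \<longleftrightarrow> z \<noteq> 0" for z using blen_le_pow[of z 0] by (simp del: neq0_conv add: neq0_conv[symmetric])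
  have "x \<noteq> y \<Longrightarrow> 0 < blen x + blen y" using *[of x] *[of y] by auto
  moreover have "blen 2 = 2" "blen 1 = 1" using blen_power[of 1] blen_power[of 0] by auto
  ultimately show "blen (if x = y then 0 else if x < y then 1 else 2) \<le> Suc (blen x + blen y)"
    by (auto simp: blen_0)
  show "(if 2 * x + of_bool i = 2 * y + of_bool j then 0 else if 2 * x + of_bool i < 2 * y + of_bool j then 1 else 2) =
       (if (if x = y then 0 else if x < y then 1 else 2) = (0::nat) then if i = j then 0 else if j then 1 else 2
        else if x = y then 0 else if x < y then 1 else (2::nat))" for i j
    by (cases x y rule: linorder_cases; cases i; cases j) auto
qed simp

lemma CP_eq: "C k a \<Longrightarrow> C k b \<Longrightarrow> CP k (\<lambda>xs. a xs = b xs)"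
  by (rule CP_ext[OF CP_not[OF CP_neq0[OF C_cmp[of k a b]]]]) auto

lemma CP_less: "C k a \<Longrightarrow> C k b \<Longrightarrow> CP k (\<lambda>xs. a xs < b xs)"
  by (rule CP_ext[OF CP_odd[OF C_cmp[of k a b]]]) auto

lemma CP_le: "C k a \<Longrightarrow> C k b \<Longrightarrow> CP k (\<lambda>xs. a xs \<le> b xs)"
  by (rule CP_ext[OF CP_not[OF CP_less[of k b a]]]) auto

lemma C_pad: assumes "C k u" "C k y" shows "C k (\<lambda>xs. y xs * 2 ^ blen (u xs))"
proof (rule C_rec_ctxt[where F = "\<lambda>x ys. y ys * 2 ^ blen x" and H = "\<lambda>b x r ys. 2 * r" and g = y, OF assms(2) _ _ _ _ assms(1)])
  show "C (k + 2) (\<lambda>zs. 2 * zs ! 1)" by (intro C_dbl C_proj) simp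
  show "pbd (Suc k) (\<lambda>xs. blen (y (tl xs) * 2 ^ blen (hd xs)))"
  proof (rule pbd_mono)
    show "pbd (Suc k) (\<lambda>xs. blen (y (tl xs)) + blen (hd xs))" by (intro pbd_add pbd_hd C_bound C_tl assms)
    show "blen (y (tl xs) * 2 ^ blen (hd xs)) \<le> blen (y (tl xs)) + blen (hd xs)" for xs
      using less_power_blen[of "y (tl xs)"] by (simp add: blen_le_pow power_add)
  qed
  show "y ys * 2 ^ blen (2 * x + of_bool b) = 2 * (y ys * 2 ^ blen x)" if "0 < 2 * x + of_bool b" for ys b x
    using that by (simp only: blen_step) simp
qed (simp add: blen_0)

lemma C_mult: assumes "C k a" "C k b" shows "C k (\<lambda>xs. a xs * b xs)"
proof (rule C_rec_ctxt[where F = "\<lambda>x ys. x * b ys" and H = "\<lambda>c x r ys. 2 * r + (if c then b ys else 0)" and g = "\<lambda>_. 0", OF _ _ _ _ _ assms(1)])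
  show "C (k + 2) (\<lambda>zs. 2 * zs ! 1 + (if c then b (tl (tl zs)) else 0))" for c
    by (cases c) (auto intro!: C_add C_dbl C_proj C_zero C_tl2' assms)
  show "pbd (Suc k) (\<lambda>xs. blen (hd xs * b (tl xs)))"
  proof (rule pbd_mono)
    show "pbd (Suc k) (\<lambda>xs. blen (hd xs) + blen (b (tl xs)))" by (intro pbd_add pbd_hd C_bound C_tl assms)
    show "blen (hd xs * b (tl xs)) \<le> blen (hd xs) + blen (b (tl xs))" for xs
      using less_power_blen[of "hd xs"] less_power_blen[of "b (tl xs)"]
      by (simp add: blen_le_pow power_add mult_strict_mono)
  qed
qed (auto intro: C_zero simp: algebra_simps)

lemma C_len: assumes "C k a" shows "C k (\<lambda>xs. blen (a xs))"
proof (rule C_rec_ctxt[where F = "\<lambda>x ys. blen x" and H = "\<lambda>b x r ys. Suc r" and g = "\<lambda>_. 0", OF _ _ _ _ _ assms])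
  show "C (k + 2) (\<lambda>zs. Suc (zs ! 1))" by (intro C_Suc C_proj) simp
  show "pbd (Suc k) (\<lambda>xs. blen (blen (hd xs)))"
    by (rule pbd_mono[OF pbd_hd]) (use less_exp in \<open>simp add: blen_le_pow\<close>)
qed (auto intro: C_zero simp: blen_0 blen_step simp del: neq0_conv)

lemma C_smash: assumes "C k a" "C k b" shows "C k (\<lambda>xs. 2 ^ (blen (a xs) * blen (b xs)))"
proof (rule C_rec_ctxt[where F = "\<lambda>x ys. 2 ^ (blen x * blen (b ys))" and H = "\<lambda>c x r ys. r * 2 ^ blen (b ys)" and g = "\<lambda>_. Suc 0", OF C_one _ _ _ _ assms(1)])
  show "C (k + 2) (\<lambda>zs. zs ! 1 * 2 ^ blen (b (tl (tl zs))))" by (intro C_pad C_proj C_tl2 assms) simp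
  show "pbd (Suc k) (\<lambda>xs. blen (2 ^ (blen (hd xs) * blen (b (tl xs)))))"
    unfolding blen_power by (intro pbd_Suc pbd_mult pbd_hd C_bound C_tl assms)
  show "(2::nat) ^ (blen (2 * x + of_bool c) * blen (b ys)) = 2 ^ (blen x * blen (b ys)) * 2 ^ blen (b ys)"
    if "0 < 2 * x + of_bool c" for ys c x
    using that by (simp only: blen_step) (simp add: power_add algebra_simps)
qed (simp add: blen_0)

text \<open>The truncation in \<open>limited_rec\<close> bounds every value by \<open>g\<close> or
  \<open>l\<close>, so the side condition of \<open>C_rec\<close> is met whatever \<open>h0\<close>
  and \<open>h1\<close> are.\<close>

lemma C_limited_rec:
  assumes g: "C k g" and h: "C (Suc (Suc k)) h0" "C (Suc (Suc k)) h1" and l: "C (Suc k) l" and a: "C k a"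
  shows "C k (\<lambda>xs. limited_rec (g xs) (\<lambda>x z. h0 (x # z # xs)) (\<lambda>x z. h1 (x # z # xs)) (\<lambda>x. l (x # xs)) (a xs))"
proof (rule C_rec_ctxt[where F = "\<lambda>x xs. limited_rec (g xs) (\<lambda>x z. h0 (x # z # xs)) (\<lambda>x z. h1 (x # z # xs)) (\<lambda>x. l (x # xs)) x"
    and H = "\<lambda>b x r xs. let v = (if b then h1 else h0) (x # r # xs); w = l ((2 * x + of_bool b) # xs) in
       if blen v \<le> blen w then v else w" and g = g, OF g _ _ _ _ a])
  fix b
  have z: "z ! 0 # z ! 1 # tl (tl z) = z" if "length z = k + 2" for z :: "nat list"
    using that by (cases z; cases "tl z") auto
  have l': "C (k + 2) (\<lambda>zs. l ((2 * zs ! 0 + of_bool b) # tl (tl zs)))"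
  proof -
    have "C (k + 2) (\<lambda>zs. l (map (\<lambda>g. g zs) ((\<lambda>zs. 2 * zs ! 0 + of_bool b) # map (\<lambda>i zs. zs ! (i + 2)) [0..<k])))"
      by (rule C_comp[OF l]) (cases b; auto intro!: C_proj C_dbl C_dbl1)+
    then show ?thesis
    proof (rule C_ext)
      fix zs :: "nat list" assume "length zs = k + 2"
      then have "map (\<lambda>g. g zs) (map (\<lambda>i zs. zs ! (i + 2)) [0..<k]) = tl (tl zs)"
        by (intro nth_equalityI) (auto simp: nth_tl)
      then show "l (map (\<lambda>g. g zs) ((\<lambda>zs. 2 * zs ! 0 + of_bool b) # map (\<lambda>i zs. zs ! (i + 2)) [0..<k])) =
        l ((2 * zs ! 0 + of_bool b) # tl (tl zs))" by simp
    qed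
  qed
  have h': "C (k + 2) (\<lambda>zs. (if b then h1 else h0) (zs ! 0 # zs ! 1 # tl (tl zs)))"
    by (rule C_ext[of _ "if b then h1 else h0"]) (use h z in auto)
  show "C (k + 2) (\<lambda>zs. let v = (if b then h1 else h0) (zs ! 0 # zs ! 1 # tl (tl zs));
        w = l ((2 * zs ! 0 + of_bool b) # tl (tl zs)) in if blen v \<le> blen w then v else w)"
    unfolding Let_def by (intro C_if CP_blen_le h' l')
next
  show "pbd (Suc k) (\<lambda>xs. blen (limited_rec (g (tl xs)) (\<lambda>x z. h0 (x # z # tl xs)) (\<lambda>x z. h1 (x # z # tl xs)) (\<lambda>x. l (x # tl xs)) (hd xs)))"
  proof (rule pbd_mono)
    show "pbd (Suc k) (\<lambda>xs. blen (g (tl xs)) + blen (l xs))" by (intro pbd_add C_bound C_tl g l)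
    fix xs :: "nat list" assume "length xs = Suc k"
    then have "hd xs # tl xs = xs" by (cases xs) auto
    then show "blen (limited_rec (g (tl xs)) (\<lambda>x z. h0 (x # z # tl xs)) (\<lambda>x z. h1 (x # z # tl xs)) (\<lambda>x. l (x # tl xs)) (hd xs))
       \<le> blen (g (tl xs)) + blen (l xs)"
      by (subst limited_rec.simps) (auto simp: Let_def)
  qed
next
  show "limited_rec (g ys) (\<lambda>x z. h0 (x # z # ys)) (\<lambda>x z. h1 (x # z # ys)) (\<lambda>x. l (x # ys)) (2 * x + of_bool b) =
     (let v = (if b then h1 else h0) (x # limited_rec (g ys) (\<lambda>x z. h0 (x # z # ys)) (\<lambda>x z. h1 (x # z # ys)) (\<lambda>x. l (x # ys)) x # ys);
          w = l ((2 * x + of_bool b) # ys) in if blen v \<le> blen w then v else w)"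
    if "0 < 2 * x + of_bool b" for b x ys
    unfolding limited_rec_step[OF that] Let_def by (cases b) simp_all
qed (subst limited_rec.simps, simp)

theorem C_pv: "wf_pv f \<Longrightarrow> C (arity f) (eval f)"
proof (induction f)
  case (Comp n f gs)
  have "C n (\<lambda>xs. eval f (map (\<lambda>g. g xs) (map eval gs)))"
    by (rule C_comp[of "arity f"]) (use Comp in auto)
  then show ?case unfolding arity.simps by (rule C_ext) (simp add: comp_def)
next
  case (Rec g h0 h1 l)
  have "C (Suc (arity g)) (\<lambda>xs. limited_rec (eval g (tl xs)) (\<lambda>x z. eval h0 (x # z # tl xs)) (\<lambda>x z. eval h1 (x # z # tl xs))
      (\<lambda>x. eval l (x # tl xs)) (hd xs))"
  proof -
    let ?k = "arity g"
    \<comment> \<open>\<open>C_limited_rec\<close> takes the recursion argument \<open>hd\<close>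
      from the context, while the symbols expect only the parameters there; the argument at position
      \<open>n\<close> is therefore dropped.\<close>
    have w: "C (n + Suc ?k) (\<lambda>zs. e (take n zs @ drop (Suc n) zs))" if e: "C (n + ?k) e" for n e
    proof -
      have "C (n + Suc ?k) (\<lambda>zs. e (map (\<lambda>g. g zs) (map (\<lambda>i zs. zs ! (if i < n then i else Suc i)) [0..<n + ?k])))"
        by (rule C_comp[OF e]) (auto intro!: C_proj)
      then show ?thesis
      proof (rule C_ext)
        fix zs :: "nat list" assume "length zs = n + Suc ?k"
        then have "map (\<lambda>g. g zs) (map (\<lambda>i zs. zs ! (if i < n then i else Suc i)) [0..<n + ?k]) = take n zs @ drop (Suc n) zs"
          by (intro nth_equalityI) (auto simp: nth_append)
        then show "e (map (\<lambda>g. g zs) (map (\<lambda>i zs. zs ! (if i < n then i else Suc i)) [0..<n + ?k])) = e (take n zs @ drop (Suc n) zs)"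
          by simp
      qed
    qed
    have "C ?k (eval g)" "C (2 + ?k) (eval h0)" "C (2 + ?k) (eval h1)" "C (1 + ?k) (eval l)"
      using Rec by (simp_all add: add.commute)
    from this(1) w[OF this(2)] w[OF this(3)] w[OF this(4)] show ?thesis
      using C_limited_rec[of "Suc ?k" "\<lambda>xs. eval g (tl xs)" "\<lambda>zs. eval h0 (take 2 zs @ drop (Suc 2) zs)"
          "\<lambda>zs. eval h1 (take 2 zs @ drop (Suc 2) zs)" "\<lambda>zs. eval l (take 1 zs @ drop (Suc 1) zs)" hd, OF C_tl _ _ _ C_hd]
      by (simp add: drop_Suc numeral_2_eq_2)
  qed
  then show ?case by simp
next
  case Zero
  show ?case unfolding arity.simps by (rule C_ext[OF C_zero]) simp
next
  case Succ
  show ?case unfolding arity.simps by (rule C_ext[OF C_Suc[OF C_proj[of 0]]]) simp_all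
next
  case Plus
  show ?case unfolding arity.simps by (rule C_ext[OF C_add[OF C_proj[of 0] C_proj[of 1]]]) simp_all
next
  case Times
  show ?case unfolding arity.simps by (rule C_ext[OF C_mult[OF C_proj[of 0] C_proj[of 1]]]) simp_all
next
  case Smash
  show ?case unfolding arity.simps by (rule C_ext[OF C_smash[OF C_proj[of 0] C_proj[of 1]]]) simp_all
next
  case Len
  show ?case unfolding arity.simps by (rule C_ext[OF C_len[OF C_proj[of 0]]]) simp_all
next
  case Half
  show ?case unfolding arity.simps by (rule C_ext[OF C_half[OF C_proj[of 0]]]) simp_all
next
  case (Proj n i)
  then show ?case unfolding arity.simps by (intro C_ext[OF C_proj[of i]]) simp_all
qed

end

section \<open>Sequences, search and tables\<close>

fun horner :: "nat \<Rightarrow> nat list \<Rightarrow> nat" where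
  "horner M [] = 0"
| "horner M (z # zs) = z + M * horner M zs"

text \<open>The code of \<open>zs\<close> with blocks of \<open>s\<close> bits, in the sense of \<open>eval_beta\<close>.\<close>

definition code :: "nat \<Rightarrow> nat list \<Rightarrow> nat" where
  "code s zs = (2 * horner (2 ^ s) zs + 1) * 2 ^ s"

lemma horner_digit:
  "\<forall>z\<in>set zs. z < 2 ^ s \<Longrightarrow> j < length zs \<Longrightarrow> horner (2 ^ s) zs div 2 ^ (j * s) mod 2 ^ s = zs ! j"
proof (induction zs arbitrary: j)
  case (Cons z zs)
  show ?case
  proof (cases j)
    case 0
    then show ?thesis using Cons.prems by simp
  next
    case (Suc i)
    have "(z + 2 ^ s * horner (2 ^ s) zs) div 2 ^ s = horner (2 ^ s) zs" using Cons.prems by simp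
    then show ?thesis using Suc Cons by (simp add: power_add div_mult2_eq)
  qed
qed simp

lemma beta_code: "\<forall>z\<in>set zs. z < 2 ^ s \<Longrightarrow> j < length zs \<Longrightarrow> eval beta [code s zs, j] = zs ! j"
  by (simp only: code_def eval_beta horner_digit)

lemma horner_less: "\<forall>z\<in>set zs. z < 2 ^ s \<Longrightarrow> horner (2 ^ s) zs < 2 ^ (s * length zs)"
proof (induction zs)
  case (Cons z zs)
  then have "z < 2 ^ s" "Suc (horner (2 ^ s) zs) \<le> 2 ^ (s * length zs)" by auto
  then have "z + 2 ^ s * horner (2 ^ s) zs < 2 ^ s * Suc (horner (2 ^ s) zs)" by simp
  also have "\<dots> \<le> 2 ^ s * 2 ^ (s * length zs)" using \<open>Suc _ \<le> _\<close> by (rule mult_le_mono2)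
  finally show ?case by (simp add: power_add)
qed simp

lemma code_less: "\<forall>z\<in>set zs. z < 2 ^ s \<Longrightarrow> code s zs < 2 ^ (s * (length zs + 1) + 1)"
proof -
  assume "\<forall>z\<in>set zs. z < 2 ^ s"
  then have "Suc (horner (2 ^ s) zs) \<le> 2 ^ (s * length zs)" using horner_less by (simp add: Suc_le_eq)
  then have "2 * horner (2 ^ s) zs + 1 < 2 * 2 ^ (s * length zs)" by linarith
  then have "(2 * horner (2 ^ s) zs + 1) * 2 ^ s < 2 * 2 ^ (s * length zs) * 2 ^ s" by (rule mult_strict_right_mono) simp
  then show ?thesis by (simp add: code_def power_add algebra_simps)
qed

lemma code_ge: "2 ^ s \<le> code s zs"
  by (simp add: code_def)

lemma horner_eq_sum: "horner M zs = (\<Sum>i<length zs. zs ! i * M ^ i)"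
  by (induction zs) (simp_all add: sum.lessThan_Suc_shift sum_distrib_left algebra_simps del: sum.lessThan_Suc)

context fclass
begin

lemma C_pv2: "wf_pv p \<Longrightarrow> arity p = 2 \<Longrightarrow> C k a \<Longrightarrow> C k b \<Longrightarrow> C k (\<lambda>xs. eval p [a xs, b xs])"
  using C_comp2[of "eval p"] C_pv[of p] by simp

lemma C_beta: "C k a \<Longrightarrow> C k b \<Longrightarrow> C k (\<lambda>xs. eval beta [a xs, b xs])"
  by (intro C_pv2) (simp_all add: beta_def low_def low_step_def shift_def tz_def pow2_def parity_def)

lemma C_pow2: "C k a \<Longrightarrow> C k b \<Longrightarrow> C k (\<lambda>xs. eval pow2 [a xs, b xs])"
  by (intro C_pv2) (simp_all add: pow2_def)

lemma C_mod_pow: "C k a \<Longrightarrow> C k u \<Longrightarrow> C k (\<lambda>xs. a xs mod 2 ^ blen (u xs))"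
  unfolding eval_low[symmetric]
  by (intro C_pv2) (simp_all add: low_def low_step_def shift_def parity_def)

lemma C_sum_list: "\<forall>g\<in>set gs. C k g \<Longrightarrow> C k (\<lambda>xs. sum_list (map (\<lambda>g. g xs) gs))"
  by (induction gs) (auto intro: C_zero C_add)

lemma C_horner: "\<forall>g\<in>set gs. C k g \<Longrightarrow> C k M \<Longrightarrow> C k (\<lambda>xs. horner (M xs) (map (\<lambda>g. g xs) gs))"
  by (induction gs) (auto intro: C_zero C_add C_mult)

lemma C_pow2_len: "C k a \<Longrightarrow> C k (\<lambda>xs. 2 ^ blen (a xs))"
  using C_pad[OF _ C_one] by simp

lemma C_code: "\<forall>g\<in>set gs. C k g \<Longrightarrow> C k a \<Longrightarrow> C k (\<lambda>xs. code (blen (a xs)) (map (\<lambda>g. g xs) gs))"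
  unfolding code_def by (intro C_pad C_add C_mult C_const C_horner C_pow2_len)

lemma C_tail_ctxt: "C (Suc k) g \<Longrightarrow> C (k + 2) (\<lambda>zs. g (E (zs ! 0) # tl (tl zs)))"
  if "C (k + 2) (\<lambda>zs. E (zs ! 0))"
proof -
  assume g: "C (Suc k) g"
  have "C (k + 2) (\<lambda>zs. g (map (\<lambda>g. g zs) ((\<lambda>zs. E (zs ! 0)) # map (\<lambda>i zs. zs ! (i + 2)) [0..<k])))"
    by (rule C_comp[OF g]) (use that in \<open>auto intro!: C_proj\<close>)
  then show ?thesis
  proof (rule C_ext)
    fix zs :: "nat list" assume "length zs = k + 2"
    then have "map (\<lambda>g. g zs) (map (\<lambda>i zs. zs ! (i + 2)) [0..<k]) = tl (tl zs)"
      by (intro nth_equalityI) (auto simp: nth_tl)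
    then show "g (map (\<lambda>g. g zs) ((\<lambda>zs. E (zs ! 0)) # map (\<lambda>i zs. zs ! (i + 2)) [0..<k])) =
        g (E (zs ! 0) # tl (tl zs))" by simp
  qed
qed

text \<open>This is recursion on the notation of \<open>u\<close>, where every digit of the counter
  contributes one summand. Sharply bounded quantifiers and searches reduce to such sums.\<close>

lemma C_sum:
  assumes g: "C (Suc k) (\<lambda>zs. E (hd zs) (tl zs))" and u: "C k u"
  shows "C k (\<lambda>xs. \<Sum>j<blen (u xs). E j xs)"
proof (rule C_rec_ctxt[where F = "\<lambda>x ys. \<Sum>j<blen x. E j ys" and H = "\<lambda>b x r ys. r + E (blen x) ys" and g = "\<lambda>_. 0", OF _ _ _ _ _ u])
  have "C (k + 2) (\<lambda>zs. blen (zs ! 0))" by (intro C_len C_proj) simp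
  from C_tail_ctxt[OF this g] show "C (k + 2) (\<lambda>zs. zs ! 1 + E (blen (zs ! 0)) (tl (tl zs)))"
    by (intro C_add C_proj) auto
  obtain e where e: "\<And>xs. length xs = Suc k \<Longrightarrow> blen (E (hd xs) (tl xs)) \<le> sz xs ^ e"
    using C_bound[OF g] unfolding pbd_def by blast
  show "pbd (Suc k) (\<lambda>xs. blen (\<Sum>j<blen (hd xs). E j (tl xs)))"
  proof (rule pbd_mono)
    show "pbd (Suc k) (\<lambda>xs. blen (hd xs) + sz xs ^ e)" by (intro pbd_add pbd_hd pbd_power pbd_sz)
    fix xs :: "nat list" assume l: "length xs = Suc k"
    have "E j (tl xs) \<le> 2 ^ (sz xs ^ e)" if "j < blen (hd xs)" for j
    proof -
      have "blen j \<le> j" by (simp add: blen_le_pow)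
      then have "sz (j # tl xs) \<le> sz xs" using l that by (cases xs) (auto simp: sz_def)
      then have "sz (j # tl xs) ^ e \<le> sz xs ^ e" by (rule power_mono) simp
      then have "blen (E j (tl xs)) \<le> sz xs ^ e" using e[of "j # tl xs"] l by simp
      then show ?thesis by (simp add: blen_le_pow)
    qed
    then have "(\<Sum>j<blen (hd xs). E j (tl xs)) \<le> blen (hd xs) * 2 ^ (sz xs ^ e)"
      using sum_bounded_above[of "{..<blen (hd xs)}" "\<lambda>j. E j (tl xs)" "2 ^ (sz xs ^ e)"] by simp
    also have "\<dots> < 2 ^ blen (hd xs) * 2 ^ (sz xs ^ e)" using less_exp by simp
    finally show "blen (\<Sum>j<blen (hd xs). E j (tl xs)) \<le> blen (hd xs) + sz xs ^ e"
      by (simp add: blen_le_pow power_add)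
  qed
  show "(\<Sum>j<blen (2 * x + of_bool b). E j ys) = (\<Sum>j<blen x. E j ys) + E (blen x) ys" if "0 < 2 * x + of_bool b" for b ys x
    using that by (simp only: blen_step) simp
qed (auto intro: C_zero simp: blen_0)

lemma CP_ex:
  assumes "CP (Suc k) (\<lambda>zs. P (hd zs) (tl zs))" and "C k u"
  shows "CP k (\<lambda>xs. \<exists>j<blen (u xs). P j xs)"
proof (rule CP_ext[OF CP_neq0])
  show "C k (\<lambda>xs. \<Sum>j<blen (u xs). of_bool (P j xs))"
    by (rule C_sum) (use assms in \<open>auto simp: CP_def\<close>)
  show "((\<Sum>j<blen (u xs). of_bool (P j xs)) \<noteq> (0::nat)) = (\<exists>j<blen (u xs). P j xs)" for xs
    by auto
qed

lemma CP_all: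
  assumes "CP (Suc k) (\<lambda>zs. P (hd zs) (tl zs))" and "C k u"
  shows "CP k (\<lambda>xs. \<forall>j<blen (u xs). P j xs)"
  by (rule CP_ext[OF CP_not[OF CP_ex[OF CP_not[OF assms(1)] assms(2)]]]) auto

text \<open>The least solution equals the number of all \<open>j\<close> such that there is no
  solution up to \<open>j\<close>, so a sum performs the search.\<close>

lemma C_least:
  assumes P: "CP (Suc k) (\<lambda>zs. P (hd zs) (tl zs))" and u: "C k u"
  obtains m :: "nat list \<Rightarrow> nat" where "C k m" "\<And>xs. length xs = k \<Longrightarrow> \<exists>j<blen (u xs). P j xs \<Longrightarrow>
      m xs < blen (u xs) \<and> P (m xs) xs \<and> (\<forall>i<m xs. \<not> P i xs)"
proof
  define m :: "nat list \<Rightarrow> nat" where "m xs = (\<Sum>j<blen (u xs). of_bool (\<not> (\<exists>i<blen (u xs). i \<le> j \<and> P i xs)))" for xs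
  have "CP (Suc (Suc k)) (\<lambda>zs. hd zs \<le> hd (tl zs) \<and> P (hd zs) (tl (tl zs)))"
  proof (intro CP_conj CP_le C_hd C_hd_tl)
    have "CP (Suc (Suc k)) (\<lambda>zs. (\<lambda>zs. P (hd zs) (tl zs)) (map (\<lambda>g. g zs) (hd # map (\<lambda>i zs. zs ! (i + 2)) [0..<k])))"
      unfolding CP_def by (rule C_comp[OF P[unfolded CP_def]]) (auto intro!: C_proj C_hd)
    then show "CP (Suc (Suc k)) (\<lambda>zs. P (hd zs) (tl (tl zs)))"
    proof (rule CP_ext)
      fix zs :: "nat list" assume "length zs = Suc (Suc k)"
      then have "map (\<lambda>g. g zs) (map (\<lambda>i zs. zs ! (i + 2)) [0..<k]) = tl (tl zs)"
        by (intro nth_equalityI) (auto simp: nth_tl)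
      then show "(\<lambda>zs. P (hd zs) (tl zs)) (map (\<lambda>g. g zs) (hd # map (\<lambda>i zs. zs ! (i + 2)) [0..<k])) = P (hd zs) (tl (tl zs))"
        by simp
    qed
  qed
  then have "CP (Suc k) (\<lambda>zs. \<exists>i<blen (u (tl zs)). i \<le> hd zs \<and> P i (tl zs))"
    using CP_ex[of "Suc k" "\<lambda>i zs. i \<le> hd zs \<and> P i (tl zs)" "\<lambda>zs. u (tl zs)"] C_tl[OF u] by simp
  then show "C k m" unfolding m_def by (intro C_sum u CP_not[unfolded CP_def]) (simp add: CP_def)
  fix xs :: "nat list" assume "\<exists>j<blen (u xs). P j xs"
  then obtain j where j: "j < blen (u xs)" "P j xs" "\<And>i. i < j \<Longrightarrow> \<not> P i xs"
    using exists_least_iff[of "\<lambda>j. j < blen (u xs) \<and> P j xs"] by (metis less_trans)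
  have "m xs = (\<Sum>i<blen (u xs). of_bool (i < j))"
    unfolding m_def
  proof (rule sum.cong)
    fix n assume "n \<in> {..<blen (u xs)}"
    have "(\<not> (\<exists>i<blen (u xs). i \<le> n \<and> P i xs)) \<longleftrightarrow> n < j"
      using j by (metis less_le_trans le_trans not_le)
    then show "of_bool (\<not> (\<exists>i<blen (u xs). i \<le> n \<and> P i xs)) = (of_bool (n < j) :: nat)" by simp
  qed simp
  also have "\<dots> = card ({..<blen (u xs)} \<inter> {i. i < j})"
    by (simp add: sum_of_bool_eq)
  also have "{..<blen (u xs)} \<inter> {i. i < j} = {..<j}" using j(1) by auto
  finally have "m xs = j" by simp
  then show "m xs < blen (u xs) \<and> P (m xs) xs \<and> (\<forall>i<m xs. \<not> P i xs)" using j by simp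
qed

text \<open>The code is a polynomial in \<open>2 ^ blen (a xs)\<close>. Its \<open>j\<close>-th
  power is obtained by the smash function from a number of length \<open>j\<close>, namely half of
  \<open>2 ^ j\<close>.\<close>

lemma C_seq:
  assumes y: "C (Suc k) (\<lambda>zs. y (hd zs) (tl zs))" and u: "C k u" and a: "C k a"
  shows "C k (\<lambda>xs. code (blen (a xs)) (map (\<lambda>j. y j xs) [0..<blen (u xs)]))"
proof -
  have h: "C (Suc k) (\<lambda>zs. y (hd zs) (tl zs) * 2 ^ (blen (a (tl zs)) * blen (eval pow2 [hd zs, u (tl zs)] div 2)))"
    by (intro C_mult y C_smash C_half C_pow2 C_hd C_tl u a)
  have "C k (\<lambda>xs. (2 * (\<Sum>j<blen (u xs). y j xs * 2 ^ (blen (a xs) * blen (eval pow2 [j, u xs] div 2))) + 1) * 2 ^ blen (a xs))"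
    by (intro C_pad C_add C_mult C_const C_sum a u h)
  then show ?thesis
  proof (rule C_ext)
    fix xs :: "nat list"
    have "(\<Sum>j<blen (u xs). y j xs * 2 ^ (blen (a xs) * blen (eval pow2 [j, u xs] div 2))) = horner (2 ^ blen (a xs)) (map (\<lambda>j. y j xs) [0..<blen (u xs)])"
      unfolding horner_eq_sum
    proof (rule sum.cong)
      fix j assume j: "j \<in> {..<length (map (\<lambda>j. y j xs) [0..<blen (u xs)])}"
      then have "u xs > 0" by (cases "u xs") (auto simp: blen_0)
      then have "blen (eval pow2 [j, u xs] div 2) = j" using j by (simp add: eval_pow2 blen_half_power)
      then show "y j xs * 2 ^ (blen (a xs) * blen (eval pow2 [j, u xs] div 2)) =
         map (\<lambda>j. y j xs) [0..<blen (u xs)] ! j * (2 ^ blen (a xs)) ^ j"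
        using j by (simp add: power_mult)
    qed simp
    then show "(2 * (\<Sum>j<blen (u xs). y j xs * 2 ^ (blen (a xs) * blen (eval pow2 [j, u xs] div 2))) + 1) * 2 ^ blen (a xs) =
       code (blen (a xs)) (map (\<lambda>j. y j xs) [0..<blen (u xs)])" by (simp add: code_def)
  qed
qed

text \<open>Binary search for a place where \<open>Q\<close> changes from true to false;
  \<open>Q\<close> need not be monotone. \<open>R xs n\<close> consists of the \<open>n\<close>
  leading digits of the result, and \<open>Q\<close> holds at the lower but not at the upper end of
  the interval that they determine.\<close>

lemma C_bisect:
  assumes Q: "CP (Suc k) (\<lambda>zs. Q (hd zs) (tl zs))" and t: "C k t"
  obtains r where "C k r" "\<And>xs. length xs = k \<Longrightarrow> Q 0 xs \<Longrightarrow> \<not> Q (2 ^ blen (t xs)) xs \<Longrightarrow> Q (r xs) xs \<and> \<not> Q (Suc (r xs)) xs"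
proof
  define R where "R ys = rec_nat 0 (\<lambda>n r. if Q ((2 * r + 1) * (2 ^ blen (t ys) div 2 ^ n div 2)) ys then 2 * r + 1 else 2 * r)" for ys
  have R0: "R ys 0 = 0" and RS: "R ys (Suc n) = (if Q ((2 * R ys n + 1) * (2 ^ blen (t ys) div 2 ^ n div 2)) ys then 2 * R ys n + 1 else 2 * R ys n)"
    for ys n by (simp_all add: R_def)
  show "C k (\<lambda>xs. R xs (blen (t xs)))"
  proof (rule C_rec_ctxt[where F = "\<lambda>x ys. R ys (blen x)" and g = "\<lambda>_. 0" and
      H = "\<lambda>b x r ys. if Q ((2 * r + 1) * (2 ^ blen (t ys) div 2 ^ blen x div 2)) ys then 2 * r + 1 else 2 * r", OF _ _ _ _ _ t])
    have E: "C (k + 2) (\<lambda>zs. (2 * zs ! 1 + 1) * (2 ^ blen (t (tl (tl zs))) div 2 ^ blen (zs ! 0) div 2))"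
      by (intro C_mult C_add C_const C_half C_shift C_pow2_len C_tl2 t C_proj) auto
    have "CP (k + 2) (\<lambda>zs. (\<lambda>zs. Q (hd zs) (tl zs)) (map (\<lambda>g. g zs) ((\<lambda>zs. (2 * zs ! 1 + 1) * (2 ^ blen (t (tl (tl zs))) div 2 ^ blen (zs ! 0) div 2)) # map (\<lambda>i zs. zs ! (i + 2)) [0..<k])))"
      unfolding CP_def by (rule C_comp[OF Q[unfolded CP_def]]) (use E in \<open>auto intro!: C_proj\<close>)
    then have "CP (k + 2) (\<lambda>zs. Q ((2 * zs ! 1 + 1) * (2 ^ blen (t (tl (tl zs))) div 2 ^ blen (zs ! 0) div 2)) (tl (tl zs)))"
    proof (rule CP_ext)
      fix zs :: "nat list" assume "length zs = k + 2"
      then have "map (\<lambda>g. g zs) (map (\<lambda>i zs. zs ! (i + 2)) [0..<k]) = tl (tl zs)"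
        by (intro nth_equalityI) (auto simp: nth_tl)
      then show "(\<lambda>zs. Q (hd zs) (tl zs)) (map (\<lambda>g. g zs) ((\<lambda>zs. (2 * zs ! 1 + 1) * (2 ^ blen (t (tl (tl zs))) div 2 ^ blen (zs ! 0) div 2)) # map (\<lambda>i zs. zs ! (i + 2)) [0..<k])) =
        Q ((2 * zs ! 1 + 1) * (2 ^ blen (t (tl (tl zs))) div 2 ^ blen (zs ! 0) div 2)) (tl (tl zs))"
        by simp
    qed
    then show "C (k + 2) (\<lambda>zs. if Q ((2 * zs ! 1 + 1) * (2 ^ blen (t (tl (tl zs))) div 2 ^ blen (zs ! 0) div 2)) (tl (tl zs)) then 2 * zs ! 1 + 1 else 2 * zs ! 1)"
      by (intro C_if C_add C_mult C_const C_proj) auto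
    have less: "R ys n < 2 ^ n" for ys n by (induction n) (auto simp: R0 RS)
    show "pbd (Suc k) (\<lambda>xs. blen (R (tl xs) (blen (hd xs))))"
      by (rule pbd_mono[OF pbd_hd]) (simp add: blen_le_pow less)
    show "R ys (blen (2 * x + of_bool b)) = (if Q ((2 * R ys (blen x) + 1) * (2 ^ blen (t ys) div 2 ^ blen x div 2)) ys then 2 * R ys (blen x) + 1 else 2 * R ys (blen x))"
      if "0 < 2 * x + of_bool b" for b x ys
      using that by (simp only: blen_step RS)
  qed (auto intro: C_zero simp: blen_0 R0)
  fix xs :: "nat list" assume *: "Q 0 xs" "\<not> Q (2 ^ blen (t xs)) xs"
  let ?L = "blen (t xs)"
  have "n \<le> ?L \<Longrightarrow> Q (R xs n * 2 ^ (?L - n)) xs \<and> \<not> Q (Suc (R xs n) * 2 ^ (?L - n)) xs" for n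
  proof (induction n)
    case 0
    then show ?case using * by (simp add: R0)
  next
    case (Suc n)
    then have L: "?L - n = Suc (?L - Suc n)" by simp
    have "(2::nat) ^ ?L div 2 ^ n = 2 ^ (?L - n)" using Suc.prems by (simp add: power_diff)
    then have "(2::nat) ^ ?L div 2 ^ n div 2 = 2 ^ (?L - Suc n)" by (simp only: L) simp
    then show ?case using Suc unfolding RS L by (auto simp: algebra_simps)
  qed
  from this[of ?L] show "Q (R xs ?L) xs \<and> \<not> Q (Suc (R xs ?L)) xs" by simp
qed

text \<open>Bisection is applied to the absence of solutions below \<open>z\<close>, which changes
  at the least solution. In this way an oracle for an existential predicate produces
  witnesses.\<close>

lemma C_witness:
  assumes "CP (Suc k) (\<lambda>zs. \<exists>y<hd zs. P y (tl zs))" and t: "C k t"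
  obtains r where "C k r" "\<And>xs. length xs = k \<Longrightarrow> \<exists>y<t xs. P y xs \<Longrightarrow> r xs < t xs \<and> P (r xs) xs"
proof -
  have "CP (Suc k) (\<lambda>zs. \<not> (\<exists>y<hd zs. P y (tl zs)))" by (rule CP_not[OF assms(1)])
  from C_bisect[OF this t] obtain r where r: "C k r" "\<And>xs. length xs = k \<Longrightarrow> \<not> (\<exists>y<0. P y xs) \<Longrightarrow>
     \<not> \<not> (\<exists>y<2 ^ blen (t xs). P y xs) \<Longrightarrow> \<not> (\<exists>y<r xs. P y xs) \<and> \<not> \<not> (\<exists>y<Suc (r xs). P y xs)"
    by blast
  show ?thesis
  proof (rule that[OF r(1)])
    fix xs :: "nat list" assume l: "length xs = k" and ex: "\<exists>y<t xs. P y xs"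
    then have "\<exists>y<2 ^ blen (t xs). P y xs" using less_power_blen[of "t xs"] less_trans by blast
    then have *: "\<not> (\<exists>y<r xs. P y xs)" "\<exists>y<Suc (r xs). P y xs" using r(2)[OF l] by auto
    then have "P (r xs) xs" by (auto simp: less_Suc_eq)
    moreover have "r xs < t xs" using * ex by (metis not_le less_le_trans)
    ultimately show "r xs < t xs \<and> P (r xs) xs" by blast
  qed
qed

text \<open>On arguments below a constant any function is a finite table, here a sum over the
  possible values of the first argument. The transition table of a machine enters in this
  form.\<close>

lemma C_table:
  "\<forall>g\<in>set gs. C k g \<Longrightarrow> C k (\<lambda>xs. if \<forall>g\<in>set gs. g xs < B then H (map (\<lambda>g. g xs) gs) else 0)"
proof (induction gs arbitrary: H)
  case Nil
  then show ?case by (simp add: C_const)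
next
  case (Cons g gs)
  have "C k (\<lambda>xs. sum_list (map (\<lambda>f. f xs) (map (\<lambda>v xs. if g xs = v then
      (if \<forall>g\<in>set gs. g xs < B then H (v # map (\<lambda>g. g xs) gs) else 0) else 0) [0..<B])))"
    using Cons by (intro C_sum_list) (auto intro!: C_if CP_eq C_const Cons.IH)
  then show ?case
  proof (rule C_ext)
    fix xs :: "nat list"
    let ?h = "\<lambda>v. if \<forall>g\<in>set gs. g xs < B then H (v # map (\<lambda>g. g xs) gs) else 0"
    have "sum_list (map (\<lambda>v. if g xs = v then ?h v else 0) [0..<B]) = (\<Sum>v\<in>{0..<B}. if g xs = v then ?h v else 0)"
      by (subst sum_list_distinct_conv_sum_set) simp_all
    also have "\<dots> = (if g xs < B then ?h (g xs) else 0)" by (subst sum.delta') auto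
    finally show "sum_list (map (\<lambda>f. f xs) (map (\<lambda>v xs. if g xs = v then
      (if \<forall>g\<in>set gs. g xs < B then H (v # map (\<lambda>g. g xs) gs) else 0) else 0) [0..<B])) =
      (if \<forall>g\<in>set (g # gs). g xs < B then H (map (\<lambda>g. g xs) (g # gs)) else 0)"
      by (simp add: comp_def cong: if_cong)
  qed
qed

end

lemma fclass_pt: "fclass (pt A)"
proof
  show "pt A k f \<Longrightarrow> (\<And>xs. length xs = k \<Longrightarrow> f xs = g xs) \<Longrightarrow> pt A k g" for k f g by (rule pt_ext)
  show "pt A k (\<lambda>_. 0)" for k by (rule pt_zero)
  show "i < k \<Longrightarrow> pt A k (\<lambda>xs. xs ! i)" for i k by (rule pt_proj)
  show "pt A 1 (\<lambda>xs. 2 * xs ! 0 + of_bool b)" for b by (rule pt_push)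
  show "pt A l h \<Longrightarrow> length gs = l \<Longrightarrow> \<forall>g\<in>set gs. pt A k g \<Longrightarrow> pt A k (\<lambda>xs. h (map (\<lambda>g. g xs) gs))" for l h gs k
    by (rule pt_comp)
  show "pt A k g \<Longrightarrow> (\<And>b. pt A (k + 2) (hb b)) \<Longrightarrow> (\<And>ys. length ys = k \<Longrightarrow> f (0 # ys) = g ys) \<Longrightarrow>
      (\<And>b x ys. length ys = k \<Longrightarrow> 0 < 2 * x + of_bool b \<Longrightarrow>
         f ((2 * x + of_bool b) # ys) = hb b (x # f (x # ys) # ys)) \<Longrightarrow>
      pbd (Suc k) (\<lambda>xs. blen (f xs)) \<Longrightarrow> pt A (Suc k) f" for k g hb f
    by (rule pt_rec)
  show "pt A k f \<Longrightarrow> pbd k (\<lambda>xs. blen (f xs))" for k f by (rule pt_bound)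
qed

section \<open>The functions given by symbols of PV\<close>

definition PVC :: "nat \<Rightarrow> (nat list \<Rightarrow> nat) \<Rightarrow> bool" where
  "PVC k f \<longleftrightarrow> (\<exists>p. wf_pv p \<and> arity p = k \<and> (\<forall>xs. length xs = k \<longrightarrow> eval p xs = f xs))"

lemma PVC_bound: "PVC k f \<Longrightarrow> pbd k (\<lambda>xs. blen (f xs))"
proof -
  assume "PVC k f"
  then obtain p where p: "wf_pv p" "arity p = k" "\<And>xs. length xs = k \<Longrightarrow> eval p xs = f xs"
    unfolding PVC_def by blast
  have "pbd k (\<lambda>xs. blen (eval p xs))"
    using pt_bound[OF fclass.C_pv[OF fclass_pt p(1)]] p(2) by simp
  then show ?thesis by (rule pbd_mono) (simp add: p)
qed

lemma PVC_comp:
  assumes "PVC l h" "length gs = l" "\<forall>g\<in>set gs. PVC k g"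
  shows "PVC k (\<lambda>xs. h (map (\<lambda>g. g xs) gs))"
proof -
  obtain p where p: "wf_pv p" "arity p = l" "\<And>xs. length xs = l \<Longrightarrow> eval p xs = h xs"
    using assms(1) unfolding PVC_def by blast
  obtain q where q: "\<And>g. g \<in> set gs \<Longrightarrow> wf_pv (q g) \<and> arity (q g) = k \<and> (\<forall>xs. length xs = k \<longrightarrow> eval (q g) xs = g xs)"
    using assms(3) unfolding PVC_def by metis
  have "eval (Comp k p (map q gs)) xs = h (map (\<lambda>g. g xs) gs)" if "length xs = k" for xs
  proof -
    have "map (\<lambda>g. eval (q g) xs) gs = map (\<lambda>g. g xs) gs" using q that by (intro map_cong) auto
    moreover have "length (map (\<lambda>g. g xs) gs) = l" using assms(2) by simp
    ultimately show ?thesis using p(3) by (simp add: comp_def del: map_eq_conv)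
  qed
  moreover have "wf_pv (Comp k p (map q gs))" using p q assms(2) by auto
  ultimately show ?thesis unfolding PVC_def by (intro exI[of _ "Comp k p (map q gs)"]) simp
qed

lemma PVC_pv: "wf_pv p \<Longrightarrow> PVC (arity p) (eval p)"
  unfolding PVC_def by blast

lemma PVC_ext: "PVC k f \<Longrightarrow> (\<And>xs. length xs = k \<Longrightarrow> f xs = g xs) \<Longrightarrow> PVC k g"
  unfolding PVC_def by metis

lemma PVC_proj: "i < k \<Longrightarrow> PVC k (\<lambda>xs. xs ! i)"
  by (rule PVC_ext[OF PVC_pv[of "Proj k i", simplified]]) simp_all

lemma PVC_comp1: "wf_pv p \<Longrightarrow> arity p = 1 \<Longrightarrow> PVC k a \<Longrightarrow> PVC k (\<lambda>xs. eval p [a xs])"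
  using PVC_comp[OF PVC_pv, of p "[a]" k] by simp

lemma PVC_comp2: "wf_pv p \<Longrightarrow> arity p = 2 \<Longrightarrow> PVC k a \<Longrightarrow> PVC k b \<Longrightarrow> PVC k (\<lambda>xs. eval p [a xs, b xs])"
  using PVC_comp[OF PVC_pv, of p "[a, b]" k] by simp

lemma PVC_const: "PVC k (\<lambda>_. c)"
proof (induction c)
  case 0
  then show ?case using PVC_comp[OF PVC_pv[of Zero], of "[]" k] by simp
next
  case (Suc c)
  then show ?case using PVC_comp1[of Succ] by simp
qed

lemma PVC_power: "m \<le> k \<Longrightarrow> PVC k (\<lambda>xs. 2 ^ (\<Sum>i<m. blen (xs ! i)))"
proof (induction m)
  case (Suc m)
  have "PVC k (\<lambda>xs. eval Times [2 ^ (\<Sum>i<m. blen (xs ! i)), eval Smash [1, xs ! m]])"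
    using Suc by (intro PVC_comp2[of Times] PVC_comp2[of Smash] PVC_const PVC_proj) auto
  moreover have "blen 1 = 1" using blen_power[of 0] by simp
  ultimately show ?case by (simp add: power_add)
qed (simp add: PVC_const)

text \<open>The smash function multiplies lengths, so every power of \<open>sz xs\<close> is at most
  the length of a value. This supplies the limiting function that the symbol \<open>Rec\<close>
  requires.\<close>

lemma PVC_dominates:
  assumes "pbd k T"
  obtains g where "PVC k g" "\<And>xs. length xs = k \<Longrightarrow> T xs \<le> blen (g xs)"
proof -
  obtain e where e: "\<And>xs. length xs = k \<Longrightarrow> T xs \<le> sz xs ^ e" using assms unfolding pbd_def by blast
  have "\<exists>g. PVC k g \<and> (\<forall>xs. length xs = k \<longrightarrow> sz xs ^ e \<le> blen (g xs))"
  proof (induction e)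
    case 0
    have "blen 1 = 1" using blen_power[of 0] by simp
    then show ?case using PVC_const[of k 1] by (intro exI[of _ "\<lambda>_. 1"]) simp
  next
    case (Suc e)
    then obtain g where g: "PVC k g" "\<And>xs. length xs = k \<Longrightarrow> sz xs ^ e \<le> blen (g xs)" by blast
    \<comment> \<open>The factor 4 accounts for the summand 2 in \<open>sz\<close>.\<close>
    let ?A = "\<lambda>xs. eval Times [2 ^ (\<Sum>i<k. blen (xs ! i)), 4]"
    have A: "PVC k ?A" by (intro PVC_comp2[of Times] PVC_power PVC_const) auto
    have "sz xs \<le> blen (?A xs)" if "length xs = k" for xs
    proof -
      have "?A xs = 2 ^ (sum_list (map blen xs) + 2)"
        using that by (simp add: power_add sum_list_sum_nth atLeast0LessThan)
      then show ?thesis by (simp only: blen_power) (simp add: sz_def)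
    qed
    then have "sz xs ^ Suc e \<le> blen (eval Smash [?A xs, g xs])" if "length xs = k" for xs
      using that g(2)[OF that] mult_le_mono[of "sz xs" "blen (?A xs)" "sz xs ^ e" "blen (g xs)"]
      by (simp only: eval.simps nth_Cons_0 nth_Cons_Suc One_nat_def blen_power power_Suc) (simp add: le_SucI)
    moreover have "PVC k (\<lambda>xs. eval Smash [?A xs, g xs])" by (intro PVC_comp2 A g) auto
    ultimately show ?case by blast
  qed
  then obtain g where "PVC k g" "\<And>xs. length xs = k \<Longrightarrow> sz xs ^ e \<le> blen (g xs)" by blast
  then show ?thesis using that e order_trans by metis
qed

text \<open>With a limiting function at least as long as \<open>f\<close>, the truncation in
  \<open>limited_rec\<close> never takes effect.\<close>

lemma PVC_rec:
  assumes g: "PVC k g" and h: "\<And>b. PVC (k + 2) (h b)"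
    and f0: "\<And>ys. length ys = k \<Longrightarrow> f (0 # ys) = g ys"
    and fS: "\<And>b x ys. length ys = k \<Longrightarrow> 0 < 2 * x + of_bool b \<Longrightarrow>
               f ((2 * x + of_bool b) # ys) = h b (x # f (x # ys) # ys)"
    and bd: "pbd (Suc k) (\<lambda>xs. blen (f xs))"
  shows "PVC (Suc k) f"
proof -
  obtain pg where pg: "wf_pv pg" "arity pg = k" "\<And>xs. length xs = k \<Longrightarrow> eval pg xs = g xs"
    using g unfolding PVC_def by blast
  obtain ph where ph: "\<And>b. wf_pv (ph b)" "\<And>b. arity (ph b) = k + 2" "\<And>b xs. length xs = k + 2 \<Longrightarrow> eval (ph b) xs = h b xs"
    using h unfolding PVC_def by metis
  obtain l where "PVC (Suc k) l" "\<And>xs. length xs = Suc k \<Longrightarrow> blen (f xs) \<le> blen (l xs)"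
    using PVC_dominates[OF bd] by blast
  then obtain pl where pl: "wf_pv pl" "arity pl = Suc k" "\<And>xs. length xs = Suc k \<Longrightarrow> blen (f xs) \<le> blen (eval pl xs)"
    unfolding PVC_def by metis
  let ?p = "Rec pg (ph False) (ph True) pl"
  have "eval ?p xs = f xs" if l: "length xs = Suc k" for xs
  proof -
    obtain x ys where xs: "xs = x # ys" "length ys = k" using l by (cases xs) auto
    have "limited_rec (eval pg ys) (\<lambda>x z. eval (ph False) (x # z # ys)) (\<lambda>x z. eval (ph True) (x # z # ys)) (\<lambda>x. eval pl (x # ys)) x = f (x # ys)"
    proof (rule limited_rec_eqI)
      show "f (0 # ys) = eval pg ys" using f0 pg xs by simp
      show "blen (f (y # ys)) \<le> blen (eval pl (y # ys))" for y using pl xs by simp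
      fix y :: nat assume "y > 0"
      then have "2 * (y div 2) + of_bool (odd y) = y" "0 < 2 * (y div 2) + of_bool (odd y)"
        by (auto simp: odd_two_times_div_two_succ)
      then have "f (y # ys) = h (odd y) (y div 2 # f (y div 2 # ys) # ys)"
        using fS[OF xs(2), of "y div 2" "odd y"] by simp
      then show "(if even y then \<lambda>x z. eval (ph False) (x # z # ys) else (\<lambda>x z. eval (ph True) (x # z # ys))) (y div 2) (f (y div 2 # ys)) = f (y # ys)"
        using ph(3) xs by auto
    qed
    then show ?thesis by (simp add: xs)
  qed
  then show ?thesis unfolding PVC_def using pg ph pl by (intro exI[of _ ?p]) simp
qed

lemma PVC_push: "PVC 1 (\<lambda>xs. 2 * xs ! 0 + of_bool b)"
proof -
  have "PVC 1 (\<lambda>xs. eval Plus [eval Plus [xs ! 0, xs ! 0], of_bool b])"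
    by (intro PVC_comp2 PVC_const PVC_proj) auto
  then show ?thesis by (rule PVC_ext) simp
qed

interpretation PV: fclass PVC
proof
  show "PVC k f \<Longrightarrow> (\<And>xs. length xs = k \<Longrightarrow> f xs = g xs) \<Longrightarrow> PVC k g" for k f g by (rule PVC_ext)
  show "PVC k (\<lambda>_. 0)" for k by (rule PVC_const)
  show "i < k \<Longrightarrow> PVC k (\<lambda>xs. xs ! i)" for i k by (rule PVC_proj)
  show "PVC 1 (\<lambda>xs. 2 * xs ! 0 + of_bool b)" for b by (rule PVC_push)
  show "PVC l h \<Longrightarrow> length gs = l \<Longrightarrow> \<forall>g\<in>set gs. PVC k g \<Longrightarrow> PVC k (\<lambda>xs. h (map (\<lambda>g. g xs) gs))" for l h gs k
    by (rule PVC_comp)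
  show "PVC k g \<Longrightarrow> (\<And>b. PVC (k + 2) (hb b)) \<Longrightarrow> (\<And>ys. length ys = k \<Longrightarrow> f (0 # ys) = g ys) \<Longrightarrow>
      (\<And>b x ys. length ys = k \<Longrightarrow> 0 < 2 * x + of_bool b \<Longrightarrow>
         f ((2 * x + of_bool b) # ys) = hb b (x # f (x # ys) # ys)) \<Longrightarrow>
      pbd (Suc k) (\<lambda>xs. blen (f xs)) \<Longrightarrow> PVC (Suc k) f" for k g hb f
    by (rule PVC_rec)
  show "PVC k f \<Longrightarrow> pbd k (\<lambda>xs. blen (f xs))" for k f by (rule PVC_bound)
qed

section \<open>Simulation of machines without oracle\<close>

definition dec :: "nat \<Rightarrow> bool list" where "dec n = butlast (bits n)"

lemma dec_num [simp]: "dec (num x) = x"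
  by (simp add: dec_def bits_num)

lemma dec_0 [simp]: "dec 0 = []" by (simp add: dec_def)

lemma dec_step: "0 < n \<Longrightarrow> dec (2 * n + of_bool b) = b # dec n"
  by (simp add: dec_def bits_double)

lemma length_dec: "length (dec n) = blen n - 1"
  by (simp add: dec_def)

lemma num_dec: "0 < n \<Longrightarrow> num (dec n) = n"
proof (induction n rule: bits.induct)
  case (1 n)
  show ?case
  proof (cases "n div 2 = 0")
    case True
    then have "n = 1" using 1(2) by simp
    then show ?thesis by (simp add: dec_def bits.simps)
  next
    case False
    have "n = 2 * (n div 2) + of_bool (odd n)" by (simp add: odd_two_times_div_two_succ)
    with dec_step[of "n div 2" "odd n"] False have "dec n = odd n # dec (n div 2)" by simp
    then show ?thesis using 1 False by (simp add: odd_two_times_div_two_succ)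
  qed
qed

fun dig :: "bool option \<Rightarrow> nat" where
  "dig None = 0" | "dig (Some False) = 1" | "dig (Some True) = 2"

definition undig :: "nat \<Rightarrow> bool option" where
  "undig n = (if n = 1 then Some False else if n = 2 then Some True else None)"

lemma undig_dig [simp]: "undig (dig a) = a"
  by (cases a rule: dig.cases) (auto simp: undig_def)

lemma dig_less: "dig a < 3"
  by (cases a rule: dig.cases) auto

text \<open>The two halves are numbers in base 4 with the digit next to the head as the lowest one;
  the scanned cell belongs to \<open>r\<close>. As the digit 0 is the blank, a number describes an
  infinite half.\<close>

definition half_tapes :: "nat \<Rightarrow> nat \<Rightarrow> int \<Rightarrow> (int \<Rightarrow> bool option) \<Rightarrow> bool" where
  "half_tapes l r p t \<longleftrightarrow> (\<forall>k. t (p + int k) = undig (r div 4 ^ k mod 4)) \<and>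
     (\<forall>k. t (p - 1 - int k) = undig (l div 4 ^ k mod 4))"

text \<open>The argument \<open>d\<close> is the head movement plus 1, which makes it a natural
  number.\<close>

fun move_l :: "nat \<Rightarrow> nat \<Rightarrow> nat \<Rightarrow> nat \<Rightarrow> nat" where
  "move_l d a l r = (if d = 2 then 4 * l + a else if d = 0 then l div 4 else l)"

fun move_r :: "nat \<Rightarrow> nat \<Rightarrow> nat \<Rightarrow> nat \<Rightarrow> nat" where
  "move_r d a l r = (if d = 2 then r div 4 else if d = 0 then 4 * (4 * (r div 4) + a) + l mod 4
                     else 4 * (r div 4) + a)"

lemma digit_push:
  fixes x :: nat
  assumes "a < 4"
  shows "(4 * x + a) div 4 ^ k mod 4 = (case k of 0 \<Rightarrow> a | Suc j \<Rightarrow> x div 4 ^ j mod 4)"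
proof (cases k)
  case (Suc j)
  have "(4 * x + a) div 4 ^ Suc j = (4 * x + a) div 4 div 4 ^ j" by (simp add: div_mult2_eq)
  also have "(4 * x + a) div 4 = x" using assms by simp
  finally show ?thesis using Suc by simp
qed (use assms in simp)

lemma digit_pop: "(x::nat) div 4 div 4 ^ k mod 4 = x div 4 ^ Suc k mod 4"
  by (simp add: div_mult2_eq)

lemma half_tapes_step:
  assumes ht: "half_tapes l r p t" and d: "d \<in> {-1, 0, 1}"
  shows "half_tapes (move_l (nat (d + 1)) (dig a) l r) (move_r (nat (d + 1)) (dig a) l r) (p + d) (t(p := a))"
proof -
  have R: "t (p + int k) = undig (r div 4 ^ k mod 4)" and L: "t (p - 1 - int k) = undig (l div 4 ^ k mod 4)" for k
    using ht by (auto simp: half_tapes_def)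
  have a: "dig a < 4" using dig_less[of a] by simp
  have wr: "(4 * (r div 4) + dig a) div 4 ^ k mod 4 = (case k of 0 \<Rightarrow> dig a | Suc j \<Rightarrow> r div 4 ^ Suc j mod 4)" for k
    unfolding digit_push[OF a] by (auto simp: digit_pop split: nat.splits)
  have R': "(t(p := a)) (p + int k) = undig ((4 * (r div 4) + dig a) div 4 ^ k mod 4)" for k
    unfolding wr using R[of k] by (auto split: nat.splits)
  have L': "(t(p := a)) (p - 1 - int k) = undig (l div 4 ^ k mod 4)" for k
    using L[of k] by auto
  consider "d = -1" | "d = 0" | "d = 1" using d by auto
  then show ?thesis
  proof cases
    case 1
    have "(t(p := a)) (p + d + int k) = undig ((4 * (4 * (r div 4) + dig a) + l mod 4) div 4 ^ k mod 4)" for k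
    proof (cases k)
      case 0
      have "(4 * y + l mod 4) mod 4 = l mod 4" for y by simp
      then show ?thesis using L'[of 0] 1 0 by (simp del: distrib_left_numeral)
    next
      case (Suc j)
      have "p + d + int k = p + int j" using Suc 1 by simp
      then show ?thesis using R'[of j] Suc by (simp only: digit_push[OF mod_less_divisor]) simp
    qed
    moreover have "(t(p := a)) (p + d - 1 - int k) = undig (l div 4 div 4 ^ k mod 4)" for k
      using L'[of "Suc k"] 1 by (simp add: digit_pop algebra_simps)
    ultimately show ?thesis using 1 by (simp add: half_tapes_def)
  next
    case 2
    then show ?thesis using R' L' by (simp add: half_tapes_def)
  next
    case 3
    have "(t(p := a)) (p + d + int k) = undig (r div 4 div 4 ^ k mod 4)" for k
      using R[of "Suc k"] 3 by (simp add: digit_pop algebra_simps)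
    moreover have "(t(p := a)) (p + d - 1 - int k) = undig ((4 * l + dig a) div 4 ^ k mod 4)" for k
    proof (cases k)
      case 0
      then show ?thesis using 3 a by (simp add: digit_push[OF a])
    next
      case (Suc j)
      have "p + d - 1 - int k = p - 1 - int j" using Suc 3 by simp
      then show ?thesis using L'[of j] Suc by (simp only: digit_push[OF a]) simp
    qed
    ultimately show ?thesis using 3 by (simp add: half_tapes_def)
  qed
qed

text \<open>As the oracle is empty, the query state 3 always leads to the state 5 (\<open>q_no\<close>).\<close>

definition full_delta :: "otm \<Rightarrow> nat \<Rightarrow> bool option list \<Rightarrow> nat \<times> (bool option \<times> int) list" where
  "full_delta M q as = (if q = 1 \<or> q = 2 then (q, map (\<lambda>a. (a, 0)) as)
     else if q = 3 then (5, map (\<lambda>a. (a, 0)) as) else delta M q as)"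

lemma step_full_delta:
  "step {} M (q, pos, tp) = (case full_delta M q (map (\<lambda>i. tp i (pos i)) [0..<tapes M]) of (q', acts) \<Rightarrow>
     (q', \<lambda>i. if i < tapes M then pos i + snd (acts ! i) else pos i,
          \<lambda>i. if i < tapes M then (tp i)(pos i := fst (acts ! i)) else tp i))"
  by (auto simp: step_def full_delta_def fun_eq_iff split: prod.splits)

lemma full_delta_bounds:
  assumes "wf_otm M" "q < states M" "length as = tapes M"
  shows "fst (full_delta M q as) < states M" "length (snd (full_delta M q as)) = tapes M"
    "i < tapes M \<Longrightarrow> snd (snd (full_delta M q as) ! i) \<in> {-1, 0, 1}"
proof -
  have "6 \<le> states M" using assms(1) by (auto simp: wf_otm_def)
  have d: "case delta M q as of (q', acts) \<Rightarrow> q' < states M \<and> length acts = tapes M \<and> (\<forall>(a, d)\<in>set acts. d \<in> {-1, 0, 1})"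
    using assms(1)[unfolded wf_otm_def, THEN conjunct2, THEN conjunct2, rule_format, OF assms(2,3)] .
  then show "fst (full_delta M q as) < states M" "length (snd (full_delta M q as)) = tapes M"
    using assms \<open>6 \<le> states M\<close> by (auto simp: full_delta_def split: prod.splits)
  assume i: "i < tapes M"
  have "snd (x ! i) \<in> {-1, 0, 1}" if "\<forall>(a, d)\<in>set x. d \<in> {-1, 0, 1}" "length x = tapes M" for x :: "(bool option \<times> int) list"
  proof -
    have "x ! i \<in> set x" using that i by simp
    from bspec[OF that(1) this] show ?thesis by (simp add: case_prod_beta)
  qed
  then show "snd (snd (full_delta M q as) ! i) \<in> {-1, 0, 1}"
    using d i assms by (auto simp: full_delta_def split: prod.splits)
qed

definition syms :: "otm \<Rightarrow> nat list \<Rightarrow> nat list" where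
  "syms M cs = cs ! 0 # map (\<lambda>i. cs ! (2 * i + 2) mod 4) [0..<tapes M]"

text \<open>A configuration is the list of the state and, for each tape \<open>i\<close>, its two
  halves at the places \<open>2 * i + 1\<close> and \<open>2 * i + 2\<close>. Only the state and the
  lowest digits of the right halves are looked up in the transition table.\<close>

definition next_conf :: "otm \<Rightarrow> nat list \<Rightarrow> nat \<Rightarrow> nat" where
  "next_conf M cs j =
     (let sy = syms M cs; (q', acts) = full_delta M (hd sy) (map undig (tl sy)); i = (j - 1) div 2;
          a = dig (fst (acts ! i)); d = nat (snd (acts ! i) + 1); l = cs ! (2 * i + 1); r = cs ! (2 * i + 2) in
      if j = 0 then q' else if odd j then move_l d a l r else move_r d a l r)"

definition sim :: "otm \<Rightarrow> nat list \<Rightarrow> config \<Rightarrow> bool" where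
  "sim M cs = (\<lambda>(q, pos, tp). length cs = 2 * tapes M + 1 \<and> cs ! 0 = q \<and> q < states M \<and>
     (\<forall>i<tapes M. half_tapes (cs ! (2 * i + 1)) (cs ! (2 * i + 2)) (pos i) (tp i)))"

lemma sim_step:
  assumes wf: "wf_otm M" and s: "sim M cs c"
  shows "sim M (map (next_conf M cs) [0..<2 * tapes M + 1]) (step {} M c)"
proof -
  obtain q pos tp where c: "c = (q, pos, tp)" by (cases c) auto
  have s': "length cs = 2 * tapes M + 1" "cs ! 0 = q" "q < states M"
    "\<And>i. i < tapes M \<Longrightarrow> half_tapes (cs ! (2 * i + 1)) (cs ! (2 * i + 2)) (pos i) (tp i)"
    using s by (auto simp: sim_def c)
  define as where "as = map (\<lambda>i. tp i (pos i)) [0..<tapes M]"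
  have "undig (cs ! (2 * i + 2) mod 4) = tp i (pos i)" if "i < tapes M" for i
    using s'(4)[OF that] by (auto simp: half_tapes_def dest: spec[of _ 0])
  then have sy: "map undig (tl (syms M cs)) = as" "hd (syms M cs) = q"
    using s'(2) by (auto simp: syms_def as_def)
  obtain q' acts where fd: "full_delta M q as = (q', acts)" by (cases "full_delta M q as")
  have as: "length as = tapes M" by (simp add: as_def)
  note b = full_delta_bounds[OF wf s'(3) as, unfolded fd, simplified]
  have st: "step {} M c = (q', \<lambda>i. if i < tapes M then pos i + snd (acts ! i) else pos i,
          \<lambda>i. if i < tapes M then (tp i)(pos i := fst (acts ! i)) else tp i)"
    unfolding c step_full_delta as_def[symmetric] fd by simp
  have nc: "next_conf M cs 0 = q'"
    "next_conf M cs (2 * i + 1) = move_l (nat (snd (acts ! i) + 1)) (dig (fst (acts ! i))) (cs ! (2 * i + 1)) (cs ! (2 * i + 2))"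
    "next_conf M cs (2 * i + 2) = move_r (nat (snd (acts ! i) + 1)) (dig (fst (acts ! i))) (cs ! (2 * i + 1)) (cs ! (2 * i + 2))" for i
    by (simp_all add: next_conf_def Let_def sy fd del: move_l.simps move_r.simps)
  show ?thesis unfolding st sim_def prod.case
  proof (intro conjI allI impI)
    show "map (next_conf M cs) [0..<2 * tapes M + 1] ! 0 = q'" using nc(1) by (subst nth_map) (auto simp del: upt_Suc)
    show "q' < states M" using b by simp
    fix i assume i: "i < tapes M"
    have "map (next_conf M cs) [0..<2 * tapes M + 1] ! (2 * i + 1) = next_conf M cs (2 * i + 1)"
      "map (next_conf M cs) [0..<2 * tapes M + 1] ! (2 * i + 2) = next_conf M cs (2 * i + 2)"
      using i by (subst nth_map; simp del: upt_Suc)+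
    moreover have "half_tapes (next_conf M cs (2 * i + 1)) (next_conf M cs (2 * i + 2)) (pos i + snd (acts ! i)) ((tp i)(pos i := fst (acts ! i)))"
      unfolding nc by (rule half_tapes_step[OF s'(4)[OF i]]) (use b i in auto)
    ultimately show "half_tapes (map (next_conf M cs) [0..<2 * tapes M + 1] ! (2 * i + 1)) (map (next_conf M cs) [0..<2 * tapes M + 1] ! (2 * i + 2))
      (if i < tapes M then pos i + snd (acts ! i) else pos i) (if i < tapes M then (tp i)(pos i := fst (acts ! i)) else tp i)"
      using i by (simp only: if_True)
  qed simp
qed

fun run_conf :: "otm \<Rightarrow> nat list \<Rightarrow> nat \<Rightarrow> nat list" where
  "run_conf M cs 0 = cs"
| "run_conf M cs (Suc t) = map (next_conf M (run_conf M cs t)) [0..<2 * tapes M + 1]"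

lemma sim_run: "wf_otm M \<Longrightarrow> sim M cs c \<Longrightarrow> sim M (run_conf M cs t) ((step {} M ^^ t) c)"
proof (induction t)
  case (Suc t)
  then show ?case using sim_step[of M "run_conf M cs t" "(step {} M ^^ t) c"] by simp
qed simp

text \<open>A step lengthens a half by at most one digit in base 4; the factor 16 also leaves room
  for the digits that are put in place.\<close>

lemma run_conf_bound:
  assumes wf: "wf_otm M" and s: "sim M cs c" and b: "\<forall>x\<in>set cs. x < states M * 4 ^ N"
  shows "\<forall>x\<in>set (run_conf M cs t). x < states M * 4 ^ (N + 2 * t)"
proof (induction t)
  case (Suc t)
  let ?B = "states M * 4 ^ (N + 2 * t)"
  have st: "0 < states M" using wf by (auto simp: wf_otm_def)
  have len: "length (run_conf M cs t) = 2 * tapes M + 1"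
    using sim_run[OF wf s, of t] by (auto simp: sim_def)
  have sim': "sim M (run_conf M cs (Suc t)) ((step {} M ^^ Suc t) c)" by (rule sim_run[OF wf s])
  show ?case
  proof
    fix x assume "x \<in> set (run_conf M cs (Suc t))"
    then obtain j where j: "j < 2 * tapes M + 1" "x = next_conf M (run_conf M cs t) j" by (auto simp del: upt_Suc)
    show "x < states M * 4 ^ (N + 2 * Suc t)"
    proof (cases "j = 0")
      case True
      have "run_conf M cs (Suc t) ! 0 = x" using j True by (simp del: upt_Suc)
      then have "x < states M" using sim' by (auto simp: sim_def simp del: run_conf.simps)
      also have "\<dots> \<le> states M * 4 ^ (N + 2 * Suc t)" by simp
      finally show ?thesis .
    next
      case False
      define i where "i = (j - 1) div 2"
      have i: "i < tapes M" using j False by (auto simp: i_def)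
      define l r where "l = run_conf M cs t ! (2 * i + 1)" and "r = run_conf M cs t ! (2 * i + 2)"
      have lr: "l < ?B" "r < ?B" using Suc len i by (auto simp: l_def r_def)
      let ?sy = "syms M (run_conf M cs t)"
      obtain q' acts where fd: "full_delta M (hd ?sy) (map undig (tl ?sy)) = (q', acts)" by fastforce
      define d a where "d = nat (snd (acts ! i) + 1)" and "a = dig (fst (acts ! i))"
      have "a < 3" "x = move_l d a l r \<or> x = move_r d a l r"
        using False dig_less
        unfolding j(2) next_conf_def Let_def fd prod.case i_def[symmetric] a_def d_def l_def r_def by auto
      then have "x < 16 * ?B" using lr st by (auto split: if_splits)
      also have "16 * ?B = states M * 4 ^ (N + 2 * Suc t)" by (simp add: power_add)
      finally show ?thesis .
    qed
  qed
qed (use b in simp)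

fun rd :: "bool list \<Rightarrow> nat" where
  "rd [] = 0"
| "rd (b # x) = 4 * rd x + dig (Some b)"

lemma rd_digit: "rd x div 4 ^ k mod 4 = (if k < length x then dig (Some (x ! k)) else 0)"
proof (induction x arbitrary: k)
  case (Cons b x)
  have "dig (Some b) < 4" using dig_less[of "Some b"] by simp
  then show ?case using Cons by (simp only: rd.simps digit_push) (auto split: nat.splits)
qed simp

lemma rd_less: "rd x < 4 ^ length x"
proof (induction x)
  case (Cons b x)
  then show ?case using dig_less[of "Some b"] by simp
qed simp

definition init_conf :: "otm \<Rightarrow> bool list \<Rightarrow> nat list" where
  "init_conf M x = 0 # 0 # rd x # replicate (2 * tapes M - 2) 0"

lemma sim_init: "wf_otm M \<Longrightarrow> sim M (init_conf M x) (init_config x)"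
proof -
  assume wf: "wf_otm M"
  then have M: "2 \<le> tapes M" "6 \<le> states M" by (auto simp: wf_otm_def)
  have u0: "undig 0 = None" by (simp add: undig_def)
  have "half_tapes 0 (rd x) 0 (\<lambda>z. if 0 = 0 \<and> 0 \<le> z \<and> z < int (length x) then Some (x ! nat z) else None)"
    by (auto simp: half_tapes_def rd_digit u0)
  moreover have "half_tapes 0 0 0 (\<lambda>z. None)" by (simp add: half_tapes_def u0)
  ultimately show ?thesis using M
    by (auto simp: sim_def init_conf_def init_config_def nth_Cons split: nat.splits)
qed

lemma poly_nat_mono: "(x::nat) \<le> y \<Longrightarrow> poly p x \<le> poly p y"
  by (induction p) (auto intro: mult_le_mono)

lemma pbd_poly: "pbd k T \<Longrightarrow> pbd k (\<lambda>xs. poly p (T xs))"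
  by (induction p) auto

lemma final_states_stable:
  assumes "fst ((step A M ^^ t) c) \<in> {1, 2}" "t \<le> t'"
  shows "(step A M ^^ t') c = (step A M ^^ t) c"
proof -
  have "step A M ((step A M ^^ t) c) = (step A M ^^ t) c"
    using assms(1) by (cases "(step A M ^^ t) c") (auto simp: step_def)
  then have "(step A M ^^ (t' - t + t)) c = (step A M ^^ t) c"
    unfolding funpow_add comp_apply by (rule funpow_fixpoint)
  then show ?thesis using assms(2) by simp
qed

text \<open>The leading digit of the number is the sentinel and contributes no symbol, hence the
  separate case \<open>x = 0\<close>.\<close>

lemma PVC_rd: "PVC 1 (\<lambda>xs. rd (dec (xs ! 0)))"
proof (rule PV.C_rec_ctxt[where F = "\<lambda>x ys. rd (dec x)" and g = "\<lambda>_. 0" and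
    H = "\<lambda>b x r ys. if x = 0 then 0 else 4 * r + (1 + of_bool b)"])
  show "PVC (1 + 2) (\<lambda>zs. if zs ! 0 = 0 then 0 else 4 * zs ! 1 + (1 + of_bool b))" for b
    by (intro PV.C_if0 PV.C_add PV.C_mult PVC_const PVC_proj) auto
  show "rd (dec (2 * x + of_bool b)) = (if x = 0 then 0 else 4 * rd (dec x) + (1 + of_bool b))"
    if "0 < 2 * x + of_bool b" for b x
  proof (cases "x = 0")
    case True
    then show ?thesis using that by (cases b) (auto simp: dec_def bits.simps)
  next
    case False
    then show ?thesis by (cases b) (auto simp: dec_step[of x True, simplified] dec_step[of x False, simplified])
  qed
  show "pbd (Suc 1) (\<lambda>xs. blen (rd (dec (hd xs))))"
  proof (rule pbd_mono)
    show "pbd (Suc 1) (\<lambda>xs. 2 * blen (hd xs))" by (intro pbd_mult pbd_const PV.pbd_hd)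
    fix xs :: "nat list"
    have "rd (dec (hd xs)) < 4 ^ length (dec (hd xs))" by (rule rd_less)
    also have "\<dots> \<le> 4 ^ blen (hd xs)" by (intro power_increasing) (auto simp: length_dec)
    also have "\<dots> = 2 ^ (2 * blen (hd xs))" by (simp add: power_mult)
    finally show "blen (rd (dec (hd xs))) \<le> 2 * blen (hd xs)" by (simp add: blen_le_pow)
  qed
qed (auto intro: PVC_const PVC_proj)

text \<open>The codes of the configurations are iterated along the digits of \<open>U xs\<close>.
  The length of \<open>U xs\<close> only dominates the running time; by
  \<open>final_states_stable\<close> the surplus rounds do not change the verdict.\<close>

theorem P_imp_PVC:
  assumes "L \<in> P_rel {}"
  shows "PV.CP 1 (\<lambda>xs. dec (xs ! 0) \<in> L)"
proof -
  obtain M and p :: "nat poly" where wf: "wf_otm M" and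
    M: "\<And>x. fst ((step {} M ^^ poly p (length x)) (init_config x)) = (if x \<in> L then 1 else 2)"
    using assms unfolding P_rel_def by blast
  define T where "T = tapes M"
  have MT: "2 \<le> T" "6 \<le> states M" using wf by (auto simp: wf_otm_def T_def)
  have bl: "pbd 1 (\<lambda>xs. blen (xs ! 0))" by (rule pbd_blen_nth) simp
  obtain U where U: "PVC 1 U" "\<And>xs. length xs = 1 \<Longrightarrow> poly p (blen (xs ! 0)) \<le> blen (U xs)"
    using PVC_dominates[OF pbd_poly[OF bl]] by blast
  \<comment> \<open>The length of a block: after \<open>t\<close> steps all entries are below
    \<open>states M * 4 ^ (N + 2 * t)\<close> by \<open>run_conf_bound\<close>, and
    \<open>states M\<close> is below \<open>2 ^ states M\<close>.\<close>
  have "pbd 1 (\<lambda>xs. states M + 2 * (blen (xs ! 0) + 2 * blen (U xs)))"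
    by (intro pbd_add pbd_mult pbd_const bl PVC_bound U)
  then obtain a where a: "PVC 1 a" "\<And>xs. length xs = 1 \<Longrightarrow> states M + 2 * (blen (xs ! 0) + 2 * blen (U xs)) \<le> blen (a xs)"
    using PVC_dominates by blast
  \<comment> \<open>The exponent from \<open>code_less\<close> for a configuration with its
    \<open>2 * T + 1\<close> entries.\<close>
  have "pbd 1 (\<lambda>xs. blen (a xs) * (2 * T + 2) + 1)" by (intro pbd_add pbd_mult pbd_const PVC_bound a)
  then obtain l where l: "PVC 1 l" "\<And>xs. length xs = 1 \<Longrightarrow> blen (a xs) * (2 * T + 2) + 1 \<le> blen (l xs)"
    using PVC_dominates by blast
  \<comment> \<open>Exceeds all states and all digits in base 4, the only arguments of the
    transition table.\<close>
  define B where "B = states M + 4"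
  define c where "c i = (\<lambda>zs. eval beta [zs ! 1, i])" for i :: nat
  define gs where "gs = c 0 # map (\<lambda>i zs. c (2 * i + 2) zs mod 4) [0..<T]"
  define tb where "tb H zs = (if \<forall>g\<in>set gs. g zs < B then H (map (\<lambda>g. g zs) gs) else 0)"
    for H :: "nat list \<Rightarrow> nat" and zs :: "nat list"
  define fd where "fd sy = full_delta M (hd sy) (map undig (tl sy))" for sy
  define HA where "HA i sy = dig (fst (snd (fd sy) ! i))" for i sy
  define HD where "HD i sy = nat (snd (snd (fd sy) ! i) + 1)" for i sy
  define nc where "nc j = (\<lambda>zs. if j = 0 then tb (\<lambda>sy. fst (fd sy)) zs else
     let i = (j - 1) div 2 in if odd j then move_l (tb (HD i) zs) (tb (HA i) zs) (c (2 * i + 1) zs) (c (2 * i + 2) zs)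
       else move_r (tb (HD i) zs) (tb (HA i) zs) (c (2 * i + 1) zs) (c (2 * i + 2) zs))" for j :: nat
  have Cc: "PVC 3 (c i)" for i unfolding c_def by (intro PV.C_beta PVC_proj PVC_const) simp
  have mod4: "(\<lambda>zs. x zs mod 4) = (\<lambda>zs. x zs mod 2 ^ blen 3)" for x :: "nat list \<Rightarrow> nat"
    using blen_ones[of 2] by simp
  have Cm: "PVC 3 (\<lambda>zs. x zs mod 4)" if "PVC 3 x" for x
    unfolding mod4 by (intro PV.C_mod_pow that PVC_const)
  have Cq: "PVC k (\<lambda>zs. x zs div 4)" if "PVC k x" for k x
    using PV.C_half[OF PV.C_half[OF that]] by (simp add: div_mult2_eq[symmetric])
  have Ctb: "PVC 3 (tb H)" for H
    unfolding tb_def by (rule PV.C_table) (auto simp: gs_def intro: Cc Cm)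
  have Cnc: "PVC 3 (nc j)" for j
  proof -
    note I = Ctb PV.C_if PV.CP_eq PV.C_add PV.C_mult PVC_const Cc Cm Cq
    let ?i = "(j - 1) div 2"
    have "PVC 3 (\<lambda>zs. move_l (tb (HD ?i) zs) (tb (HA ?i) zs) (c (2 * ?i + 1) zs) (c (2 * ?i + 2) zs))"
      unfolding move_l.simps by (intro I)
    moreover have "PVC 3 (\<lambda>zs. move_r (tb (HD ?i) zs) (tb (HA ?i) zs) (c (2 * ?i + 1) zs) (c (2 * ?i + 2) zs))"
      unfolding move_r.simps by (intro I)
    ultimately show ?thesis unfolding nc_def Let_def
      by (cases "j = 0"; cases "odd j") (simp_all add: Ctb[simplified] del: move_l.simps move_r.simps)
  qed
  define h where "h zs = code (blen (a [zs ! 2])) (map (\<lambda>g. g zs) (map nc [0..<2 * T + 1]))" for zs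
  have Ch: "PVC 3 h" unfolding h_def
    by (intro PV.C_code PV.C_comp1[OF a(1)] PVC_proj) (auto intro: Cnc)
  define g where "g xs = code (blen (a xs)) (map (\<lambda>g. g xs) ([\<lambda>_. 0, \<lambda>_. 0, \<lambda>xs. rd (dec (xs ! 0))] @ replicate (2 * T - 2) (\<lambda>_. 0)))" for xs
  have Cg: "PVC 1 g" unfolding g_def
    by (intro PV.C_code a) (use PVC_rd in \<open>auto intro: PVC_const\<close>)
  have g_init: "g [z] = code (blen (a [z])) (init_conf M (dec z))" for z
    by (simp add: g_def init_conf_def T_def)
  define run where "run xs = limited_rec (g xs) (\<lambda>x w. h (x # w # xs)) (\<lambda>x w. h (x # w # xs)) (\<lambda>x. l xs) (U xs)" for xs
  have Cl: "PVC (Suc 1) (\<lambda>zs. l (tl zs))" by (rule PV.C_tl[OF l(1)])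
  have Crun: "PVC 1 run"
    unfolding run_def using PV.C_limited_rec[OF Cg _ _ Cl U(1), of h h] Ch by (simp add: numeral_3_eq_3)
  have run: "beta_state = (if dec z \<in> L then 1 else 2)" if bs: "beta_state = eval beta [run [z], 0]" for z beta_state
  proof -
    define s where "s = blen (a [z])"
    define N where "N = blen z"
    define cs where "cs = run_conf M (init_conf M (dec z))"
    have sim0: "sim M (init_conf M (dec z)) (init_config (dec z))" by (rule sim_init[OF wf])
    have sim: "sim M (cs t) ((step {} M ^^ t) (init_config (dec z)))" for t
      unfolding cs_def by (rule sim_run[OF wf sim0])
    have init_b: "\<forall>x\<in>set (init_conf M (dec z)). x < states M * 4 ^ N"
    proof
      fix x assume "x \<in> set (init_conf M (dec z))"
      then have "x = 0 \<or> x = rd (dec z)" by (auto simp: init_conf_def)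
      moreover have "rd (dec z) < 4 ^ N"
        by (rule less_le_trans[OF rd_less power_increasing]) (simp_all add: length_dec N_def)
      moreover have "1 * 4 ^ N \<le> states M * 4 ^ N" using MT by (intro mult_le_mono1) simp
      ultimately show "x < states M * 4 ^ N" using MT by (auto intro: less_le_trans)
    qed
    have cs_less: "\<forall>x\<in>set (cs t). x < 2 ^ s" if "t \<le> blen (U [z])" for t
    proof
      fix x assume "x \<in> set (cs t)"
      then have "x < states M * 4 ^ (N + 2 * t)" using run_conf_bound[OF wf sim0 init_b] by (auto simp: cs_def)
      also have "\<dots> \<le> 2 ^ states M * 2 ^ (2 * (N + 2 * t))" unfolding power_mult[of "2::nat" 2] by (intro mult_le_mono) (simp_all add: less_imp_le)
      also have "\<dots> \<le> 2 ^ s" using a(2)[of "[z]"] that unfolding power_add[symmetric]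
        by (intro power_increasing) (auto simp: s_def N_def)
      finally show "x < 2 ^ s" .
    qed
    have len: "length (cs t) = 2 * T + 1" for t using sim[of t] by (auto simp: sim_def T_def)
    have decode: "c i [x, code s (cs t), z] = cs t ! i" if "t \<le> blen (U [z])" "i < 2 * T + 1" for x t i
      unfolding c_def using beta_code[OF cs_less[OF that(1)]] len that(2) by simp
    have nc: "nc j [x, code s (cs t), z] = next_conf M (cs t) j" if t: "t \<le> blen (U [z])" and j: "j < 2 * T + 1" for x t j
    proof -
      let ?zs = "[x, code s (cs t), z]"
      have sy: "map (\<lambda>g. g ?zs) gs = syms M (cs t)"
        unfolding gs_def syms_def T_def[symmetric] using decode[OF t] by (auto simp: comp_def)
      have "cs t ! 0 < states M" using sim[of t] by (auto simp: sim_def)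
      then have "\<forall>g\<in>set gs. g ?zs < B" using decode[OF t, of 0] by (auto simp: gs_def B_def)
      then have tb: "tb H ?zs = H (syms M (cs t))" for H by (simp add: tb_def sy)
      show ?thesis
      proof (cases "j = 0")
        case True
        then show ?thesis by (simp add: nc_def next_conf_def Let_def tb fd_def case_prod_beta)
      next
        case False
        then have "(j - 1) div 2 < T" using j by auto
        then have "c (2 * ((j - 1) div 2) + 1) ?zs = cs t ! (2 * ((j - 1) div 2) + 1)"
          "c (2 * ((j - 1) div 2) + 2) ?zs = cs t ! (2 * ((j - 1) div 2) + 2)"
          by (intro decode[OF t]; linarith)+
        then show ?thesis
          unfolding nc_def next_conf_def Let_def tb fd_def HA_def HD_def case_prod_beta
          by (simp only:)
      qed
    qed
    have step: "h [x, code s (cs t), z] = code s (cs (Suc t))" if "t \<le> blen (U [z])" for x t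
    proof -
      have "map (\<lambda>g. g [x, code s (cs t), z]) (map nc [0..<2 * T + 1]) = cs (Suc t)"
        unfolding cs_def run_conf.simps T_def[symmetric] map_map
        by (rule map_cong) (use nc that in \<open>auto simp: cs_def\<close>)
      then show ?thesis by (simp add: h_def s_def)
    qed
    have "limited_rec (g [z]) (\<lambda>x w. h (x # w # [z])) (\<lambda>x w. h (x # w # [z])) (\<lambda>x. l [z]) u = code s (cs (blen u))"
      if "blen u \<le> blen (U [z])" for u
      using that
    proof (induction u rule: less_induct)
      case (less u)
      show ?case
      proof (cases "u = 0")
        case True
        then show ?thesis by (subst limited_rec.simps) (simp add: blen_0 g_init s_def cs_def)
      next
        case False
        have u: "blen u = Suc (blen (u div 2))" using False by (simp add: blen_double)
        have IH: "limited_rec (g [z]) (\<lambda>x w. h (x # w # [z])) (\<lambda>x w. h (x # w # [z])) (\<lambda>x. l [z]) (u div 2) = code s (cs (blen (u div 2)))"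
          using less u False by simp
        have st: "h (u div 2 # code s (cs (blen (u div 2))) # [z]) = code s (cs (blen u))"
          using step[of "blen (u div 2)"] less.prems u by simp
        have "code s (cs (blen u)) < 2 ^ (s * (2 * T + 2) + 1)"
          using code_less[OF cs_less[OF less.prems]] len by simp
        then have "blen (code s (cs (blen u))) \<le> s * (2 * T + 2) + 1" by (simp only: blen_le_pow)
        then have "blen (code s (cs (blen u))) \<le> blen (l [z])"
          using l(2)[of "[z]"] by (simp only: s_def) simp
        then show ?thesis using False
          by (subst limited_rec.simps) (simp add: IH st)
      qed
    qed
    then have "run [z] = code s (cs (blen (U [z])))" by (simp add: run_def)
    then have "beta_state = cs (blen (U [z])) ! 0"
      using bs beta_code[OF cs_less[OF order_refl], of 0] len by simp
    also have "\<dots> = fst ((step {} M ^^ blen (U [z])) (init_config (dec z)))"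
      using sim[of "blen (U [z])"] by (auto simp: sim_def)
    also have "\<dots> = fst ((step {} M ^^ poly p (length (dec z))) (init_config (dec z)))"
    proof (rule arg_cong[OF final_states_stable])
      show "fst ((step {} M ^^ poly p (length (dec z))) (init_config (dec z))) \<in> {1, 2}" by (simp add: M)
      have "poly p (length (dec z)) \<le> poly p (blen z)" by (rule poly_nat_mono) (simp add: length_dec)
      then show "poly p (length (dec z)) \<le> blen (U [z])" using U(2)[of "[z]"] by simp
    qed
    finally show ?thesis by (simp add: M)
  qed
  have "PV.CP 1 (\<lambda>xs. eval beta [run xs, 0] = 1)"
    by (intro PV.CP_eq PV.C_beta Crun PVC_const)
  then show ?thesis
  proof (rule PV.CP_ext)
    fix xs :: "nat list" assume "length xs = 1"
    then obtain z where "xs = [z]" by (cases xs) auto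
    then show "(eval beta [run xs, 0] = 1) = (dec (xs ! 0) \<in> L)" using run[OF refl, of z] by simp
  qed
qed

section \<open>The polynomial hierarchy of predicates on numbers\<close>

lemma (in fclass) PVC_imp: "PVC k f \<Longrightarrow> C k f"
  unfolding PVC_def using C_pv C_ext by blast

text \<open>Negation below the quantifier lets one clause generate the alternation, as in
  \<open>Sigma_p\<close>. Witnesses are numbers below a PV function instead of short words, which
  fits bounded formulas.\<close>

fun SP :: "nat \<Rightarrow> nat \<Rightarrow> (nat list \<Rightarrow> bool) \<Rightarrow> bool" where
  "SP 0 k P \<longleftrightarrow> PV.CP k P"
| "SP (Suc i) k P \<longleftrightarrow> (\<exists>Q t. SP i (Suc k) Q \<and> PVC k t \<and>
     (\<forall>xs. length xs = k \<longrightarrow> (P xs \<longleftrightarrow> (\<exists>y\<le>t xs. \<not> Q (y # xs)))))"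

lemma SP_ext: "SP i k P \<Longrightarrow> (\<And>xs. length xs = k \<Longrightarrow> P xs = Q xs) \<Longrightarrow> SP i k Q"
proof (cases i)
  case 0
  then show "SP i k P \<Longrightarrow> (\<And>xs. length xs = k \<Longrightarrow> P xs = Q xs) \<Longrightarrow> SP i k Q"
    using PV.CP_ext[of k P Q] by simp
next
  case (Suc j)
  then show "SP i k P \<Longrightarrow> (\<And>xs. length xs = k \<Longrightarrow> P xs = Q xs) \<Longrightarrow> SP i k Q"
    by simp
qed

lemma PV_CP_comp: "PV.CP l P \<Longrightarrow> length gs = l \<Longrightarrow> \<forall>g\<in>set gs. PVC k g \<Longrightarrow> PV.CP k (\<lambda>xs. P (map (\<lambda>g. g xs) gs))"
  unfolding PV.CP_def by (rule PVC_comp)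

lemma SP_comp:
  "SP i l P \<Longrightarrow> length gs = l \<Longrightarrow> \<forall>g\<in>set gs. PVC k g \<Longrightarrow> SP i k (\<lambda>xs. P (map (\<lambda>g. g xs) gs))"
proof (induction i arbitrary: l k P gs)
  case 0
  then show ?case by (simp add: PV_CP_comp)
next
  case (Suc i)
  then obtain Q t where Q: "SP i (Suc l) Q" "PVC l t"
    "\<And>xs. length xs = l \<Longrightarrow> P xs \<longleftrightarrow> (\<exists>y\<le>t xs. \<not> Q (y # xs))" by auto
  have "SP i (Suc k) (\<lambda>xs. Q (map (\<lambda>g. g xs) (hd # map (\<lambda>g xs. g (tl xs)) gs)))"
    by (rule Suc.IH[OF Q(1)]) (use Suc.prems in \<open>auto intro: PV.C_hd PV.C_tl\<close>)
  moreover have "PVC k (\<lambda>xs. t (map (\<lambda>g. g xs) gs))" by (rule PVC_comp) (use Q Suc.prems in auto)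
  ultimately show ?case using Q(3) Suc.prems
    by (auto simp: comp_def intro!: exI[of _ "\<lambda>xs. Q (map (\<lambda>g. g xs) (hd # map (\<lambda>g xs. g (tl xs)) gs))"]
        exI[of _ "\<lambda>xs. t (map (\<lambda>g. g xs) gs)"])
qed

lemma SP_subst_list:
  assumes "SP i (l + k) P" "length gs = l" "\<forall>g\<in>set gs. PVC m g" "k \<le> m"
  shows "SP i m (\<lambda>xs. P (map (\<lambda>g. g xs) gs @ drop (m - k) xs))"
proof (rule SP_ext[OF SP_comp[OF assms(1), of "gs @ map (\<lambda>j xs. xs ! (m - k + j)) [0..<k]"]])
  fix xs :: "nat list" assume "length xs = m"
  then have "map (\<lambda>g. g xs) (map (\<lambda>j xs. xs ! (m - k + j)) [0..<k]) = drop (m - k) xs"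
    using assms(4) by (intro nth_equalityI) auto
  then show "P (map (\<lambda>g. g xs) (gs @ map (\<lambda>j xs. xs ! (m - k + j)) [0..<k])) = P (map (\<lambda>g. g xs) gs @ drop (m - k) xs)"
    by simp
qed (use assms in \<open>auto intro!: PVC_proj\<close>)

lemma SP_tl: "SP i k P \<Longrightarrow> SP i (Suc k) (\<lambda>xs. P (tl xs))"
  using SP_subst_list[of i 0 k P "[]" "Suc k"] by (simp add: drop_Suc)

lemma SP_subst1: "SP i (Suc k) P \<Longrightarrow> PVC (Suc k) a \<Longrightarrow> SP i (Suc k) (\<lambda>xs. P (a xs # tl xs))"
  using SP_subst_list[of i 1 k P "[a]" "Suc k"] by (simp add: drop_Suc)

lemma SP_subst2:
  "SP i (Suc (Suc k)) P \<Longrightarrow> PVC (Suc k) a \<Longrightarrow> PVC (Suc k) b \<Longrightarrow> SP i (Suc k) (\<lambda>xs. P (a xs # b xs # tl xs))"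
  using SP_subst_list[of i 2 k P "[a, b]" "Suc k"] by (simp add: drop_Suc)

lemma SP_subst2':
  "SP i (Suc (Suc k)) P \<Longrightarrow> PVC (Suc (Suc k)) a \<Longrightarrow> PVC (Suc (Suc k)) b \<Longrightarrow>
   SP i (Suc (Suc k)) (\<lambda>xs. P (a xs # b xs # tl (tl xs)))"
  using SP_subst_list[of i 2 k P "[a, b]" "Suc (Suc k)"] by (simp add: drop_Suc numeral_2_eq_2)

lemma SP_not: "SP i k P \<Longrightarrow> SP (Suc i) k (\<lambda>xs. \<not> P xs)"
  unfolding SP.simps using SP_tl[of i k P] PVC_const[of k 0]
  by (intro exI[of _ "\<lambda>xs. P (tl xs)"] exI[of _ "\<lambda>_. 0"]) simp

lemma SP_lift: "SP i k P \<Longrightarrow> SP (Suc i) k P"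
proof (induction i arbitrary: k P)
  case 0
  then have "SP 0 k (\<lambda>xs. \<not> P xs)" by (simp add: PV.CP_not)
  from SP_not[OF this] show ?case by simp
next
  case (Suc i)
  then obtain Q t where Q: "SP i (Suc k) Q" "PVC k t" "\<forall>xs. length xs = k \<longrightarrow> (P xs \<longleftrightarrow> (\<exists>y\<le>t xs. \<not> Q (y # xs)))"
    by auto
  then show ?case using Suc.IH[OF Q(1)] by (subst SP.simps(2)) blast
qed

lemma SP_PV: "PV.CP k P \<Longrightarrow> SP i k P"
proof (induction i)
  case (Suc i)
  then show ?case by (intro SP_lift)
qed simp

lemma PVC_beta_hd: "PVC (Suc k) (\<lambda>zs. eval beta [hd zs, c])"
  by (intro PV.C_beta PV.C_hd PVC_const)

lemma PVC_code_bound: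
  assumes "PVC k a" shows "PVC k (\<lambda>xs. 2 * 2 ^ (blen (a xs) * (n + 1)))"
proof -
  have "PVC k (\<lambda>xs. 2 * 2 ^ (blen (a xs) * blen (2 ^ (n + 1) - 1)))"
    by (intro PV.C_mult PV.C_smash PVC_const assms)
  then show ?thesis by (simp only: blen_ones)
qed

lemma pair_code:
  fixes t t' y y' :: nat
  assumes "y \<le> t" "y' \<le> t'"
  defines "w \<equiv> code (blen (t + t')) [y, y']"
  shows "eval beta [w, 0] = y" "eval beta [w, 1] = y'" "w \<le> 2 * 2 ^ (blen (t + t') * (2 + 1))"
proof -
  have *: "\<forall>z\<in>set [y, y']. z < 2 ^ blen (t + t')"
    using assms less_power_blen[of "t + t'"] by (auto intro: le_less_trans[rotated])
  show "eval beta [w, 0] = y" "eval beta [w, 1] = y'"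
    unfolding w_def using beta_code[OF *, of 0] beta_code[OF *, of 1] by simp_all
  show "w \<le> 2 * 2 ^ (blen (t + t') * (2 + 1))"
    unfolding w_def using code_less[OF *] by (simp add: algebra_simps)
qed

text \<open>The induction is simultaneous because the complement below the quantifier exchanges the
  connectives. For a conjunction one number codes both witnesses; for a disjunction a single number
  is tested on both sides, each with its own bound.\<close>

lemma SP_conj_disj:
  "SP i k P \<Longrightarrow> SP i k P' \<Longrightarrow> SP i k (\<lambda>xs. P xs \<and> P' xs) \<and> SP i k (\<lambda>xs. P xs \<or> P' xs)"
proof (induction i arbitrary: k P P')
  case 0
  then show ?case by (simp add: PV.CP_conj PV.CP_disj)
next
  case (Suc i)
  obtain Q t where Q: "SP i (Suc k) Q" "PVC k t" "\<And>xs. length xs = k \<Longrightarrow> P xs \<longleftrightarrow> (\<exists>y\<le>t xs. \<not> Q (y # xs))"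
    using Suc.prems(1) by auto
  obtain Q' t' where Q': "SP i (Suc k) Q'" "PVC k t'" "\<And>xs. length xs = k \<Longrightarrow> P' xs \<longleftrightarrow> (\<exists>y\<le>t' xs. \<not> Q' (y # xs))"
    using Suc.prems(2) by auto
  note C = Suc.IH[THEN conjunct1] and D = Suc.IH[THEN conjunct2]
  have t: "PVC (Suc k) (\<lambda>zs. t (tl zs))" "PVC (Suc k) (\<lambda>zs. t' (tl zs))" using Q Q' PV.C_tl by blast+
  let ?b = "\<lambda>c zs. eval beta [hd zs, c]"
  define R where "R zs \<longleftrightarrow> (\<not> ?b 0 zs \<le> t (tl zs) \<or> Q (?b 0 zs # tl zs)) \<or> (\<not> ?b 1 zs \<le> t' (tl zs) \<or> Q' (?b 1 zs # tl zs))" for zs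
  have R: "SP i (Suc k) R" unfolding R_def
    by (intro D SP_PV PV.CP_not PV.CP_le PVC_beta_hd t SP_subst1[OF Q(1)] SP_subst1[OF Q'(1)])
  define T :: "nat list \<Rightarrow> nat" where "T xs = 2 * 2 ^ (blen (t xs + t' xs) * (2 + 1))" for xs
  have T: "PVC k T" unfolding T_def by (intro PVC_code_bound PV.C_add Q Q')
  have "(P xs \<and> P' xs) \<longleftrightarrow> (\<exists>w\<le>T xs. \<not> R (w # xs))" if l: "length xs = k" for xs
  proof
    assume "P xs \<and> P' xs"
    then obtain y y' where y: "y \<le> t xs" "\<not> Q (y # xs)" "y' \<le> t' xs" "\<not> Q' (y' # xs)"
      using Q(3)[OF l] Q'(3)[OF l] by blast
    show "\<exists>w\<le>T xs. \<not> R (w # xs)"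
      using pair_code[OF y(1,3)] y by (intro exI[of _ "code (blen (t xs + t' xs)) [y, y']"]) (simp add: R_def T_def)
  next
    assume "\<exists>w\<le>T xs. \<not> R (w # xs)"
    then show "P xs \<and> P' xs" using Q(3)[OF l] Q'(3)[OF l] by (auto simp: R_def)
  qed
  with R T have 1: "SP (Suc i) k (\<lambda>xs. P xs \<and> P' xs)" by auto
  define S where "S zs \<longleftrightarrow> (\<not> hd zs \<le> t (tl zs) \<or> Q zs) \<and> (\<not> hd zs \<le> t' (tl zs) \<or> Q' zs)" for zs
  have S: "SP i (Suc k) S" unfolding S_def
    by (intro C D SP_PV PV.CP_not PV.CP_le PV.C_hd t Q Q')
  have "(P xs \<or> P' xs) \<longleftrightarrow> (\<exists>y\<le>t xs + t' xs. \<not> S (y # xs))" if l: "length xs = k" for xs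
    unfolding Q(3)[OF l] Q'(3)[OF l] S_def by (auto intro: trans_le_add1 trans_le_add2)
  moreover have "PVC k (\<lambda>xs. t xs + t' xs)" by (intro PV.C_add Q Q')
  ultimately have "SP (Suc i) k (\<lambda>xs. P xs \<or> P' xs)" using S by auto
  with 1 show ?case by blast
qed

lemmas SP_conj = SP_conj_disj[THEN conjunct1] and SP_disj = SP_conj_disj[THEN conjunct2]

text \<open>The function \<open>u\<close> need not be monotone, but the polynomial bound on its
  length is.\<close>

lemma PVC_uniform_bound:
  assumes u: "PVC (Suc k) u" and t: "PVC k t"
  obtains V where "PVC k V" "\<And>xs y. length xs = k \<Longrightarrow> y \<le> t xs \<Longrightarrow> u (y # xs) \<le> V xs"
proof -
  obtain e where e: "\<And>xs. length xs = Suc k \<Longrightarrow> blen (u xs) \<le> sz xs ^ e"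
    using PVC_bound[OF u] unfolding pbd_def by blast
  have "pbd (Suc k) (\<lambda>xs. sz xs ^ e)" by auto
  then obtain g where g: "PVC (Suc k) g" "\<And>xs. length xs = Suc k \<Longrightarrow> sz xs ^ e \<le> blen (g xs)"
    using PVC_dominates by blast
  have "PVC (Suc k) (\<lambda>zs. g (hd zs # tl zs))" by (rule PVC_ext[OF g(1)]) (auto simp: length_Suc_conv)
  then have "PVC k (\<lambda>xs. g (t xs # xs))" using PV.C_subst[of k "\<lambda>y xs. g (y # xs)" t] t by simp
  then have "PVC k (\<lambda>xs. 2 ^ blen (g (t xs # xs)))" by (rule PV.C_pow2_len)
  then show ?thesis
  proof (rule that)
    fix xs :: "nat list" and y assume l: "length xs = k" and y: "y \<le> t xs"
    have "sz (y # xs) \<le> sz (t xs # xs)" using floorlog_mono[OF y] by (simp add: sz_def)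
    then have "sz (y # xs) ^ e \<le> sz (t xs # xs) ^ e" by (rule power_mono) simp
    then have "blen (u (y # xs)) \<le> blen (g (t xs # xs))"
      using e[of "y # xs"] g(2)[of "t xs # xs"] l by simp
    then show "u (y # xs) \<le> 2 ^ blen (g (t xs # xs))" by (simp add: blen_le_pow)
  qed
qed

lemma PVC_Cons: "PVC (Suc k) u \<Longrightarrow> PVC m a \<Longrightarrow> PVC m b \<Longrightarrow> m = Suc k \<Longrightarrow> PVC m (\<lambda>zs. u (b zs # tl zs))"
proof -
  assume u: "PVC (Suc k) u" and b: "PVC m b" and m: "m = Suc k"
  have "PVC m (\<lambda>zs. u (map (\<lambda>g. g zs) (b # map (\<lambda>i zs. zs ! Suc i) [0..<k])))"
    by (rule PVC_comp[OF u]) (use b m in \<open>auto intro: PVC_proj\<close>)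
  then show ?thesis
  proof (rule PVC_ext)
    fix zs :: "nat list" assume "length zs = m"
    then have "map (\<lambda>g. g zs) (map (\<lambda>i zs. zs ! Suc i) [0..<k]) = tl zs"
      using m by (intro nth_equalityI) (auto simp: nth_tl)
    then show "u (map (\<lambda>g. g zs) (b # map (\<lambda>i zs. zs ! Suc i) [0..<k])) = u (b zs # tl zs)" by simp
  qed
qed

text \<open>Two adjacent quantifiers of the same kind are merged by coding, for which the inner
  bound is first made independent of the outer variable.\<close>

lemma SP_ex:
  assumes P: "SP (Suc i) (Suc k) P" and t: "PVC k t"
  shows "SP (Suc i) k (\<lambda>xs. \<exists>y\<le>t xs. P (y # xs))"
proof -
  obtain Q u where Q: "SP i (Suc (Suc k)) Q" "PVC (Suc k) u"
    "\<And>xs. length xs = Suc k \<Longrightarrow> P xs \<longleftrightarrow> (\<exists>y\<le>u xs. \<not> Q (y # xs))"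
    using P by auto
  obtain V where V: "PVC k V" "\<And>xs y. length xs = k \<Longrightarrow> y \<le> t xs \<Longrightarrow> u (y # xs) \<le> V xs"
    using PVC_uniform_bound[OF Q(2) t] by blast
  let ?b = "\<lambda>c zs. eval beta [hd zs, c]"
  define R where "R zs \<longleftrightarrow> (\<not> ?b 0 zs \<le> t (tl zs) \<or> \<not> ?b 1 zs \<le> u (?b 0 zs # tl zs)) \<or> Q (?b 1 zs # ?b 0 zs # tl zs)" for zs
  have R: "SP i (Suc k) R" unfolding R_def
    by (intro SP_disj SP_PV PV.CP_not PV.CP_le PV.CP_disj PVC_beta_hd PV.C_tl[OF t] PVC_Cons[OF Q(2) PVC_beta_hd PVC_beta_hd]
        SP_subst2[OF Q(1)] refl)
  define T :: "nat list \<Rightarrow> nat" where "T xs = 2 * 2 ^ (blen (t xs + V xs) * (2 + 1))" for xs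
  have T: "PVC k T" unfolding T_def by (intro PVC_code_bound PV.C_add t V)
  have "(\<exists>y\<le>t xs. P (y # xs)) \<longleftrightarrow> (\<exists>w\<le>T xs. \<not> R (w # xs))" if l: "length xs = k" for xs
  proof
    assume "\<exists>y\<le>t xs. P (y # xs)"
    then obtain y v where y: "y \<le> t xs" "v \<le> u (y # xs)" "\<not> Q (v # y # xs)"
      using Q(3)[of "_ # xs"] l by auto
    then have v: "v \<le> V xs" using V(2)[OF l] le_trans by blast
    show "\<exists>w\<le>T xs. \<not> R (w # xs)"
      using pair_code[OF y(1) v] y by (intro exI[of _ "code (blen (t xs + V xs)) [y, v]"]) (simp add: R_def T_def)
  next
    assume "\<exists>w\<le>T xs. \<not> R (w # xs)"
    then show "\<exists>y\<le>t xs. P (y # xs)" using Q(3)[of "_ # xs"] l by (auto simp: R_def)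
  qed
  with R T show ?thesis by auto
qed

text \<open>Collection in the standard model: the witnesses for all \<open>j\<close> are put into
  one code, and the sharply bounded universal quantifier moves inside. There the complement makes it
  existential, so the induction hypothesis for the lower level applies.\<close>

lemma SP_sharp:
  "SP i (Suc k) P \<Longrightarrow> PVC k u \<Longrightarrow>
   SP i k (\<lambda>xs. \<exists>j<blen (u xs). P (j # xs)) \<and> SP i k (\<lambda>xs. \<forall>j<blen (u xs). P (j # xs))"
proof (induction i arbitrary: k P u)
  case 0
  have "PV.CP (Suc k) (\<lambda>zs. P (hd zs # tl zs))"
    by (rule PV.CP_ext[of _ P]) (use 0 in \<open>auto simp: length_Suc_conv\<close>)
  then show ?case using PV.CP_ex[of k "\<lambda>j xs. P (j # xs)" u] PV.CP_all[of k "\<lambda>j xs. P (j # xs)" u] 0 by simp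
next
  case (Suc i)
  note u = Suc.prems(2)
  have "SP (Suc i) (Suc k) (\<lambda>zs. hd zs < blen (u (tl zs)) \<and> P zs)"
    by (intro SP_conj SP_PV PV.CP_less PV.C_hd PV.C_len PV.C_tl u Suc.prems(1))
  from SP_ex[OF this PV.C_len[OF u]] have 1: "SP (Suc i) k (\<lambda>xs. \<exists>j<blen (u xs). P (j # xs))"
    by (rule SP_ext) (auto intro: less_imp_le)
  obtain Q t where Q: "SP i (Suc (Suc k)) Q" "PVC (Suc k) t"
    "\<And>xs. length xs = Suc k \<Longrightarrow> P xs \<longleftrightarrow> (\<exists>y\<le>t xs. \<not> Q (y # xs))"
    using Suc.prems(1) by auto
  obtain V where V: "PVC k V" "\<And>xs y. length xs = k \<Longrightarrow> y \<le> blen (u xs) \<Longrightarrow> t (y # xs) \<le> V xs"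
    using PVC_uniform_bound[OF Q(2) PV.C_len[OF u]] by blast
  let ?b = "\<lambda>zs. eval beta [hd (tl zs), hd zs]"
  have b: "PVC (Suc (Suc k)) ?b" by (intro PV.C_beta PV.C_hd PV.C_hd_tl)
  define R0 where "R0 zs \<longleftrightarrow> \<not> ?b zs \<le> t (hd zs # tl (tl zs)) \<or> Q (?b zs # hd zs # tl (tl zs))" for zs
  have t': "PVC (Suc (Suc k)) (\<lambda>zs. t (hd zs # tl (tl zs)))"
  proof -
    have "PVC (Suc (Suc k)) (\<lambda>zs. t (map (\<lambda>g. g zs) (hd # map (\<lambda>i zs. zs ! (i + 2)) [0..<k])))"
      by (rule PVC_comp[OF Q(2)]) (auto intro: PVC_proj PV.C_hd)
    then show ?thesis
    proof (rule PVC_ext)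
      fix zs :: "nat list" assume "length zs = Suc (Suc k)"
      then have "map (\<lambda>g. g zs) (map (\<lambda>i zs. zs ! (i + 2)) [0..<k]) = tl (tl zs)"
        by (intro nth_equalityI) (auto simp: nth_tl)
      then show "t (map (\<lambda>g. g zs) (hd # map (\<lambda>i zs. zs ! (i + 2)) [0..<k])) = t (hd zs # tl (tl zs))" by simp
    qed
  qed
  have R0: "SP i (Suc (Suc k)) R0" unfolding R0_def
    by (intro SP_disj SP_PV PV.CP_not PV.CP_le b t' SP_subst2'[OF Q(1)] PV.C_hd)
  define R where "R zs \<longleftrightarrow> (\<exists>j<blen (u (tl zs)). R0 (j # zs))" for zs
  have R: "SP i (Suc k) R" unfolding R_def
    using Suc.IH[OF R0 PV.C_tl[OF u]] by blast
  define T :: "nat list \<Rightarrow> nat" where "T xs = 2 * 2 ^ (blen (V xs) * blen (Suc (2 * u xs)))" for xs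
  have T: "PVC k T" unfolding T_def by (intro PV.C_mult PV.C_smash PVC_const V PV.C_dbl1 u)
  have "(\<forall>j<blen (u xs). P (j # xs)) \<longleftrightarrow> (\<exists>w\<le>T xs. \<not> R (w # xs))" if l: "length xs = k" for xs
  proof
    assume "\<forall>j<blen (u xs). P (j # xs)"
    then have "\<forall>j<blen (u xs). \<exists>y. y \<le> t (j # xs) \<and> \<not> Q (y # j # xs)" using Q(3)[of "_ # xs"] l by auto
    then obtain y where y: "\<And>j. j < blen (u xs) \<Longrightarrow> y j \<le> t (j # xs) \<and> \<not> Q (y j # j # xs)" by metis
    let ?l = "map y [0..<blen (u xs)]"
    have less: "\<forall>z\<in>set ?l. z < 2 ^ blen (V xs)"
    proof
      fix z assume "z \<in> set ?l"
      then obtain j where "j < blen (u xs)" "z = y j" by auto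
      then have "z \<le> V xs" using y[of j] V(2)[OF l, of j] by simp
      then show "z < 2 ^ blen (V xs)" using less_power_blen le_less_trans by blast
    qed
    have "\<not> R (code (blen (V xs)) ?l # xs)" unfolding R_def R0_def using y beta_code[OF less] by auto
    moreover have "code (blen (V xs)) ?l \<le> T xs"
      using code_less[OF less] by (simp add: T_def blen_double)
    ultimately show "\<exists>w\<le>T xs. \<not> R (w # xs)" by blast
  next
    assume "\<exists>w\<le>T xs. \<not> R (w # xs)"
    then show "\<forall>j<blen (u xs). P (j # xs)" using Q(3)[of "_ # xs"] l by (auto simp: R_def R0_def)
  qed
  with R T have "SP (Suc i) k (\<lambda>xs. \<forall>j<blen (u xs). P (j # xs))" by auto
  with 1 show ?case by blast
qed

section \<open>Pairs of words, and the levels of the hierarchy\<close>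

definition pair_pv :: "nat \<Rightarrow> nat \<Rightarrow> nat" where
  "pair_pv z v = num (pair (dec z) (dec v))"

lemma num_less: "num x < 2 ^ Suc (length x)"
  by (induction x) (auto simp: of_bool_def)

lemma length_pair: "length (pair x y) = 2 * length x + 1 + length y"
  by (induction x) auto

lemma PVC_pair:
  assumes "PVC k a" "PVC k b" shows "PVC k (\<lambda>xs. pair_pv (a xs) (b xs))"
proof (rule PV.C_rec_ctxt[where F = "\<lambda>x ys. pair_pv x (b ys)" and g = "\<lambda>ys. 2 * (if b ys = 0 then 1 else b ys)" and
    H = "\<lambda>c x r ys. if x = 0 then 2 * (if b ys = 0 then 1 else b ys) else 4 * r + (1 + 2 * of_bool c)", OF _ _ _ _ _ assms(1)])
  show "PVC k (\<lambda>ys. 2 * (if b ys = 0 then 1 else b ys))" by (intro PV.C_mult PV.C_if0 PVC_const assms)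
  show "PVC (k + 2) (\<lambda>zs. if zs ! 0 = 0 then 2 * (if b (tl (tl zs)) = 0 then 1 else b (tl (tl zs))) else 4 * zs ! 1 + (1 + 2 * of_bool c))" for c
    by (intro PV.C_if0 PV.C_add PV.C_mult PVC_const PVC_proj PV.C_tl2 assms) auto
  \<comment> \<open>Both 0 and 1 represent the empty word.\<close>
  have nd: "num (dec v) = (if v = 0 then 1 else v)" for v by (auto simp: num_dec)
  then show "pair_pv 0 (b ys) = 2 * (if b ys = 0 then 1 else b ys)" for ys by (simp add: pair_pv_def)
  show "pair_pv (2 * x + of_bool c) (b ys) = (if x = 0 then 2 * (if b ys = 0 then 1 else b ys) else 4 * pair_pv x (b ys) + (1 + 2 * of_bool c))"
    if "0 < 2 * x + of_bool c" for c x ys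
  proof (cases "x = 0")
    case True
    then have "c" using that by auto
    moreover have "dec 1 = []" by (simp add: dec_def bits.simps)
    ultimately show ?thesis using True nd[of "b ys"] by (simp add: pair_pv_def)
  next
    case False
    then show ?thesis by (simp add: pair_pv_def dec_step)
  qed
  show "pbd (Suc k) (\<lambda>xs. blen (pair_pv (hd xs) (b (tl xs))))"
  proof (rule pbd_mono)
    show "pbd (Suc k) (\<lambda>xs. Suc (2 * blen (hd xs) + 1 + blen (b (tl xs))))"
      by (intro pbd_Suc pbd_add pbd_mult pbd_const PV.pbd_hd PVC_bound PV.C_tl assms)
    fix xs :: "nat list"
    have "pair_pv (hd xs) (b (tl xs)) < 2 ^ Suc (length (pair (dec (hd xs)) (dec (b (tl xs)))))"
      unfolding pair_pv_def by (rule num_less)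
    also have "\<dots> \<le> 2 ^ Suc (2 * blen (hd xs) + 1 + blen (b (tl xs)))"
      by (intro power_increasing) (auto simp: length_pair length_dec)
    finally show "blen (pair_pv (hd xs) (b (tl xs))) \<le> Suc (2 * blen (hd xs) + 1 + blen (b (tl xs)))"
      by (simp only: blen_le_pow)
  qed
qed

lemma dec_pair_pv [simp]: "dec (pair_pv z v) = pair (dec z) (dec v)"
  by (simp add: pair_pv_def)

lemma PVC_div4: assumes "PVC k a" "PVC k b"
  shows "PVC k (\<lambda>xs. let e = eval pow2 [b xs, a xs] div 2 in a xs div 2 ^ blen e div 2 ^ blen e)"
  unfolding Let_def by (intro PV.C_shift PV.C_half PV.C_pow2 assms)

lemma div4_eq: "j < blen n \<Longrightarrow> (let e = eval pow2 [j, n] div 2 in n div 2 ^ blen e div 2 ^ blen e) = n div 4 ^ j"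
proof -
  assume j: "j < blen n"
  then have "n > 0" by (cases n) (auto simp: blen_0)
  then have "blen (eval pow2 [j, n] div 2) = j" using j by (simp add: eval_pow2 blen_half_power)
  moreover have "(2::nat) ^ j * 2 ^ j = 4 ^ j" by (simp add: power_mult_distrib[symmetric])
  ultimately show ?thesis by (simp add: div_mult2_eq[symmetric])
qed

lemma num_pair_div4: "j \<le> length x \<Longrightarrow> num (pair x y) div 4 ^ j = num (pair (drop j x) y)"
proof (induction j)
  case (Suc j)
  then have d: "drop j x = x ! j # drop (Suc j) x" by (simp add: Cons_nth_drop_Suc)
  have "num (pair x y) div 4 ^ Suc j = num (pair x y) div 4 ^ j div 4" by (simp only: power_Suc2 div_mult2_eq)
  also have "\<dots> = (4 * num (pair (drop (Suc j) x) y) + (2 * of_bool (x ! j) + 1)) div 4"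
    using Suc d by (simp add: algebra_simps)
  also have "\<dots> = num (pair (drop (Suc j) x) y)" by (cases "x ! j") simp_all
  finally show ?case .
qed simp

lemma odd_num_pair: "odd (num (pair x y)) \<longleftrightarrow> x \<noteq> []"
  by (cases x) auto

lemma num_eq_sum: "num x = (\<Sum>j<length x. of_bool (x ! j) * 2 ^ j) + 2 ^ length x"
  by (induction x) (simp_all add: sum.lessThan_Suc_shift sum_distrib_left algebra_simps
      del: sum.lessThan_Suc sum_of_bool_mult_eq)

text \<open>In \<open>num (pair x y)\<close> every second digit, starting from the lowest, is 1 as
  long as letters of \<open>x\<close> follow. Hence the length of \<open>x\<close> is the least
  \<open>j\<close> for which the quotient by \<open>4 ^ j\<close> is even.\<close>

lemma unpair_pv:
  obtains f g where "PVC 1 f" "PVC 1 g" "\<And>x y. f [num (pair x y)] = num x" "\<And>x y. g [num (pair x y)] = num y"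
proof -
  define D where "D j n = (let e = eval pow2 [j, n] div 2 in n div 2 ^ blen e div 2 ^ blen e)" for j n
  have CD: "PVC k (\<lambda>xs. D (a xs) (b xs))" if "PVC k a" "PVC k b" for k a b
    unfolding D_def by (rule PVC_div4[OF that(2,1)])
  have D: "D j n = n div 4 ^ j" if "j < blen n" for j n unfolding D_def by (rule div4_eq[OF that])
  have "PV.CP (Suc 1) (\<lambda>zs. \<not> odd (D (hd zs) (tl zs ! 0)))"
    by (intro PV.CP_not PV.CP_odd CD PV.C_hd PV.C_nth_tl) simp
  from PV.C_least[OF this PVC_proj[of 0 1]] obtain k where k: "PVC 1 k"
    "\<And>xs. length xs = 1 \<Longrightarrow> \<exists>j<blen (xs ! 0). \<not> odd (D j (xs ! 0)) \<Longrightarrow>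
      k xs < blen (xs ! 0) \<and> \<not> odd (D (k xs) (xs ! 0)) \<and> (\<forall>i<k xs. \<not> \<not> odd (D i (xs ! 0)))" by auto
  have len: "2 * length x + 1 < blen (num (pair x y))" for x y
    using arg_cong[OF bits_num[of "pair x y"], of length] by (simp add: length_pair)
  have kx: "k [num (pair x y)] = length x" for x y
  proof -
    let ?n = "num (pair x y)"
    have o: "odd (D j ?n) \<longleftrightarrow> j < length x" if "j \<le> length x" for j
      using that len[of x y] by (auto simp: D num_pair_div4 odd_num_pair)
    have "\<exists>j<blen ([?n] ! 0). \<not> odd (D j ([?n] ! 0))"
      using o[of "length x"] len[of x y] by (intro exI[of _ "length x"]) simp
    from k(2)[OF _ this] have "\<not> odd (D (k [?n]) ?n)" "\<forall>i<k [?n]. odd (D i ?n)" by auto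
    then have "\<not> k [?n] < length x" "\<not> length x < k [?n]" using o[of "k [?n]"] o[of "length x"] by auto
    then show ?thesis by simp
  qed
  define g where "g xs = D (k xs) (xs ! 0) div 2" for xs
  define f where "f xs = (\<Sum>j<blen (xs ! 0). if j < k xs \<and> odd (D j (xs ! 0) div 2) then eval pow2 [j, xs ! 0] else 0) + eval pow2 [k xs, xs ! 0]" for xs
  show ?thesis
  proof (rule that[of f g])
    show "PVC 1 g" unfolding g_def by (intro PV.C_half CD k PVC_proj) simp
    show "PVC 1 f" unfolding f_def
      by (intro PV.C_add PV.C_sum PV.C_if PV.CP_conj PV.CP_less PV.CP_odd PV.C_half CD PV.C_pow2 PV.C_hd PV.C_nth_tl PV.C_tl[OF k(1)] PVC_const PVC_proj k) simp_all
    fix x y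
    let ?n = "num (pair x y)"
    have "D (length x) ?n = num (pair [] y)" using len[of x y] by (simp add: D num_pair_div4)
    then show "g [?n] = num y" by (simp add: g_def kx)
    have "(\<Sum>j<blen ?n. if j < length x \<and> odd (D j ?n div 2) then eval pow2 [j, ?n] else 0) =
      (\<Sum>j<length x. of_bool (x ! j) * 2 ^ j)"
    proof (rule sum.mono_neutral_cong_right)
      show "{..<length x} \<subseteq> {..<blen ?n}" using len[of x y] by auto
      fix j assume "j \<in> {..<length x}"
      then have j: "j < length x" "j < blen ?n" using len[of x y] by auto
      then have "D j ?n = num (pair (drop j x) y)" by (simp add: D num_pair_div4)
      also have "drop j x = x ! j # drop (Suc j) x" using j by (simp add: Cons_nth_drop_Suc)
      finally have "odd (D j ?n div 2) \<longleftrightarrow> x ! j" by (cases "x ! j") simp_all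
      moreover have "eval pow2 [j, ?n] = 2 ^ j" using j by (simp add: eval_pow2)
      ultimately show "(if j < length x \<and> odd (D j ?n div 2) then eval pow2 [j, ?n] else 0) = of_bool (x ! j) * 2 ^ j"
        using j by simp
    qed auto
    moreover have "eval pow2 [length x, ?n] = 2 ^ length x" using len[of x y] by (simp add: eval_pow2)
    ultimately show "f [?n] = num x" unfolding f_def kx nth_Cons_0 num_eq_sum[of x] by (simp only:)
  qed
qed

lemma poly_bound_nat:
  assumes "pbd 1 T"
  obtains p :: "nat poly" where "\<And>x. T [num x] \<le> poly p (length x)"
proof -
  obtain e where e: "\<And>xs. length xs = 1 \<Longrightarrow> T xs \<le> sz xs ^ e" using assms unfolding pbd_def by blast
  have "T [num x] \<le> poly ([:3, 1:] ^ e) (length x)" for x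
  proof -
    have "sz [num x] = length x + 3"
      using arg_cong[OF bits_num[of x], of length] by (simp add: sz_def)
    then show ?thesis using e[of "[num x]"] by (simp add: poly_power add.commute)
  qed
  then show ?thesis by (rule that)
qed

theorem SP_imp_Sigma_p: "SP i 1 P \<Longrightarrow> {x. P [num x]} \<in> Sigma_p i"
proof (induction i arbitrary: P)
  case 0
  then have "pt {} 1 (\<lambda>xs. of_bool (P xs))"
    using fclass.PVC_imp[OF fclass_pt] by (simp add: PV.CP_def)
  from pt_decides[OF this] show ?case by simp
next
  case (Suc i)
  obtain Q t where Q: "SP i 2 Q" "PVC 1 t" "\<And>z. P [z] \<longleftrightarrow> (\<exists>y\<le>t [z]. \<not> Q [y, z])"
    using Suc.prems by (auto simp: numeral_2_eq_2)
  obtain f g where fg: "PVC 1 f" "PVC 1 g" "\<And>x y. f [num (pair x y)] = num x" "\<And>x y. g [num (pair x y)] = num y"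
    using unpair_pv by blast
  \<comment> \<open>A witness \<open>y\<close> is represented by the word with number
    \<open>2 * y + 1\<close>, since \<open>num\<close> never takes the value 0; hence the
    \<open>div 2\<close>.\<close>
  define Q' where "Q' xs \<longleftrightarrow> \<not> g xs div 2 \<le> t [f xs] \<or> Q [g xs div 2, f xs]" for xs
  have "SP i 1 (\<lambda>xs. Q (map (\<lambda>h. h xs) [\<lambda>xs. g xs div 2, f]))"
    by (rule SP_comp[OF Q(1)]) (use fg in \<open>auto intro: PV.C_half\<close>)
  then have 1: "SP i 1 (\<lambda>xs. Q [g xs div 2, f xs])" by simp
  have "SP i 1 Q'" unfolding Q'_def
    by (rule SP_disj[OF SP_PV 1]) (intro PV.CP_not PV.CP_le PV.C_half PV.C_comp1[OF Q(2)] fg)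
  then have R: "{w. Q' [num w]} \<in> Sigma_p i" by (rule Suc.IH)
  obtain p :: "nat poly" where p: "\<And>x. blen (t [num x]) \<le> poly p (length x)"
    using poly_bound_nat[OF PVC_bound[OF Q(2)]] by blast
  have "x \<in> {x. P [num x]} \<longleftrightarrow> (\<exists>y. length y \<le> poly p (length x) \<and> pair x y \<in> - {w. Q' [num w]})" for x
  proof
    assume "x \<in> {x. P [num x]}"
    then obtain y where y: "y \<le> t [num x]" "\<not> Q [y, num x]" using Q(3) by auto
    have "num (dec (Suc (2 * y))) = Suc (2 * y)" by (rule num_dec) simp
    then have "\<not> Q' [num (pair x (dec (Suc (2 * y))))]" using y by (simp add: Q'_def fg)
    moreover have "blen y \<le> blen (t [num x])" using y(1) by (rule floorlog_mono)
    then have "length (dec (Suc (2 * y))) \<le> poly p (length x)"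
      using p[of x] by (simp add: length_dec blen_double)
    ultimately show "\<exists>y. length y \<le> poly p (length x) \<and> pair x y \<in> - {w. Q' [num w]}" by blast
  next
    assume "\<exists>y. length y \<le> poly p (length x) \<and> pair x y \<in> - {w. Q' [num w]}"
    then show "x \<in> {x. P [num x]}" unfolding mem_Collect_eq Q(3) by (auto simp: Q'_def fg)
  qed
  then show ?case using R by (auto intro!: exI[of _ "- {w. Q' [num w]}"] exI[of _ p])
qed

text \<open>Horner's scheme in the exponent: smash multiplies exponents and multiplication adds
  them.\<close>

lemma PVC_pow_poly: "PVC k a \<Longrightarrow> PVC k (\<lambda>xs. 2 ^ poly p (blen (a xs)))"
proof (induction p)
  case (pCons c p)
  have "PVC k (\<lambda>xs. 2 ^ c * 2 ^ (blen (a xs) * blen (2 ^ poly p (blen (a xs)) div 2)))"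
    by (intro PV.C_mult PV.C_smash PV.C_half PVC_const pCons)
  then show ?case by (simp only: blen_half_power poly_pCons power_add)
qed (simp add: PVC_const)

lemma PVC_ones: "PVC k a \<Longrightarrow> PVC k (\<lambda>xs. 2 ^ blen (a xs) - 1)"
proof (rule PV.C_rec_ctxt[where F = "\<lambda>x ys. 2 ^ blen x - 1" and g = "\<lambda>_. 0" and H = "\<lambda>b x r ys. 2 * r + 1"])
  show "PVC (k + 2) (\<lambda>zs. 2 * zs ! 1 + 1)" by (intro PV.C_add PV.C_mult PVC_const PVC_proj) simp
  show "pbd (Suc k) (\<lambda>xs. blen (2 ^ blen (hd xs) - 1))" unfolding blen_ones by (rule PV.pbd_hd)
  show "(2::nat) ^ blen (2 * x + of_bool b) - 1 = 2 * (2 ^ blen x - 1) + 1" if "0 < 2 * x + of_bool b" for b x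
  proof -
    have "(1::nat) \<le> 2 ^ blen x" by simp
    then show ?thesis unfolding blen_step[OF that] power_Suc by linarith
  qed
qed (auto intro: PVC_const simp: blen_0)

theorem Sigma_p_imp_SP: "L \<in> Sigma_p i \<Longrightarrow> SP i 1 (\<lambda>xs. dec (xs ! 0) \<in> L)"
proof (induction i arbitrary: L)
  case 0
  then show ?case using P_imp_PVC by simp
next
  case (Suc i)
  then obtain R and p :: "nat poly" where R: "- R \<in> Sigma_p i"
    "\<And>x. x \<in> L \<longleftrightarrow> (\<exists>y. length y \<le> poly p (length x) \<and> pair x y \<in> R)" by auto
  have "SP i (Suc 1) (\<lambda>zs. (\<lambda>xs. dec (xs ! 0) \<in> - R) (map (\<lambda>g. g zs) [\<lambda>zs. pair_pv (zs ! 1) (zs ! 0)]))"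
    by (rule SP_comp[OF Suc.IH[OF R(1)]]) (auto intro!: PVC_pair PVC_proj)
  then have Q: "SP i (Suc 1) (\<lambda>zs. pair (dec (zs ! 1)) (dec (zs ! 0)) \<notin> R)" by simp
  define t :: "nat list \<Rightarrow> nat" where "t xs = 2 ^ blen (2 ^ poly p (blen (xs ! 0 div 2))) - 1" for xs
  have t: "PVC 1 t" unfolding t_def by (intro PVC_ones PVC_pow_poly PV.C_half PVC_proj) simp
  have lt: "y \<le> t xs \<longleftrightarrow> length (dec y) \<le> poly p (length (dec (xs ! 0)))" for y xs
  proof -
    have "y \<le> t xs \<longleftrightarrow> y < 2 ^ Suc (poly p (blen (xs ! 0 div 2)))"
      unfolding t_def blen_power by (metis One_nat_def Suc_pred less_Suc_eq_le pos2 zero_less_power)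
    also have "\<dots> \<longleftrightarrow> blen y \<le> Suc (poly p (blen (xs ! 0 div 2)))" by (rule blen_le_pow[symmetric])
    also have "blen (xs ! 0 div 2) = length (dec (xs ! 0))"
      by (cases "xs ! 0 = 0") (simp_all add: length_dec blen_0 blen_double)
    finally show ?thesis by (auto simp: length_dec)
  qed
  have "dec (xs ! 0) \<in> L \<longleftrightarrow> (\<exists>y\<le>t xs. \<not> pair (dec ((y # xs) ! 1)) (dec ((y # xs) ! 0)) \<notin> R)" for xs
  proof -
    have "(\<exists>y. length y \<le> poly p (length x) \<and> pair x y \<in> R) \<longleftrightarrow>
      (\<exists>y. length (dec y) \<le> poly p (length x) \<and> pair x (dec y) \<in> R)" for x by (metis dec_num)
    then show ?thesis unfolding R(2) by (simp add: lt)
  qed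
  with Q t show ?case by (auto intro!: exI[of _ "\<lambda>zs. pair (dec (zs ! 1)) (dec (zs ! 0)) \<notin> R"] exI[of _ t])
qed

section \<open>Truth in the standard model\<close>

fun tval :: "(nat \<Rightarrow> nat) \<Rightarrow> tm \<Rightarrow> nat" where
  "tval e (Var n) = e n"
| "tval e (Fn f ts) = eval f (map (tval e) ts)"

fun natsat :: "(nat \<Rightarrow> nat) \<Rightarrow> fm \<Rightarrow> bool" where
  "natsat e (s \<^bold>= t) \<longleftrightarrow> tval e s = tval e t"
| "natsat e (s \<^bold>\<le> t) \<longleftrightarrow> tval e s \<le> tval e t"
| "natsat e Fls \<longleftrightarrow> False"
| "natsat e (p \<^bold>\<longrightarrow> q) \<longleftrightarrow> (natsat e p \<longrightarrow> natsat e q)"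
| "natsat e (p \<^bold>\<and> q) \<longleftrightarrow> natsat e p \<and> natsat e q"
| "natsat e (p \<^bold>\<or> q) \<longleftrightarrow> natsat e p \<or> natsat e q"
| "natsat e (Forall p) \<longleftrightarrow> (\<forall>x. natsat (case_nat x e) p)"
| "natsat e (Exists p) \<longleftrightarrow> (\<exists>x. natsat (case_nat x e) p)"

lemma tval_subst: "tval e (subst_tm \<sigma> t) = tval (\<lambda>n. tval e (\<sigma> n)) t"
  by (induction t) (auto simp: comp_def intro!: arg_cong[where f = "eval _"])

lemma tval_lift [simp]: "tval (case_nat x e) (lift_tm t) = tval e t"
  by (simp add: tval_subst)

lemma natsat_BExists [simp]: "natsat e (BExists t p) \<longleftrightarrow> (\<exists>x\<le>tval e t. natsat (case_nat x e) p)"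
  by (auto simp: BExists_def)

lemma natsat_BForall [simp]: "natsat e (BForall t p) \<longleftrightarrow> (\<forall>x\<le>tval e t. natsat (case_nat x e) p)"
  by (auto simp: BForall_def)

lemma bnd_le_foldr: "t \<in> set ts \<Longrightarrow> bnd_tm t \<le> foldr max (map bnd_tm ts) 0"
  by (induction ts) (auto simp: max.coboundedI2)

lemma tval_cong: "(\<And>n. n < bnd_tm t \<Longrightarrow> e n = e' n) \<Longrightarrow> tval e t = tval e' t"
proof (induction t)
  case (Fn f ts)
  have "map (tval e) ts = map (tval e') ts"
  proof (rule map_cong[OF refl])
    fix t assume t: "t \<in> set ts"
    show "tval e t = tval e' t"
      by (rule Fn.IH[OF t]) (use Fn.prems bnd_le_foldr[OF t] in auto)
  qed
  then show ?case by (simp only: tval.simps)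
qed simp

lemma natsat_cong: "(\<And>n. n < bnd_fm p \<Longrightarrow> e n = e' n) \<Longrightarrow> natsat e p = natsat e' p"
proof (induction p arbitrary: e e')
  case (Forall p)
  have "natsat (case_nat x e) p = natsat (case_nat x e') p" for x
    by (rule Forall.IH) (use Forall.prems in \<open>auto split: nat.split\<close>)
  then show ?case by simp
next
  case (Exists p)
  have "natsat (case_nat x e) p = natsat (case_nat x e') p" for x
    by (rule Exists.IH) (use Exists.prems in \<open>auto split: nat.split\<close>)
  then show ?case by simp
next
  case (Imp p q)
  have "natsat e p = natsat e' p" "natsat e q = natsat e' q"
    by (rule Imp.IH; use Imp.prems in simp)+
  then show ?case by simp
next
  case (Conj p q)
  have "natsat e p = natsat e' p" "natsat e q = natsat e' q"
    by (rule Conj.IH; use Conj.prems in simp)+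
  then show ?case by simp
next
  case (Disj p q)
  have "natsat e p = natsat e' p" "natsat e q = natsat e' q"
    by (rule Disj.IH; use Disj.prems in simp)+
  then show ?case by simp
next
  case (Eq s t)
  then show ?case using tval_cong[of s e e'] tval_cong[of t e e'] by simp
next
  case (Le s t)
  then show ?case using tval_cong[of s e e'] tval_cong[of t e e'] by simp
qed simp

lemma wf_subst_tm: "wf_tm (subst_tm (\<lambda>n. Var (r n)) t) \<longleftrightarrow> wf_tm t"
  by (induction t) auto

lemma PVC_tval: "wf_tm t \<Longrightarrow> bnd_tm t \<le> k \<Longrightarrow> PVC k (\<lambda>xs. tval ((!) xs) t)"
proof (induction t)
  case (Var n)
  then show ?case by (simp add: PVC_proj)
next
  case (Fn f ts)
  have "PVC k (\<lambda>xs. eval f (map (\<lambda>g. g xs) (map (\<lambda>t xs. tval ((!) xs) t) ts)))"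
    by (rule PVC_comp[OF PVC_pv]) (use Fn bnd_le_foldr in \<open>auto intro: le_trans\<close>)
  then show ?case by (simp add: comp_def)
qed

lemma case_nat_nth: "case_nat x ((!) xs) = (!) (x # xs)"
  by (auto split: nat.split)

lemma bnd_lift_tm: "bnd_tm (lift_tm t) \<le> Suc k \<Longrightarrow> bnd_tm t \<le> k"
proof (induction t)
  case (Fn f ts)
  have *: "foldr max ns 0 \<le> m \<longleftrightarrow> (\<forall>n\<in>set ns. n \<le> m)" for ns :: "nat list" and m
    by (induction ns) auto
  show ?case using Fn by (simp add: * comp_def)
qed simp

lemma wf_bnd_BExists:
  "wf_fm (BExists t p) \<Longrightarrow> bnd_fm (BExists t p) \<le> k \<Longrightarrow> wf_tm t \<and> bnd_tm t \<le> k \<and> wf_fm p \<and> bnd_fm p \<le> Suc k"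
  unfolding BExists_def using bnd_lift_tm[of t k] by (auto simp: wf_subst_tm)

lemma wf_bnd_BForall:
  "wf_fm (BForall t p) \<Longrightarrow> bnd_fm (BForall t p) \<le> k \<Longrightarrow> wf_tm t \<and> bnd_tm t \<le> k \<and> wf_fm p \<and> bnd_fm p \<le> Suc k"
  unfolding BForall_def using bnd_lift_tm[of t k] by (auto simp: wf_subst_tm)

text \<open>An appended digit converts the inclusive bounds of formulas into the strict ones of sums
  and searches.\<close>

lemma le_blen_iff: "j \<le> blen x \<longleftrightarrow> j < blen (Suc (2 * x))"
  by (simp add: blen_double less_Suc_eq_le)

lemma SP_sharp_le:
  assumes "SP i (Suc k) P" "PVC k u"
  shows "SP i k (\<lambda>xs. \<exists>j\<le>blen (u xs). P (j # xs))" "SP i k (\<lambda>xs. \<forall>j\<le>blen (u xs). P (j # xs))"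
  using SP_sharp[OF assms(1) PV.C_dbl1[OF assms(2)]] unfolding le_blen_iff by blast+

lemma PV_natsat_sharp:
  "sharply_bounded p \<Longrightarrow> wf_fm p \<Longrightarrow> bnd_fm p \<le> k \<Longrightarrow> PV.CP k (\<lambda>xs. natsat ((!) xs) p)"
proof (induction arbitrary: k rule: sharply_bounded.induct)
  case (7 p t)
  note w = wf_bnd_BForall[OF 7(3,4)]
  have t: "wf_tm t" "bnd_tm t \<le> k" using w by auto
  have "SP 0 (Suc k) (\<lambda>xs. natsat ((!) xs) p)" using 7 w by simp
  from SP_sharp_le(2)[OF this PVC_tval[OF t]] show ?case by (simp add: case_nat_nth)
next
  case (8 p t)
  note w = wf_bnd_BExists[OF 8(3,4)]
  have t: "wf_tm t" "bnd_tm t \<le> k" using w by auto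
  have "SP 0 (Suc k) (\<lambda>xs. natsat ((!) xs) p)" using 8 w by simp
  from SP_sharp_le(1)[OF this PVC_tval[OF t]] show ?case by (simp add: case_nat_nth)
qed (auto intro!: PV.CP_eq PV.CP_le PV.CP_const PV.CP_imp PV.CP_conj PV.CP_disj PVC_tval)

text \<open>For the dual class the complement is placed in the hierarchy, as \<open>SP\<close> has
  existential levels only.\<close>

theorem SP_natsat:
  "SigmaB i p \<Longrightarrow> wf_fm p \<Longrightarrow> bnd_fm p \<le> k \<Longrightarrow> SP i k (\<lambda>xs. natsat ((!) xs) p)"
  "PiB i p \<Longrightarrow> wf_fm p \<Longrightarrow> bnd_fm p \<le> k \<Longrightarrow> SP i k (\<lambda>xs. \<not> natsat ((!) xs) p)"
proof (induction arbitrary: k and k rule: SigmaB_PiB.inducts)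
  case (1 p i)
  then show ?case by (intro SP_PV PV_natsat_sharp)
next
  case (2 i p)
  then show ?case using SP_not[of i k "\<lambda>xs. \<not> natsat ((!) xs) p"] by (simp only: not_not)
next
  case (3 i p)
  then show ?case by (intro SP_lift)
next
  case (4 i p q)
  then show ?case unfolding natsat.simps by (intro SP_conj) auto
next
  case (5 i p q)
  then show ?case unfolding natsat.simps by (intro SP_disj) auto
next
  case (6 i p q)
  have "SP (Suc i) k (\<lambda>xs. \<not> natsat ((!) xs) p \<or> natsat ((!) xs) q)" using 6 by (intro SP_disj) auto
  then show ?case by (rule SP_ext) auto
next
  case (7 i p t)
  note w = wf_bnd_BForall[OF 7(3,4)]
  have t: "wf_tm t" "bnd_tm t \<le> k" using w by auto
  have "SP (Suc i) (Suc k) (\<lambda>xs. natsat ((!) xs) p)" using 7 w by blast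
  from SP_sharp_le(2)[OF this PVC_tval[OF t]] show ?case
    by (simp add: case_nat_nth del: SP.simps)
next
  case (8 i p t)
  note w = wf_bnd_BExists[OF 8(3,4)]
  have t: "wf_tm t" "bnd_tm t \<le> k" using w by auto
  have "SP (Suc i) (Suc k) (\<lambda>xs. natsat ((!) xs) p)" using 8 w by blast
  from SP_ex[OF this PVC_tval[OF t]] show ?case by (simp add: case_nat_nth del: SP.simps)
next
  case (9 p i)
  then show ?case by (intro SP_PV PV.CP_not PV_natsat_sharp)
next
  case (10 i p)
  then show ?case by (intro SP_not)
next
  case (11 i p)
  then show ?case by (intro SP_lift)
next
  case (12 i p q)
  have "SP (Suc i) k (\<lambda>xs. \<not> natsat ((!) xs) p \<or> \<not> natsat ((!) xs) q)" using 12 by (intro SP_disj) auto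
  then show ?case by (rule SP_ext) auto
next
  case (13 i p q)
  have "SP (Suc i) k (\<lambda>xs. \<not> natsat ((!) xs) p \<and> \<not> natsat ((!) xs) q)" using 13 by (intro SP_conj) auto
  then show ?case by (rule SP_ext) auto
next
  case (14 i p q)
  have "SP (Suc i) k (\<lambda>xs. natsat ((!) xs) p \<and> \<not> natsat ((!) xs) q)" using 14 by (intro SP_conj) auto
  then show ?case by (rule SP_ext) auto
next
  case (15 i p t)
  note w = wf_bnd_BExists[OF 15(3,4)]
  have t: "wf_tm t" "bnd_tm t \<le> k" using w by auto
  have "SP (Suc i) (Suc k) (\<lambda>xs. \<not> natsat ((!) xs) p)" using 15 w by blast
  from SP_sharp_le(2)[OF this PVC_tval[OF t]] show ?case
    by (simp add: case_nat_nth del: SP.simps)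
next
  case (16 i p t)
  note w = wf_bnd_BForall[OF 16(3,4)]
  have t: "wf_tm t" "bnd_tm t \<le> k" using w by auto
  have "SP (Suc i) (Suc k) (\<lambda>xs. \<not> natsat ((!) xs) p)" using 16 w by blast
  from SP_ex[OF this PVC_tval[OF t]] show ?case by (simp add: case_nat_nth del: SP.simps)
qed

lemma SP_strict_formula:
  assumes "SP i k P" "length ts = k" "\<forall>t\<in>set ts. wf_tm t"
  shows "(\<exists>p. strict_SigmaB i p \<and> wf_fm p \<and> (\<forall>e. natsat e p \<longleftrightarrow> P (map (tval e) ts))) \<and>
    (\<exists>p. strict_PiB i p \<and> wf_fm p \<and> (\<forall>e. natsat e p \<longleftrightarrow> \<not> P (map (tval e) ts)))"
  using assms
proof (induction i arbitrary: k P ts)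
  case 0
  then obtain f where f: "wf_pv f" "arity f = k" "\<And>xs. length xs = k \<Longrightarrow> eval f xs = of_bool (P xs)"
    unfolding SP.simps PV.CP_def PVC_def by blast
  have "natsat e (Fn f ts \<^bold>= \<^bold>1) \<longleftrightarrow> P (map (tval e) ts)" "natsat e (Fn f ts \<^bold>= \<^bold>0) \<longleftrightarrow> \<not> P (map (tval e) ts)" for e
    using f(3) 0 by auto
  moreover have "sharply_bounded (Fn f ts \<^bold>= \<^bold>1)" "sharply_bounded (Fn f ts \<^bold>= \<^bold>0)"
    by (rule sharply_bounded.intros)+
  moreover have "wf_fm (Fn f ts \<^bold>= \<^bold>1)" "wf_fm (Fn f ts \<^bold>= \<^bold>0)" using f 0 by auto
  ultimately show ?case unfolding strict_SigmaB.simps strict_PiB.simps by blast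
next
  case (Suc i)
  obtain Q t where Q: "SP i (Suc k) Q" "PVC k t"
    "\<And>xs. length xs = k \<Longrightarrow> P xs \<longleftrightarrow> (\<exists>y\<le>t xs. \<not> Q (y # xs))"
    using Suc.prems(1) by auto
  obtain f where f: "wf_pv f" "arity f = k" "\<And>xs. length xs = k \<Longrightarrow> eval f xs = t xs"
    using Q(2) unfolding PVC_def by blast
  let ?ts = "Var 0 # map lift_tm ts"
  have m: "map (tval (case_nat y e)) ?ts = y # map (tval e) ts" for y e by simp
  obtain q r where q: "strict_SigmaB i q" "wf_fm q" "\<forall>e. natsat e q \<longleftrightarrow> Q (map (tval e) ?ts)"
    and r: "strict_PiB i r" "wf_fm r" "\<forall>e. natsat e r \<longleftrightarrow> \<not> Q (map (tval e) ?ts)"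
    using Suc.IH[OF Q(1), of ?ts] Suc.prems(2,3) by (auto simp: wf_subst_tm)
  have t: "tval e (Fn f ts) = t (map (tval e) ts)" for e using f Suc.prems(2) by simp
  have wt: "wf_tm (lift_tm (Fn f ts))" using f Suc.prems by (auto simp: wf_subst_tm)
  have "natsat e (BExists (Fn f ts) r) \<longleftrightarrow> P (map (tval e) ts)" for e
    using Q(3)[of "map (tval e) ts"] Suc.prems(2) r(3) unfolding natsat_BExists t m[symmetric] by (simp del: list.map)
  moreover have "natsat e (BForall (Fn f ts) q) \<longleftrightarrow> \<not> P (map (tval e) ts)" for e
    using Q(3)[of "map (tval e) ts"] Suc.prems(2) q(3) unfolding natsat_BForall t m[symmetric] by (simp del: list.map)
  moreover have "wf_fm (BExists (Fn f ts) r)" "wf_fm (BForall (Fn f ts) q)"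
    using wt q r by (simp_all add: BExists_def BForall_def)
  ultimately show ?case using q(1) r(1) by (intro conjI exI[of _ "BExists (Fn f ts) r"] exI[of _ "BForall (Fn f ts) q"]) auto
qed

lemma strict_imp_SigmaB: "(strict_SigmaB i p \<longrightarrow> SigmaB i p) \<and> (strict_PiB i p \<longrightarrow> PiB i p)"
proof (induction i arbitrary: p)
  case 0
  then show ?case by (auto intro: SigmaB_PiB.intros)
next
  case (Suc i)
  then show ?case by (auto intro!: SigmaB_PiB.intros(8,16) intro: SigmaB_PiB.intros(2,10))
qed

section \<open>Polynomial time with an oracle from the hierarchy\<close>

text \<open>Reversal compensates for the order in which a stack stands on the oracle tape: a query
  about the stack \<open>bits n\<close> decides \<open>P [n]\<close>.\<close>

definition orc :: "(nat list \<Rightarrow> bool) \<Rightarrow> lang" where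
  "orc P = {w. P [val (rev w)]}"

text \<open>The functions computable in polynomial time with an oracle from
  \<open>Sigma_p i\<close>, often written with a box. Testing whether a value is nonzero leads to
  languages in \<open>Delta_p (i + 1)\<close>.\<close>

definition FD :: "nat \<Rightarrow> nat \<Rightarrow> (nat list \<Rightarrow> nat) \<Rightarrow> bool" where
  "FD i k f \<longleftrightarrow> (\<exists>P. SP i 1 P \<and> pt (orc P) k f)"

lemma SP_comp1: "SP i 1 P \<Longrightarrow> PVC k a \<Longrightarrow> SP i k (\<lambda>xs. P [a xs])"
  using SP_comp[of i 1 P "[a]" k] by simp

text \<open>The last letter of a query word, which is the lowest digit of its number, selects the
  oracle.\<close>

lemma oracle_join:
  assumes "SP i 1 P" "SP i 1 Q"
  obtains R where "SP i 1 R" "\<And>k f. pt (orc P) k f \<Longrightarrow> pt (orc R) k f" "\<And>k f. pt (orc Q) k f \<Longrightarrow> pt (orc R) k f"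
proof
  define R where "R xs \<longleftrightarrow> (odd (xs ! 0) \<and> Q [xs ! 0 div 2]) \<or> (\<not> odd (xs ! 0) \<and> P [xs ! 0 div 2])" for xs :: "nat list"
  have p: "PVC 1 (\<lambda>xs. xs ! 0)" by (rule PVC_proj) simp
  show "SP i 1 R" unfolding R_def
    by (intro SP_disj SP_conj SP_comp1[OF assms(1)] SP_comp1[OF assms(2)] PV.C_half p
        SP_PV[OF PV.CP_odd[OF p]] SP_PV[OF PV.CP_not[OF PV.CP_odd[OF p]]])
  have "w @ [False] \<in> orc R \<longleftrightarrow> w \<in> orc P" "w @ [True] \<in> orc R \<longleftrightarrow> w \<in> orc Q" for w
    by (simp_all add: orc_def R_def)
  then show "pt (orc P) k f \<Longrightarrow> pt (orc R) k f" "pt (orc Q) k f \<Longrightarrow> pt (orc R) k f" for k f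
    using pt_change_oracle by blast+
qed

lemma SP_triv: "SP i k (\<lambda>_. c)" by (rule SP_PV[OF PV.CP_const])

text \<open>Composition and recursion combine functions with different oracles, while their programs
  have to be run with a single one.\<close>

lemma FD_common_oracle:
  assumes "\<forall>(k, f)\<in>set fs. FD i k f"
  obtains P where "SP i 1 P" "\<forall>(k, f)\<in>set fs. pt (orc P) k f"
proof -
  have "\<exists>P. SP i 1 P \<and> (\<forall>(k, f)\<in>set fs. pt (orc P) k f)"
    using assms
  proof (induction fs)
    case Nil
    then show ?case using SP_triv by auto
  next
    case (Cons kf fs)
    obtain k f where kf: "kf = (k, f)" by (cases kf)
    obtain P where P: "SP i 1 P" "\<forall>(k, f)\<in>set fs. pt (orc P) k f" using Cons by auto
    obtain Q where Q: "SP i 1 Q" "pt (orc Q) k f" using Cons.prems unfolding kf FD_def by auto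
    obtain R where R: "SP i 1 R" "\<And>k f. pt (orc P) k f \<Longrightarrow> pt (orc R) k f" "\<And>k f. pt (orc Q) k f \<Longrightarrow> pt (orc R) k f"
      using oracle_join[OF P(1) Q(1)] by blast
    have "pt (orc R) k f" by (rule R(3)[OF Q(2)])
    moreover have "\<forall>(k, f)\<in>set fs. pt (orc R) k f" using P(2) R(2) by auto
    ultimately show ?case using R(1) unfolding kf by auto
  qed
  then show ?thesis using that by blast
qed

lemma FD_comp:
  assumes "FD i l h" "length gs = l" "\<forall>g\<in>set gs. FD i k g"
  shows "FD i k (\<lambda>xs. h (map (\<lambda>g. g xs) gs))"
proof -
  have "\<forall>(k, f)\<in>set ((l, h) # map (\<lambda>g. (k, g)) gs). FD i k f" using assms by auto
  then obtain P where P: "SP i 1 P" "\<forall>(k, f)\<in>set ((l, h) # map (\<lambda>g. (k, g)) gs). pt (orc P) k f"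
    by (rule FD_common_oracle)
  then have "pt (orc P) k (\<lambda>xs. h (map (\<lambda>g. g xs) gs))" by (intro pt_comp[OF _ assms(2)]) auto
  then show ?thesis using P(1) unfolding FD_def by blast
qed

lemma FD_rec:
  assumes "FD i k g" "\<And>b. FD i (k + 2) (h b)"
    and "\<And>ys. length ys = k \<Longrightarrow> f (0 # ys) = g ys"
    and "\<And>b x ys. length ys = k \<Longrightarrow> 0 < 2 * x + of_bool b \<Longrightarrow>
               f ((2 * x + of_bool b) # ys) = h b (x # f (x # ys) # ys)"
    and "pbd (Suc k) (\<lambda>xs. blen (f xs))"
  shows "FD i (Suc k) f"
proof -
  have "\<forall>(k, f)\<in>set [(k, g), (k + 2, h False), (k + 2, h True)]. FD i k f" using assms(1,2) by auto
  then obtain P where P: "SP i 1 P" "\<forall>(k, f)\<in>set [(k, g), (k + 2, h False), (k + 2, h True)]. pt (orc P) k f"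
    by (rule FD_common_oracle)
  have "pt (orc P) (k + 2) (h b)" for b using P(2) by (cases b) auto
  then have "pt (orc P) (Suc k) f" using P(2) by (intro pt_rec[OF _ _ assms(3-5)]) auto
  then show ?thesis using P(1) unfolding FD_def by blast
qed

lemma pt_imp_FD: "(\<And>A. pt A k f) \<Longrightarrow> FD i k f"
  unfolding FD_def using SP_triv by blast

lemma FD_ext: "FD i k f \<Longrightarrow> (\<And>xs. length xs = k \<Longrightarrow> f xs = g xs) \<Longrightarrow> FD i k g"
  unfolding FD_def using pt_ext by blast

lemma FD_bound: "FD i k f \<Longrightarrow> pbd k (\<lambda>xs. blen (f xs))"
  unfolding FD_def using pt_bound by blast

interpretation FD: fclass "FD i" for i
proof
  show "FD i k f \<Longrightarrow> (\<And>xs. length xs = k \<Longrightarrow> f xs = g xs) \<Longrightarrow> FD i k g" for k f g by (rule FD_ext)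
  show "FD i k (\<lambda>_. 0)" for k by (rule pt_imp_FD[OF pt_zero])
  show "j < k \<Longrightarrow> FD i k (\<lambda>xs. xs ! j)" for j k by (rule pt_imp_FD[OF pt_proj])
  show "FD i 1 (\<lambda>xs. 2 * xs ! 0 + of_bool b)" for b by (rule pt_imp_FD[OF pt_push])
  show "FD i l h \<Longrightarrow> length gs = l \<Longrightarrow> \<forall>g\<in>set gs. FD i k g \<Longrightarrow> FD i k (\<lambda>xs. h (map (\<lambda>g. g xs) gs))" for l h gs k
    by (rule FD_comp)
  show "FD i k g \<Longrightarrow> (\<And>b. FD i (k + 2) (hb b)) \<Longrightarrow> (\<And>ys. length ys = k \<Longrightarrow> f (0 # ys) = g ys) \<Longrightarrow>
      (\<And>b x ys. length ys = k \<Longrightarrow> 0 < 2 * x + of_bool b \<Longrightarrow>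
         f ((2 * x + of_bool b) # ys) = hb b (x # f (x # ys) # ys)) \<Longrightarrow>
      pbd (Suc k) (\<lambda>xs. blen (f xs)) \<Longrightarrow> FD i (Suc k) f" for k g hb f
    by (rule FD_rec)
  show "FD i k f \<Longrightarrow> pbd k (\<lambda>xs. blen (f xs))" for k f by (rule FD_bound)
qed

lemma PVC_encode:
  shows "PVC k (\<lambda>xs. code (blen (sum_list (map ((!) xs) [0..<k]))) (map ((!) xs) [0..<k]))"
proof -
  have "PVC k (\<lambda>xs. sum_list (map (\<lambda>g. g xs) (map (\<lambda>j xs. xs ! j) [0..<k])))"
    by (rule PV.C_sum_list) (auto intro: PVC_proj)
  moreover have "\<forall>g\<in>set (map (\<lambda>j xs. xs ! j) [0..<k]). PVC k g" by (auto intro: PVC_proj)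
  ultimately have "PVC k (\<lambda>xs. code (blen (sum_list (map (\<lambda>g. g xs) (map (\<lambda>j xs. xs ! j) [0..<k])))) (map (\<lambda>g. g xs) (map (\<lambda>j xs. xs ! j) [0..<k])))"
    by (intro PV.C_code)
  then show ?thesis by (simp add: comp_def)
qed

lemma beta_encode: "j < length xs \<Longrightarrow> eval beta [code (blen (sum_list xs)) xs, j] = xs ! j"
proof (rule beta_code)
  show "\<forall>z\<in>set xs. z < 2 ^ blen (sum_list xs)"
    using member_le_sum_list[of _ xs] less_power_blen le_less_trans by blast
qed

text \<open>The oracle takes one number, so the arguments are coded as a sequence; their sum
  provides a sufficient block length.\<close>

lemma SP_imp_FD: assumes "SP i k P" shows "FD.CP i k P"
proof -
  define P' where "P' zs \<longleftrightarrow> P (map (\<lambda>j. eval beta [zs ! 0, j]) [0..<k])" for zs :: "nat list"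
  have "SP i 1 (\<lambda>zs. P (map (\<lambda>g. g zs) (map (\<lambda>j zs. eval beta [zs ! 0, j]) [0..<k])))"
    by (rule SP_comp[OF assms]) (auto intro!: PV.C_beta PVC_proj PVC_const)
  then have "SP i 1 P'" unfolding P'_def by (simp add: comp_def)
  then have "FD i 1 (\<lambda>xs. of_bool (rev (bits (xs ! 0)) \<in> orc P'))"
    unfolding FD_def using pt_oracle by blast
  then have 1: "FD i 1 (\<lambda>xs. of_bool (P' [xs ! 0]))" by (simp add: orc_def)
  have 2: "FD i k (\<lambda>xs. code (blen (sum_list (map ((!) xs) [0..<k]))) (map ((!) xs) [0..<k]))"
    by (rule FD.PVC_imp[OF PVC_encode])
  show ?thesis unfolding FD.CP_def
  proof (rule FD_ext[OF FD.C_comp1[OF 1 2]])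
    fix xs :: "nat list" assume l: "length xs = k"
    then have m: "map ((!) xs) [0..<k] = xs" using map_nth by blast
    have "map (\<lambda>j. eval beta [code (blen (sum_list xs)) xs, j]) [0..<k] = map ((!) xs) [0..<k]"
      using l by (intro map_cong) (simp_all only: set_upt atLeastLessThan_iff beta_encode)
    then show "of_bool (P' [[code (blen (sum_list (map ((!) xs) [0..<k]))) (map ((!) xs) [0..<k])] ! 0]) = of_bool (P xs)"
      unfolding m P'_def by (simp add: m)
  qed
qed

text \<open>In \<open>orc\<close> the first letter of a word is the most significant digit, in
  \<open>num\<close> the least significant one; this translation puts \<open>orc P\<close> on the
  same level of the hierarchy as \<open>P\<close>.\<close>

lemma PVC_val_rev: obtains f where "PVC 1 f" "\<And>x. f [num x] = val (rev x)"
proof -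
  have va: "val (x @ [b]) = val x + of_bool b * 2 ^ length x" for x b by (induction x) auto
  have nd: "blen (num x div 2) = length x" for x
    using arg_cong[OF bits_num[of x], of length] by (simp add: blen_double)
  have vl: "val (rev x) < 2 ^ length x" for x using blen_val_le[of "rev x"] by (simp add: blen_le_pow)
  have "PVC 1 (\<lambda>xs. val (rev (dec (xs ! 0))))"
  proof (rule PV.C_rec_ctxt[where F = "\<lambda>z ys. val (rev (dec z))" and g = "\<lambda>_. 0" and
      H = "\<lambda>b z r ys. if z = 0 then 0 else r + of_bool b * 2 ^ blen (z div 2)"])
    show "PVC (1 + 2) (\<lambda>zs. if zs ! 0 = 0 then 0 else zs ! 1 + of_bool b * 2 ^ blen (zs ! 0 div 2))" for b
      by (intro PV.C_if0 PV.C_add PV.C_mult PV.C_pow2_len PV.C_half PVC_const PVC_proj) simp_all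
    show "val (rev (dec (2 * z + of_bool b))) = (if z = 0 then 0 else val (rev (dec z)) + of_bool b * 2 ^ blen (z div 2))"
      if "0 < 2 * z + of_bool b" for b z
    proof (cases "z = 0")
      case True
      moreover have "dec 1 = []" by (simp add: dec_def bits.simps)
      ultimately show ?thesis using that by simp
    next
      case False
      then show ?thesis using nd[of "dec z"] num_dec[of z] by (simp add: dec_step va)
    qed
    show "pbd (Suc 1) (\<lambda>xs. blen (val (rev (dec (hd xs)))))"
    proof (rule pbd_mono[OF PV.pbd_hd])
      fix xs :: "nat list"
      show "blen (val (rev (dec (hd xs)))) \<le> blen (hd xs)"
        using blen_val_le[of "rev (dec (hd xs))"] by (simp add: length_dec)
    qed
  qed (auto intro: PVC_const PVC_proj)
  then show ?thesis using that[of "\<lambda>xs. val (rev (dec (xs ! 0)))"] by simp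
qed

theorem FD_decides: assumes "FD i 1 f" shows "{x. f [num x] \<noteq> 0} \<in> Delta_p (i + 1)"
proof -
  obtain P where P: "SP i 1 P" "pt (orc P) 1 f" using assms unfolding FD_def by blast
  obtain r where r: "PVC 1 r" "\<And>x. r [num x] = val (rev x)" using PVC_val_rev by blast
  have "{x. P [r [num x]]} \<in> Sigma_p i" using SP_imp_Sigma_p[OF SP_comp1[OF P(1) r(1)]] .
  then have "orc P \<in> Sigma_p i" by (simp add: orc_def r)
  then show ?thesis using pt_decides[OF P(2)] by auto
qed

section \<open>Countability of the function classes\<close>

instance pv :: countable by countable_datatype
instance com :: countable by countable_datatype

text \<open>Predicates in \<open>SP i k\<close> are arbitrary on lists of other lengths; only the
  restrictions form a countable set.\<close>

definition restrict_pred :: "nat \<Rightarrow> (nat list \<Rightarrow> bool) \<Rightarrow> nat list \<Rightarrow> bool" where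
  "restrict_pred k P xs \<longleftrightarrow> length xs = k \<and> P xs"

lemma countable_SP: "countable {restrict_pred k P | P. SP i k P}"
proof (induction i arbitrary: k)
  case 0
  have "{restrict_pred k P | P. SP 0 k P} \<subseteq> range (\<lambda>p. restrict_pred k (\<lambda>xs. eval p xs = 1))"
  proof
    fix R assume "R \<in> {restrict_pred k P | P. SP 0 k P}"
    then obtain P p where "R = restrict_pred k P" "\<And>xs. length xs = k \<Longrightarrow> eval p xs = of_bool (P xs)"
      by (auto simp: PV.CP_def PVC_def)
    then have "R = restrict_pred k (\<lambda>xs. eval p xs = 1)" by (auto simp: restrict_pred_def fun_eq_iff)
    then show "R \<in> range (\<lambda>p. restrict_pred k (\<lambda>xs. eval p xs = 1))" by blast
  qed
  then show ?case by (rule countable_subset) simp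
next
  case (Suc i)
  let ?F = "\<lambda>(Q, p) xs. length xs = k \<and> (\<exists>y\<le>eval p xs. \<not> Q (y # xs))"
  have "{restrict_pred k P | P. SP (Suc i) k P} \<subseteq> ?F ` ({restrict_pred (Suc k) Q | Q. SP i (Suc k) Q} \<times> (UNIV :: pv set))"
  proof
    fix R assume "R \<in> {restrict_pred k P | P. SP (Suc i) k P}"
    then obtain P Q t where P: "R = restrict_pred k P" "SP i (Suc k) Q" "PVC k t"
      "\<And>xs. length xs = k \<Longrightarrow> P xs \<longleftrightarrow> (\<exists>y\<le>t xs. \<not> Q (y # xs))" by auto
    obtain p where p: "\<And>xs. length xs = k \<Longrightarrow> eval p xs = t xs" using P(3) by (auto simp: PVC_def)
    have "R = ?F (restrict_pred (Suc k) Q, p)" using P p by (auto simp: restrict_pred_def fun_eq_iff)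
    then show "R \<in> ?F ` ({restrict_pred (Suc k) Q | Q. SP i (Suc k) Q} \<times> (UNIV :: pv set))"
      using P(2) by (intro image_eqI[where x = "(restrict_pred (Suc k) Q, p)"]) auto
  qed
  then show ?case
    by (rule countable_subset) (intro countable_image countable_SIGMA Suc.IH countableI_type)
qed

text \<open>A function is determined by its program and by the restriction of its oracle predicate
  to lists of length 1. The enumeration is what numbers the lists of candidates.\<close>

lemma FD_enumeration:
  obtains E :: "nat \<Rightarrow> nat list \<Rightarrow> nat" where "\<And>n. FD i k (E n)" "\<And>f. FD i k f \<Longrightarrow> \<exists>n. \<forall>xs. length xs = k \<longrightarrow> f xs = E n xs"
proof -
  define rf where "rf f = (\<lambda>xs. if length xs = k then f xs else 0)" for f :: "nat list \<Rightarrow> nat"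
  define X where "X = {rf f | f. FD i k f}"
  define s0 where "s0 xs = (\<lambda>r. if 2 \<le> r \<and> r < 2 + k then bits (xs ! (r - 2)) else [])" for xs
  define G where "G = (\<lambda>(P, c) xs. if length xs = k then val ((THE s'. \<exists>t. exec (orc P) c (s0 xs) t s') (2 + k)) else 0)"
  have "X \<subseteq> G ` ({restrict_pred 1 P | P. SP i 1 P} \<times> (UNIV :: com set))"
  proof
    fix g assume "g \<in> X"
    then obtain f P where f: "g = rf f" "SP i 1 P" "pt (orc P) k f" by (auto simp: X_def FD_def)
    obtain c T where c: "computes (orc P) c k [2..<2 + k] (2 + k) (3 + k) T f"
      by (rule ptD[OF f(3), of "[2..<2 + k]" "3 + k" "2 + k"]) (auto simp del: upt_Suc)
    have eq: "orc (restrict_pred 1 P) = orc P" by (auto simp: orc_def restrict_pred_def)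
    have "(THE s'. \<exists>t. exec (orc P) c (s0 xs) t s') = (s0 xs)(2 + k := bits (f xs))" if l: "length xs = k" for xs
    proof -
      have "runs (orc P) c (s0 xs) (T xs) ((s0 xs)(2 + k := bits (f xs)))"
      proof (rule computesD[OF c l])
        fix j assume "j < k"
        moreover from this have "[2..<2 + k] ! j = 2 + j" by (intro nth_upt) simp
        ultimately show "s0 xs ([2..<2 + k] ! j) = bits (xs ! j)" by (simp only: s0_def) simp
      qed (auto simp: s0_def)
      then obtain t where "exec (orc P) c (s0 xs) t ((s0 xs)(2 + k := bits (f xs)))" by (auto simp: runs_def)
      then show ?thesis using exec_deterministic by (intro the_equality) blast+
    qed
    then have "g = G (restrict_pred 1 P, c)" by (simp only: f(1) rf_def G_def prod.case eq) (auto simp: fun_eq_iff)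
    then show "g \<in> G ` ({restrict_pred 1 P | P. SP i 1 P} \<times> (UNIV :: com set))"
      using f(2) by (intro image_eqI[where x = "(restrict_pred 1 P, c)"]) auto
  qed
  then have "countable X"
    by (rule countable_subset) (intro countable_image countable_SIGMA countable_SP countableI_type)
  moreover have "X \<noteq> {}" using FD.C_zero by (auto simp: X_def)
  ultimately have r: "range (from_nat_into X) = X" by (rule range_from_nat_into[rotated])
  show ?thesis
  proof (rule that[of "from_nat_into X"])
    fix n
    have "from_nat_into X n \<in> X" using r by blast
    then obtain f where "FD i k f" "from_nat_into X n = rf f" by (auto simp: X_def)
    then show "FD i k (from_nat_into X n)" by (auto intro: FD_ext simp: rf_def)
  next
    fix f assume "FD i k f"
    then have "rf f \<in> range (from_nat_into X)" unfolding r by (auto simp: X_def)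
    then obtain n where "rf f = from_nat_into X n" by blast
    then have "\<forall>xs. length xs = k \<longrightarrow> f xs = from_nat_into X n xs" by (metis rf_def)
    then show "\<exists>n. \<forall>xs. length xs = k \<longrightarrow> f xs = from_nat_into X n xs" by blast
  qed
qed

section \<open>Models of functions modulo an ultrafilter\<close>

text \<open>\<open>Cand r w\<close> is the value at \<open>w\<close> of the \<open>r\<close>-th list of candidates. An element of \<open>G\<close> may pick any
  entry of its list, which is what \<open>G_sharp\<close> expresses.\<close>

locale ultra_model =
  fixes i :: nat and F :: "'w filter" and G :: "('w \<Rightarrow> nat) set"
    and cf :: "nat \<Rightarrow> nat list \<Rightarrow> nat" and cg :: "nat \<Rightarrow> ('w \<Rightarrow> nat) list" and cq :: "nat \<Rightarrow> 'w \<Rightarrow> nat"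
    and Cand :: "nat \<Rightarrow> 'w \<Rightarrow> nat set"
  defines "Cand r w \<equiv> {cf r (j # map (\<lambda>g. g w) (cg r)) | j. j \<le> blen (cq r w)}"
  assumes ultra: "eventually P F \<or> eventually (\<lambda>w. \<not> P w) F" and nontriv: "F \<noteq> bot"
    and G_closed: "FD i (length gs) f \<Longrightarrow> set gs \<subseteq> G \<Longrightarrow> (\<lambda>w. f (map (\<lambda>g. g w) gs)) \<in> G"
    and G_sharp: "x \<in> G \<Longrightarrow> (\<And>w. g w \<le> blen (x w)) \<Longrightarrow> g \<in> G"
    and Cand_FD: "FD i (Suc (length (cg r))) (cf r)" "set (cg r) \<subseteq> G" "cq r \<in> G"
    and Cand_complete: "g \<in> G \<Longrightarrow> \<exists>r. \<forall>w. g w \<in> Cand r w"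
    and Cand_directed: "\<exists>s. \<forall>r'\<le>r. \<forall>w. Cand r' w \<subseteq> Cand s w"
begin

lemma ev_not: "eventually (\<lambda>w. \<not> P w) F \<longleftrightarrow> \<not> eventually P F"
  using ultra[of P] nontriv eventually_conj[of P F "\<lambda>w. \<not> P w"] by (auto simp: trivial_limit_def)

lemma ev_imp: "eventually (\<lambda>w. P w \<longrightarrow> Q w) F \<longleftrightarrow> (eventually P F \<longrightarrow> eventually Q F)"
proof
  assume "eventually P F \<longrightarrow> eventually Q F"
  then consider "eventually (\<lambda>w. \<not> P w) F" | "eventually Q F" using ev_not by blast
  then show "eventually (\<lambda>w. P w \<longrightarrow> Q w) F" by cases (auto elim: eventually_mono)
qed (auto elim: eventually_rev_mp)

lemma ev_disj: "eventually (\<lambda>w. P w \<or> Q w) F \<longleftrightarrow> eventually P F \<or> eventually Q F"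
  using ev_imp[of "\<lambda>w. \<not> P w" Q] ev_not[of P] by (simp add: imp_conv_disj)

text \<open>The quotient is not formed: equality is interpreted as equality almost everywhere, and
  \<open>gsat_cong\<close> stands for independence of representatives.\<close>

fun gsat :: "(nat \<Rightarrow> 'w \<Rightarrow> nat) \<Rightarrow> fm \<Rightarrow> bool" where
  "gsat e (s \<^bold>= t) \<longleftrightarrow> eventually (\<lambda>w. tval (\<lambda>n. e n w) s = tval (\<lambda>n. e n w) t) F"
| "gsat e (s \<^bold>\<le> t) \<longleftrightarrow> eventually (\<lambda>w. tval (\<lambda>n. e n w) s \<le> tval (\<lambda>n. e n w) t) F"
| "gsat e Fls \<longleftrightarrow> False"
| "gsat e (p \<^bold>\<longrightarrow> q) \<longleftrightarrow> (gsat e p \<longrightarrow> gsat e q)"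
| "gsat e (p \<^bold>\<and> q) \<longleftrightarrow> gsat e p \<and> gsat e q"
| "gsat e (p \<^bold>\<or> q) \<longleftrightarrow> gsat e p \<or> gsat e q"
| "gsat e (Forall p) \<longleftrightarrow> (\<forall>g\<in>G. gsat (case_nat g e) p)"
| "gsat e (Exists p) \<longleftrightarrow> (\<exists>g\<in>G. gsat (case_nat g e) p)"

lemma case_nat_app: "(\<lambda>n. case_nat g e n w) = case_nat (g w) (\<lambda>n. e n w)"
  by (auto simp: fun_eq_iff split: nat.split)

lemma gsat_subst: "gsat e (subst_fm \<sigma> p) \<longleftrightarrow> gsat (\<lambda>n w. tval (\<lambda>m. e m w) (\<sigma> n)) p"
proof (induction p arbitrary: e \<sigma>)
  case (Forall p)
  have "(\<lambda>n w. tval (\<lambda>m. case_nat g e m w) (up \<sigma> n)) = case_nat g (\<lambda>n w. tval (\<lambda>m. e m w) (\<sigma> n))" for g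
    by (auto simp: fun_eq_iff up_def case_nat_app split: nat.split)
  then show ?case by (simp add: Forall)
next
  case (Exists p)
  have "(\<lambda>n w. tval (\<lambda>m. case_nat g e m w) (up \<sigma> n)) = case_nat g (\<lambda>n w. tval (\<lambda>m. e m w) (\<sigma> n))" for g
    by (auto simp: fun_eq_iff up_def case_nat_app split: nat.split)
  then show ?case by (simp add: Exists)
qed (simp_all add: tval_subst)

lemma gsat_lift: "gsat (case_nat g e) (lift_fm p) \<longleftrightarrow> gsat e p"
  by (simp add: gsat_subst)

lemma gsat_inst: "gsat e (inst t p) \<longleftrightarrow> gsat (case_nat (\<lambda>w. tval (\<lambda>n. e n w) t) e) p"
proof -
  have "(\<lambda>n w. tval (\<lambda>m. e m w) (case_nat t Var n)) = case_nat (\<lambda>w. tval (\<lambda>n. e n w) t) e"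
    by (auto simp: fun_eq_iff split: nat.split)
  then show ?thesis by (simp add: gsat_subst)
qed

lemma ev_tval_cong:
  "(\<And>n. eventually (\<lambda>w. e n w = e' n w) F) \<Longrightarrow> eventually (\<lambda>w. tval (\<lambda>n. e n w) t = tval (\<lambda>n. e' n w) t) F"
proof (induction t)
  case (Fn f ts)
  have "eventually (\<lambda>w. \<forall>t\<in>set ts. tval (\<lambda>n. e n w) t = tval (\<lambda>n. e' n w) t) F"
    by (rule eventually_ball_finite) (use Fn in auto)
  then show ?case
  proof (rule eventually_mono)
    fix w assume "\<forall>t\<in>set ts. tval (\<lambda>n. e n w) t = tval (\<lambda>n. e' n w) t"
    then have "map (tval (\<lambda>n. e n w)) ts = map (tval (\<lambda>n. e' n w)) ts" by simp
    then show "tval (\<lambda>n. e n w) (Fn f ts) = tval (\<lambda>n. e' n w) (Fn f ts)" by (simp only: tval.simps)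
  qed
qed simp

lemma gsat_cong: "(\<And>n. eventually (\<lambda>w. e n w = e' n w) F) \<Longrightarrow> gsat e p \<Longrightarrow> gsat e' p"
proof (induction p arbitrary: e e')
  case (Eq s t)
  show ?case using ev_tval_cong[of e e' s, OF Eq(1)] ev_tval_cong[of e e' t, OF Eq(1)] Eq(2) unfolding gsat.simps
    by eventually_elim simp
next
  case (Le s t)
  show ?case using ev_tval_cong[of e e' s, OF Le(1)] ev_tval_cong[of e e' t, OF Le(1)] Le(2) unfolding gsat.simps
    by eventually_elim simp
next
  case (Imp p q)
  have "eventually (\<lambda>w. e' n w = e n w) F" for n using Imp.prems(1)[of n] by eventually_elim simp
  then show ?case using Imp by (metis gsat.simps(4))
next
  case (Forall p)
  have "eventually (\<lambda>w. case_nat g e n w = case_nat g e' n w) F" for g n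
    using Forall.prems(1) by (auto split: nat.split)
  then show ?case using Forall.IH Forall.prems(2) by simp blast
next
  case (Exists p)
  have "eventually (\<lambda>w. case_nat g e n w = case_nat g e' n w) F" for g n
    using Exists.prems(1) by (auto split: nat.split)
  then show ?case using Exists.IH Exists.prems(2) by simp blast
next
  case (Conj p q)
  then show ?case by (metis gsat.simps(5))
next
  case (Disj p q)
  then show ?case by (metis gsat.simps(6))
qed simp

section \<open>Soundness of natural deduction in the model\<close>

lemma G_PV: "PVC (length gs) f \<Longrightarrow> set gs \<subseteq> G \<Longrightarrow> (\<lambda>w. f (map (\<lambda>g. g w) gs)) \<in> G"
  by (intro G_closed FD.PVC_imp)

lemma G_const: "(\<lambda>_. c) \<in> G"
  using G_PV[of "[]" "\<lambda>_. c"] PVC_const by simp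

lemma G_tval: "wf_tm t \<Longrightarrow> range e \<subseteq> G \<Longrightarrow> (\<lambda>w. tval (\<lambda>n. e n w) t) \<in> G"
proof (induction t)
  case (Fn f ts)
  have "(\<lambda>w. eval f (map (\<lambda>g. g w) (map (\<lambda>t w. tval (\<lambda>n. e n w) t) ts))) \<in> G"
    by (rule G_PV) (use Fn PVC_pv[of f] in auto)
  then show ?case by (simp add: comp_def)
qed auto

lemma range_case_nat: "range (e :: nat \<Rightarrow> 'w \<Rightarrow> nat) \<subseteq> G \<Longrightarrow> g \<in> G \<Longrightarrow> range (case_nat g e) \<subseteq> G"
  by (auto simp: image_subset_iff split: nat.split)

theorem soundness: "\<Gamma> \<turnstile> p \<Longrightarrow> range e \<subseteq> G \<Longrightarrow> (\<And>q. q \<in> \<Gamma> \<Longrightarrow> gsat e q) \<Longrightarrow> gsat e p"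
proof (induction arbitrary: e rule: proves.induct)
  case (ForallI \<Gamma> p)
  have "gsat (case_nat g e) p" if "g \<in> G" for g
  proof (rule ForallI.IH)
    show "range (case_nat g e) \<subseteq> G" by (rule range_case_nat[OF ForallI.prems(1) that])
    fix q assume "q \<in> lift_fm ` \<Gamma>"
    then obtain r where "q = lift_fm r" "r \<in> \<Gamma>" by blast
    then show "gsat (case_nat g e) q" using ForallI.prems(2) by (simp only: gsat_lift)
  qed
  then show ?case by simp
next
  case (ForallE t \<Gamma> p)
  have "gsat e (Forall p)" by (rule ForallE.IH[OF ForallE.prems])
  then show ?case using G_tval[OF ForallE.hyps(1) ForallE.prems(1)] by (simp add: gsat_inst)
next
  case (ExistsI t p \<Gamma>)
  have "gsat e (inst t p)" by (rule ExistsI.IH[OF ExistsI.prems])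
  then have "gsat (case_nat (\<lambda>w. tval (\<lambda>n. e n w) t) e) p" by (simp only: gsat_inst)
  then show ?case using G_tval[OF ExistsI.hyps(1) ExistsI.prems(1)] by auto
next
  case (ExistsE \<Gamma> p q)
  have "gsat e (Exists p)" by (rule ExistsE.IH(1)[OF ExistsE.prems])
  then obtain g where g: "g \<in> G" "gsat (case_nat g e) p" by auto
  have "gsat (case_nat g e) (lift_fm q)"
  proof (rule ExistsE.IH(2))
    show "range (case_nat g e) \<subseteq> G" by (rule range_case_nat[OF ExistsE.prems(1) g(1)])
    fix r assume "r \<in> insert p (lift_fm ` \<Gamma>)"
    then consider "r = p" | r' where "r = lift_fm r'" "r' \<in> \<Gamma>" by blast
    then show "gsat (case_nat g e) r"
      by cases (use g ExistsE.prems(2) in \<open>simp_all only: gsat_lift\<close>)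
  qed
  then show ?case by (simp only: gsat_lift)
next
  case (EqSubst \<Gamma> s t p)
  have st: "eventually (\<lambda>w. tval (\<lambda>n. e n w) s = tval (\<lambda>n. e n w) t) F"
    using EqSubst.IH(1)[OF EqSubst.prems] by simp
  have "gsat (case_nat (\<lambda>w. tval (\<lambda>n. e n w) s) e) p" using EqSubst.IH(2)[OF EqSubst.prems] by (simp add: gsat_inst)
  then have "gsat (case_nat (\<lambda>w. tval (\<lambda>n. e n w) t) e) p"
    by (rule gsat_cong[rotated]) (use st in \<open>auto split: nat.split\<close>)
  then show ?case by (simp add: gsat_inst)
next
  case (DisjE \<Gamma> p q r)
  have "gsat e (p \<^bold>\<or> q)" using DisjE by blast
  then consider "gsat e p" | "gsat e q" by auto
  then show ?case
  proof cases
    case 1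
    then show ?thesis using DisjE.prems by (intro DisjE.IH(2)) auto
  next
    case 2
    then show ?thesis using DisjE.prems by (intro DisjE.IH(3)) auto
  qed
next
  case (Raa p \<Gamma>)
  show ?case
  proof (rule ccontr)
    assume "\<not> gsat e p"
    then have "gsat e Fls" using Raa.prems by (intro Raa.IH) auto
    then show False by simp
  qed
next
  case (ImpI p \<Gamma> q)
  then show ?case by (metis gsat.simps(4) insert_iff)
next
  case (ImpE \<Gamma> p q)
  then show ?case by (metis gsat.simps(4))
next
  case (ConjI \<Gamma> p q)
  then show ?case by simp
next
  case (ConjE1 \<Gamma> p q)
  then show ?case by (metis gsat.simps(5))
next
  case (ConjE2 \<Gamma> p q)
  then show ?case by (metis gsat.simps(5))
qed auto

lemma gsat_Forall_pow: "range e \<subseteq> G \<Longrightarrow> gsat e ((Forall ^^ n) p) \<Longrightarrow> e' = (\<lambda>m. if m < n then c m else e (m - n)) \<Longrightarrow>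
    (\<And>m. m < n \<Longrightarrow> c m \<in> G) \<Longrightarrow> gsat e' p"
proof (induction n arbitrary: e e' c)
  case (Suc n)
  have "gsat (case_nat (c n) e) ((Forall ^^ n) p)" using Suc.prems by simp
  then show ?case
  proof (rule Suc.IH[rotated])
    show "e' = (\<lambda>m. if m < n then c m else case_nat (c n) e (m - n))"
      unfolding Suc.prems(3) by (auto simp: fun_eq_iff less_Suc_eq split: nat.split) (metis Suc_diff_Suc diff_Suc_Suc linorder_neqE_nat nat.inject not_less_eq)+
  qed (use Suc.prems range_case_nat in auto)
qed simp

lemma gsat_univ_closure: "(\<And>e. range e \<subseteq> G \<Longrightarrow> gsat e p) \<Longrightarrow> range e \<subseteq> G \<Longrightarrow> gsat e (univ_closure p)"
proof -
  have "(\<And>e. range e \<subseteq> G \<Longrightarrow> gsat e p) \<Longrightarrow> range e \<subseteq> G \<Longrightarrow> gsat e ((Forall ^^ n) p)" for n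
  proof (induction n arbitrary: e)
    case (Suc n)
    then show ?case using range_case_nat by simp
  qed auto
  then show "(\<And>e. range e \<subseteq> G \<Longrightarrow> gsat e p) \<Longrightarrow> range e \<subseteq> G \<Longrightarrow> gsat e (univ_closure p)"
    unfolding univ_closure_def by blast
qed

text \<open>The shift of the environment vacates the places of the quantified variables;
  instantiating these with the values of \<open>e\<close> gives back \<open>e\<close>.\<close>

lemma gsat_univ_closureD:
  assumes "gsat (\<lambda>m. e (m + bnd_fm p)) (univ_closure p)" "range e \<subseteq> G"
  shows "gsat e p"
  by (rule gsat_Forall_pow[OF _ assms(1)[unfolded univ_closure_def], where c = e]) (use assms(2) in auto)

section \<open>Transfer of truth from the standard model\<close>

lemma gsat_BExists:
  "gsat e (BExists t p) \<longleftrightarrow> (\<exists>g\<in>G. eventually (\<lambda>w. g w \<le> tval (\<lambda>n. e n w) t) F \<and> gsat (case_nat g e) p)"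
  by (simp add: BExists_def case_nat_app)

lemma gsat_BForall:
  "gsat e (BForall t p) \<longleftrightarrow> (\<forall>g\<in>G. eventually (\<lambda>w. g w \<le> tval (\<lambda>n. e n w) t) F \<longrightarrow> gsat (case_nat g e) p)"
  by (simp add: BForall_def case_nat_app)

text \<open>The statement of the theorem of Los for one formula. It needs witnesses that are
  elements of \<open>G\<close>, which limits it to the levels up to \<open>i\<close>.\<close>

definition los :: "fm \<Rightarrow> bool" where
  "los p \<longleftrightarrow> (\<forall>e. range e \<subseteq> G \<longrightarrow> (gsat e p \<longleftrightarrow> eventually (\<lambda>w. natsat (\<lambda>n. e n w) p) F))"

lemma losD: "los p \<Longrightarrow> range e \<subseteq> G \<Longrightarrow> gsat e p \<longleftrightarrow> eventually (\<lambda>w. natsat (\<lambda>n. e n w) p) F"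
  unfolding los_def by blast

lemma los_conn: "los p \<Longrightarrow> los q \<Longrightarrow> los (p \<^bold>\<and> q)" "los p \<Longrightarrow> los q \<Longrightarrow> los (p \<^bold>\<or> q)" "los p \<Longrightarrow> los q \<Longrightarrow> los (p \<^bold>\<longrightarrow> q)"
  by (auto simp: los_def eventually_conj_iff ev_disj ev_imp)

lemma los_atom: "los Fls" "los (s \<^bold>= t)" "los (s \<^bold>\<le> t)"
  using nontriv by (simp_all add: los_def)

lemma los_BExists:
  assumes "los p" "\<And>e. range e \<subseteq> G \<Longrightarrow>
      eventually (\<lambda>w. \<exists>y\<le>tval (\<lambda>n. e n w) t. natsat (case_nat y (\<lambda>n. e n w)) p) F \<Longrightarrow>
      \<exists>g\<in>G. eventually (\<lambda>w. g w \<le> tval (\<lambda>n. e n w) t \<and> natsat (case_nat (g w) (\<lambda>n. e n w)) p) F"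
  shows "los (BExists t p)"
  unfolding los_def
proof (intro allI impI)
  fix e :: "nat \<Rightarrow> 'w \<Rightarrow> nat" assume e: "range e \<subseteq> G"
  have *: "gsat (case_nat g e) p \<longleftrightarrow> eventually (\<lambda>w. natsat (case_nat (g w) (\<lambda>n. e n w)) p) F" if "g \<in> G" for g
    using losD[OF assms(1) range_case_nat[OF e that]] by (simp add: case_nat_app)
  show "gsat e (BExists t p) \<longleftrightarrow> eventually (\<lambda>w. natsat (\<lambda>n. e n w) (BExists t p)) F"
  proof
    assume "gsat e (BExists t p)"
    then obtain g where "eventually (\<lambda>w. g w \<le> tval (\<lambda>n. e n w) t) F" "eventually (\<lambda>w. natsat (case_nat (g w) (\<lambda>n. e n w)) p) F"
      using * by (auto simp: gsat_BExists)
    then show "eventually (\<lambda>w. natsat (\<lambda>n. e n w) (BExists t p)) F" unfolding natsat_BExists by eventually_elim blast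
  next
    assume "eventually (\<lambda>w. natsat (\<lambda>n. e n w) (BExists t p)) F"
    then show "gsat e (BExists t p)" using assms(2)[OF e] * by (auto simp: gsat_BExists eventually_conj_iff)
  qed
qed

lemma los_BForall:
  assumes "los p" "\<And>e. range e \<subseteq> G \<Longrightarrow>
      eventually (\<lambda>w. \<exists>y\<le>tval (\<lambda>n. e n w) t. \<not> natsat (case_nat y (\<lambda>n. e n w)) p) F \<Longrightarrow>
      \<exists>g\<in>G. eventually (\<lambda>w. g w \<le> tval (\<lambda>n. e n w) t \<and> \<not> natsat (case_nat (g w) (\<lambda>n. e n w)) p) F"
  shows "los (BForall t p)"
  unfolding los_def
proof (intro allI impI)
  fix e :: "nat \<Rightarrow> 'w \<Rightarrow> nat" assume e: "range e \<subseteq> G"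
  have "los (BExists t (\<^bold>\<not> p))"
    by (rule los_BExists[OF los_conn(3)[OF assms(1) los_atom(1)]]) (simp add: assms(2))
  from losD[OF this e] show "gsat e (BForall t p) \<longleftrightarrow> eventually (\<lambda>w. natsat (\<lambda>n. e n w) (BForall t p)) F"
    using ev_not[of "\<lambda>w. natsat (\<lambda>n. e n w) (BForall t p)"]
    by (auto simp: gsat_BForall gsat_BExists)
qed

text \<open>The witness is chosen separately at every point, with no uniformity, and belongs to
  \<open>G\<close> because it is sharply bounded. The default 0 keeps it below the bound where there
  is no witness.\<close>

lemma sharp_witness:
  assumes "wf_tm (\<^bold>L t)" "range e \<subseteq> G" and ev: "eventually (\<lambda>w. \<exists>y\<le>tval (\<lambda>n. e n w) (\<^bold>L t). P w y) F"
  shows "\<exists>g\<in>G. eventually (\<lambda>w. g w \<le> tval (\<lambda>n. e n w) (\<^bold>L t) \<and> P w (g w)) F"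
proof -
  define g where "g w = (if \<exists>y\<le>tval (\<lambda>n. e n w) (\<^bold>L t). P w y then SOME y. y \<le> tval (\<lambda>n. e n w) (\<^bold>L t) \<and> P w y else 0)" for w
  have g: "g w \<le> tval (\<lambda>n. e n w) (\<^bold>L t) \<and> P w (g w)" if "\<exists>y\<le>tval (\<lambda>n. e n w) (\<^bold>L t). P w y" for w
    unfolding g_def using that by (simp only: if_True) (rule someI_ex)
  have "g w \<le> blen (tval (\<lambda>n. e n w) t)" for w
    using g[of w] by (cases "\<exists>y\<le>tval (\<lambda>n. e n w) (\<^bold>L t). P w y") (auto simp: g_def)
  then have "g \<in> G" using G_sharp[OF G_tval[of t e]] assms by auto
  then show ?thesis using g by (intro bexI[of _ g] eventually_mono[OF ev]) auto
qed

lemma los_sharp: "sharply_bounded p \<Longrightarrow> wf_fm p \<Longrightarrow> los p"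
proof (induction rule: sharply_bounded.induct)
  case (7 p t)
  then have "wf_tm (\<^bold>L t)" "los p" using wf_bnd_BForall[OF 7(3) order_refl] by auto
  then show ?case by (intro los_BForall sharp_witness)
next
  case (8 p t)
  then have "wf_tm (\<^bold>L t)" "los p" using wf_bnd_BExists[OF 8(3) order_refl] by auto
  then show ?case by (intro los_BExists sharp_witness)
qed (auto intro: los_conn los_atom)

text \<open>The bound \<open>t\<close> is an element of \<open>G\<close> and not a given function of
  \<open>gs\<close>; it is therefore passed to the search as an additional argument.\<close>

lemma G_witness:
  assumes "FD.CP i (Suc k) (\<lambda>zs. \<exists>y<hd zs. P y (tl zs))" "length gs = k" "set gs \<subseteq> G" "t \<in> G"
    and ev: "eventually (\<lambda>w. \<exists>y<t w. P y (map (\<lambda>g. g w) gs)) F"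
  shows "\<exists>g\<in>G. eventually (\<lambda>w. g w < t w \<and> P (g w) (map (\<lambda>g. g w) gs)) F"
proof -
  have "FD i (Suc (Suc k)) (\<lambda>zs. (\<lambda>zs. of_bool (\<exists>y<hd zs. P y (tl zs))) (map (\<lambda>g. g zs) (hd # map (\<lambda>i zs. zs ! (i + 2)) [0..<k])))"
    by (rule FD_comp[OF assms(1)[unfolded FD.CP_def]]) (auto intro: FD.C_hd FD.C_proj)
  then have "FD i (Suc (Suc k)) (\<lambda>zs. of_bool (\<exists>y<hd zs. P y (tl (tl zs))))"
  proof (rule FD_ext)
    fix zs :: "nat list" assume "length zs = Suc (Suc k)"
    then have "map (\<lambda>g. g zs) (map (\<lambda>i zs. zs ! (i + 2)) [0..<k]) = tl (tl zs)"
      by (intro nth_equalityI) (auto simp: nth_tl)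
    then show "(\<lambda>zs. of_bool (\<exists>y<hd zs. P y (tl zs))) (map (\<lambda>g. g zs) (hd # map (\<lambda>i zs. zs ! (i + 2)) [0..<k])) =
      of_bool (\<exists>y<hd zs. P y (tl (tl zs)))" by simp
  qed
  then have "FD.CP i (Suc (Suc k)) (\<lambda>zs. \<exists>y<hd zs. (\<lambda>y xs. P y (tl xs)) y (tl zs))" by (simp add: FD.CP_def)
  from FD.C_witness[OF this FD.C_hd] obtain r where r: "FD i (Suc k) r"
    "\<And>xs. length xs = Suc k \<Longrightarrow> \<exists>y<hd xs. P y (tl xs) \<Longrightarrow> r xs < hd xs \<and> P (r xs) (tl xs)" by blast
  have "(\<lambda>w. r (map (\<lambda>g. g w) (t # gs))) \<in> G" by (rule G_closed) (use r assms in auto)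
  then show ?thesis
    by (rule bexI[rotated]) (use r(2)[of "_ # map (\<lambda>g. g _) gs"] assms(2) in \<open>auto intro: eventually_mono[OF ev]\<close>)
qed

lemma SP_le: "SP j k P \<Longrightarrow> j \<le> n \<Longrightarrow> SP n k P"
  by (induction n) (auto simp: le_Suc_eq simp del: SP.simps intro: SP_lift)

lemma SP_skip2: "SP j (Suc k) P \<Longrightarrow> SP j (Suc (Suc k)) (\<lambda>ys. P (hd ys # tl (tl ys)))"
proof -
  assume "SP j (Suc k) P"
  then have "SP j (Suc (Suc k)) (\<lambda>zs. P (map (\<lambda>g. g zs) (hd # map (\<lambda>i zs. zs ! (i + 2)) [0..<k])))"
    by (rule SP_comp) (auto intro: PV.C_hd PVC_proj)
  then show ?thesis
  proof (rule SP_ext)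
    fix zs :: "nat list" assume "length zs = Suc (Suc k)"
    then have "map (\<lambda>g. g zs) (map (\<lambda>i zs. zs ! (i + 2)) [0..<k]) = tl (tl zs)"
      by (intro nth_equalityI) (auto simp: nth_tl)
    then show "P (map (\<lambda>g. g zs) (hd # map (\<lambda>i zs. zs ! (i + 2)) [0..<k])) = P (hd zs # tl (tl zs))" by simp
  qed
qed

text \<open>Up to level \<open>i\<close> the predicate with the bounded quantifier in front is still
  decided by an oracle for \<open>FD i\<close>, so the search for a witness stays in
  \<open>FD i\<close>.\<close>

lemma SP_witness:
  assumes P: "SP (Suc j) (Suc k) P" and j: "Suc j \<le> i" and t: "wf_tm t" "bnd_tm t \<le> k" and e: "range e \<subseteq> G"
    and ev: "eventually (\<lambda>w. \<exists>y\<le>tval (\<lambda>n. e n w) t. P (y # map (\<lambda>n. e n w) [0..<k])) F"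
  shows "\<exists>g\<in>G. eventually (\<lambda>w. g w \<le> tval (\<lambda>n. e n w) t \<and> P (g w # map (\<lambda>n. e n w) [0..<k])) F"
proof -
  have tv: "tval ((!) (map (\<lambda>n. e n w) [0..<k])) t = tval (\<lambda>n. e n w) t" for w
    by (rule tval_cong) (use t in auto)
  define Q where "Q y xs \<longleftrightarrow> y \<le> tval ((!) xs) t \<and> P (y # xs)" for y xs
  have T: "PVC (Suc (Suc k)) (\<lambda>zs. tval ((!) (tl (tl zs))) t)" by (intro PV.C_tl2' PVC_tval t)
  have "SP (Suc j) (Suc (Suc k)) (\<lambda>ys. hd ys < hd (tl ys) \<and> (hd ys \<le> tval ((!) (tl (tl ys))) t \<and> P (hd ys # tl (tl ys))))"
    by (intro SP_conj SP_skip2[OF P]) (intro SP_PV PV.CP_less PV.CP_le PV.C_hd PV.C_hd_tl T)+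
  from SP_ex[OF this PV.C_hd] have "SP (Suc j) (Suc k) (\<lambda>zs. \<exists>y<hd zs. Q y (tl zs))"
    by (rule SP_ext) (auto simp: Q_def intro: less_imp_le)
  then have 1: "FD.CP i (Suc k) (\<lambda>zs. \<exists>y<hd zs. Q y (tl zs))" using SP_imp_FD SP_le[OF _ j] by blast
  have 2: "(\<lambda>w. Suc (tval (\<lambda>n. e n w) t)) \<in> G"
    using G_tval[of "\<^bold>S t" e] t e by simp
  have 3: "eventually (\<lambda>w. \<exists>y<Suc (tval (\<lambda>n. e n w) t). Q y (map (\<lambda>g. g w) (map e [0..<k]))) F"
    using ev by (rule eventually_mono) (auto simp: Q_def comp_def tv less_Suc_eq_le)
  have 4: "length (map e [0..<k]) = k" "set (map e [0..<k]) \<subseteq> G" using e by auto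
  obtain g where "g \<in> G"
    "eventually (\<lambda>w. g w < Suc (tval (\<lambda>n. e n w) t) \<and> Q (g w) (map (\<lambda>g. g w) (map e [0..<k]))) F"
    using G_witness[OF 1 4 2 3] by blast
  then show ?thesis by (intro bexI[of _ g]) (auto simp: Q_def comp_def elim: eventually_mono)
qed

lemma natsat_list:
  assumes "bnd_fm p \<le> Suc k"
  shows "natsat ((!) (y # map (\<lambda>n. e n w) [0..<k])) p \<longleftrightarrow> natsat (case_nat y (\<lambda>n. e n w)) p"
  by (rule natsat_cong) (use assms in \<open>auto simp: nth_Cons split: nat.split\<close>)

theorem los_Sigma:
  "SigmaB j p \<Longrightarrow> j \<le> i \<Longrightarrow> wf_fm p \<Longrightarrow> los p"
  "PiB j p \<Longrightarrow> j \<le> i \<Longrightarrow> wf_fm p \<Longrightarrow> los p"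
proof (induction rule: SigmaB_PiB.inducts)
  case (1 p j)
  then show ?case by (intro los_sharp)
next
  case (7 j p t)
  then have "wf_tm (\<^bold>L t)" "los p" using wf_bnd_BForall[OF 7(4) order_refl] by auto
  then show ?case by (intro los_BForall sharp_witness)
next
  case (8 j p t)
  define k where "k = bnd_fm (BExists t p)"
  have w: "wf_tm t" "bnd_tm t \<le> k" "wf_fm p" "bnd_fm p \<le> Suc k" using wf_bnd_BExists[OF 8(4)] by (auto simp: k_def)
  have "SP (Suc j) (Suc k) (\<lambda>xs. natsat ((!) xs) p)" by (rule SP_natsat(1)) (use 8 w in auto)
  from SP_witness[OF this 8(3) w(1,2)] show ?case
    using 8 w by (intro los_BExists) (simp_all only: natsat_list[OF w(4)])
next
  case (9 p j)
  then show ?case by (intro los_sharp)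
next
  case (15 j p t)
  then have "wf_tm (\<^bold>L t)" "los p" using wf_bnd_BExists[OF 15(4) order_refl] by auto
  then show ?case by (intro los_BExists sharp_witness)
next
  case (16 j p t)
  define k where "k = bnd_fm (BForall t p)"
  have w: "wf_tm t" "bnd_tm t \<le> k" "wf_fm p" "bnd_fm p \<le> Suc k" using wf_bnd_BForall[OF 16(4)] by (auto simp: k_def)
  have "SP (Suc j) (Suc k) (\<lambda>xs. \<not> natsat ((!) xs) p)" by (rule SP_natsat(2)) (use 16 w in auto)
  from SP_witness[OF this 16(3) w(1,2)] show ?case
    using 16 w by (intro los_BForall) (simp_all only: natsat_list[OF w(4)])
qed (auto intro: los_conn)

lemma gsat_true_axiom:
  assumes "sharply_bounded p" "wf_fm p" "\<And>e. natsat e p" "range e \<subseteq> G"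
  shows "gsat e (univ_closure p)"
  by (rule gsat_univ_closure[OF _ assms(4)]) (simp add: losD[OF los_sharp[OF assms(1,2)]] assms(3))

text \<open>If \<open>p\<close> held at 0 and failed at \<open>a\<close>, bisection would give an
  element of \<open>G\<close> at which \<open>p\<close> holds almost everywhere and the next value
  of which makes \<open>p\<close> fail, against the induction step.\<close>

lemma IND_sound:
  assumes p: "SigmaB i p" "wf_fm p" and e: "range e \<subseteq> G"
  shows "gsat e (IND p)"
proof -
  have lp: "los p" by (rule los_Sigma(1)[OF p(1) _ p(2)]) simp
  have sat: "gsat (case_nat g e) p \<longleftrightarrow> eventually (\<lambda>w. natsat (case_nat (g w) (\<lambda>n. e n w)) p) F" if "g \<in> G" for g
    using losD[OF lp range_case_nat[OF e that]] by (simp add: case_nat_app)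
  have step: "gsat (case_nat g e) (subst_fm (case_nat (\<^bold>S (Var 0)) (\<lambda>n. Var (Suc n))) p) \<longleftrightarrow>
    gsat (case_nat (\<lambda>w. Suc (g w)) e) p" for g
  proof -
    have "(\<lambda>n w. tval (\<lambda>m. case_nat g e m w) (case_nat (\<^bold>S (Var 0)) (\<lambda>n. Var (Suc n)) n)) = case_nat (\<lambda>w. Suc (g w)) e"
      by (auto simp: fun_eq_iff split: nat.split)
    then show ?thesis by (simp add: gsat_subst)
  qed
  have "gsat (case_nat a e) p" if base: "gsat (case_nat (\<lambda>_. 0) e) p"
    and ind: "\<And>g. g \<in> G \<Longrightarrow> gsat (case_nat g e) p \<Longrightarrow> gsat (case_nat (\<lambda>w. Suc (g w)) e) p" and a: "a \<in> G" for a
  proof (rule ccontr)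
    assume "\<not> gsat (case_nat a e) p"
    then have na: "eventually (\<lambda>w. \<not> natsat (case_nat (a w) (\<lambda>n. e n w)) p) F" using sat[OF a] ev_not by blast
    have ba: "eventually (\<lambda>w. natsat (case_nat 0 (\<lambda>n. e n w)) p) F" using base sat[OF G_const] by simp
    define k where "k = bnd_fm p"
    have "SP i (Suc k) (\<lambda>xs. natsat ((!) xs) p)" by (rule SP_natsat(1)[OF p]) (simp add: k_def)
    then have "FD.CP i (Suc (Suc k)) (\<lambda>zs. natsat ((!) (hd zs # tl (tl zs))) p)" by (intro SP_imp_FD SP_skip2)
    \<comment> \<open>The conjunct \<open>hd zs \<le> hd (tl zs)\<close> makes the predicate false
      at the upper end of the search, a power of two above \<open>a\<close>. The search may then
      also stop at \<open>a\<close> itself, which is excluded at the end.\<close>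
    then have "FD.CP i (Suc (Suc k)) (\<lambda>zs. hd zs \<le> hd (tl zs) \<and> natsat ((!) (hd zs # tl (tl zs))) p)"
      by (intro FD.CP_conj FD.CP_le FD.C_hd FD.C_hd_tl)
    from FD.C_bisect[of i "Suc k" "\<lambda>z xs. z \<le> hd xs \<and> natsat ((!) (z # tl xs)) p", OF this FD.C_hd]
    obtain r where r: "FD i (Suc k) r" "\<And>xs. length xs = Suc k \<Longrightarrow> 0 \<le> hd xs \<and> natsat ((!) (0 # tl xs)) p \<Longrightarrow>
        \<not> (2 ^ blen (hd xs) \<le> hd xs \<and> natsat ((!) (2 ^ blen (hd xs) # tl xs)) p) \<Longrightarrow>
        (r xs \<le> hd xs \<and> natsat ((!) (r xs # tl xs)) p) \<and> \<not> (Suc (r xs) \<le> hd xs \<and> natsat ((!) (Suc (r xs) # tl xs)) p)"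
      by blast
    define g where "g w = r (a w # map (\<lambda>n. e n w) [0..<k])" for w
    have "(\<lambda>w. r (map (\<lambda>g. g w) (a # map e [0..<k]))) \<in> G"
      by (rule G_closed) (use r(1) a e in auto)
    then have g: "g \<in> G" by (simp add: g_def[abs_def] comp_def)
    have nl: "natsat ((!) (y # map (\<lambda>n. e n w) [0..<k])) p \<longleftrightarrow> natsat (case_nat y (\<lambda>n. e n w)) p" for y w
      by (rule natsat_list) (simp add: k_def)
    have gr: "g w \<le> a w \<and> natsat (case_nat (g w) (\<lambda>n. e n w)) p \<and>
        \<not> (Suc (g w) \<le> a w \<and> natsat (case_nat (Suc (g w)) (\<lambda>n. e n w)) p)"
      if "natsat (case_nat 0 (\<lambda>n. e n w)) p" for w
    proof -
      have "\<not> 2 ^ blen (a w) \<le> a w" using less_power_blen[of "a w"] by simp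
      then show ?thesis using r(2)[of "a w # map (\<lambda>n. e n w) [0..<k]"] that by (simp add: nl g_def)
    qed
    have "eventually (\<lambda>w. natsat (case_nat (g w) (\<lambda>n. e n w)) p) F" using ba by eventually_elim (use gr in blast)
    then have "gsat (case_nat (\<lambda>w. Suc (g w)) e) p" using ind[OF g] sat[OF g] by blast
    moreover have "(\<lambda>w. Suc (g w)) \<in> G" using G_tval[of "\<^bold>S (Var 0)" "\<lambda>_. g"] g by auto
    ultimately have "eventually (\<lambda>w. natsat (case_nat (Suc (g w)) (\<lambda>n. e n w)) p) F" using sat by blast
    then have "eventually (\<lambda>w. False) F" using ba na
    proof eventually_elim
      case (elim w)
      then have "g w = a w" using gr[of w] by auto
      then show ?case using gr[of w] elim by simp
    qed
    then show False using nontriv by simp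
  qed
  then show ?thesis unfolding IND_def by (simp add: gsat_inst step)
qed

end

section \<open>Truth of the axioms of the base theory\<close>

fun qf :: "fm \<Rightarrow> bool" where
  "qf (p \<^bold>\<longrightarrow> q) \<longleftrightarrow> qf p \<and> qf q"
| "qf (p \<^bold>\<and> q) \<longleftrightarrow> qf p \<and> qf q"
| "qf (p \<^bold>\<or> q) \<longleftrightarrow> qf p \<and> qf q"
| "qf (Forall p) \<longleftrightarrow> False"
| "qf (Exists p) \<longleftrightarrow> False"
| "qf p \<longleftrightarrow> True"

lemma qf_sharp: "qf p \<Longrightarrow> sharply_bounded p"
  by (induction p) (auto intro: sharply_bounded.intros)

lemma BASIC_true:
  assumes "p \<in> BASIC"
  obtains q where "p = univ_closure q" "qf q" "wf_fm q" "\<And>e. natsat e q"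
proof -
  have 1: "blen (Suc 0) = Suc 0" using blen_power[of 0] by simp
  have 2: "0 < x \<Longrightarrow> blen (Suc (x + x)) = Suc (blen x)" "0 < x \<Longrightarrow> blen (x + x) = Suc (blen x)" for x
    using blen_step[of x True] blen_step[of x False] by (simp_all add: mult_2)
  have 3: "(x = y div 2 \<longrightarrow> y div 2 + y div 2 = y \<or> Suc (y div 2 + y div 2) = y) \<and>
      (x + x = y \<longrightarrow> x = y div 2) \<and> (Suc (x + x) = y \<longrightarrow> x = y div 2)" for x y :: nat
    by presburger
  have "\<exists>q. p = univ_closure q \<and> qf q \<and> wf_fm q \<and> (\<forall>e. natsat e q)"
    using assms unfolding BASIC_def Let_def image_iff
    apply (elim bexE)
    subgoal for q
      apply (rule exI[of _ q])
      apply (elim insertE emptyE)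
      apply (simp_all add: blen_0 1 2 blen_power floorlog_mono algebra_simps power_add)
      subgoal using nat_le_linear by blast
      subgoal using blen_double by blast
      subgoal using 3 by blast
      done
    done
  then show ?thesis using that by blast
qed

lemma limited_rec_double:
  "limited_rec a h0 h1 l 0 = a"
  "0 < x \<Longrightarrow> limited_rec a h0 h1 l (x + x) =
     (let v = h0 x (limited_rec a h0 h1 l x) in if blen v \<le> blen (l (x + x)) then v else l (x + x))"
  "limited_rec a h0 h1 l (Suc (x + x)) =
     (let v = h1 x (limited_rec a h0 h1 l x) in if blen v \<le> blen (l (Suc (x + x))) then v else l (Suc (x + x)))"
  using limited_rec_step[of x False] limited_rec_step[of x True]
  by (auto simp: Let_def mult_2) (subst limited_rec.simps, simp)

lemma PV_axioms_true:
  assumes "p \<in> PV_axioms"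
  obtains q where "p = univ_closure q" "qf q" "wf_fm q" "\<And>e. natsat e q"
proof -
  obtain f q where f: "wf_pv f" "q \<in> def_axioms f" "p = univ_closure q" using assms by (auto simp: PV_axioms_def)
  have "qf q \<and> wf_fm q \<and> (\<forall>e. natsat e q)"
  proof (cases f)
    case (Proj n i)
    then show ?thesis using f by auto
  next
    case (Comp n g gs)
    then show ?thesis using f by (auto simp: Let_def comp_def)
  next
    case (Rec g h0 h1 k)
    let ?ys = "map Var [1..<Suc (arity g)]"
    have wy: "\<forall>t\<in>set ?ys. wf_tm t" "length ?ys = arity g" by auto
    have "natsat e q" for e
      using f(2) unfolding Rec
      by (auto simp: Let_def rec_axiom_def comp_def limited_rec_double simp del: upt_Suc)
    moreover have "qf q" using f(2) unfolding Rec by (auto simp: Let_def rec_axiom_def)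
    moreover have "wf_fm q" using f(1,2) wy unfolding Rec by (auto simp: Let_def rec_axiom_def simp del: upt_Suc)
    ultimately show ?thesis by blast
  qed (use f in auto)
  then show ?thesis using that f(3) by blast
qed

theorem (in ultra_model) T2_sound: "p \<in> T2 i \<Longrightarrow> range e \<subseteq> G \<Longrightarrow> gsat e p"
  unfolding T2_def
proof (elim UnE)
  assume e: "range e \<subseteq> G"
  {
    assume "p \<in> BASIC"
    from BASIC_true[OF this] obtain q where q: "p = univ_closure q" "qf q" "wf_fm q" "\<And>e. natsat e q" by blast
    show "gsat e p" unfolding q(1) by (rule gsat_true_axiom[OF qf_sharp[OF q(2)] q(3,4) e])
  next
    assume "p \<in> PV_axioms"
    from PV_axioms_true[OF this] obtain q where q: "p = univ_closure q" "qf q" "wf_fm q" "\<And>e. natsat e q" by blast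
    show "gsat e p" unfolding q(1) by (rule gsat_true_axiom[OF qf_sharp[OF q(2)] q(3,4) e])
  next
    assume "p \<in> scheme IND (SigmaB i)"
    then obtain q where q: "p = univ_closure (IND q)" "wf_fm q" "SigmaB i q" by (auto simp: scheme_def)
    show "gsat e p" unfolding q(1) by (rule gsat_univ_closure[OF IND_sound[OF q(3,2)] e])
  }
qed

section \<open>Bounded collection in the model\<close>

lemma (in fclass) CP_comp: "CP l P \<Longrightarrow> length gs = l \<Longrightarrow> \<forall>g\<in>set gs. C k g \<Longrightarrow> CP k (\<lambda>xs. P (map (\<lambda>g. g xs) gs))"
  unfolding CP_def by (rule C_comp)

text \<open>Take the instance that is solved last.\<close>

lemma ex_hardest:
  fixes D :: "nat \<Rightarrow> 'a \<Rightarrow> bool"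
  assumes "finite S" "S \<noteq> {}" and mono: "\<And>r r' j. r \<le> r' \<Longrightarrow> D r j \<Longrightarrow> D r' j"
  shows "\<exists>j\<in>S. \<forall>r. D r j \<longrightarrow> (\<forall>j'\<in>S. D r j')"
proof (rule ccontr)
  assume "\<not> ?thesis"
  then obtain \<rho> where \<rho>: "\<And>j. j \<in> S \<Longrightarrow> D (\<rho> j) j \<and> (\<exists>j'\<in>S. \<not> D (\<rho> j) j')" by metis
  have "Max (\<rho> ` S) \<in> \<rho> ` S" using assms by (intro Max_in) auto
  then obtain j where j: "j \<in> S" "\<rho> j = Max (\<rho> ` S)" by auto
  obtain j' where j': "j' \<in> S" "\<not> D (\<rho> j) j'" using \<rho>[OF j(1)] by blast
  have "\<rho> j' \<le> \<rho> j" using j' j assms by auto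
  then show False using mono \<rho>[OF j'(1)] j'(2) by blast
qed

context ultra_model
begin

text \<open>A selection from a list is given by its index, which is sharply bounded and therefore in
  \<open>G\<close>.\<close>

lemma Cand_in_G:
  assumes "\<And>w. g w \<in> Cand r w" shows "g \<in> G"
proof -
  have "\<exists>j. j \<le> blen (cq r w) \<and> g w = cf r (j # map (\<lambda>g. g w) (cg r))" for w
    using assms[of w] unfolding Cand_def by blast
  then obtain d where d: "\<And>w. d w \<le> blen (cq r w)" "\<And>w. g w = cf r (d w # map (\<lambda>g. g w) (cg r))" by metis
  have "d \<in> G" by (rule G_sharp[OF Cand_FD(3) d(1)])
  then have "(\<lambda>w. cf r (map (\<lambda>g. g w) (d # cg r))) \<in> G"
    by (intro G_closed) (use Cand_FD in auto)
  moreover have "g = (\<lambda>w. cf r (map (\<lambda>g. g w) (d # cg r)))" using d(2) by (simp add: fun_eq_iff)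
  ultimately show ?thesis by simp
qed

lemma Cand_nonempty: "cf r (0 # map (\<lambda>g. g w) (cg r)) \<in> Cand r w"
  unfolding Cand_def by blast

text \<open>For every \<open>j\<close> the function \<open>Y\<close> searches the list for an entry
  \<open>y\<close> such that some entry \<open>z\<close> satisfies \<open>P\<close>. The list is
  short and \<open>P\<close> decidable in \<open>FD i\<close>, so the search is uniform in
  \<open>j\<close> and its results can be coded as one sequence. The entries \<open>z\<close> are
  searched for but not recorded.\<close>

lemma collect_sequence:
  assumes P: "FD.CP i (n + 3) P" and gs: "length gs = n" "set gs \<subseteq> G" and x: "x \<in> G" and t: "t \<in> G"
    and ev: "eventually (\<lambda>w. \<forall>j\<le>blen (x w). \<exists>y\<in>Cand s w. \<exists>z\<in>Cand s w. y \<le> t w \<and> P (z # y # j # map (\<lambda>g. g w) gs)) F"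
  shows "\<exists>W\<in>G. eventually (\<lambda>w. \<forall>j\<le>blen (x w). eval beta [W w, j] \<le> t w \<and>
      (\<exists>z\<in>Cand s w. P (z # eval beta [W w, j] # j # map (\<lambda>g. g w) gs))) F"
proof -
  define m where "m = length (cg s)"
  define K where "K = 3 + m + n"
  \<comment> \<open>All parameters in one list. Behind \<open>a\<close> searched or indexed
    variables, \<open>CG a\<close> and \<open>E a\<close> cut out the arguments of the list of
    candidates and the parameters of \<open>P\<close>.\<close>
  define I where "I = x # t # cq s # cg s @ gs"
  define Iv where "Iv w = map (\<lambda>g. g w) I" for w
  have I: "length I = K" "set I \<subseteq> G" using gs x t Cand_FD[of s] by (auto simp: I_def K_def m_def)
  define CG where "CG a zs = map (\<lambda>l. zs ! (a + 3 + l)) [0..<m]" for a and zs :: "nat list"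
  define E where "E a zs = map (\<lambda>l. zs ! (a + 3 + m + l)) [0..<n]" for a and zs :: "nat list"
  have pre: "(p @ Iv w) ! (length p) = x w" "(p @ Iv w) ! (length p + 1) = t w" "(p @ Iv w) ! (length p + 2) = cq s w"
    "CG (length p) (p @ Iv w) = map (\<lambda>g. g w) (cg s)" "E (length p) (p @ Iv w) = map (\<lambda>g. g w) gs" for p w
    unfolding CG_def E_def Iv_def I_def using gs(1)
    by (auto simp: nth_append m_def numeral_3_eq_3 numeral_2_eq_2 intro!: nth_equalityI)
  have FV: "FD i (a + K) (\<lambda>zs. cf s (b zs # CG a zs))" if "FD i (a + K) b" for a b
  proof -
    have "FD i (a + K) (\<lambda>zs. cf s (map (\<lambda>g. g zs) (b # map (\<lambda>l zs. zs ! (a + 3 + l)) [0..<m])))"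
      by (rule FD_comp[OF Cand_FD(1)]) (use that in \<open>auto simp: m_def K_def intro!: FD.C_proj\<close>)
    then show ?thesis by (simp add: CG_def comp_def)
  qed
  define R where "R zs \<longleftrightarrow> cf s (zs ! 1 # CG 3 zs) \<le> zs ! (3 + 1) \<and>
     P (cf s (zs ! 0 # CG 3 zs) # cf s (zs ! 1 # CG 3 zs) # zs ! 2 # E 3 zs)" for zs
  have f: "FD i (3 + K) (\<lambda>zs. cf s (zs ! 0 # CG 3 zs))" "FD i (3 + K) (\<lambda>zs. cf s (zs ! 1 # CG 3 zs))"
    by (rule FV, rule FD.C_proj, simp)+
  have "FD.CP i (3 + K) (\<lambda>zs. P (map (\<lambda>g. g zs) ((\<lambda>zs. cf s (zs ! 0 # CG 3 zs)) # (\<lambda>zs. cf s (zs ! 1 # CG 3 zs)) # (\<lambda>zs. zs ! 2) #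
      map (\<lambda>l zs. zs ! (3 + 3 + m + l)) [0..<n])))"
    by (rule FD.CP_comp[OF P]) (use f in \<open>auto simp: K_def intro!: FD.C_proj\<close>)
  then have "FD.CP i (3 + K) (\<lambda>zs. P (cf s (zs ! 0 # CG 3 zs) # cf s (zs ! 1 # CG 3 zs) # zs ! 2 # E 3 zs))"
    by (simp add: E_def comp_def)
  then have R: "FD.CP i (3 + K) R" unfolding R_def
    by (intro FD.CP_conj FD.CP_le FV FD.C_proj) (auto simp: K_def)
  have R1: "FD.CP i (Suc (2 + K)) (\<lambda>zs. R (hd zs # tl zs))"
    by (rule FD.CP_ext[of i _ R]) (use R in \<open>auto simp: length_Suc_conv numeral_3_eq_3\<close>)
  define R2 where "R2 zs \<longleftrightarrow> (\<exists>c<blen (Suc (2 * zs ! (2 + 2))). R (c # zs))" for zs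
  have R2: "FD.CP i (2 + K) R2" unfolding R2_def
    by (rule FD.CP_ex[OF R1]) (auto simp: K_def intro!: FD.C_dbl1 FD.C_proj)
  have R3: "FD.CP i (Suc (1 + K)) (\<lambda>zs. R2 (hd zs # tl zs))"
    by (rule FD.CP_ext[of i _ R2]) (use R2 in \<open>auto simp: length_Suc_conv\<close>)
  have u: "FD i (1 + K) (\<lambda>zs. Suc (2 * zs ! (1 + 2)))" by (auto simp: K_def intro!: FD.C_dbl1 FD.C_proj)
  obtain \<mu> where \<mu>: "FD i (1 + K) \<mu>" "\<And>xs. length xs = 1 + K \<Longrightarrow> \<exists>b<blen (Suc (2 * xs ! (1 + 2))). R2 (b # xs) \<Longrightarrow>
      \<mu> xs < blen (Suc (2 * xs ! (1 + 2))) \<and> R2 (\<mu> xs # xs)"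
  proof (rule FD.C_least[where P = "\<lambda>b xs. R2 (b # xs)", OF R3 u])
    fix m assume m: "FD i (1 + K) m" "\<And>xs. length xs = 1 + K \<Longrightarrow> \<exists>b<blen (Suc (2 * xs ! (1 + 2))). R2 (b # xs) \<Longrightarrow>
        m xs < blen (Suc (2 * xs ! (1 + 2))) \<and> R2 (m xs # xs) \<and> (\<forall>b<m xs. \<not> R2 (b # xs))"
    show thesis by (rule that[OF m(1)], drule (1) m(2), blast)
  qed
  define Y where "Y zs = cf s (\<mu> zs # CG 1 zs)" for zs
  have Y: "FD i (1 + K) Y" unfolding Y_def by (rule FV[OF \<mu>(1)])
  have "FD i (Suc K) (\<lambda>zs. Y (hd zs # tl zs))"
    by (rule FD_ext[of i _ Y]) (use Y in \<open>auto simp: length_Suc_conv\<close>)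
  then have "FD i K (\<lambda>xs. code (blen (xs ! 1)) (map (\<lambda>j. Y (j # xs)) [0..<blen (Suc (2 * xs ! 0))]))"
    by (rule FD.C_seq) (auto simp: K_def intro!: FD.C_dbl1 FD.C_proj)
  then have W: "(\<lambda>w. code (blen (Iv w ! 1)) (map (\<lambda>j. Y (j # Iv w)) [0..<blen (Suc (2 * Iv w ! 0))])) \<in> G"
    unfolding Iv_def by (intro G_closed) (use I in auto)
  define W where "W w = code (blen (t w)) (map (\<lambda>j. Y (j # Iv w)) [0..<blen (Suc (2 * x w))])" for w
  have "W \<in> G" using W pre(1,2)[of "[]"] by (simp add: W_def[abs_def])
  moreover have "eventually (\<lambda>w. \<forall>j\<le>blen (x w). eval beta [W w, j] \<le> t w \<and>
      (\<exists>z\<in>Cand s w. P (z # eval beta [W w, j] # j # map (\<lambda>g. g w) gs))) F"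
    using ev
  proof (rule eventually_mono)
    fix w
    assume *: "\<forall>j\<le>blen (x w). \<exists>y\<in>Cand s w. \<exists>z\<in>Cand s w. y \<le> t w \<and> P (z # y # j # map (\<lambda>g. g w) gs)"
    have Rw: "R (c # b # j # Iv w) \<longleftrightarrow> cf s (b # map (\<lambda>g. g w) (cg s)) \<le> t w \<and>
        P (cf s (c # map (\<lambda>g. g w) (cg s)) # cf s (b # map (\<lambda>g. g w) (cg s)) # j # map (\<lambda>g. g w) gs)" for c b j
      using pre[of "[c, b, j]" w] by (simp add: R_def numeral_3_eq_3 numeral_2_eq_2)
    have R2w: "R2 (b # j # Iv w) \<longleftrightarrow> (\<exists>c\<le>blen (cq s w). R (c # b # j # Iv w))" for b j
      using pre(3)[of "[]" w, unfolded append_Nil list.size add_0] by (simp add: R2_def le_blen_iff)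
    have len: "length (j # Iv w) = 1 + K" for j using I by (simp add: Iv_def)
    have q: "(j # Iv w) ! (1 + 2) = cq s w" for j using pre(3)[of "[j]" w] by simp
    have Yj: "Y (j # Iv w) \<le> t w \<and> (\<exists>z\<in>Cand s w. P (z # Y (j # Iv w) # j # map (\<lambda>g. g w) gs))" if j: "j \<le> blen (x w)" for j
    proof -
      obtain b c where "b \<le> blen (cq s w)" "c \<le> blen (cq s w)" "R (c # b # j # Iv w)"
        using * j unfolding Rw Cand_def by blast
      then have "\<exists>b<blen (Suc (2 * (j # Iv w) ! (1 + 2))). R2 (b # j # Iv w)"
        unfolding q R2w le_blen_iff[symmetric] by blast
      from \<mu>(2)[OF len this] have "R2 (\<mu> (j # Iv w) # j # Iv w)" by blast
      then obtain c where c: "c \<le> blen (cq s w)" "R (c # \<mu> (j # Iv w) # j # Iv w)" unfolding R2w by blast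
      have "Y (j # Iv w) = cf s (\<mu> (j # Iv w) # map (\<lambda>g. g w) (cg s))"
        using pre(4)[of "[j]" w] by (simp add: Y_def)
      then show ?thesis using c unfolding Rw Cand_def by auto
    qed
    have "\<forall>z\<in>set (map (\<lambda>j. Y (j # Iv w)) [0..<blen (Suc (2 * x w))]). z < 2 ^ blen (t w)"
      using le_less_trans[OF conjunct1[OF Yj] less_power_blen[of "t w"]] by (auto simp: le_blen_iff[symmetric])
    from beta_code[OF this] have "eval beta [W w, j] = Y (j # Iv w)" if "j \<le> blen (x w)" for j
      using that unfolding W_def le_blen_iff by simp
    then show "\<forall>j\<le>blen (x w). eval beta [W w, j] \<le> t w \<and>
      (\<exists>z\<in>Cand s w. P (z # eval beta [W w, j] # j # map (\<lambda>g. g w) gs))" using Yj by simp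
  qed
  ultimately show ?thesis by blast
qed

text \<open>The premise is used for a single element \<open>J\<close>. This function is chosen with
  no regard to computability, but it is sharply bounded and hence in \<open>G\<close>. A solution
  consists of \<open>y\<close> and of a witness \<open>z\<close> for the leading quantifier of
  \<open>p\<close>, and both have to be found in lists.\<close>

theorem BB_sound:
  assumes p: "strict_SigmaB (Suc i) p" "wf_fm p" and e: "range e \<subseteq> G"
  shows "gsat e (BB p)"
proof -
  obtain t' q where q: "p = BExists t' q" "strict_PiB i q" using p(1) by auto
  \<comment> \<open>The variables \<open>y\<close> and \<open>j\<close> stand before the parameters,
    of which \<open>bnd_fm p\<close> are listed.\<close>
  define k where "k = bnd_fm p + 2"
  have w: "wf_tm t'" "bnd_tm t' \<le> k" "wf_fm q" "bnd_fm q \<le> Suc k"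
    using wf_bnd_BExists[of t' q k] p(2) q(1) by (auto simp: k_def)
  have lq: "los q" by (rule los_Sigma(2)[OF _ _ w(3)]) (use strict_imp_SigmaB q in auto)
  define n where "n = bnd_fm p"
  have SPq: "SP i (Suc k) (\<lambda>xs. \<not> natsat ((!) xs) q)"
    by (rule SP_natsat(2)[OF _ w(3,4)]) (use strict_imp_SigmaB q in auto)
  have "FD.CP i (Suc k) (\<lambda>xs. \<not> \<not> natsat ((!) xs) q)" by (rule FD.CP_not[OF SP_imp_FD[OF SPq]])
  then have FDq: "FD.CP i (n + 3) (\<lambda>xs. natsat ((!) xs) q)" by (simp add: k_def n_def numeral_3_eq_3)
  have FDt: "FD i (Suc k) (\<lambda>zs. tval ((!) (tl zs)) t')" by (rule FD.C_tl[OF FD.PVC_imp[OF PVC_tval[OF w(1,2)]]])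
  define P where "P zs \<longleftrightarrow> hd zs \<le> tval ((!) (tl zs)) t' \<and> natsat ((!) zs) q" for zs
  have P: "FD.CP i (n + 3) P"
    unfolding P_def by (intro FD.CP_conj FD.CP_le FDq) (use FDt FD.C_hd[of i "n + 2"] in \<open>simp_all add: k_def n_def numeral_3_eq_3 numeral_2_eq_2\<close>)
  define ev where "ev z y j w = case_nat z (case_nat y (case_nat j (\<lambda>n. e n w)))" for z y j :: nat and w
  have Pw: "P (z # y # j # map (\<lambda>g. g w) (map e [0..<n])) \<longleftrightarrow>
      z \<le> tval (case_nat y (case_nat j (\<lambda>n. e n w))) t' \<and> natsat (ev z y j w) q" for z y j w
  proof -
    have 1: "tval ((!) (y # j # map (\<lambda>g. g w) (map e [0..<n]))) t' = tval (case_nat y (case_nat j (\<lambda>n. e n w))) t'"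
    proof (rule tval_cong)
      fix l assume "l < bnd_tm t'"
      then have "l < n + 2" using w(2) by (simp add: k_def n_def)
      then show "(y # j # map (\<lambda>g. g w) (map e [0..<n])) ! l = case_nat y (case_nat j (\<lambda>n. e n w)) l"
        by (auto simp: nth_Cons split: nat.split)
    qed
    have 2: "natsat ((!) (z # y # j # map (\<lambda>g. g w) (map e [0..<n]))) q \<longleftrightarrow> natsat (ev z y j w) q"
    proof (rule natsat_cong)
      fix l assume "l < bnd_fm q"
      then have "l < n + 3" using w(4) by (simp add: k_def n_def)
      then show "(z # y # j # map (\<lambda>g. g w) (map e [0..<n])) ! l = ev z y j w l"
        by (auto simp: ev_def nth_Cons split: nat.split)
    qed
    show ?thesis unfolding P_def list.sel 1 2 by (rule refl)
  qed
  have satp: "gsat (case_nat y (case_nat j e)) p \<longleftrightarrow>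
      (\<exists>z\<in>G. eventually (\<lambda>w. P (z w # y w # j w # map (\<lambda>g. g w) (map e [0..<n]))) F)" if "y \<in> G" "j \<in> G" for y j
  proof -
    have r: "range (case_nat y (case_nat j e)) \<subseteq> G" by (intro range_case_nat e that)
    have "gsat (case_nat z (case_nat y (case_nat j e))) q \<longleftrightarrow> eventually (\<lambda>w. natsat (ev (z w) (y w) (j w) w) q) F" if "z \<in> G" for z
      using losD[OF lq range_case_nat[OF r that]] by (simp add: case_nat_app ev_def)
    then show ?thesis unfolding q(1) gsat_BExists Pw eventually_conj_iff by (auto simp: case_nat_app)
  qed
  have main: "\<exists>W\<in>G. \<forall>j\<in>G. eventually (\<lambda>w. j w \<le> blen (x w)) F \<longrightarrow>
      gsat (case_nat (\<lambda>w. eval beta [W w, j w]) (case_nat j e)) p"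
    if x: "x \<in> G" and t: "t \<in> G"
      and prem: "\<And>j. j \<in> G \<Longrightarrow> eventually (\<lambda>w. j w \<le> blen (x w)) F \<Longrightarrow>
        \<exists>y\<in>G. eventually (\<lambda>w. y w \<le> t w) F \<and> gsat (case_nat y (case_nat j e)) p" for x t
  proof -
    \<comment> \<open>Solved at stage \<open>r\<close>. Quantifying over all lists up to number
      \<open>r\<close> makes this monotone in \<open>r\<close>, as \<open>ex_hardest\<close>
      demands.\<close>
    define D where "D r w j \<longleftrightarrow> (\<exists>r1\<le>r. \<exists>r2\<le>r. \<exists>y\<in>Cand r1 w. \<exists>z\<in>Cand r2 w. y \<le> t w \<and>
        P (z # y # j # map (\<lambda>g. g w) (map e [0..<n])))" for r w j
    have "\<exists>j\<in>{..blen (x w)}. \<forall>r. D r w j \<longrightarrow> (\<forall>j'\<in>{..blen (x w)}. D r w j')" for w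
      by (rule ex_hardest) (auto simp: D_def intro: le_trans)
    then obtain J where J: "\<And>w. J w \<le> blen (x w)" "\<And>w r. D r w (J w) \<Longrightarrow> \<forall>j'\<le>blen (x w). D r w j'"
      by (metis atMost_iff)
    have JG: "J \<in> G" by (rule G_sharp[OF x J(1)])
    obtain y where y: "y \<in> G" "eventually (\<lambda>w. y w \<le> t w) F" "gsat (case_nat y (case_nat J e)) p"
      using prem[OF JG] J(1) by auto
    obtain z where z: "z \<in> G" "eventually (\<lambda>w. P (z w # y w # J w # map (\<lambda>g. g w) (map e [0..<n]))) F"
      using y(3) satp[OF y(1) JG] by blast
    obtain r1 where r1: "\<And>w. y w \<in> Cand r1 w" using Cand_complete[OF y(1)] by blast
    obtain r2 where r2: "\<And>w. z w \<in> Cand r2 w" using Cand_complete[OF z(1)] by blast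
    define r where "r = max r1 r2"
    have all: "eventually (\<lambda>w. \<forall>j\<le>blen (x w). D r w j) F"
      using y(2) z(2)
    proof eventually_elim
      case (elim w)
      then have "D r w (J w)" unfolding D_def r_def using r1 r2 by (meson max.cobounded1 max.cobounded2)
      then show ?case by (rule J(2))
    qed
    obtain s where s: "\<forall>r'\<le>r. \<forall>w. Cand r' w \<subseteq> Cand s w" using Cand_directed[of r] ..
    have "eventually (\<lambda>w. \<forall>j\<le>blen (x w). \<exists>y\<in>Cand s w. \<exists>z\<in>Cand s w. y \<le> t w \<and> P (z # y # j # map (\<lambda>g. g w) (map e [0..<n]))) F"
      using all
    proof (rule eventually_mono)
      fix w assume *: "\<forall>j\<le>blen (x w). D r w j"
      have "\<exists>y\<in>Cand s w. \<exists>z\<in>Cand s w. y \<le> t w \<and> P (z # y # j # map (\<lambda>g. g w) (map e [0..<n]))" if "j \<le> blen (x w)" for j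
      proof -
        have "D r w j" using * that by blast
        then obtain r1 r2 y z where d: "r1 \<le> r" "r2 \<le> r" "y \<in> Cand r1 w" "z \<in> Cand r2 w" "y \<le> t w"
          "P (z # y # j # map (\<lambda>g. g w) (map e [0..<n]))" unfolding D_def by blast
        have "y \<in> Cand s w" "z \<in> Cand s w" using d s by blast+
        then show ?thesis using d by blast
      qed
      then show "\<forall>j\<le>blen (x w). \<exists>y\<in>Cand s w. \<exists>z\<in>Cand s w. y \<le> t w \<and> P (z # y # j # map (\<lambda>g. g w) (map e [0..<n]))" by blast
    qed
    from collect_sequence[OF P _ _ x t this] e obtain W where W: "W \<in> G"
      "eventually (\<lambda>w. \<forall>j\<le>blen (x w). eval beta [W w, j] \<le> t w \<and>
        (\<exists>z\<in>Cand s w. P (z # eval beta [W w, j] # j # map (\<lambda>g. g w) (map e [0..<n])))) F" by auto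
    show ?thesis
    proof (intro bexI[OF _ W(1)] ballI impI)
      fix j assume j: "j \<in> G" "eventually (\<lambda>w. j w \<le> blen (x w)) F"
      have b: "(\<lambda>w. eval beta [W w, j w]) \<in> G"
        using G_PV[of "[W, j]" "\<lambda>xs. eval beta [xs ! 0, xs ! 1]"] PV.C_beta[OF PVC_proj PVC_proj, of 0 2 1] W(1) j(1)
        by (simp add: numeral_2_eq_2)
      \<comment> \<open>The witness \<open>z\<close> is not part of the sequence \<open>W\<close>.
        It is picked at each point from the list, with the entry of index 0 as default, and so
        belongs to \<open>G\<close>.\<close>
      define Z where "Z w z \<longleftrightarrow> z \<in> Cand s w \<and> P (z # eval beta [W w, j w] # j w # map (\<lambda>g. g w) (map e [0..<n]))" for w z
      define z where "z w = (if Ex (Z w) then SOME z. Z w z else cf s (0 # map (\<lambda>g. g w) (cg s)))" for w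
      have z: "Z w (z w)" if "Ex (Z w)" for w unfolding z_def using that by (simp only: if_True) (rule someI_ex)
      have "z w \<in> Cand s w" for w
        using z[of w] Cand_nonempty by (cases "Ex (Z w)") (auto simp: Z_def z_def)
      then have zG: "z \<in> G" by (rule Cand_in_G)
      have "eventually (\<lambda>w. P (z w # eval beta [W w, j w] # j w # map (\<lambda>g. g w) (map e [0..<n]))) F"
        using W(2) j(2)
      proof eventually_elim
        case (elim w)
        then have "Ex (Z w)" unfolding Z_def by blast
        then show ?case using z[of w] by (simp add: Z_def)
      qed
      then show "gsat (case_nat (\<lambda>w. eval beta [W w, j w]) (case_nat j e)) p" using satp[OF b j(1)] zG by blast
    qed
  qed
  have e1: "(\<lambda>na w. tval (\<lambda>n. case_nat y (case_nat j (case_nat t (case_nat x e))) n w) (case_nat (Var 0) (case_nat (Var 1) (\<lambda>n. Var (n + 4))) na)) =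
      case_nat y (case_nat j e)" for y j t x
    by (auto simp: fun_eq_iff eval_nat_numeral split: nat.split)
  have e2: "(\<lambda>na w. tval (\<lambda>n. case_nat j (case_nat W (case_nat t (case_nat x e))) n w) (case_nat (Fn beta [Var 1, Var 0]) (case_nat (Var 0) (\<lambda>n. Var (n + 4))) na)) =
      case_nat (\<lambda>w. eval beta [W w, j w]) (case_nat j e)" for W j t x
    by (auto simp: fun_eq_iff eval_nat_numeral split: nat.split)
  show ?thesis
    unfolding BB_def gsat.simps(7)
  proof (intro ballI)
    fix x t assume xt: "x \<in> G" "t \<in> G"
    show "gsat (case_nat t (case_nat x e)) (BForall (\<^bold>L (Var 1)) (BExists (Var 1)
          (subst_fm (case_nat (Var 0) (case_nat (Var 1) (\<lambda>n. Var (n + 4)))) p)) \<^bold>\<longrightarrow>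
        Exists (BForall (\<^bold>L (Var 2))
          (subst_fm (case_nat (Fn beta [Var 1, Var 0]) (case_nat (Var 0) (\<lambda>n. Var (n + 4)))) p)))"
      unfolding gsat.simps gsat_BForall gsat_BExists gsat_subst e1 e2
      using main[OF xt] by (simp add: numeral_2_eq_2)
  qed
qed

end

text \<open>Zorn's lemma gives a minimal proper filter below \<open>F\<close>. It decides every
  predicate, since otherwise adjoining the predicate would give a proper filter that is strictly
  smaller in the order.\<close>

lemma ex_ultrafilter:
  fixes F :: "'a filter"
  assumes "F \<noteq> bot"
  obtains U where "U \<le> F" "U \<noteq> bot" "\<And>P. eventually P U \<or> eventually (\<lambda>x. \<not> P x) U"
proof -
  define A where "A = {U. U \<le> F \<and> U \<noteq> bot}"
  define R where "R = (\<lambda>a b :: 'a filter. b \<le> a)"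
  have "\<exists>m\<in>A. \<forall>a\<in>A. R m a \<longrightarrow> a = m"
  proof (rule predicate_Zorn)
    show "partial_order_on A (relation_of R A)"
      by (rule partial_order_on_relation_ofI) (auto simp: R_def)
    fix C assume C: "C \<in> Chains (relation_of R A)"
    have sub: "C \<subseteq> A" and total: "\<And>a b. a \<in> C \<Longrightarrow> b \<in> C \<Longrightarrow> a \<le> b \<or> b \<le> a"
      using C by (auto simp: Chains_def relation_of_def R_def)
    show "\<exists>u\<in>A. \<forall>a\<in>C. R a u"
    proof (cases "C = {}")
      case True
      then show ?thesis using assms by (auto simp: A_def)
    next
      case False
      have "eventually P (Inf C) \<longleftrightarrow> (\<exists>b\<in>C. eventually P b)" for P
      proof (rule eventually_Inf_base[OF False])
        fix a b assume "a \<in> C" "b \<in> C"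
        then show "\<exists>x\<in>C. x \<le> inf a b" using total[of a b] by (auto simp: le_inf_iff)
      qed
      then have "Inf C \<noteq> bot" using sub by (auto simp: trivial_limit_def A_def)
      moreover have "Inf C \<le> F" using False sub by (auto simp: A_def intro: Inf_lower2)
      ultimately show ?thesis by (intro bexI[of _ "Inf C"]) (auto simp: A_def R_def intro: Inf_lower)
    qed
  qed
  then obtain U where U: "U \<in> A" "\<And>a. a \<in> A \<Longrightarrow> a \<le> U \<Longrightarrow> a = U" by (auto simp: R_def)
  have "eventually P U \<or> eventually (\<lambda>x. \<not> P x) U" for P
  proof (rule ccontr)
    assume *: "\<not> ?thesis"
    have "inf U (principal {x. P x}) \<noteq> bot"
      using * by (auto simp: trivial_limit_def eventually_inf_principal)
    then have "inf U (principal {x. P x}) = U" using U by (auto simp: A_def le_infI1)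
    moreover have "eventually P (inf U (principal {x. P x}))" by (simp add: eventually_inf_principal)
    ultimately have "eventually P U" by simp
    then show False using * by blast
  qed
  then show ?thesis using that U by (auto simp: A_def)
qed

section \<open>Short lists of helpers\<close>

lemma (in fclass) CP_bex_list: "(\<And>r. r \<in> set rs \<Longrightarrow> CP k (P r)) \<Longrightarrow> CP k (\<lambda>xs. \<exists>r\<in>set rs. P r xs)"
proof (induction rs)
  case Nil
  then show ?case using CP_const[of k False] by simp
next
  case (Cons r rs)
  have "CP k (\<lambda>xs. P r xs \<or> (\<exists>r\<in>set rs. P r xs))" by (intro CP_disj) (use Cons in auto)
  then show ?case by simp
qed

lemma blen_num: "blen (num x) = Suc (length x)"
  using arg_cong[OF bits_num[of x], of length] by simp

text \<open>The advice codes the helpers for the given length. Soundness of \<open>sol\<close>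
  excludes wrong acceptance whatever number is used as helper, so the list matters for completeness
  only. Lengths are those of \<open>num x\<close>, one more than the length of
  \<open>x\<close>.\<close>

lemma helpers_imp_advice:
  assumes sol: "FD.CP i 2 (\<lambda>xs. sol (xs ! 0) (xs ! 1))"
    and sound: "\<And>x h. sol (num x) h \<Longrightarrow> x \<in> L"
    and T: "pbd 1 (\<lambda>xs. T (blen (xs ! 0)))"
    and hs: "\<And>n. \<exists>hs. length hs \<le> T n \<and> (\<forall>h\<in>set hs. h < 2 ^ T n) \<and>
               (\<forall>x\<in>L. Suc (length x) = n \<longrightarrow> (\<exists>h\<in>set hs. sol (num x) h))"
  shows "L \<in> (Delta_p (i + 1))/poly"
proof -
  obtain hs where hs: "\<And>n. length (hs n) \<le> T n" "\<And>n. \<forall>h\<in>set (hs n). h < 2 ^ T n"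
    "\<And>n x. x \<in> L \<Longrightarrow> Suc (length x) = n \<Longrightarrow> \<exists>h\<in>set (hs n). sol (num x) h"
    using hs by metis
  define \<alpha> where "\<alpha> m = code (T (Suc m)) (hs (Suc m))" for m
  have \<alpha>0: "0 < \<alpha> m" for m unfolding \<alpha>_def code_def by simp
  have len: "length (dec (\<alpha> (length x))) \<le> T (Suc (length x)) * Suc (T (Suc (length x))) + 1" for x :: "bool list"
  proof -
    have "\<alpha> (length x) < 2 ^ (T (Suc (length x)) * (length (hs (Suc (length x))) + 1) + 1)"
      unfolding \<alpha>_def by (rule code_less[OF hs(2)])
    then have "blen (\<alpha> (length x)) \<le> T (Suc (length x)) * (length (hs (Suc (length x))) + 1) + 1"
      by (simp only: blen_le_pow)
    also have "\<dots> \<le> T (Suc (length x)) * Suc (T (Suc (length x))) + 1"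
      using hs(1)[of "Suc (length x)"] by (intro add_mono mult_le_mono) auto
    finally show ?thesis by (simp add: length_dec)
  qed
  have "pbd 1 (\<lambda>xs. T (blen (xs ! 0)) * Suc (T (blen (xs ! 0))) + 1)"
    by (intro pbd_add pbd_mult pbd_Suc T pbd_const)
  then obtain p :: "nat poly" where p: "\<And>x. T (blen ([num x] ! 0)) * Suc (T (blen ([num x] ! 0))) + 1 \<le> poly p (length x)"
    using poly_bound_nat[of "\<lambda>xs. T (blen (xs ! 0)) * Suc (T (blen (xs ! 0))) + 1"] by blast
  have adv: "length (dec (\<alpha> m)) \<le> poly p m" for m
    using len[of "replicate m False"] p[of "replicate m False"] by (simp add: blen_num)
  \<comment> \<open>With blocks of \<open>T\<close> bits the code is longer than \<open>T\<close>,
    hence longer than the number of helpers, so the search below \<open>blen a\<close> reaches them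
    all. Blocks past the end of the list are harmless by soundness.\<close>
  define D where "D x a \<longleftrightarrow> (\<exists>k<blen a. sol x (eval beta [a, k]))" for x a
  obtain f g where fg: "PVC 1 f" "PVC 1 g" "\<And>x y. f [num (pair x y)] = num x" "\<And>x y. g [num (pair x y)] = num y"
  proof (rule unpair_pv)
    fix f g assume "PVC 1 f" "PVC 1 g" "\<And>x y. f [num (pair x y)] = num x" "\<And>x y. g [num (pair x y)] = num y"
    then show thesis by (rule that)
  qed
  have F: "FD i 1 f" "FD i 1 g" using fg FD.PVC_imp by blast+
  have "FD.CP i (Suc 1) (\<lambda>zs. (\<lambda>xs. sol (xs ! 0) (xs ! 1)) (map (\<lambda>u. u zs) [\<lambda>zs. f (tl zs), \<lambda>zs. eval beta [g (tl zs), hd zs]]))"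
    by (rule FD.CP_comp[OF sol]) (use F in \<open>auto intro!: FD.C_tl FD.C_beta FD.C_hd\<close>)
  then have "FD.CP i (Suc 1) (\<lambda>zs. sol (f (tl zs)) (eval beta [g (tl zs), hd zs]))" by simp
  from FD.CP_ex[where P = "\<lambda>k zs. sol (f zs) (eval beta [g zs, k])", OF this F(2)]
  have "FD i 1 (\<lambda>xs. of_bool (D (f xs) (g xs)))" unfolding FD.CP_def D_def .
  from FD_decides[OF this] have B: "{x. D (f [num x]) (g [num x])} \<in> Delta_p (i + 1)" (is "?B \<in> _") by simp
  have "x \<in> L \<longleftrightarrow> pair x (dec (\<alpha> (length x))) \<in> ?B" for x
  proof -
    have "pair x (dec (\<alpha> (length x))) \<in> ?B \<longleftrightarrow> D (num x) (\<alpha> (length x))"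
      using \<alpha>0 by (simp add: fg num_dec)
    also have "\<dots> \<longleftrightarrow> x \<in> L"
    proof
      assume "D (num x) (\<alpha> (length x))"
      then show "x \<in> L" unfolding D_def using sound by blast
    next
      assume "x \<in> L"
      then obtain h where h: "h \<in> set (hs (Suc (length x)))" "sol (num x) h" using hs(3) by blast
      then obtain k where k: "k < length (hs (Suc (length x)))" "hs (Suc (length x)) ! k = h" by (auto simp: in_set_conv_nth)
      have "\<not> \<alpha> (length x) < 2 ^ T (Suc (length x))"
        using code_ge[of "T (Suc (length x))" "hs (Suc (length x))"] unfolding \<alpha>_def by linarith
      then have "T (Suc (length x)) < blen (\<alpha> (length x))" using blen_le_pow linorder_not_le by blast
      then have "k < blen (\<alpha> (length x))" using k(1) hs(1)[of "Suc (length x)"] by linarith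
      moreover have "eval beta [\<alpha> (length x), k] = h"
        unfolding \<alpha>_def k(2)[symmetric] by (rule beta_code[OF hs(2) k(1)])
      ultimately show "D (num x) (\<alpha> (length x))" unfolding D_def using h(2) by blast
    qed
    finally show ?thesis by blast
  qed
  then show ?thesis unfolding with_poly_advice_def
    by (intro CollectI bexI[OF _ B] exI[of _ "\<lambda>m. dec (\<alpha> m)"] exI[of _ p] conjI allI adv)
qed

section \<open>Averaging over tuples\<close>

text \<open>Double counting of the pairs of a tuple and a replacement of its entry at \<open>l\<close>.\<close>

lemma card_replace:
  assumes "finite S" "finite I" "l \<in> I"
  shows "(\<Sum>a\<in>PiE I (\<lambda>_. S). card {x \<in> S. P (a(l := x))}) = card S * card {a \<in> PiE I (\<lambda>_. S). P a}"
proof -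
  let ?A = "PiE I (\<lambda>_. S)"
  have fA: "finite ?A" using assms by (intro finite_PiE) auto
  have "(\<Sum>a\<in>?A. card {x \<in> S. P (a(l := x))}) = card (SIGMA a:?A. {x \<in> S. P (a(l := x))})"
    using fA assms(1) by (subst card_SigmaI) auto
  \<comment> \<open>The bijection exchanges the entry at \<open>l\<close> with its
    replacement.\<close>
  also have "\<dots> = card (S \<times> {a \<in> ?A. P a})"
  proof (rule bij_betw_same_card[of "\<lambda>(a, x). (a l, a(l := x))"], rule bij_betw_byWitness[where f' = "\<lambda>(y, a). (a(l := y), a l)"])
    show "(\<lambda>(a, x). (a l, a(l := x))) ` (SIGMA a:?A. {x \<in> S. P (a(l := x))}) \<subseteq> S \<times> {a \<in> ?A. P a}"
      using assms(3) by (auto simp: PiE_def extensional_def)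
    show "(\<lambda>(y, a). (a(l := y), a l)) ` (S \<times> {a \<in> ?A. P a}) \<subseteq> (SIGMA a:?A. {x \<in> S. P (a(l := x))})"
      using assms(3) by (auto simp: PiE_def extensional_def)
  qed auto
  finally show ?thesis by (simp add: card_cartesian_product)
qed

text \<open>A union bound: if replacing the entry at \<open>l\<close> always solved less than the
  fraction \<open>1 / card I\<close> of \<open>S\<close>, then less than this fraction of the tuples
  would be solved at \<open>l\<close>, and some tuple would be solved at no position.\<close>

lemma averaging:
  assumes S: "finite S" "S \<noteq> {}" and I: "finite I"
    and *: "\<And>a. a \<in> PiE I (\<lambda>_. S) \<Longrightarrow> \<exists>l\<in>I. P l a"
  obtains l a where "l \<in> I" "a \<in> PiE I (\<lambda>_. S)" "card S \<le> card I * card {x \<in> S. P l (a(l := x))}"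
proof (rule ccontr)
  note found = that
  let ?A = "PiE I (\<lambda>_. S)"
  assume no: "\<not> thesis"
  have less: "card I * card {x \<in> S. P l (a(l := x))} < card S" if "l \<in> I" "a \<in> ?A" for l a
    using found[OF that] no by (metis not_le)
  have fA: "finite ?A" using S I by (intro finite_PiE) auto
  have ne: "?A \<noteq> {}" using S by (simp add: PiE_eq_empty_iff)
  then have Ine: "I \<noteq> {}" using * by blast
  have l: "card I * card {a \<in> ?A. P l a} < card ?A" if "l \<in> I" for l
  proof -
    have "card S * (card I * card {a \<in> ?A. P l a}) = (\<Sum>a\<in>?A. card I * card {x \<in> S. P l (a(l := x))})"
      using card_replace[OF S(1) I that, of "P l"] by (simp add: sum_distrib_left[symmetric])
    also have "\<dots> < (\<Sum>a\<in>?A. card S)" by (rule sum_strict_mono[OF fA ne]) (use less that in blast)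
    also have "\<dots> = card S * card ?A" by simp
    finally show ?thesis by simp
  qed
  have "?A \<subseteq> (\<Union>l\<in>I. {a \<in> ?A. P l a})" using * by blast
  then have "card ?A \<le> card (\<Union>l\<in>I. {a \<in> ?A. P l a})" using fA I by (intro card_mono) auto
  also have "\<dots> \<le> (\<Sum>l\<in>I. card {a \<in> ?A. P l a})" by (rule card_UN_le[OF I])
  finally have "card I * card ?A \<le> (\<Sum>l\<in>I. card I * card {a \<in> ?A. P l a})"
    by (simp add: sum_distrib_left[symmetric])
  also have "\<dots> < (\<Sum>l\<in>I. card ?A)" by (rule sum_strict_mono[OF I Ine l])
  finally show False by simp
qed

text \<open>In other words, \<open>(1 - 1 / K) ^ K\<close> is at most one half. The inductive claim
  is Bernoulli's inequality for \<open>(1 + 1 / k) ^ m\<close>, cleared of denominators.\<close>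

lemma two_mult_pow_le: "0 < K \<Longrightarrow> 2 * (K - 1) ^ K \<le> (K :: nat) ^ K"
proof (cases K)
  case (Suc k)
  have "k ^ m * (k + m) \<le> k * Suc k ^ m" for m
  proof (induction m)
    case (Suc m)
    have "k ^ Suc m * (k + Suc m) \<le> Suc k * (k ^ m * (k + m))" by (simp add: algebra_simps)
    also have "\<dots> \<le> Suc k * (k * Suc k ^ m)" by (rule mult_le_mono2[OF Suc])
    finally show ?case by (simp add: algebra_simps)
  qed simp
  from this[of "Suc k"] have "k * (2 * k ^ Suc k) \<le> k * Suc k ^ Suc k" by (simp add: algebra_simps)
  then have "2 * k ^ Suc k \<le> Suc k ^ Suc k" by (cases k) (simp_all only: mult_le_cancel1, simp_all)
  then show ?thesis using Suc by simp
qed simp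

text \<open>If a helper solves a fraction \<open>1 / K\<close> of every set of instances, then \<open>n\<close> rounds of \<open>K\<close> greedy
  choices each halve the set of open instances.\<close>

lemma greedy_cover:
  assumes S: "finite S" "card S < 2 ^ n" and K: "0 < K"
    and *: "\<And>R. R \<subseteq> S \<Longrightarrow> R \<noteq> {} \<Longrightarrow> \<exists>h\<in>H. card R \<le> K * card {x \<in> R. sol x h}"
  obtains hs where "length hs \<le> K * n" "set hs \<subseteq> H" "\<forall>x\<in>S. \<exists>h\<in>set hs. sol x h"
proof -
  define op where "op hs = {x \<in> S. \<forall>h\<in>set hs. \<not> sol x h}" for hs
  \<comment> \<open>Each choice leaves at most the fraction \<open>(K - 1) / K\<close> of the open
    instances, stated without division.\<close>
  have "\<exists>hs. length hs \<le> m \<and> set hs \<subseteq> H \<and> K ^ m * card (op hs) \<le> (K - 1) ^ m * card S" for m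
  proof (induction m)
    case 0
    show ?case by (intro exI[of _ "[]"]) (simp add: op_def)
  next
    case (Suc m)
    then obtain hs where hs: "length hs \<le> m" "set hs \<subseteq> H" "K ^ m * card (op hs) \<le> (K - 1) ^ m * card S" by blast
    show ?case
    proof (cases "op hs = {}")
      case True
      then show ?thesis using hs by (intro exI[of _ hs]) simp
    next
      case False
      then obtain h where h: "h \<in> H" "card (op hs) \<le> K * card {x \<in> op hs. sol x h}"
        using *[of "op hs"] by (auto simp: op_def)
      have fin: "finite (op hs)" using S by (simp add: op_def)
      have "op (h # hs) = op hs - {x \<in> op hs. sol x h}" by (auto simp: op_def)
      then have "card (op (h # hs)) = card (op hs) - card {x \<in> op hs. sol x h}"
        using fin by (simp add: card_Diff_subset)
      then have "K * card (op (h # hs)) \<le> K * card (op hs) - card (op hs)" using h(2) by (simp add: diff_mult_distrib2)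
      also have "\<dots> = (K - 1) * card (op hs)" by (simp add: diff_mult_distrib)
      finally have "K ^ m * (K * card (op (h # hs))) \<le> K ^ m * ((K - 1) * card (op hs))" by (rule mult_le_mono2)
      also have "\<dots> = (K - 1) * (K ^ m * card (op hs))" by simp
      also have "\<dots> \<le> (K - 1) * ((K - 1) ^ m * card S)" by (rule mult_le_mono2[OF hs(3)])
      finally have "K ^ Suc m * card (op (h # hs)) \<le> (K - 1) ^ Suc m * card S" by (simp add: algebra_simps)
      then show ?thesis using hs h by (intro exI[of _ "h # hs"]) simp
    qed
  qed
  then obtain hs where hs: "length hs \<le> K * n" "set hs \<subseteq> H" "K ^ (K * n) * card (op hs) \<le> (K - 1) ^ (K * n) * card S" by blast
  have "op hs = {}"
  proof (rule ccontr)
    assume "op hs \<noteq> {}"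
    then have "1 \<le> card (op hs)" using S by (simp add: op_def card_gt_0_iff Suc_le_eq)
    then have "K ^ (K * n) * 1 \<le> K ^ (K * n) * card (op hs)" by (rule mult_le_mono2)
    then have "K ^ (K * n) \<le> (K - 1) ^ (K * n) * card S" using hs(3) by linarith
    then have 1: "(K ^ K) ^ n \<le> ((K - 1) ^ K) ^ n * card S" by (simp add: power_mult)
    have "(2 * (K - 1) ^ K) ^ n \<le> (K ^ K) ^ n" by (rule power_mono[OF two_mult_pow_le[OF K]]) simp
    then have "2 ^ n * ((K - 1) ^ K) ^ n \<le> (K ^ K) ^ n" by (simp only: power_mult_distrib)
    then have 2: "2 ^ n * ((K - 1) ^ K) ^ n \<le> card S * ((K - 1) ^ K) ^ n" using 1 by (simp only: mult.commute)
    have "0 < (K ^ K) ^ n" using K by simp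
    then have "0 < ((K - 1) ^ K) ^ n" using 1 by (metis gr0I less_le_trans mult_0 not_less_zero)
    then have "2 ^ n \<le> card S" using 2 by (metis mult_le_cancel2)
    then show False using S(2) by simp
  qed
  then have "\<forall>x\<in>S. \<exists>h\<in>set hs. sol x h" by (auto simp: op_def)
  then show ?thesis using hs(1,2) that by blast
qed

section \<open>Tuples of instances with hidden witnesses\<close>

text \<open>The list of candidates that sees the first \<open>m\<close> values. Bounding the index
  by a length keeps the list polynomially long, so that all entries can be tried.\<close>

definition cand :: "nat \<times> (nat list \<Rightarrow> nat) \<times> (nat list \<Rightarrow> nat) \<Rightarrow> (nat \<Rightarrow> nat) \<Rightarrow> nat set" where
  "cand = (\<lambda>(m, f, q) v. {f (j # map v [0..<m]) | j. j \<le> blen (q (map v [0..<m]))})"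

definition FDtriple :: "nat \<Rightarrow> nat \<times> (nat list \<Rightarrow> nat) \<times> (nat list \<Rightarrow> nat) \<Rightarrow> bool" where
  "FDtriple i = (\<lambda>(m, f, q). FD i (Suc m) f \<and> FD i m q)"

lemma cand_cong: "(\<And>l. l < fst r \<Longrightarrow> v l = v' l) \<Longrightarrow> cand r v = cand r v'"
proof -
  assume *: "\<And>l. l < fst r \<Longrightarrow> v l = v' l"
  obtain m f q where r: "r = (m, f, q)" by (cases r)
  have 1: "map v [0..<m] = map v' [0..<m]" using * r by simp
  show ?thesis unfolding cand_def r prod.case 1 ..
qed

text \<open>The code is affine in each entry, so a removed entry is put back by one multiplication
  and one addition. The exponent combines the place of the block, the shift by \<open>s\<close> and
  the doubling in \<open>code\<close>.\<close>

lemma code_update: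
  assumes "l < length zs"
  shows "code s zs = code s (zs[l := 0]) + zs ! l * 2 ^ (s * l + s + 1)"
proof -
  have "horner (2 ^ s) zs = horner (2 ^ s) (zs[l := 0]) + zs ! l * (2 ^ s) ^ l"
    using assms
  proof (induction zs arbitrary: l)
    case (Cons z zs)
    then show ?case by (cases l) (simp_all add: algebra_simps)
  qed simp
  moreover have "(2 :: nat) ^ (s * l + s + 1) = 2 * (2 ^ s) ^ l * 2 ^ s" by (simp add: power_add power_mult)
  ultimately show ?thesis by (simp add: code_def algebra_simps)
qed

locale hard_instances =
  fixes i :: nat and b :: pv and Q :: "nat list \<Rightarrow> bool" and t :: "nat list \<Rightarrow> nat" and L :: lang
    and x0 w0 :: nat
  assumes b: "wf_pv b" "arity b = 1" "mono (\<lambda>x. eval b [x])" "\<And>m. \<exists>x. m \<le> eval b [x]" "\<And>x. eval b [x] \<le> x"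
    and Q: "SP i 2 Q" and t: "PVC 1 t" and L: "\<And>x. x \<in> L \<longleftrightarrow> (\<exists>y\<le>t [num x]. \<not> Q [y, num x])"
    and notin: "L \<notin> (Delta_p (i + 1))/poly"
    and x0: "0 < x0" "w0 \<le> t [x0]" "\<not> Q [w0, x0]"
begin

definition wit :: "nat \<Rightarrow> nat \<Rightarrow> bool" where "wit x y \<longleftrightarrow> y \<le> t [x] \<and> \<not> Q [y, x]"

abbreviation K :: "nat \<Rightarrow> nat" where "K n \<equiv> eval b [n]"

text \<open>The condition on \<open>x0\<close> lets it fit into blocks of \<open>n\<close> bits, so
  that the whole tuple has a code with this block length.\<close>

definition valid :: "nat list \<times> nat list \<Rightarrow> bool" where
  "valid = (\<lambda>(xs, ws). let n = blen (xs ! 1) in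
     length xs = Suc (K n) \<and> 0 < K n \<and> blen x0 \<le> n \<and> xs ! 0 = x0 \<and>
     (\<forall>l\<in>{1..K n}. blen (xs ! l) = n \<and> wit (xs ! l) (ws ! l)))"

text \<open>The witness of \<open>x0\<close> is a constant and need not be shown, so slot 0 is used
  for the code of the tuple.\<close>

definition known :: "nat \<Rightarrow> nat list \<times> nat list \<Rightarrow> nat" where
  "known l = (\<lambda>(xs, ws). if l = 0 then code (blen (xs ! 1)) xs else ws ! l)"

text \<open>The first conjunct, for lists that see more and more witnesses, puts the number of
  instances above every standard number of the model.\<close>

definition hidden :: "nat \<times> (nat list \<Rightarrow> nat) \<times> (nat list \<Rightarrow> nat) \<Rightarrow> nat list \<times> nat list \<Rightarrow> bool" where
  "hidden r = (\<lambda>(xs, ws). fst r \<le> K (blen (xs ! 1)) \<and>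
     (\<forall>l\<in>{1..K (blen (xs ! 1))}. fst r \<le> l \<longrightarrow> (\<forall>y\<in>cand r (\<lambda>m. known m (xs, ws)). \<not> wit (xs ! l) y)))"

definition decoded :: "nat \<Rightarrow> nat \<Rightarrow> nat \<Rightarrow> nat" where
  "decoded x h l = (if l = 0 then eval beta [h, 0] + x * eval beta [h, 1] else eval beta [eval beta [h, 2], l])"

text \<open>The first alternative, a helper that contains the witness itself, serves the finitely
  many small lengths.\<close>

definition sol :: "(nat \<times> (nat list \<Rightarrow> nat) \<times> (nat list \<Rightarrow> nat)) list \<Rightarrow> nat \<Rightarrow> nat \<Rightarrow> bool" where
  "sol rs x h \<longleftrightarrow> wit x (eval beta [h, 3]) \<or> (\<exists>r\<in>set rs. \<exists>y\<in>cand r (decoded x h). wit x y)"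

lemma CP_wit: "FD i k a \<Longrightarrow> FD i k c \<Longrightarrow> FD.CP i k (\<lambda>xs. wit (a xs) (c xs))"
proof -
  assume ac: "FD i k a" "FD i k c"
  have "FD.CP i k (\<lambda>xs. Q (map (\<lambda>g. g xs) [c, a]))"
    by (rule FD.CP_comp[OF SP_imp_FD[OF Q]]) (use ac in auto)
  then have "FD.CP i k (\<lambda>xs. Q [c xs, a xs])" by simp
  moreover have "FD i k (\<lambda>xs. t [a xs])" by (rule FD.C_comp1[OF FD.PVC_imp[OF t] ac(1)])
  ultimately show ?thesis unfolding wit_def using ac by (intro FD.CP_conj FD.CP_le FD.CP_not)
qed

lemma FD_decoded: "FD i k a \<Longrightarrow> FD i k c \<Longrightarrow> FD i k (\<lambda>xs. decoded (a xs) (c xs) l)"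
  by (cases "l = 0") (auto simp: decoded_def intro!: FD.C_add FD.C_mult FD.C_beta FD.C_const)

lemma CP_sol:
  assumes "\<forall>r\<in>set rs. FDtriple i r"
  shows "FD.CP i 2 (\<lambda>xs. sol rs (xs ! 0) (xs ! 1))"
proof -
  have p: "FD i 2 (\<lambda>xs. xs ! 0)" "FD i 2 (\<lambda>xs. xs ! 1)" by (rule FD.C_proj, simp)+
  have "FD.CP i 2 (\<lambda>xs. \<exists>y\<in>cand r (decoded (xs ! 0) (xs ! 1)). wit (xs ! 0) y)" if r: "r \<in> set rs" for r
  proof -
    obtain m f q where mfq: "r = (m, f, q)" by (cases r)
    have f: "FD i (Suc m) f" and q: "FD i m q" using assms r unfolding mfq FDtriple_def by auto
    have q': "FD i 2 (\<lambda>xs. q (map (\<lambda>g. g xs) (map (\<lambda>l xs. decoded (xs ! 0) (xs ! 1) l) [0..<m])))"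
      by (rule FD_comp[OF q]) (use FD_decoded[OF p] in auto)
    have tlp: "FD i (Suc 2) (\<lambda>zs. tl zs ! 0)" "FD i (Suc 2) (\<lambda>zs. tl zs ! 1)" by (rule FD.C_nth_tl, simp)+
    have "FD i (Suc 2) (\<lambda>zs. f (map (\<lambda>g. g zs) (hd # map (\<lambda>l zs. decoded (tl zs ! 0) (tl zs ! 1) l) [0..<m])))"
      by (rule FD_comp[OF f]) (use FD_decoded[OF tlp] FD.C_hd[of i 2] in auto)
    then have "FD.CP i (Suc 2) (\<lambda>zs. wit (tl zs ! 0) (f (hd zs # map (decoded (tl zs ! 0) (tl zs ! 1)) [0..<m])))"
      by (intro CP_wit tlp) (simp add: comp_def)
    from FD.CP_ex[where P = "\<lambda>j zs. wit (zs ! 0) (f (j # map (decoded (zs ! 0) (zs ! 1)) [0..<m]))", OF this FD.C_dbl1[OF q']]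
    have "FD.CP i 2 (\<lambda>xs. \<exists>j<blen (Suc (2 * q (map (decoded (xs ! 0) (xs ! 1)) [0..<m]))).
        wit (xs ! 0) (f (j # map (decoded (xs ! 0) (xs ! 1)) [0..<m])))"
      by (simp add: comp_def)
    then show ?thesis by (rule FD.CP_ext) (auto simp: mfq cand_def le_blen_iff)
  qed
  then have "FD.CP i 2 (\<lambda>xs. \<exists>r\<in>set rs. \<exists>y\<in>cand r (decoded (xs ! 0) (xs ! 1)). wit (xs ! 0) y)"
    by (rule FD.CP_bex_list)
  then show ?thesis unfolding sol_def by (intro FD.CP_disj CP_wit FD.C_beta p FD.C_const)
qed

lemma wit_imp_L: "wit (num x) y \<Longrightarrow> x \<in> L"
  unfolding L wit_def by blast

lemma sol_sound: "sol rs (num x) h \<Longrightarrow> x \<in> L"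
  unfolding sol_def using wit_imp_L by blast

text \<open>A helper for position \<open>l\<close> does not depend on the entry at \<open>l\<close>: it consists of the code of the
  tuple with that entry replaced by 0, the power of two to be multiplied with the entry when it is put
  back, the visible witnesses of the other entries, and a dummy in place of a direct witness.\<close>

definition helper :: "nat \<Rightarrow> nat \<Rightarrow> nat \<Rightarrow> (nat \<Rightarrow> nat) \<Rightarrow> nat \<Rightarrow> (nat \<Rightarrow> nat) \<Rightarrow> nat" where
  "helper tb n M wt l a = code (n * (n + 2) + 2 + tb * (M + 2))
     [code n ((x0 # map a [1..<Suc (K n)])[l := 0]), 2 ^ (n * l + n + 1),
      code tb (map (\<lambda>l'. if l' = 0 \<or> l' = l then 0 else wt (a l')) [0..<Suc M]), 0]"

lemma helper_upd: "helper tb n M wt l (a(l := x)) = helper tb n M wt l a"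
proof -
  have "(x0 # map (a(l := x)) [1..<Suc (K n)])[l := 0] = (x0 # map a [1..<Suc (K n)])[l := 0]"
  proof (rule nth_equalityI)
    fix j assume "j < length ((x0 # map (a(l := x)) [1..<Suc (K n)])[l := 0])"
    then show "(x0 # map (a(l := x)) [1..<Suc (K n)])[l := 0] ! j = (x0 # map a [1..<Suc (K n)])[l := 0] ! j"
      by (cases "j = l"; cases j) (simp_all del: upt_Suc list_update.simps)
  qed (simp only: length_list_update list.size length_map)
  moreover have "map (\<lambda>l'. if l' = 0 \<or> l' = l then 0 else wt ((a(l := x)) l')) [0..<Suc M] =
      map (\<lambda>l'. if l' = 0 \<or> l' = l then 0 else wt (a l')) [0..<Suc M]" by (rule map_cong) auto
  ultimately show ?thesis unfolding helper_def by (simp only:)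
qed

lemma helper_parts:
  assumes a: "\<And>l. l \<in> {1..K n} \<Longrightarrow> blen (a l) = n" "\<And>l. l \<in> {1..K n} \<Longrightarrow> blen (wt (a l)) \<le> tb"
    and n: "blen x0 \<le> n" and M: "M \<le> K n" and l: "l \<in> {1..K n}"
  shows "helper tb n M wt l a < 2 ^ ((n * (n + 2) + 2 + tb * (M + 2)) * 5 + 1)"
    and "decoded (a l) (helper tb n M wt l a) 0 = code n (x0 # map a [1..<Suc (K n)])"
    and "\<And>l'. 0 < l' \<Longrightarrow> l' \<le> M \<Longrightarrow> l' \<noteq> l \<Longrightarrow> decoded (a l) (helper tb n M wt l a) l' = wt (a l')"
proof -
  define xs where "xs = x0 # map a [1..<Suc (K n)]"
  define W where "W = map (\<lambda>l'. if l' = 0 \<or> l' = l then 0 else wt (a l')) [0..<Suc M]"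
  \<comment> \<open>Large enough for each of the four entries: the code of the tuple, the power of
    two for the removed entry, the code of the visible witnesses, and 0.\<close>
  define s where "s = n * (n + 2) + 2 + tb * (M + 2)"
  define zs where "zs = [code n (xs[l := 0]), 2 ^ (n * l + n + 1), code tb W, 0]"
  have h: "helper tb n M wt l a = code s zs" unfolding helper_def s_def zs_def xs_def W_def ..
  have Kn: "K n \<le> n" by (rule b(5))
  have lxs: "length xs = Suc (K n)" by (simp add: xs_def)
  have "\<forall>z\<in>set (xs[l := 0]). z < 2 ^ n"
  proof
    fix z assume "z \<in> set (xs[l := 0])"
    then have "z = 0 \<or> z = x0 \<or> (\<exists>l'\<in>{1..K n}. z = a l')"
    proof -
      have "z = 0 \<or> z \<in> set xs" using \<open>z \<in> _\<close> set_update_subset_insert[of xs l 0] by blast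
      then show ?thesis by (auto simp: xs_def simp del: upt_Suc)
    qed
    then show "z < 2 ^ n" using a(1) n by (auto simp: blen_le_pow[symmetric] blen_0)
  qed
  from code_less[OF this] have "code n (xs[l := 0]) < 2 ^ (n * (K n + 2) + 1)" by (simp add: lxs)
  also have "\<dots> \<le> 2 ^ s" 
  proof (rule power_increasing)
    have "n * (K n + 2) \<le> n * (n + 2)" by (rule mult_le_mono2) (use Kn in simp)
    then show "n * (K n + 2) + 1 \<le> s" unfolding s_def by linarith
  qed simp
  finally have z1: "code n (xs[l := 0]) < 2 ^ s" .
  have "n * l \<le> n * n" by (rule mult_le_mono2) (use l Kn in auto)
  moreover have "n * (n + 2) = n * n + 2 * n" by (simp add: algebra_simps)
  ultimately have "n * l + n + 1 < s" unfolding s_def by linarith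
  then have z2: "2 ^ (n * l + n + 1) < (2 :: nat) ^ s" by (rule power_strict_increasing) simp
  have W: "\<forall>z\<in>set W. z < 2 ^ tb"
    unfolding W_def using a(2) M by (auto simp: blen_le_pow[symmetric] blen_0 simp del: upt_Suc)
  from code_less[OF this] have "code tb W < 2 ^ (tb * (M + 2) + 1)" by (simp add: W_def)
  also have "\<dots> \<le> 2 ^ s" unfolding s_def by (intro power_increasing) auto
  finally have z3: "code tb W < 2 ^ s" .
  have zs: "\<forall>z\<in>set zs. z < 2 ^ s" using z1 z2 z3 by (simp add: zs_def)
  have "length zs + 1 = 5" by (simp add: zs_def)
  with code_less[OF zs] show "helper tb n M wt l a < 2 ^ ((n * (n + 2) + 2 + tb * (M + 2)) * 5 + 1)"
    unfolding h s_def[symmetric] by metis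
  have bz: "eval beta [helper tb n M wt l a, j] = zs ! j" if "j < 4" for j
    unfolding h by (rule beta_code[OF zs]) (use that in \<open>simp add: zs_def\<close>)
  have "code n xs = code n (xs[l := 0]) + xs ! l * 2 ^ (n * l + n + 1)"
    by (rule code_update) (use l in \<open>simp add: lxs\<close>)
  moreover have "xs ! l = a l" using l by (cases l) (auto simp: xs_def simp del: upt_Suc)
  moreover have "eval beta [helper tb n M wt l a, 0] = code n (xs[l := 0])" using bz[of 0] by (simp add: zs_def)
  moreover have "eval beta [helper tb n M wt l a, 1] = 2 ^ (n * l + n + 1)" using bz[of 1] by (simp add: zs_def)
  ultimately show "decoded (a l) (helper tb n M wt l a) 0 = code n (x0 # map a [1..<Suc (K n)])"
    unfolding decoded_def xs_def[symmetric] by simp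
  fix l' assume l': "0 < l'" "l' \<le> M" "l' \<noteq> l"
  have "eval beta [helper tb n M wt l a, 2] = code tb W" using bz[of 2] by (simp add: zs_def)
  then have "decoded (a l) (helper tb n M wt l a) l' = eval beta [code tb W, l']" using l'(1) by (simp add: decoded_def)
  also have "\<dots> = W ! l'" by (rule beta_code[OF W]) (use l'(2) in \<open>simp add: W_def\<close>)
  also have "\<dots> = wt (a l')" unfolding W_def using l' by (subst nth_map) (auto simp del: upt_Suc)
  finally show "decoded (a l) (helper tb n M wt l a) l' = wt (a l')" .
qed

text \<open>If no tuple stays unsolved, then by averaging a single tuple solves many instances in one of
  its positions, and the remaining entries of the tuple, together with their witnesses, serve as
  advice.\<close>

theorem ex_hidden:
  assumes rs: "\<forall>r\<in>set rs. FDtriple i r"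
  shows "\<exists>w. valid w \<and> (\<forall>r\<in>set rs. hidden r w)"
proof (rule ccontr)
  assume no: "\<not> ?thesis"
  \<comment> \<open>At least 1, so that \<open>M \<le> K n\<close> also makes \<open>K n\<close>
    positive.\<close>
  define M where "M = Max (insert 1 (fst ` set rs))"
  have M: "1 \<le> M" "\<And>r. r \<in> set rs \<Longrightarrow> fst r \<le> M" unfolding M_def by (auto intro: Max_ge)
  obtain N0 where N0: "M \<le> K N0" using b(4) by blast
  define N where "N = max N0 (blen x0)"
  have KM: "M \<le> K n" if "N \<le> n" for n
    using order_trans[OF N0 monoD[OF b(3), of N0 n]] that unfolding N_def by auto
  obtain e where e: "\<And>xs. length xs = 1 \<Longrightarrow> blen (t xs) \<le> sz xs ^ e" using PVC_bound[OF t] unfolding pbd_def by blast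
  define tb where "tb n = (n + 2) ^ e" for n :: nat
  have tb: "blen (t [x]) \<le> tb (blen x)" for x using e[of "[x]"] by (simp add: sz_def tb_def)
  \<comment> \<open>With one witness fixed for every instance, the averaging runs over the instances
    alone.\<close>
  define wt where "wt x = (SOME y. wit x y)" for x
  have wt: "wit x (wt x)" if "Ex (wit x)" for x using someI_ex[OF that] by (simp add: wt_def)
  have wtb: "blen (wt x) \<le> tb (blen x)" if "Ex (wit x)" for x
    using wt[OF that] floorlog_mono[of "wt x" "t [x]" 2] tb[of x] by (auto simp: wit_def)
  define S where "S n = {x. 0 < x \<and> blen x = n \<and> Ex (wit x)}" for n
  have Ssub: "S n \<subseteq> {0<..<2 ^ n}" for n unfolding S_def by (auto simp: less_power_blen)
  then have S: "finite (S n)" for n by (rule finite_subset) simp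
  have Sc: "card (S n) < 2 ^ n" for n
  proof -
    have "card (S n) \<le> card {0<..<2 ^ n :: nat}" by (rule card_mono[OF _ Ssub]) simp
    also have "\<dots> < 2 ^ n" by simp
    finally show ?thesis .
  qed
  \<comment> \<open>The sum of bounds for the number of greedily chosen helpers, the number of
    direct ones at small lengths, and the bit lengths of these two kinds.\<close>
  define T where "T n = n * n + 2 ^ N + (n * (n + 2) + 2 + tb n * (M + 2)) * 5 + 1 + (tb n * 5 + 1)" for n
  define H where "H n = {h :: nat. h < 2 ^ ((n * (n + 2) + 2 + tb n * (M + 2)) * 5 + 1)}" for n
  have large: "\<exists>h\<in>H n. card R \<le> K n * card {x \<in> R. sol rs x h}" if n: "N \<le> n" and R: "R \<subseteq> S n" "R \<noteq> {}" for n R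
  proof -
    have fR: "finite R" using R S finite_subset by blast
    have Kpos: "0 < K n" using KM[OF n] M(1) by linarith
    have pe: "blen (a l) = n \<and> Ex (wit (a l)) \<and> blen (wt (a l)) \<le> tb n" if "a \<in> PiE {1..K n} (\<lambda>_. R)" "l \<in> {1..K n}" for a l
    proof -
      have "a l \<in> S n" using PiE_mem[OF that] R(1) by blast
      then show ?thesis using wtb[of "a l"] unfolding S_def by simp
    qed
    have "\<exists>l\<in>{1..K n}. sol rs (a l) (helper (tb n) n M wt l a)" if a: "a \<in> PiE {1..K n} (\<lambda>_. R)" for a
    proof -
      define xs where "xs = x0 # map a [1..<Suc (K n)]"
      define ws where "ws = map (\<lambda>l. wt (a l)) [0..<Suc (K n)]"
      have xsl: "xs ! l = a l" if "l \<in> {1..K n}" for l using that by (cases l) (auto simp: xs_def simp del: upt_Suc)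
      have wsl: "ws ! l = wt (a l)" if "l \<le> K n" for l unfolding ws_def using that by (subst nth_map) (auto simp del: upt_Suc)
      have x1: "blen (xs ! 1) = n" using xsl[of 1] pe[OF a, of 1] Kpos by auto
      have "valid (xs, ws)" unfolding valid_def prod.case Let_def x1
      proof (intro conjI ballI)
        show "length xs = Suc (K n)" "xs ! 0 = x0" by (simp_all add: xs_def)
        show "blen x0 \<le> n" using n by (simp add: N_def)
        fix l assume l: "l \<in> {1..K n}"
        show "blen (xs ! l) = n" "wit (xs ! l) (ws ! l)" using l pe[OF a l] wt by (simp_all add: xsl wsl)
      qed (rule Kpos)
      then obtain r where r: "r \<in> set rs" "\<not> hidden r (xs, ws)" using no by blast
      have "fst r \<le> K n" using M(2)[OF r(1)] KM[OF n] by linarith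
      then obtain l y where l: "l \<in> {1..K n}" "fst r \<le> l" "y \<in> cand r (\<lambda>m. known m (xs, ws))" "wit (a l) y"
        using r(2) unfolding hidden_def prod.case x1 using xsl by auto
      \<comment> \<open>Only slots below \<open>fst r \<le> l\<close> are compared, so the witness
        of the entry at \<open>l\<close> is never asked from the helper.\<close>
      have "known m (xs, ws) = decoded (a l) (helper (tb n) n M wt l a) m" if m: "m < fst r" for m
      proof (cases "m = 0")
        case True
        have "decoded (a l) (helper (tb n) n M wt l a) 0 = code n (x0 # map a [1..<Suc (K n)])"
          by (rule helper_parts(2)[OF _ _ _ KM[OF n] l(1)]) (use pe[OF a] n in \<open>auto simp: N_def\<close>)
        then show ?thesis using True x1 by (simp add: known_def xs_def)
      next
        case False
        have "decoded (a l) (helper (tb n) n M wt l a) m = wt (a m)"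
          by (rule helper_parts(3)[OF _ _ _ KM[OF n] l(1)]) (use pe[OF a] n False m l(2) M(2)[OF r(1)] in \<open>auto simp: N_def\<close>)
        moreover have "m \<le> K n" using m l by simp
        ultimately show ?thesis using False by (simp add: known_def wsl)
      qed
      from cand_cong[of r, OF this] have "y \<in> cand r (decoded (a l) (helper (tb n) n M wt l a))" using l(3) by simp
      then show ?thesis using l r(1) unfolding sol_def by blast
    qed
    \<comment> \<open>By \<open>helper_upd\<close> the helper survives the replacement of the entry
      at \<open>l\<close>, so one helper solves all instances counted here.\<close>
    from averaging[where P = "\<lambda>l a. sol rs (a l) (helper (tb n) n M wt l a)", OF fR R(2) _ this]
    obtain l a where la: "l \<in> {1..K n}" "a \<in> PiE {1..K n} (\<lambda>_. R)"
      "card R \<le> card {1..K n} * card {x \<in> R. sol rs ((a(l := x)) l) (helper (tb n) n M wt l (a(l := x)))}"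
      by blast
    have "helper (tb n) n M wt l a \<in> H n" unfolding H_def mem_Collect_eq
      by (rule helper_parts(1)[OF _ _ _ KM[OF n] la(1)]) (use pe[OF la(2)] n in \<open>auto simp: N_def\<close>)
    then show ?thesis using la(3) by (auto simp: helper_upd)
  qed
  have "\<exists>hs. length hs \<le> T n \<and> (\<forall>h\<in>set hs. h < 2 ^ T n) \<and>
        (\<forall>x\<in>L. Suc (length x) = n \<longrightarrow> (\<exists>h\<in>set hs. sol rs (num x) h))" for n
  proof -
    have "\<exists>hs. length hs \<le> T n \<and> (\<forall>h\<in>set hs. h < 2 ^ T n) \<and> (\<forall>x\<in>S n. \<exists>h\<in>set hs. sol rs x h)"
    proof (cases "N \<le> n")
      case True
      have "0 < K n" using KM[OF True] M(1) by linarith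
      from greedy_cover[OF S Sc this large[OF True]] obtain hs where
        hs: "length hs \<le> K n * n" "set hs \<subseteq> H n" "\<forall>x\<in>S n. \<exists>h\<in>set hs. sol rs x h" by blast
      have "K n * n \<le> n * n" using b(5)[of n] by simp
      then have "length hs \<le> T n" using hs(1) unfolding T_def by linarith
      moreover have "h < 2 ^ T n" if "h \<in> set hs" for h
      proof -
        have "h < 2 ^ ((n * (n + 2) + 2 + tb n * (M + 2)) * 5 + 1)" using that hs(2) unfolding H_def by blast
        also have "\<dots> \<le> 2 ^ T n" unfolding T_def by (intro power_increasing) auto
        finally show ?thesis .
      qed
      ultimately show ?thesis using hs(3) by blast
    next
      case False
      \<comment> \<open>Below \<open>N\<close> the witnesses themselves are listed. There are fewer
        than \<open>2 ^ N\<close> instances, and entry 3 of a helper is where \<open>sol\<close>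
        expects a direct witness.\<close>
      define hs where "hs = map (\<lambda>x. code (tb n) [0, 0, 0, wt x]) (sorted_list_of_set (S n))"
      have "(2 :: nat) ^ n \<le> 2 ^ N" by (rule power_increasing) (use False in simp_all)
      then have "card (S n) \<le> 2 ^ N" using Sc[of n] by linarith
      then have "length hs \<le> T n" by (simp add: hs_def T_def)
      moreover have "h < 2 ^ T n \<and> sol rs x h" if x: "x \<in> S n" "h = code (tb n) [0, 0, 0, wt x]" for h x
      proof -
        have "wt x < 2 ^ tb n" using wtb[of x] x(1) by (auto simp: S_def blen_le_pow)
        then have z: "\<forall>z\<in>set [0, 0, 0, wt x]. z < 2 ^ tb n" by simp
        have "length [0, 0, 0, wt x] + 1 = 5" by simp
        with code_less[OF z] have "h < 2 ^ (tb n * 5 + 1)" unfolding x(2) by metis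
        also have "\<dots> \<le> 2 ^ T n" unfolding T_def by (intro power_increasing) auto
        finally have "h < 2 ^ T n" .
        moreover have "eval beta [h, 3] = wt x" using beta_code[OF z, of 3] x(2) by simp
        ultimately show ?thesis using wt[of x] x(1) by (auto simp: sol_def S_def)
      qed
      ultimately show ?thesis using S by (intro exI[of _ hs]) (auto simp: hs_def)
    qed
    then obtain hs where hs: "length hs \<le> T n" "\<forall>h\<in>set hs. h < 2 ^ T n" "\<forall>x\<in>S n. \<exists>h\<in>set hs. sol rs x h" by blast
    have "num x \<in> S n" if "x \<in> L" "Suc (length x) = n" for x
    proof -
      have "0 < num x" by simp
      moreover have "Ex (wit (num x))" using that(1) unfolding L wit_def by blast
      ultimately show ?thesis using that(2) by (simp add: S_def blen_num)
    qed
    then show ?thesis using hs by blast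
  qed
  moreover have "pbd 1 (\<lambda>xs. T (blen (xs ! 0)))" unfolding T_def tb_def
    by (intro pbd_add pbd_mult pbd_power pbd_const pbd_blen_nth) simp_all
  ultimately have "L \<in> (Delta_p (i + 1))/poly"
    by (intro helpers_imp_advice[OF CP_sol[OF rs] sol_sound])
  then show False using notin by contradiction
qed

end

section \<open>The model generated by a sequence of elements\<close>

text \<open>Merges two indices into one, the second occupying the lowest \<open>blen b\<close> bits.
  The bound is polynomial in \<open>a\<close> and \<open>b\<close>, so for lengths it is again
  dominated by a length.\<close>

lemma pair_sharp:
  assumes "j1 \<le> a" "j2 \<le> b"
  shows "(j1 * 2 ^ blen b + j2) div 2 ^ blen b = j1" "(j1 * 2 ^ blen b + j2) mod 2 ^ blen b = j2"
    "j1 * 2 ^ blen b + j2 \<le> (a + 1) * (2 * b + 2)"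
proof -
  have lt: "j2 < 2 ^ blen b" using assms less_power_blen[of b] by linarith
  then show "(j1 * 2 ^ blen b + j2) div 2 ^ blen b = j1" "(j1 * 2 ^ blen b + j2) mod 2 ^ blen b = j2" by simp_all
  have "2 ^ blen b \<le> 2 * b + 2"
  proof (cases "b = 0")
    case False
    then have "\<not> blen b \<le> blen b - 1" using blen_double[of b] by simp
    then have "2 ^ (blen b - 1) \<le> b" unfolding blen_le_pow by simp
    moreover have "(2 :: nat) ^ blen b = 2 * 2 ^ (blen b - 1)"
      using False blen_double[of b] by (simp flip: power_Suc)
    ultimately show ?thesis by linarith
  qed (simp add: blen_0)
  then have p: "2 ^ blen b \<le> 2 * b + 2" .
  have "j1 * 2 ^ blen b + j2 \<le> (j1 + 1) * 2 ^ blen b" using lt by simp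
  also have "\<dots> \<le> (a + 1) * (2 * b + 2)" by (rule mult_le_mono) (use assms p in simp_all)
  finally show "j1 * 2 ^ blen b + j2 \<le> (a + 1) * (2 * b + 2)" .
qed

locale generated_model =
  fixes i :: nat and F :: "'w filter" and v :: "nat \<Rightarrow> 'w \<Rightarrow> nat"
  assumes ultra: "eventually P F \<or> eventually (\<lambda>w. \<not> P w) F" and nontriv: "F \<noteq> bot"
begin

abbreviation vis :: "nat \<Rightarrow> 'w \<Rightarrow> nat list" where "vis m w \<equiv> map (\<lambda>l. v l w) [0..<m]"

definition cands :: "nat \<times> (nat list \<Rightarrow> nat) \<times> (nat list \<Rightarrow> nat) \<Rightarrow> 'w \<Rightarrow> nat set" where
  "cands r w = cand r (\<lambda>l. v l w)"

lemma cands_eq: "cands (m, f, q) w = {f (j # vis m w) | j. j \<le> blen (q (vis m w))}"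
  by (simp add: cands_def cand_def)

definition G :: "('w \<Rightarrow> nat) set" where
  "G = {g. \<exists>r. FDtriple i r \<and> (\<forall>w. g w \<in> cands r w)}"

lemma G_vis: "FD i m q \<Longrightarrow> (\<lambda>w. q (vis m w)) \<in> G"
  unfolding G_def
  by (intro CollectI exI[of _ "(m, \<lambda>zs. q (tl zs), q)"] conjI allI)
    (auto simp: FDtriple_def cands_eq intro: FD.C_tl)

lemma v_in_G: "v l \<in> G"
  using G_vis[OF FD.C_proj[of l "Suc l" i]] by (simp del: upt_Suc)

lemma take_vis: "m \<le> n \<Longrightarrow> take m (vis n w) = vis m w"
  by (simp add: take_map)

lemma FD_take: "FD i m q \<Longrightarrow> m \<le> n \<Longrightarrow> FD i n (\<lambda>zs. q (take m zs))"
proof -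
  assume q: "FD i m q" and mn: "m \<le> n"
  have "FD i n (\<lambda>zs. q (map (\<lambda>g. g zs) (map (\<lambda>l zs. zs ! l) [0..<m])))"
    by (rule FD_comp[OF q]) (use mn in \<open>auto intro!: FD.C_proj\<close>)
  then show ?thesis
  proof (rule FD_ext)
    fix zs :: "nat list" assume "length zs = n"
    then have "map (\<lambda>g. g zs) (map (\<lambda>l zs. zs ! l) [0..<m]) = take m zs" using mn by (intro nth_equalityI) auto
    then show "q (map (\<lambda>g. g zs) (map (\<lambda>l zs. zs ! l) [0..<m])) = q (take m zs)" by simp
  qed
qed

lemma FD_take_hd: "FD i (Suc m) f \<Longrightarrow> m \<le> n \<Longrightarrow> FD i (Suc n) (\<lambda>zs. f (hd zs # take m (tl zs)))"
proof -
  assume "FD i (Suc m) f" "m \<le> n"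
  then have "FD i (Suc n) (\<lambda>zs. f (take (Suc m) zs))" by (intro FD_take) auto
  then show ?thesis by (rule FD_ext) (auto simp: length_Suc_conv)
qed

lemma FD_subst_hd: "FD i (Suc m) f \<Longrightarrow> FD i (Suc m) a \<Longrightarrow> FD i (Suc m) (\<lambda>zs. f (a zs # tl zs))"
proof -
  assume f: "FD i (Suc m) f" and a: "FD i (Suc m) a"
  have "FD i (Suc m) (\<lambda>zs. f (map (\<lambda>g. g zs) (a # map (\<lambda>l zs. tl zs ! l) [0..<m])))"
    by (rule FD_comp[OF f]) (use a in \<open>auto intro!: FD.C_nth_tl\<close>)
  then show ?thesis
  proof (rule FD_ext)
    fix zs :: "nat list" assume "length zs = Suc m"
    then have "map (\<lambda>g. g zs) (map (\<lambda>l zs. tl zs ! l) [0..<m]) = tl zs" by (intro nth_equalityI) auto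
    then show "f (map (\<lambda>g. g zs) (a # map (\<lambda>l zs. tl zs ! l) [0..<m])) = f (a zs # tl zs)" by simp
  qed
qed

text \<open>Merging the indices lets one number select the values of finitely many elements
  simultaneously. Closure of \<open>G\<close> under functions is then plain composition.\<close>

lemma common_index:
  "set gs \<subseteq> G \<Longrightarrow> \<exists>m q fs. FD i m q \<and> length fs = length gs \<and> (\<forall>f\<in>set fs. FD i (Suc m) f) \<and>
     (\<forall>w. \<exists>j\<le>blen (q (vis m w)). map (\<lambda>g. g w) gs = map (\<lambda>f. f (j # vis m w)) fs)"
proof (induction gs)
  case Nil
  show ?case by (rule exI[of _ 0], rule exI[of _ "\<lambda>_. 0"], rule exI[of _ "[]"]) (auto intro: FD.C_zero)
next
  case (Cons g gs)
  obtain m1 q1 fs where 1: "FD i m1 q1" "length fs = length gs" "\<forall>f\<in>set fs. FD i (Suc m1) f"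
    "\<And>w. \<exists>j\<le>blen (q1 (vis m1 w)). map (\<lambda>g. g w) gs = map (\<lambda>f. f (j # vis m1 w)) fs"
    using Cons by auto
  obtain m2 f q2 where 2: "FD i (Suc m2) f" "FD i m2 q2" "\<And>w. g w \<in> cands (m2, f, q2) w"
    using Cons.prems by (auto simp: G_def FDtriple_def)
  define m where "m = max m1 m2"
  define u1 u2 where "u1 zs = q1 (take m1 zs)" and "u2 zs = q2 (take m2 zs)" for zs
  have u: "FD i m u1" "FD i m u2" unfolding u1_def u2_def by (rule FD_take, use 1 2 m_def in auto)+
  \<comment> \<open>The length of this number is a product that dominates the bound in
    \<open>pair_sharp\<close>.\<close>
  define q where "q zs = (2 :: nat) ^ (blen (Suc (2 * u1 zs)) * blen (2 ^ (blen (Suc (2 * u2 zs)) * blen 2)))" for zs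
  have q: "FD i m q" unfolding q_def by (intro FD.C_smash FD.C_dbl1 u FD.C_const)
  define J1 J2 where "J1 zs = hd zs div 2 ^ blen (blen (u2 (tl zs)))" and "J2 zs = hd zs mod 2 ^ blen (blen (u2 (tl zs)))" for zs :: "nat list"
  have J: "FD i (Suc m) J1" "FD i (Suc m) J2" unfolding J1_def J2_def
    by (intro FD.C_shift FD.C_mod_pow FD.C_len FD.C_tl[OF u(2)] FD.C_hd)+
  define lift1 where "lift1 h zs = h (J1 zs # take m1 (tl zs))" for h :: "nat list \<Rightarrow> nat" and zs
  define f' where "f' zs = f (J2 zs # take m2 (tl zs))" for zs
  have lift1: "FD i (Suc m) (lift1 h)" if "FD i (Suc m1) h" for h
  proof -
    have "FD i (Suc m) (\<lambda>zs. h (hd zs # take m1 (tl zs)))" by (rule FD_take_hd[OF that]) (simp add: m_def)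
    from FD_subst_hd[OF this J(1)] show ?thesis unfolding lift1_def by simp
  qed
  have f': "FD i (Suc m) f'"
  proof -
    have "FD i (Suc m) (\<lambda>zs. f (hd zs # take m2 (tl zs)))" by (rule FD_take_hd[OF 2(1)]) (simp add: m_def)
    from FD_subst_hd[OF this J(2)] show ?thesis unfolding f'_def by simp
  qed
  have "\<exists>j\<le>blen (q (vis m w)). map (\<lambda>g. g w) (g # gs) = map (\<lambda>f. f (j # vis m w)) (f' # map lift1 fs)" for w
  proof -
    have t: "take m1 (vis m w) = vis m1 w" "take m2 (vis m w) = vis m2 w" by (rule take_vis, simp add: m_def)+
    have uw: "u1 (vis m w) = q1 (vis m1 w)" "u2 (vis m w) = q2 (vis m2 w)" by (simp_all only: u1_def u2_def t)
    obtain j1 where j1: "j1 \<le> blen (u1 (vis m w))" "map (\<lambda>g. g w) gs = map (\<lambda>f. f (j1 # vis m1 w)) fs"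
      using 1(4) unfolding uw by blast
    obtain j2 where j2: "j2 \<le> blen (u2 (vis m w))" "g w = f (j2 # vis m2 w)"
      using 2(3)[of w] unfolding cands_eq uw by blast
    define j where "j = j1 * 2 ^ blen (blen (u2 (vis m w))) + j2"
    note p = pair_sharp[OF j1(1) j2(1), folded j_def]
    have J12: "J1 (j # vis m w) = j1" "J2 (j # vis m w) = j2" using p by (simp_all only: J1_def J2_def list.sel)
    have bd: "blen (Suc (2 * x)) = blen x + 1" for x using blen_step[of x True] by simp
    have b2: "blen 2 = 2" using blen_power[of 1] by simp
    have "blen (q (vis m w)) = Suc ((blen (u1 (vis m w)) + 1) * Suc ((blen (u2 (vis m w)) + 1) * 2))"
      by (simp only: q_def blen_power bd b2)
    moreover have "(blen (u1 (vis m w)) + 1) * (2 * blen (u2 (vis m w)) + 2)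
        \<le> (blen (u1 (vis m w)) + 1) * Suc ((blen (u2 (vis m w)) + 1) * 2)" by (rule mult_le_mono2) simp
    ultimately have "j \<le> blen (q (vis m w))" using p(3) by linarith
    moreover have "f' (j # vis m w) = g w" by (simp only: f'_def J12 t list.sel j2(2))
    moreover have "lift1 h (j # vis m w) = h (j1 # vis m1 w)" for h by (simp only: lift1_def J12 t list.sel)
    then have "map (\<lambda>f. f (j # vis m w)) (map lift1 fs) = map (\<lambda>g. g w) gs" by (simp only: map_map comp_def j1(2))
    ultimately show ?thesis by (intro exI[of _ j]) (simp only: list.map simp_thms)
  qed
  moreover have "\<forall>h\<in>set (f' # map lift1 fs). FD i (Suc m) h" using f' lift1 1(3) by auto
  moreover have "length (f' # map lift1 fs) = length (g # gs)" using 1(2) by simp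
  ultimately show ?case using q by blast
qed

lemma G_closed:
  assumes f: "FD i (length gs) f" and gs: "set gs \<subseteq> G"
  shows "(\<lambda>w. f (map (\<lambda>g. g w) gs)) \<in> G"
proof -
  obtain m q fs where c: "FD i m q" "length fs = length gs" "\<forall>f\<in>set fs. FD i (Suc m) f"
    "\<And>w. \<exists>j\<le>blen (q (vis m w)). map (\<lambda>g. g w) gs = map (\<lambda>f. f (j # vis m w)) fs"
    using common_index[OF gs] by auto
  have "FD i (Suc m) (\<lambda>zs. f (map (\<lambda>h. h zs) fs))" by (rule FD_comp[OF f c(2,3)])
  then have "FDtriple i (m, \<lambda>zs. f (map (\<lambda>h. h zs) fs), q)" using c(1) by (simp add: FDtriple_def)
  moreover have "f (map (\<lambda>g. g w) gs) \<in> cands (m, \<lambda>zs. f (map (\<lambda>h. h zs) fs), q) w" for w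
  proof -
    obtain j where "j \<le> blen (q (vis m w))" "map (\<lambda>g. g w) gs = map (\<lambda>f. f (j # vis m w)) fs" using c(4) by blast
    then show ?thesis unfolding cands_eq by auto
  qed
  ultimately show ?thesis unfolding G_def by blast
qed

text \<open>The sum of all candidates for \<open>x\<close> bounds \<open>x\<close>, so the values of
  \<open>g\<close> lie in the list of all numbers up to the length of this sum, where the index is
  its own value.\<close>

lemma G_sharp:
  assumes x: "x \<in> G" and g: "\<And>w. g w \<le> blen (x w)"
  shows "g \<in> G"
proof -
  obtain m f q where r: "FD i (Suc m) f" "FD i m q" "\<And>w. x w \<in> cands (m, f, q) w"
    using x by (auto simp: G_def FDtriple_def)
  define q' where "q' zs = (\<Sum>j<blen (Suc (2 * q zs)). f (j # zs))" for zs
  have "FD i (Suc m) (\<lambda>zs. f (hd zs # tl zs))" by (rule FD_ext[OF r(1)]) (auto simp: length_Suc_conv)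
  from FD.C_sum[where E = "\<lambda>j zs. f (j # zs)", OF this FD.C_dbl1[OF r(2)]] have q': "FD i m q'" unfolding q'_def .
  have "g w \<in> cands (m, hd, q') w" for w
  proof -
    obtain j where j: "j \<le> blen (q (vis m w))" "x w = f (j # vis m w)" using r(3)[of w] unfolding cands_eq by blast
    have "x w \<le> q' (vis m w)" unfolding q'_def j(2) by (rule member_le_sum) (use j(1) in \<open>auto simp: le_blen_iff\<close>)
    then have "g w \<le> blen (q' (vis m w))" using g[of w] floorlog_mono[of "x w" "q' (vis m w)" 2] by linarith
    then show ?thesis unfolding cands_eq by auto
  qed
  then show ?thesis unfolding G_def using q' FD.C_hd[of i m] by (intro CollectI exI[of _ "(m, hd, q')"]) (auto simp: FDtriple_def)
qed

text \<open>The parity of the index selects one of the two lists.\<close>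

lemma cands_join:
  assumes "FDtriple i r1" "FDtriple i r2"
  obtains r where "FDtriple i r" "\<And>w. cands r1 w \<subseteq> cands r w" "\<And>w. cands r2 w \<subseteq> cands r w"
proof -
  obtain m1 f1 q1 m2 f2 q2 where r: "r1 = (m1, f1, q1)" "r2 = (m2, f2, q2)" by (cases r1, cases r2) auto
  have f: "FD i (Suc m1) f1" "FD i m1 q1" "FD i (Suc m2) f2" "FD i m2 q2" using assms unfolding r FDtriple_def by auto
  define m where "m = max m1 m2"
  define u where "u zs = q1 (take m1 zs) + q2 (take m2 zs)" for zs
  have u: "FD i m u" unfolding u_def by (rule FD.C_add; rule FD_take; use f m_def in auto)
  define q where "q zs = (2 :: nat) ^ (blen (Suc (2 * u zs)) * blen 2)" for zs
  have q: "FD i m q" unfolding q_def by (intro FD.C_smash FD.C_dbl1 u FD.C_const)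
  define h where "h zs = (if odd (hd zs) then f1 (hd zs div 2 # take m1 (tl zs)) else f2 (hd zs div 2 # take m2 (tl zs)))" for zs
  have d: "FD i (Suc m) (\<lambda>zs. hd zs div 2)" by (intro FD.C_half FD.C_hd)
  have "FD i (Suc m) (\<lambda>zs. f1 (hd zs # take m1 (tl zs)))" "FD i (Suc m) (\<lambda>zs. f2 (hd zs # take m2 (tl zs)))"
    by (rule FD_take_hd, use f m_def in auto)+
  from this[THEN FD_subst_hd[OF _ d]]
  have h: "FD i (Suc m) h" unfolding h_def by (intro FD.C_if FD.CP_odd FD.C_hd) simp_all
  have sub: "cands r1 w \<subseteq> cands (m, h, q) w" "cands r2 w \<subseteq> cands (m, h, q) w" for w
  proof -
    have t: "take m1 (vis m w) = vis m1 w" "take m2 (vis m w) = vis m2 w" by (rule take_vis, simp add: m_def)+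
    have bd: "blen (Suc (2 * x)) = blen x + 1" for x using blen_step[of x True] by simp
    have b2: "blen 2 = 2" using blen_power[of 1] by simp
    have bq: "blen (q (vis m w)) = Suc ((blen (q1 (vis m1 w) + q2 (vis m2 w)) + 1) * 2)"
      by (simp only: q_def u_def t blen_power bd b2)
    have le: "blen (q1 (vis m1 w)) \<le> blen (q1 (vis m1 w) + q2 (vis m2 w))" "blen (q2 (vis m2 w)) \<le> blen (q1 (vis m1 w) + q2 (vis m2 w))"
      by (intro floorlog_mono; simp)+
    show "cands r1 w \<subseteq> cands (m, h, q) w"
    proof
      fix y assume "y \<in> cands r1 w"
      then obtain j where j: "j \<le> blen (q1 (vis m1 w))" "y = f1 (j # vis m1 w)" unfolding r cands_eq by blast
      have "h (Suc (2 * j) # vis m w) = y" by (simp add: h_def j(2) t del: upt_Suc)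
      moreover have "Suc (2 * j) \<le> blen (q (vis m w))" using order_trans[OF j(1) le(1)] unfolding bq by simp
      ultimately show "y \<in> cands (m, h, q) w" unfolding cands_eq by blast
    qed
    show "cands r2 w \<subseteq> cands (m, h, q) w"
    proof
      fix y assume "y \<in> cands r2 w"
      then obtain j where j: "j \<le> blen (q2 (vis m2 w))" "y = f2 (j # vis m2 w)" unfolding r cands_eq by blast
      have "h (2 * j # vis m w) = y" by (simp add: h_def j(2) t del: upt_Suc)
      moreover have "2 * j \<le> blen (q (vis m w))" using order_trans[OF j(1) le(2)] unfolding bq by simp
      ultimately show "y \<in> cands (m, h, q) w" unfolding cands_eq by blast
    qed
  qed
  show ?thesis by (rule that[of "(m, h, q)", OF _ sub]) (use h q in \<open>simp add: FDtriple_def\<close>)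
qed

lemma cands_join_finite: "(\<And>r'. r' \<le> (n :: nat) \<Longrightarrow> FDtriple i (R r')) \<Longrightarrow> \<exists>r. FDtriple i r \<and> (\<forall>r'\<le>n. \<forall>w. cands (R r') w \<subseteq> cands r w)"
proof (induction n)
  case (Suc n)
  then obtain r where r: "FDtriple i r" "\<And>r' w. r' \<le> n \<Longrightarrow> cands (R r') w \<subseteq> cands r w" by auto
  obtain s where s: "FDtriple i s" "\<And>w. cands r w \<subseteq> cands s w" "\<And>w. cands (R (Suc n)) w \<subseteq> cands s w"
    using cands_join[OF r(1) Suc.prems[of "Suc n"]] by blast
  have "\<forall>r'\<le>Suc n. \<forall>w. cands (R r') w \<subseteq> cands s w" using r(2) s(2,3) by (metis le_Suc_eq subset_trans)
  then show ?case using s(1) by blast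
next
  case 0
  then show ?case by (intro exI[of _ "R 0"]) simp
qed

lemma ex_enumeration: "\<exists>R. (\<forall>n :: nat. FDtriple i (R n)) \<and> (\<forall>r. FDtriple i r \<longrightarrow> (\<exists>n. \<forall>w. cands r w = cands (R n) w))"
proof -
  have "\<exists>E. (\<forall>n :: nat. FD i k (E n)) \<and> (\<forall>f. FD i k f \<longrightarrow> (\<exists>n. \<forall>xs. length xs = k \<longrightarrow> f xs = E n xs))" for k
  proof (rule FD_enumeration[of i k])
    fix E assume "\<And>n :: nat. FD i k (E n)" "\<And>f. FD i k f \<Longrightarrow> \<exists>n. \<forall>xs. length xs = k \<longrightarrow> f xs = E n xs"
    then show ?thesis by blast
  qed
  then obtain E where E: "\<And>k n :: nat. FD i k (E k n)" "\<And>k f. FD i k f \<Longrightarrow> \<exists>n. \<forall>xs. length xs = k \<longrightarrow> f xs = E k n xs"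
    by metis
  define R where "R n = (case prod_decode n of (m, n') \<Rightarrow> case prod_decode n' of (a, b) \<Rightarrow> (m, E (Suc m) a, E m b))" for n
  have "FDtriple i (R n)" for n using E(1) by (simp add: R_def FDtriple_def split: prod.split)
  moreover have "\<exists>n. \<forall>w. cands r w = cands (R n) w" if tr: "FDtriple i r" for r
  proof -
    obtain m f q where r: "r = (m, f, q)" by (cases r)
    obtain a b where ab: "\<And>xs. length xs = Suc m \<Longrightarrow> f xs = E (Suc m) a xs" "\<And>xs. length xs = m \<Longrightarrow> q xs = E m b xs"
      using tr E(2)[of "Suc m" f] E(2)[of m q] unfolding r FDtriple_def by auto
    have "R (prod_encode (m, prod_encode (a, b))) = (m, E (Suc m) a, E m b)" by (simp add: R_def)
    moreover have "cands r w = cands (m, E (Suc m) a, E m b) w" for w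
      unfolding r cands_eq using ab by simp
    ultimately show ?thesis by (intro exI[of _ "prod_encode (m, prod_encode (a, b))"]) (simp add: r)
  qed
  ultimately show ?thesis by blast
qed

lemma ex_model:
  obtains cf cg cq where "ultra_model i F G cf cg cq"
proof -
  obtain R where R: "\<And>n :: nat. FDtriple i (R n)" "\<And>r. FDtriple i r \<Longrightarrow> \<exists>n. \<forall>w. cands r w = cands (R n) w"
    using ex_enumeration by metis
  define cf where "cf n = fst (snd (R n))" for n
  define cg where "cg n = map v [0..<fst (R n)]" for n
  define cq where "cq n w = snd (snd (R n)) (vis (fst (R n)) w)" for n w
  have Cand: "{cf n (j # map (\<lambda>g. g w) (cg n)) | j. j \<le> blen (cq n w)} = cands (R n) w" for n w
  proof -
    obtain m f q where r: "R n = (m, f, q)" by (cases "R n")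
    show ?thesis unfolding cf_def cg_def cq_def r cands_eq by (simp add: comp_def)
  qed
  have "ultra_model i F G cf cg cq"
  proof (unfold_locales, unfold Cand)
    show "eventually P F \<or> eventually (\<lambda>w. \<not> P w) F" for P by (rule ultra)
    show "F \<noteq> bot" by (rule nontriv)
    show "FD i (length gs) f \<Longrightarrow> set gs \<subseteq> G \<Longrightarrow> (\<lambda>w. f (map (\<lambda>g. g w) gs)) \<in> G" for gs f by (rule G_closed)
    show "x \<in> G \<Longrightarrow> (\<And>w. g w \<le> blen (x w)) \<Longrightarrow> g \<in> G" for x g by (rule G_sharp)
    fix r
    obtain m f q where r: "R r = (m, f, q)" by (cases "R r")
    have fq: "FD i (Suc m) f" "FD i m q" using R(1)[of r] unfolding r FDtriple_def by auto
    show "FD i (Suc (length (cg r))) (cf r)" using fq(1) by (simp add: cg_def cf_def r)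
    show "set (cg r) \<subseteq> G" using v_in_G by (auto simp: cg_def)
    show "cq r \<in> G" using G_vis[OF fq(2)] by (simp add: cq_def[abs_def] r)
    show "\<exists>s. \<forall>r'\<le>r. \<forall>w. cands (R r') w \<subseteq> cands (R s) w"
      using cands_join_finite[of r R] R by metis
  next
    fix g assume "g \<in> G"
    then show "\<exists>r. \<forall>w. g w \<in> cands (R r) w" unfolding G_def using R(2) by fastforce
  qed
  then show ?thesis by (rule that)
qed

end

text \<open>An ultrafilter that contains a finite union contains one of its members. Thus elements
  below a standard number are standard.\<close>

lemma (in ultra_model) ev_bounded_const: "eventually (\<lambda>w. n w < c) F \<Longrightarrow> \<exists>k<c. eventually (\<lambda>w. n w = (k :: nat)) F"
proof (induction c)
  case 0
  then show ?case using nontriv by (simp add: eventually_False)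
next
  case (Suc c)
  then have "eventually (\<lambda>w. n w < c) F \<or> eventually (\<lambda>w. n w = c) F" by (simp add: less_Suc_eq ev_disj)
  then show ?case using Suc.IH less_Suc_eq by blast
qed

section \<open>Failure of length induction\<close>

context hard_instances
begin

lemma validD:
  assumes "valid w"
  shows "length (fst w) = Suc (K (blen (fst w ! 1)))" "0 < K (blen (fst w ! 1))" "blen x0 \<le> blen (fst w ! 1)"
    "fst w ! 0 = x0" "\<And>l. l \<in> {1..K (blen (fst w ! 1))} \<Longrightarrow> blen (fst w ! l) = blen (fst w ! 1)"
    "\<And>l. l \<in> {1..K (blen (fst w ! 1))} \<Longrightarrow> wit (fst w ! l) (snd w ! l)"
  using assms[unfolded valid_def Let_def case_prod_beta] by blast+

lemma hiddenD:
  assumes "hidden r w"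
  shows "fst r \<le> K (blen (fst w ! 1))" "\<And>l y. l \<in> {1..K (blen (fst w ! 1))} \<Longrightarrow> fst r \<le> l \<Longrightarrow>
    y \<in> cand r (\<lambda>m. known m w) \<Longrightarrow> \<not> wit (fst w ! l) y"
  using assms[unfolded hidden_def case_prod_beta prod.collapse] by blast+

lemma valid_beta:
  assumes "valid w" "l \<le> K (blen (fst w ! 1))"
  shows "eval beta [known 0 w, l] = fst w ! l"
proof -
  define n where "n = blen (fst w ! 1)"
  note v = validD[OF assms(1), folded n_def]
  have "\<forall>z\<in>set (fst w). z < 2 ^ n"
  proof
    fix z assume "z \<in> set (fst w)"
    then obtain l where l: "l < length (fst w)" "z = fst w ! l" by (auto simp: in_set_conv_nth)
    have "blen z \<le> n"
    proof (cases "l = 0")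
      case True
      then show ?thesis using v(3,4) l(2) by simp
    next
      case False
      then show ?thesis using v(5)[of l] v(1) l by simp
    qed
    then show "z < 2 ^ n" by (simp only: blen_le_pow)
  qed
  from beta_code[OF this, of l] have "eval beta [code n (fst w), l] = fst w ! l" using assms(2) v(1) by (simp add: n_def)
  moreover have "known 0 w = code n (fst w)" by (simp add: known_def n_def case_prod_beta)
  ultimately show ?thesis by simp
qed

text \<open>For finitely many triples, \<open>ex_hidden\<close> is the finite intersection property
  of the sets \<open>B r\<close>.\<close>

lemma ex_hidden_ultrafilter:
  obtains U where "U \<noteq> bot" "\<And>P. eventually P U \<or> eventually (\<lambda>w. \<not> P w) U"
    "\<And>r. FDtriple i r \<Longrightarrow> eventually (\<lambda>w. valid w \<and> hidden r w) U"
proof -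
  define B where "B r = {w. valid w \<and> hidden r w}" for r
  define H where "H = (INF r\<in>{r. FDtriple i r}. principal (B r))"
  have "H \<noteq> bot" unfolding H_def
  proof (rule INF_filter_not_bot)
    fix R assume R: "R \<subseteq> {r. FDtriple i r}" "finite R"
    obtain rs where rs: "set rs = insert (0, \<lambda>_. 0, \<lambda>_. 0) R" using R(2) finite_list[of "insert (0, \<lambda>_. 0, \<lambda>_. 0) R"] by auto
    have "\<forall>r\<in>set rs. FDtriple i r" unfolding rs using R(1) by (auto simp: FDtriple_def intro: FD.C_zero)
    from ex_hidden[OF this] obtain w where "valid w" "\<forall>r\<in>R. hidden r w" unfolding rs by blast
    then have "w \<in> (\<Inter>r\<in>R. B r)" unfolding B_def by blast
    then show "(INF r\<in>R. principal (B r)) \<noteq> bot" unfolding INF_principal_finite[OF R(2)] by (auto simp: principal_eq_bot_iff)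
  qed
  then show ?thesis
  proof (rule ex_ultrafilter)
    fix U assume U: "U \<le> H" "U \<noteq> bot" "\<And>P. eventually P U \<or> eventually (\<lambda>w. \<not> P w) U"
    show ?thesis
    proof (rule that[OF U(2,3)])
      fix r assume "FDtriple i r"
      then have "U \<le> principal (B r)" using U(1) unfolding H_def by (meson INF_lower mem_Collect_eq order_trans)
      then show "eventually (\<lambda>w. valid w \<and> hidden r w) U"
        unfolding le_principal B_def by (simp only: mem_Collect_eq)
    qed
  qed
qed

text \<open>The induction step holds in the model because a witness in \<open>G\<close> forces its
  position to be standard, and then the witness at the next position is one of the generators
  \<open>known l\<close>.\<close>

theorem LIND_unprovable:
  obtains p where "strict_SigmaB (Suc i) p" "wf_fm p"
    "\<not> (T2 i \<union> scheme BB (strict_SigmaB (Suc i)) \<turnstile> univ_closure (LIND b p))"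
proof -
  obtain U where U: "U \<noteq> bot" "\<And>P. eventually P U \<or> eventually (\<lambda>w. \<not> P w) U"
    "\<And>r. FDtriple i r \<Longrightarrow> eventually (\<lambda>w. valid w \<and> hidden r w) U"
    by (rule ex_hidden_ultrafilter) blast
  interpret gm: generated_model i U known by unfold_locales (rule U(2), rule U(1))
  obtain cf cg cq where um: "ultra_model i U gm.G cf cg cq" by (rule gm.ex_model)
  interpret M: ultra_model i U gm.G cf cg cq "\<lambda>r w. {cf r (j # map (\<lambda>g. g w) (cg r)) | j. j \<le> blen (cq r w)}"
    by (rule um, rule reflexive)
  obtain f where f: "wf_pv f" "arity f = 1" "\<And>xs. length xs = 1 \<Longrightarrow> eval f xs = t xs"
    using t unfolding PVC_def by blast
  have beta: "wf_pv beta" "arity beta = 2"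
    by (simp_all add: beta_def low_def low_step_def shift_def tz_def pow2_def parity_def)
  \<comment> \<open>In \<open>p\<close> the index is \<open>Var 0\<close> and the code of the tuple
    is \<open>Var 1\<close>; below the quantifier of \<open>p\<close> both indices are greater by
    one.\<close>
  define T where "T = Fn f [Fn beta [Var 1, Var 0]]"
  have "(\<exists>q. strict_SigmaB i q \<and> wf_fm q \<and> (\<forall>e. natsat e q \<longleftrightarrow> Q (map (tval e) [Var 0, Fn beta [Var 2, Var 1]]))) \<and>
    (\<exists>q. strict_PiB i q \<and> wf_fm q \<and> (\<forall>e. natsat e q \<longleftrightarrow> \<not> Q (map (tval e) [Var 0, Fn beta [Var 2, Var 1]])))"
    by (rule SP_strict_formula[OF Q]) (use beta in simp_all)
  then obtain q where q: "strict_PiB i q" "wf_fm q" "\<And>e. natsat e q \<longleftrightarrow> \<not> Q [e 0, eval beta [e 2, e 1]]"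
    by auto
  define p where "p = BExists T q"
  have "\<exists>t' q'. p = BExists t' q' \<and> strict_PiB i q'" using q(1) unfolding p_def by blast
  then have "strict_SigmaB (Suc i) p" by simp
  moreover have "wf_fm p" using q(2) f(1,2) beta by (simp add: p_def BExists_def T_def)
  ultimately have p: "strict_SigmaB (Suc i) p" "wf_fm p" .
  have losq: "M.los q" by (rule M.los_Sigma(2)[OF _ _ q(2)]) (use strict_imp_SigmaB q in auto)
  \<comment> \<open>The code of the tuple is the only parameter of \<open>p\<close>.\<close>
  define e0 where "e0 = case_nat (known 0) (\<lambda>(_ :: nat) (_ :: nat list \<times> nat list). 0 :: nat)"
  have e0: "range e0 \<subseteq> gm.G" unfolding e0_def by (rule M.range_case_nat[OF _ gm.v_in_G]) (use M.G_const in auto)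
  define A where "A n \<longleftrightarrow> (\<exists>y\<in>gm.G. eventually (\<lambda>w. wit (eval beta [known 0 w, n w]) (y w)) U)" for n
  have satp: "M.gsat (case_nat n e0) p \<longleftrightarrow> A n" if "n \<in> gm.G" for n
  proof -
    have r: "range (case_nat n e0) \<subseteq> gm.G" by (rule M.range_case_nat[OF e0 that])
    have tv: "tval (\<lambda>m. case_nat n e0 m w) T = t [eval beta [known 0 w, n w]]" for w
      by (simp add: T_def f(3) e0_def)
    have "M.gsat (case_nat y (case_nat n e0)) q \<longleftrightarrow> eventually (\<lambda>w. \<not> Q [y w, eval beta [known 0 w, n w]]) U" if "y \<in> gm.G" for y
      unfolding M.losD[OF losq M.range_case_nat[OF r that]] q(3) by (simp add: e0_def numeral_2_eq_2)
    then show ?thesis unfolding p_def M.gsat_BExists A_def tv wit_def eventually_conj_iff by blast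
  qed
  have valid: "eventually valid U"
    using U(3)[of "(0, \<lambda>_. 0, \<lambda>_. 0)"] FD.C_zero by (auto simp: FDtriple_def elim: eventually_mono)
  \<comment> \<open>The entry at 1 serves as \<open>x\<close> in \<open>LIND\<close>: its length is
    the common length \<open>n\<close>, so the induction runs up to the last position
    \<open>K n\<close>.\<close>
  define x where "x w = eval beta [known 0 w, 1]" for w
  have xG: "x \<in> gm.G"
    using M.G_PV[of "[known 0]" "\<lambda>xs. eval beta [xs ! 0, 1]"] PV.C_beta[OF PVC_proj PVC_const, of 0 1 1] gm.v_in_G[of 0]
    by (simp add: x_def[abs_def])
  have x: "x w = fst w ! 1" if "valid w" for w
    using valid_beta[OF that, of 1] validD(2)[OF that] unfolding x_def by simp
  define k where "k w = K (blen (x w))" for w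
  have kG: "k \<in> gm.G"
    using M.G_PV[of "[x]" "\<lambda>xs. eval b [blen (xs ! 0)]"] PVC_comp1[OF b(1,2) PV.C_len[OF PVC_proj[of 0 1]]] xG
    by (simp add: k_def[abs_def])
  have k: "valid w \<Longrightarrow> k w = K (blen (fst w ! 1))" for w by (simp add: k_def x)
  have A0: "A (\<lambda>_. 0)" unfolding A_def
  proof (rule bexI[OF _ M.G_const[of w0]], rule eventually_mono[OF valid])
    fix w assume v: "valid w"
    from validD(4)[OF this] show "wit (eval beta [known 0 w, 0]) w0" using valid_beta[OF v, of 0] x0 by (simp add: wit_def)
  qed
  \<comment> \<open>If an element of list \<open>r\<close> is a witness at a positive position, then
    this position is among those whose witnesses \<open>r\<close> may see.\<close>
  have unhide: "eventually (\<lambda>w. valid w \<and> (0 < n w \<longrightarrow> n w \<le> k w \<longrightarrow> n w < fst r)) U"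
    if y: "\<And>w. y w \<in> gm.cands r w" and r: "FDtriple i r"
      and e: "eventually (\<lambda>w. n w \<le> k w \<longrightarrow> wit (eval beta [known 0 w, n w]) (y w)) U" for r y n
    using U(3)[OF r] e
  proof eventually_elim
    case (elim w)
    then have v: "valid w" by blast
    have "n w < fst r" if n: "0 < n w" "n w \<le> k w"
    proof (rule ccontr)
      assume "\<not> n w < fst r"
      moreover have "n w \<in> {1..K (blen (fst w ! 1))}" using n k[OF v] by simp
      ultimately have "\<not> wit (fst w ! n w) (y w)"
        using hiddenD(2)[of r w "n w" "y w"] elim(1) y[of w] unfolding gm.cands_def by auto
      moreover have "wit (fst w ! n w) (y w)" using elim(2) n(2) valid_beta[OF v, of "n w"] k[OF v] by simp
      ultimately show False by blast
    qed
    then show ?case using v by blast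
  qed
  \<comment> \<open>By \<open>unhide\<close> the last position would be below \<open>fst r\<close>,
    while the first conjunct of \<open>hidden\<close> puts it at or above.\<close>
  have Ak: "\<not> A k"
  proof
    assume "A k"
    then obtain y r where y: "FDtriple i r" "\<And>w. y w \<in> gm.cands r w"
      "eventually (\<lambda>w. wit (eval beta [known 0 w, k w]) (y w)) U"
      unfolding A_def gm.G_def by blast
    have "eventually (\<lambda>w. k w \<le> k w \<longrightarrow> wit (eval beta [known 0 w, k w]) (y w)) U" using y(3) by simp
    from unhide[OF y(2,1) this] have "eventually (\<lambda>w. valid w \<and> (0 < k w \<longrightarrow> k w < fst r)) U" by simp
    then have "eventually (\<lambda>w. False) U" using U(3)[OF y(1)]
    proof eventually_elim
      case (elim w)
      then have "0 < k w" "fst r \<le> k w" using k[of w] validD(2)[of w] hiddenD(1)[of r w] by auto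
      then show ?case using elim(1) by simp
    qed
    then show False using U(1) by (simp add: eventually_False)
  qed
  \<comment> \<open>The position is below the standard number \<open>Suc (fst r)\<close>, hence
    equal to some standard \<open>k0\<close> almost everywhere, and the generator with index
    \<open>Suc k0\<close> is the next witness.\<close>
  have AS: "A (\<lambda>w. Suc (n w))" if n: "eventually (\<lambda>w. n w < k w) U" "A n" for n
  proof -
    obtain y r where y: "FDtriple i r" "\<And>w. y w \<in> gm.cands r w"
      "eventually (\<lambda>w. wit (eval beta [known 0 w, n w]) (y w)) U"
      using n(2) unfolding A_def gm.G_def by blast
    have "eventually (\<lambda>w. n w \<le> k w \<longrightarrow> wit (eval beta [known 0 w, n w]) (y w)) U"
      using y(3) by (rule eventually_mono) simp
    from unhide[OF y(2,1) this] n(1) have "eventually (\<lambda>w. n w < Suc (fst r)) U"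
      by eventually_elim linarith
    then obtain k0 where k0: "eventually (\<lambda>w. n w = k0) U" using M.ev_bounded_const by blast
    show ?thesis unfolding A_def
    proof (rule bexI[OF _ gm.v_in_G[of "Suc k0"]])
      show "eventually (\<lambda>w. wit (eval beta [known 0 w, Suc (n w)]) (known (Suc k0) w)) U"
        using k0 n(1) valid
      proof eventually_elim
        case (elim w)
        then have le: "Suc k0 \<le> K (blen (fst w ! 1))" using k[of w] by simp
        have "wit (fst w ! Suc k0) (snd w ! Suc k0)" using validD(6)[OF elim(3), of "Suc k0"] le by simp
        moreover have "known (Suc k0) w = snd w ! Suc k0" by (cases w) (simp add: known_def)
        ultimately show ?case using valid_beta[OF elim(3) le] elim(1) by simp
      qed
    qed
  qed
  have fails: "\<not> M.gsat e0 (LIND b p)"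
  proof
    assume "M.gsat e0 (LIND b p)"
    have e: "(\<lambda>na w. tval (\<lambda>n. case_nat x e0 n w) (case_nat \<^bold>0 (\<lambda>n. Var (n + 1)) na)) = case_nat (\<lambda>_. 0) e0"
      "(\<lambda>na w. tval (\<lambda>n. case_nat x e0 n w) (case_nat (Fn b [\<^bold>L (Var 0)]) (\<lambda>n. Var (n + 1)) na)) = case_nat k e0"
      "(\<lambda>na w. tval (\<lambda>n'. case_nat n (case_nat x e0) n' w) (case_nat (Var 0) (\<lambda>n. Var (n + 2)) na)) = case_nat n e0"
      "(\<lambda>na w. tval (\<lambda>n'. case_nat n (case_nat x e0) n' w) (case_nat (\<^bold>S (Var 0)) (\<lambda>n. Var (n + 2)) na)) = case_nat (\<lambda>w. Suc (n w)) e0" for n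
      by (auto simp: fun_eq_iff k_def split: nat.split)
    have "M.gsat (case_nat x e0)
       (subst_fm (case_nat \<^bold>0 (\<lambda>n. Var (n + 1))) p \<^bold>\<and>
        Forall (Var 0 \<^bold>< Fn b [\<^bold>L (Var 1)] \<^bold>\<longrightarrow>
          subst_fm (case_nat (Var 0) (\<lambda>n. Var (n + 2))) p \<^bold>\<longrightarrow>
          subst_fm (case_nat (\<^bold>S (Var 0)) (\<lambda>n. Var (n + 2))) p) \<^bold>\<longrightarrow>
        subst_fm (case_nat (Fn b [\<^bold>L (Var 0)]) (\<lambda>n. Var (n + 1))) p)"
      using \<open>M.gsat e0 (LIND b p)\<close> xG unfolding LIND_def M.gsat.simps(7) by blast
    then have imp: "A (\<lambda>_. 0) \<Longrightarrow> (\<And>n. n \<in> gm.G \<Longrightarrow>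
        M.gsat (case_nat n (case_nat x e0)) (Var 0 \<^bold>< Fn b [\<^bold>L (Var 1)]) \<Longrightarrow>
        M.gsat (case_nat n e0) p \<Longrightarrow> M.gsat (case_nat (\<lambda>w. Suc (n w)) e0) p) \<Longrightarrow> A k"
      unfolding M.gsat.simps(4,5,7) M.gsat_subst e satp[OF kG] satp[OF M.G_const] by blast
    have "A k"
    proof (rule imp[OF A0])
      fix n assume n: "n \<in> gm.G" "M.gsat (case_nat n (case_nat x e0)) (Var 0 \<^bold>< Fn b [\<^bold>L (Var 1)])" "M.gsat (case_nat n e0) p"
      have SG: "(\<lambda>w. Suc (n w)) \<in> gm.G"
        using M.G_PV[of "[n]" "\<lambda>xs. Suc (xs ! 0)"] PV.C_Suc[OF PVC_proj[of 0 1]] n(1) by simp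
      have "eventually (\<lambda>w. n w \<le> k w) U" "\<not> eventually (\<lambda>w. n w = k w) U" using n(2) by (simp_all add: k_def)
      then have "eventually (\<lambda>w. n w < k w) U" unfolding M.ev_not[symmetric] by eventually_elim simp
      from AS[OF this] show "M.gsat (case_nat (\<lambda>w. Suc (n w)) e0) p" using n(1,3) satp SG by blast
    qed
    then show False using Ak by contradiction
  qed
  have "\<not> (T2 i \<union> scheme BB (strict_SigmaB (Suc i)) \<turnstile> univ_closure (LIND b p))"
  proof
    assume prov: "T2 i \<union> scheme BB (strict_SigmaB (Suc i)) \<turnstile> univ_closure (LIND b p)"
    have r: "range (\<lambda>m. e0 (m + bnd_fm (LIND b p))) \<subseteq> gm.G" using e0 by auto
    have "M.gsat (\<lambda>m. e0 (m + bnd_fm (LIND b p))) (univ_closure (LIND b p))"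
    proof (rule M.soundness[OF prov r])
      fix a assume "a \<in> T2 i \<union> scheme BB (strict_SigmaB (Suc i))"
      then consider "a \<in> T2 i" | p' where "a = univ_closure (BB p')" "wf_fm p'" "strict_SigmaB (Suc i) p'"
        unfolding scheme_def by blast
      then show "M.gsat (\<lambda>m. e0 (m + bnd_fm (LIND b p))) a"
      proof cases
        case 1
        then show ?thesis by (rule M.T2_sound[OF _ r])
      next
        case 2
        show ?thesis unfolding 2(1) by (rule M.gsat_univ_closure[OF M.BB_sound[OF 2(3,2)] r])
      qed
    qed
    from M.gsat_univ_closureD[OF this e0] show False using fails by contradiction
  qed
  from that[OF p this] show ?thesis .
qed

end

theorem theorem1p11:
  fixes i :: nat and b :: pv
  assumes "\<not> Sigma_p (i + 1) \<subseteq> (Delta_p (i + 1))/poly"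
    and "wf_pv b" and "arity b = 1"
    and "mono (\<lambda>x. eval b [x])" and "\<forall>m. \<exists>x. m \<le> eval b [x]"
    and "\<forall>x. eval b [x] \<le> x"
  shows "\<not> scheme (LIND b) (strict_SigmaB (i + 1))
             \<subseteq> thms_of (T2 i \<union> scheme BB (strict_SigmaB (i + 1)))
       \<and> \<not> thms_of (T2 i \<union> scheme (LIND b) (strict_SigmaB (i + 1)))
             \<subseteq> thms_of (T2 i \<union> scheme BB (strict_SigmaB (i + 1)))"
proof -
  obtain L where L: "L \<in> Sigma_p (i + 1)" "L \<notin> (Delta_p (i + 1))/poly" using assms(1) by blast
  have "SP (Suc i) 1 (\<lambda>xs. dec (xs ! 0) \<in> L)" using L(1) by (intro Sigma_p_imp_SP) simp
  then obtain Q t where Qt: "SP i 2 Q" "PVC 1 t"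
    "\<And>xs. length xs = 1 \<Longrightarrow> dec (xs ! 0) \<in> L \<longleftrightarrow> (\<exists>y\<le>t xs. \<not> Q (y # xs))"
    by (auto simp: numeral_2_eq_2)
  have LQ: "x \<in> L \<longleftrightarrow> (\<exists>y\<le>t [num x]. \<not> Q [y, num x])" for x using Qt(3)[of "[num x]"] by simp
  \<comment> \<open>A member of \<open>L\<close> is needed as the fixed entry at position 0; the
    empty language would be decided with no helpers at all.\<close>
  have "L \<noteq> {}"
  proof
    assume "L = {}"
    have "L \<in> (Delta_p (i + 1))/poly"
      by (rule helpers_imp_advice[where sol = "\<lambda>_ _. False" and T = "\<lambda>_. 0"]) (auto simp: \<open>L = {}\<close> intro: FD.CP_const)
    then show False using L(2) by contradiction
  qed
  then obtain x w0 where xw: "w0 \<le> t [num x]" "\<not> Q [w0, num x]" using LQ by blast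
  interpret hard_instances i b Q t L "num x" w0
    by unfold_locales (use assms Qt LQ L xw in auto)
  obtain p where p: "strict_SigmaB (Suc i) p" "wf_fm p"
    "\<not> (T2 i \<union> scheme BB (strict_SigmaB (Suc i)) \<turnstile> univ_closure (LIND b p))"
    by (rule LIND_unprovable)
  then have "univ_closure (LIND b p) \<in> scheme (LIND b) (strict_SigmaB (i + 1))"
    and "univ_closure (LIND b p) \<notin> thms_of (T2 i \<union> scheme BB (strict_SigmaB (i + 1)))"
    unfolding scheme_def thms_of_def by auto
  then show ?thesis unfolding thms_of_def by (auto intro: Assm)
qed

end
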